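(* Let $u\in H^1(\Omega)$ be the weak solution of the Helmholtz problem, i.e. $a(u,v)=F(v)$ for all $v\in H^1(\Omega)$, and let $u_{hp}\in V_{hp}$ be the discrete solution, i.e. $a_{hp}(u_{hp},v_{hp})=F_{hp}(v_{hp})$ for all $v_{hp}\in V_{hp}$. Let $\boldsymbol{\sigma}_{hp}\in H(\mathrm{div};\Omega)$ be any equilibrated flux reconstruction for $u_{hp}$, let $s_{hp}\in H^1_*(\Omega)$ be any potential, and let $\eta_{hp}$ be the error estimator $$\begin{aligned} \eta_{hp}^2 :=& \sum_{T\in\mathcal{T}} \Big( \|\mathcal{G}(u_{hp})+\boldsymbol{\sigma}_{hp}\|_{0,T} + \frac{h_T}{j_{1,1}}\|f + k^2 u_{hp} -\mathrm{div}\,\boldsymbol{\sigma}_{hp}\|_{0,T}\\ &\quad + C_{tr}\sum_{E\in\mathcal{E}(T)\cap \mathcal{E}(\partial\Omega)} h_E^{1/2}\big\|\boldsymbol{\sigma}_{hp}\cdot\boldsymbol{n} + g + iku_{hp} - \gamma k \tfrac{\mathsf{h}}{\mathsf{p}}(g - \nabla_h u_{hp} \cdot \boldsymbol{n} + iku_{hp})\big\|_{0,E}\Big)^2\\ & + \sum_{T\in\mathcal{T}}\|\mathcal{G}(u_{hp})-\nabla s_{hp}\|_{0,T}^2 . \end{aligned}$$ Then $$\|\nabla u-\mathcal{G}(u_{hp})\|_{0,\Omega} \lesssim \eta_{hp} + k^2\|u-u_{hp}\|_{0,\Omega} + k\|u-u_{hp}\|_{0,\partial\Omega} + \big\|\gamma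 k \tfrac{\mathsf{h}}{\mathsf{p}}(g - \nabla_h u_{hp}\cdot\boldsymbol{n} + iku_{hp})\big\|_{0,\partial\Omega}.$$
   Context: All function spaces are complex; $(\cdot,\cdot)_\omega$ is the complex $L^2(\omega)$ inner product ($\int_\omega v\,\overline{w}$), with $\omega=\Omega$ if omitted; $\|\cdot\|_{0,\omega}$ is the $L^2(\omega)$ norm. $\Omega\subset\mathbb{R}^2$ is a bounded Lipschitz domain with outer unit normal $\boldsymbol n$, $f\in L^2(\Omega)$, $g\in L^2(\partial\Omega)$, $k>0$ constant. $x\lesssim y$ means $x\le Cy$ with a generic constant $C$ independent of the wave number $k$, the mesh size and the polynomial degrees, but possibly dependent on the shape regularity of the mesh (the domain $\Omega$ and the parameters $\alpha,\beta,\gamma$ are fixed). Weak form: $a(u,v)=(\nabla u,\nabla v)-k^2(u,v)-ik(u,v)_{\partial\Omega}$, $F(v)=(f,v)+(g,v)_{\partial\Omega}$. Mesh: $\mathcal T$ is a shape-regular conforming triangulation of $\Omega$ into triangles (no hanging nodes); $\mathcal{E}(\Omega)$, $\mathcal{E}(\partial\Omega)$ are the interior and boundary edges, $\mathcal{E}(T)$ the edges of $T$; $h_T$ is the diameter of $T$, $h_E$ the length of $E$. For an interior edge $E=\partial T_+\cap\partial T_-$, with $\boldsymbol n_\pm$ the outer unit normals of $T_\pm$: $\mathcal{T}(E)=\{T_+,T_-\}$, $\omega_E$ is the union of $T_\pm$; for scalar $v$, $\{\!\{v\}\!\}=\frac12(v|_{T_+}+v|_{T_-})$ and $[\![v]\!]=v|_{T_+}\boldsymbol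 n_++v|_{T_-}\boldsymbol n_-$; for vector $\boldsymbol\tau$, $\{\!\{\boldsymbol\tau\}\!\}=\frac12(\boldsymbol\tau|_{T_+}+\boldsymbol\tau|_{T_-})$ and $[\![\boldsymbol\tau]\!]=\boldsymbol\tau|_{T_+}\cdot\boldsymbol n_++\boldsymbol\tau|_{T_-}\cdot\boldsymbol n_-$. $\nabla_h$ is the elementwise gradient. $V_{hp}=\{v\in L^2(\Omega): v|_T\in\mathbb{P}_{p_T}(T)\ \forall T\in\mathcal T\}$ with integers $p_T\ge1$, where $\mathbb P_p$ denotes polynomials of degree $\le p$. The functions $\mathsf h,\mathsf p$ are edgewise constant: $\mathsf h|_E=\min(h_{T_+},h_{T_-})$, $\mathsf p|_E=\max(p_{T_+},p_{T_-})$ for interior $E$; $\mathsf h|_E=h_T$, $\mathsf p|_E=p_T$ for $E=\partial T\cap\partial\Omega$. DG method: with fixed constants $\alpha>0$, $\beta>0$, $0<\gamma<1/3$, $$\begin{aligned}a_{hp}(u,v)=&(\nabla_hu,\nabla_hv)-k^2(u,v)-\sum_{E\in\mathcal E(\Omega)}([\![u]\!],\{\!\{\nabla_hv\}\!\})_E-\sum_{E\in\mathcal E(\Omega)}(\{\!\{\nabla_hu\}\!\},[\![v]\!])_E\\&-(\gamma k\tfrac{\mathsf h}{\mathsf p}u,\nabla_hv\cdot\boldsymbol n)_{\partial\Omega}-(\gamma k\tfrac{\mathsf h}{\mathsf p}\nabla_hu\cdot\boldsymbol n,v)_{\partial\Omega}-i\sum_{E\in\mathcal E(\Omega)}(\beta\tfrac{\mathsf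 h}{\mathsf p}[\![\nabla_hu]\!],[\![\nabla_hv]\!])_E\\&-i\sum_{E\in\mathcal E(\Omega)}(\alpha\tfrac{\mathsf p^2}{\mathsf h}[\![u]\!],[\![v]\!])_E-i(\gamma\tfrac{\mathsf h}{\mathsf p}\nabla_hu\cdot\boldsymbol n,\nabla_hv\cdot\boldsymbol n)_{\partial\Omega}-i(k(1-\gamma k\tfrac{\mathsf h}{\mathsf p})u,v)_{\partial\Omega},\end{aligned}$$ $F_{hp}(v)=(f,v)-i(\gamma\tfrac{\mathsf h}{\mathsf p}g,\nabla_hv\cdot\boldsymbol n)_{\partial\Omega}+((1-\gamma k\tfrac{\mathsf h}{\mathsf p})g,v)_{\partial\Omega}$. DG gradient: for $E\in\mathcal E(\Omega)$, $\mathbb P_0(\mathcal T(E))^2$ is the space of vector fields on $\omega_E$ that are constant on each of $T_\pm$. The lifts $\mathcal L_E^0([\![v]\!]),\mathcal L_E^1([\![\nabla_hv]\!])\in\mathbb P_0(\mathcal T(E))^2$ (extended by zero) are defined by $\int_{\omega_E}\mathcal L^0_E([\![v]\!])\cdot\overline{\boldsymbol\tau}\,dx=\int_E[\![v]\!]\cdot\{\!\{\overline{\boldsymbol\tau}\}\!\}\,ds$ and $\int_{\omega_E}\mathcal L^1_E([\![\nabla_hv]\!])\cdot\overline{\boldsymbol\tau}\,dx=i\beta\int_E\frac{\mathsf h}{\mathsf p}[\![\nabla_hv]\!][\![\overline{\boldsymbol\tau}]\!]\,ds$ for all $\boldsymbol\tau\in\mathbb P_0(\mathcal T(E))^2$.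 Then $\mathcal G(u_{hp})=\nabla_hu_{hp}-\sum_{E\in\mathcal E(\Omega)}\mathcal L_E^0([\![u_{hp}]\!])-\sum_{E\in\mathcal E(\Omega)}\mathcal L_E^1([\![\nabla_hu_{hp}]\!])$. Equilibrated flux reconstruction for $u_{hp}$: any $\boldsymbol\sigma_{hp}\in H(\mathrm{div};\Omega)$ (with $\boldsymbol\sigma_{hp}\cdot\boldsymbol n\in L^2(E)$ on boundary edges, so that the expressions make sense; not necessarily piecewise polynomial) such that $\int_T\mathrm{div}\,\boldsymbol\sigma_{hp}\,dx=\int_Tf+k^2u_{hp}\,dx$ for all $T\in\mathcal T$, and $\int_E\boldsymbol\sigma_{hp}\cdot\boldsymbol n\,ds=\int_E-(g+iku_{hp})+\gamma k\frac{\mathsf h}{\mathsf p}(g-\nabla_hu_{hp}\cdot\boldsymbol n+iku_{hp})\,ds$ for all $E\in\mathcal E(\partial\Omega)$. Potential: any $s_{hp}\in H^1_*(\Omega)=\{v\in H^1(\Omega):(v,1)=0\}$. Constants: $j_{1,1}\approx3.8317$ is the first positive root of the Bessel function of the first kind $J_1$; on element $T$, $C_{tr}^2=(j_{1,1}^{-1}+j_{1,1}^{-2})h_T^2/|T|$. *)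

theory Defs
  imports "HOL-Analysis.Analysis"
begin

section \<open>Square-integrable functions\<close>

type_synonym pt = "real^2"

text \<open>Vector fields take values in \<open>complex^2\<close>, whose library norm is the Hermitian one.
  \<open>dotc\<close> is the Hermitian product \<open>a \<bullet> cnj b\<close>; \<open>dotb\<close> is the bilinear product
  \<open>a \<bullet> b\<close> without conjugation.\<close>

definition dotc :: "complex^2 \<Rightarrow> complex^2 \<Rightarrow> complex" where
  "dotc a b = (\<Sum>i\<in>UNIV. a $ i * cnj (b $ i))"

definition dotb :: "complex^2 \<Rightarrow> complex^2 \<Rightarrow> complex" where
  "dotb a b = (\<Sum>i\<in>UNIV. a $ i * b $ i)"

definition cvec :: "real^2 \<Rightarrow> complex^2" where
  "cvec n = (\<chi> i. complex_of_real (n $ i))"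

definition L2 :: "'a measure \<Rightarrow> ('a \<Rightarrow> 'b::{banach, second_countable_topology}) \<Rightarrow> bool" where
  "L2 M f \<longleftrightarrow> f \<in> borel_measurable M \<and> integrable M (\<lambda>x. (norm (f x))\<^sup>2)"

definition L2norm :: "'a measure \<Rightarrow> ('a \<Rightarrow> 'b::{banach, second_countable_topology}) \<Rightarrow> real" where
  "L2norm M f = sqrt (\<integral>x. (norm (f x))\<^sup>2 \<partial>M)"

definition ip :: "'a measure \<Rightarrow> ('a \<Rightarrow> complex) \<Rightarrow> ('a \<Rightarrow> complex) \<Rightarrow> complex" where
  "ip M v w = (\<integral>x. v x * cnj (w x) \<partial>M)"

definition ipv :: "'a measure \<Rightarrow> ('a \<Rightarrow> complex^2) \<Rightarrow> ('a \<Rightarrow> complex^2) \<Rightarrow> complex" where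
  "ipv M v w = (\<integral>x. dotc (v x) (w x) \<partial>M)"


section \<open>Classical and weak derivatives\<close>

definition partial :: "2 \<Rightarrow> (pt \<Rightarrow> complex) \<Rightarrow> pt \<Rightarrow> complex" where
  "partial i f x = vector_derivative (\<lambda>t. f (x + t *\<^sub>R axis i 1)) (at 0)"

definition grad :: "(pt \<Rightarrow> complex) \<Rightarrow> pt \<Rightarrow> complex^2" where
  "grad f x = (\<chi> i. partial i f x)"

fun Ck :: "nat \<Rightarrow> (pt \<Rightarrow> complex) \<Rightarrow> bool" where
  "Ck 0 f \<longleftrightarrow> continuous_on UNIV f"
| "Ck (Suc n) f \<longleftrightarrow> (\<forall>x. f differentiable at x) \<and> (\<forall>i. Ck n (partial i f))"

definition smooth :: "(pt \<Rightarrow> complex) \<Rightarrow> bool" where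
  "smooth f \<longleftrightarrow> (\<forall>n. Ck n f)"

definition test_fun :: "pt set \<Rightarrow> (pt \<Rightarrow> complex) \<Rightarrow> bool" where
  "test_fun \<Omega> \<phi> \<longleftrightarrow> smooth \<phi> \<and>
     compact (closure {x. \<phi> x \<noteq> 0}) \<and> closure {x. \<phi> x \<noteq> 0} \<subseteq> \<Omega>"

definition has_weak_grad :: "pt set \<Rightarrow> (pt \<Rightarrow> complex) \<Rightarrow> (pt \<Rightarrow> complex^2) \<Rightarrow> bool" where
  "has_weak_grad \<Omega> v w \<longleftrightarrow> (\<forall>\<phi> i. test_fun \<Omega> \<phi> \<longrightarrow>
     (\<integral>x. v x * partial i \<phi> x \<partial>lebesgue_on \<Omega>) = - (\<integral>x. w x $ i * \<phi> x \<partial>lebesgue_on \<Omega>))"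

definition H1 :: "pt set \<Rightarrow> (pt \<Rightarrow> complex) set" where
  "H1 \<Omega> = {v. L2 (lebesgue_on \<Omega>) v \<and> (\<exists>w. L2 (lebesgue_on \<Omega>) w \<and> has_weak_grad \<Omega> v w)}"

definition wgrad :: "pt set \<Rightarrow> (pt \<Rightarrow> complex) \<Rightarrow> pt \<Rightarrow> complex^2" where
  "wgrad \<Omega> v = (SOME w. L2 (lebesgue_on \<Omega>) w \<and> has_weak_grad \<Omega> v w)"

definition H1_mean0 :: "pt set \<Rightarrow> (pt \<Rightarrow> complex) set" where
  "H1_mean0 \<Omega> = {v \<in> H1 \<Omega>. ip (lebesgue_on \<Omega>) v (\<lambda>_. 1) = 0}"

definition has_weak_div :: "pt set \<Rightarrow> (pt \<Rightarrow> complex^2) \<Rightarrow> (pt \<Rightarrow> complex) \<Rightarrow> bool" where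
  "has_weak_div \<Omega> \<sigma> d \<longleftrightarrow> (\<forall>\<phi>. test_fun \<Omega> \<phi> \<longrightarrow>
     (\<integral>x. dotb (\<sigma> x) (grad \<phi> x) \<partial>lebesgue_on \<Omega>) = - (\<integral>x. d x * \<phi> x \<partial>lebesgue_on \<Omega>))"

definition Hdiv :: "pt set \<Rightarrow> (pt \<Rightarrow> complex^2) set" where
  "Hdiv \<Omega> = {\<sigma>. L2 (lebesgue_on \<Omega>) \<sigma> \<and> (\<exists>d. L2 (lebesgue_on \<Omega>) d \<and> has_weak_div \<Omega> \<sigma> d)}"

definition wdiv :: "pt set \<Rightarrow> (pt \<Rightarrow> complex^2) \<Rightarrow> pt \<Rightarrow> complex" where
  "wdiv \<Omega> \<sigma> = (SOME d. L2 (lebesgue_on \<Omega>) d \<and> has_weak_div \<Omega> \<sigma> d)"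


section \<open>Domains and meshes\<close>

definition lipschitz_domain :: "pt set \<Rightarrow> bool" where
  "lipschitz_domain \<Omega> \<longleftrightarrow> open \<Omega> \<and> connected \<Omega> \<and> bounded \<Omega> \<and> \<Omega> \<noteq> {} \<and>
     (\<forall>x\<in>frontier \<Omega>. \<exists>r>0. \<exists>e1 e2 :: pt. \<exists>L. \<exists>\<psi> :: real \<Rightarrow> real.
        norm e1 = 1 \<and> norm e2 = 1 \<and> e1 \<bullet> e2 = 0 \<and> L-lipschitz_on UNIV \<psi> \<and>
        \<Omega> \<inter> ball x r = {y \<in> ball x r. \<psi> (e1 \<bullet> y) < e2 \<bullet> y})"

text \<open>The library's \<open>triangulation\<close> demands that two simplices meet in a common (possibly empty)
  face, which excludes hanging nodes. Elements and edges are closed sets.\<close>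

definition mesh :: "pt set \<Rightarrow> pt set set \<Rightarrow> bool" where
  "mesh \<Omega> \<T> \<longleftrightarrow> triangulation \<T> \<and> (\<forall>T\<in>\<T>. 2 simplex T) \<and> \<Union>\<T> = closure \<Omega>"

text \<open>\<open>h\<^sub>T \<le> \<kappa> \<rho>\<^sub>T\<close>, where \<open>\<rho>\<^sub>T\<close> is the diameter of the largest disc contained in \<open>T\<close>.\<close>

definition shape_regular :: "real \<Rightarrow> pt set set \<Rightarrow> bool" where
  "shape_regular \<kappa> \<T> \<longleftrightarrow> (\<forall>T\<in>\<T>. \<exists>x. \<exists>r>0. cball x r \<subseteq> T \<and> diameter T \<le> \<kappa> * (2 * r))"

definition interior_edges :: "pt set set \<Rightarrow> pt set set" where
  "interior_edges \<T> = {E. \<exists>T\<in>\<T>. \<exists>T'\<in>\<T>. T \<noteq> T' \<and> E edge_of T \<and> E edge_of T'}"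

definition boundary_edges :: "pt set \<Rightarrow> pt set set \<Rightarrow> pt set set" where
  "boundary_edges \<Omega> \<T> = {E. (\<exists>T\<in>\<T>. E edge_of T) \<and> E \<subseteq> frontier \<Omega>}"

definition patch :: "pt set set \<Rightarrow> pt set \<Rightarrow> pt set set" where
  "patch \<T> E = {T\<in>\<T>. E edge_of T}"

definition bdry_elt :: "pt set set \<Rightarrow> pt set \<Rightarrow> pt set" where
  "bdry_elt \<T> E = (THE T. T \<in> patch \<T> E)"

definition normal :: "pt set \<Rightarrow> pt set \<Rightarrow> pt" where
  "normal T E = (THE n. norm n = 1 \<and> (\<forall>x\<in>E. \<forall>y\<in>T. n \<bullet> (y - x) \<le> 0))"

text \<open>On a boundary edge the patch is a singleton, so \<open>hE\<close> and \<open>pE\<close> give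
  \<open>h\<^sub>T\<close> and \<open>p\<^sub>T\<close> there.\<close>

definition hE :: "pt set set \<Rightarrow> pt set \<Rightarrow> real" where
  "hE \<T> E = Min (diameter ` patch \<T> E)"

definition pE :: "pt set set \<Rightarrow> (pt set \<Rightarrow> nat) \<Rightarrow> pt set \<Rightarrow> real" where
  "pE \<T> p E = real (Max (p ` patch \<T> E))"

definition hp :: "pt set set \<Rightarrow> (pt set \<Rightarrow> nat) \<Rightarrow> pt set \<Rightarrow> real" where
  "hp \<T> p E = hE \<T> E / pE \<T> p E"

text \<open>Arc length on the segment \<open>E\<close>; the measure does not depend on the orientation chosen.\<close>

definition arclen :: "pt set \<Rightarrow> pt measure" where
  "arclen E = (let ab = (SOME ab. E = closed_segment (fst ab) (snd ab)) in
     completion (scale_measure (ennreal (dist (fst ab) (snd ab)))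
       (distr (restrict_space lborel {0..1}) borel (linepath (fst ab) (snd ab)))))"

text \<open>The boundary of a triangulated domain is the union of the boundary edges, which meet only
  in endpoints; integrals over it are sums of edge integrals.\<close>

definition L2_bdry :: "pt set \<Rightarrow> pt set set \<Rightarrow> (pt \<Rightarrow> complex) \<Rightarrow> bool" where
  "L2_bdry \<Omega> \<T> q \<longleftrightarrow> (\<forall>E\<in>boundary_edges \<Omega> \<T>. L2 (arclen E) q)"

definition ip_bdry :: "pt set \<Rightarrow> pt set set \<Rightarrow> (pt \<Rightarrow> complex) \<Rightarrow> (pt \<Rightarrow> complex) \<Rightarrow> complex" where
  "ip_bdry \<Omega> \<T> v w = (\<Sum>E\<in>boundary_edges \<Omega> \<T>. ip (arclen E) v w)"

text \<open>The trace operator as the continuous extension to \<open>H\<^sup>1(\<Omega>)\<close> of the restriction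
  \<open>\<phi> \<mapsto> \<phi>|\<^bsub>\<partial>\<Omega>\<^esub>\<close> of smooth functions.\<close>

definition is_trace :: "pt set \<Rightarrow> pt set set \<Rightarrow> (pt \<Rightarrow> complex) \<Rightarrow> (pt \<Rightarrow> complex) \<Rightarrow> bool" where
  "is_trace \<Omega> \<T> v t \<longleftrightarrow> L2_bdry \<Omega> \<T> t \<and>
     (\<exists>\<phi> :: nat \<Rightarrow> pt \<Rightarrow> complex. (\<forall>n. smooth (\<phi> n)) \<and>
        (\<lambda>n. L2norm (lebesgue_on \<Omega>) (\<lambda>x. \<phi> n x - v x)) \<longlonglongrightarrow> 0 \<and>
        (\<lambda>n. L2norm (lebesgue_on \<Omega>) (\<lambda>x. grad (\<phi> n) x - wgrad \<Omega> v x)) \<longlonglongrightarrow> 0 \<and>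
        (\<forall>E\<in>boundary_edges \<Omega> \<T>. (\<lambda>n. L2norm (arclen E) (\<lambda>x. \<phi> n x - t x)) \<longlonglongrightarrow> 0))"

definition bdry_trace :: "pt set \<Rightarrow> pt set set \<Rightarrow> (pt \<Rightarrow> complex) \<Rightarrow> pt \<Rightarrow> complex" where
  "bdry_trace \<Omega> \<T> v = (SOME t. is_trace \<Omega> \<T> v t)"

text \<open>The normal trace of a field in \<open>H(div; \<Omega>)\<close> is defined by Green's formula.\<close>

definition is_ntrace ::
    "pt set \<Rightarrow> pt set set \<Rightarrow> (pt \<Rightarrow> complex^2) \<Rightarrow> (pt \<Rightarrow> complex) \<Rightarrow> bool" where
  "is_ntrace \<Omega> \<T> \<sigma> q \<longleftrightarrow> L2_bdry \<Omega> \<T> q \<and>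
     (\<forall>v\<in>H1 \<Omega>. ipv (lebesgue_on \<Omega>) \<sigma> (wgrad \<Omega> v) + ip (lebesgue_on \<Omega>) (wdiv \<Omega> \<sigma>) v
        = ip_bdry \<Omega> \<T> q (bdry_trace \<Omega> \<T> v))"

definition ntrace :: "pt set \<Rightarrow> pt set set \<Rightarrow> (pt \<Rightarrow> complex^2) \<Rightarrow> pt \<Rightarrow> complex" where
  "ntrace \<Omega> \<T> \<sigma> = (SOME q. is_ntrace \<Omega> \<T> \<sigma> q)"


section \<open>Weak form of the Helmholtz problem\<close>

definition a_form :: "pt set \<Rightarrow> pt set set \<Rightarrow> real \<Rightarrow>
    (pt \<Rightarrow> complex) \<Rightarrow> (pt \<Rightarrow> complex) \<Rightarrow> complex" where
  "a_form \<Omega> \<T> k u v = ipv (lebesgue_on \<Omega>) (wgrad \<Omega> u) (wgrad \<Omega> v)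
     - k\<^sup>2 * ip (lebesgue_on \<Omega>) u v
     - \<i> * k * ip_bdry \<Omega> \<T> (bdry_trace \<Omega> \<T> u) (bdry_trace \<Omega> \<T> v)"

definition F_form :: "pt set \<Rightarrow> pt set set \<Rightarrow> (pt \<Rightarrow> complex) \<Rightarrow> (pt \<Rightarrow> complex) \<Rightarrow>
    (pt \<Rightarrow> complex) \<Rightarrow> complex" where
  "F_form \<Omega> \<T> f g v = ip (lebesgue_on \<Omega>) f v + ip_bdry \<Omega> \<T> g (bdry_trace \<Omega> \<T> v)"

definition weak_solution :: "pt set \<Rightarrow> pt set set \<Rightarrow> real \<Rightarrow> (pt \<Rightarrow> complex) \<Rightarrow> (pt \<Rightarrow> complex) \<Rightarrow>
    (pt \<Rightarrow> complex) \<Rightarrow> bool" where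
  "weak_solution \<Omega> \<T> k f g u \<longleftrightarrow>
     u \<in> H1 \<Omega> \<and> (\<forall>v\<in>H1 \<Omega>. a_form \<Omega> \<T> k u v = F_form \<Omega> \<T> f g v)"


section \<open>Broken functions and the discontinuous Galerkin method\<close>

text \<open>A piecewise defined function \<open>v\<close> is represented by the family \<open>T \<mapsto> v|\<^sub>T\<close>, so that its
  one-sided values on edges make sense. \<open>glue\<close> yields the function on \<open>\<Omega>\<close> (up to the
  null set formed by the edges).\<close>

type_synonym 'b broken = "pt set \<Rightarrow> pt \<Rightarrow> 'b"

definition glue :: "pt set set \<Rightarrow> ('b::real_vector) broken \<Rightarrow> pt \<Rightarrow> 'b" where
  "glue \<T> v x = (\<Sum>T\<in>\<T>. indicator (interior T) x *\<^sub>R v T x)"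

definition poly_deg_le :: "nat \<Rightarrow> (pt \<Rightarrow> complex) \<Rightarrow> bool" where
  "poly_deg_le m q \<longleftrightarrow> (\<exists>c :: nat \<Rightarrow> nat \<Rightarrow> complex. \<forall>x.
     q x = (\<Sum>i\<le>m. \<Sum>j\<le>m - i. c i j * complex_of_real (x $ 1 ^ i * x $ 2 ^ j)))"

definition V_hp :: "pt set set \<Rightarrow> (pt set \<Rightarrow> nat) \<Rightarrow> complex broken set" where
  "V_hp \<T> p = {v. \<forall>T\<in>\<T>. poly_deg_le (p T) (v T)}"

definition gradh :: "complex broken \<Rightarrow> (complex^2) broken" where
  "gradh v T = grad (v T)"

definition avg :: "pt set set \<Rightarrow> pt set \<Rightarrow> (complex^2) broken \<Rightarrow> pt \<Rightarrow> complex^2" where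
  "avg \<T> E \<tau> x = (1/2) *\<^sub>R (\<Sum>T\<in>patch \<T> E. \<tau> T x)"

definition jump :: "pt set set \<Rightarrow> pt set \<Rightarrow> complex broken \<Rightarrow> pt \<Rightarrow> complex^2" where
  "jump \<T> E v x = (\<Sum>T\<in>patch \<T> E. v T x *s cvec (normal T E))"

definition njump :: "pt set set \<Rightarrow> pt set \<Rightarrow> (complex^2) broken \<Rightarrow> pt \<Rightarrow> complex" where
  "njump \<T> E \<tau> x = (\<Sum>T\<in>patch \<T> E. dotb (\<tau> T x) (cvec (normal T E)))"

text \<open>The values of \<open>v\<close> and of \<open>\<nabla>\<^sub>h v \<bullet> n\<close> on a boundary edge.\<close>

definition bval :: "pt set set \<Rightarrow> pt set \<Rightarrow> complex broken \<Rightarrow> pt \<Rightarrow> complex" where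
  "bval \<T> E v x = v (bdry_elt \<T> E) x"

definition bdn :: "pt set set \<Rightarrow> pt set \<Rightarrow> complex broken \<Rightarrow> pt \<Rightarrow> complex" where
  "bdn \<T> E v x = dotb (gradh v (bdry_elt \<T> E) x) (cvec (normal (bdry_elt \<T> E) E))"

definition a_hp :: "pt set \<Rightarrow> pt set set \<Rightarrow> (pt set \<Rightarrow> nat) \<Rightarrow> real \<Rightarrow> real \<Rightarrow> real \<Rightarrow> real \<Rightarrow>
    complex broken \<Rightarrow> complex broken \<Rightarrow> complex" where
  "a_hp \<Omega> \<T> p \<alpha> \<beta> \<gamma> k u v =
     ipv (lebesgue_on \<Omega>) (glue \<T> (gradh u)) (glue \<T> (gradh v))
     - k\<^sup>2 * ip (lebesgue_on \<Omega>) (glue \<T> u) (glue \<T> v)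
     - (\<Sum>E\<in>interior_edges \<T>. ipv (arclen E) (jump \<T> E u) (avg \<T> E (gradh v)))
     - (\<Sum>E\<in>interior_edges \<T>. ipv (arclen E) (avg \<T> E (gradh u)) (jump \<T> E v))
     - (\<Sum>E\<in>boundary_edges \<Omega> \<T>.
          ip (arclen E) (\<lambda>x. complex_of_real (\<gamma> * k * hp \<T> p E) * bval \<T> E u x) (bdn \<T> E v))
     - (\<Sum>E\<in>boundary_edges \<Omega> \<T>.
          ip (arclen E) (\<lambda>x. complex_of_real (\<gamma> * k * hp \<T> p E) * bdn \<T> E u x) (bval \<T> E v))
     - \<i> * (\<Sum>E\<in>interior_edges \<T>.
          ip (arclen E) (\<lambda>x. complex_of_real (\<beta> * hp \<T> p E) * njump \<T> E (gradh u) x) (njump \<T> E (gradh v)))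
     - \<i> * (\<Sum>E\<in>interior_edges \<T>.
          ipv (arclen E) (\<lambda>x. (\<alpha> * (pE \<T> p E)\<^sup>2 / hE \<T> E) *\<^sub>R jump \<T> E u x) (jump \<T> E v))
     - \<i> * (\<Sum>E\<in>boundary_edges \<Omega> \<T>.
          ip (arclen E) (\<lambda>x. complex_of_real (\<gamma> * hp \<T> p E) * bdn \<T> E u x) (bdn \<T> E v))
     - \<i> * (\<Sum>E\<in>boundary_edges \<Omega> \<T>.
          ip (arclen E) (\<lambda>x. complex_of_real (k * (1 - \<gamma> * k * hp \<T> p E)) * bval \<T> E u x) (bval \<T> E v))"

definition F_hp :: "pt set \<Rightarrow> pt set set \<Rightarrow> (pt set \<Rightarrow> nat) \<Rightarrow> real \<Rightarrow> real \<Rightarrow>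
    (pt \<Rightarrow> complex) \<Rightarrow> (pt \<Rightarrow> complex) \<Rightarrow> complex broken \<Rightarrow> complex" where
  "F_hp \<Omega> \<T> p \<gamma> k f g v =
     ip (lebesgue_on \<Omega>) f (glue \<T> v)
     - \<i> * (\<Sum>E\<in>boundary_edges \<Omega> \<T>. ip (arclen E) (\<lambda>x. complex_of_real (\<gamma> * hp \<T> p E) * g x) (bdn \<T> E v))
     + (\<Sum>E\<in>boundary_edges \<Omega> \<T>.
          ip (arclen E) (\<lambda>x. complex_of_real (1 - \<gamma> * k * hp \<T> p E) * g x) (bval \<T> E v))"

definition dg_solution :: "pt set \<Rightarrow> pt set set \<Rightarrow> (pt set \<Rightarrow> nat) \<Rightarrow>
    real \<Rightarrow> real \<Rightarrow> real \<Rightarrow> real \<Rightarrow> (pt \<Rightarrow> complex) \<Rightarrow> (pt \<Rightarrow> complex) \<Rightarrow> complex broken \<Rightarrow> bool" where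
  "dg_solution \<Omega> \<T> p \<alpha> \<beta> \<gamma> k f g u \<longleftrightarrow> u \<in> V_hp \<T> p \<and>
     (\<forall>v\<in>V_hp \<T> p. a_hp \<Omega> \<T> p \<alpha> \<beta> \<gamma> k u v = F_hp \<Omega> \<T> p \<gamma> k f g v)"


section \<open>Discrete gradient, flux reconstruction and estimator\<close>

text \<open>An element of \<open>P\<^sub>0(\<T>(E))\<^sup>2\<close> is given by its constant values on the elements of the patch.\<close>

definition lift0 :: "pt set set \<Rightarrow> pt set \<Rightarrow> complex broken \<Rightarrow> pt set \<Rightarrow> complex^2" where
  "lift0 \<T> E v = (THE L. (\<forall>T. T \<notin> patch \<T> E \<longrightarrow> L T = 0) \<and>
     (\<forall>\<tau>. (\<Sum>T\<in>patch \<T> E. ipv (lebesgue_on T) (\<lambda>_. L T) (\<lambda>_. \<tau> T))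
        = ipv (arclen E) (jump \<T> E v) (avg \<T> E (\<lambda>T _. \<tau> T))))"

definition lift1 :: "pt set set \<Rightarrow> (pt set \<Rightarrow> nat) \<Rightarrow> real \<Rightarrow> pt set \<Rightarrow> complex broken \<Rightarrow>
    pt set \<Rightarrow> complex^2" where
  "lift1 \<T> p \<beta> E v = (THE L. (\<forall>T. T \<notin> patch \<T> E \<longrightarrow> L T = 0) \<and>
     (\<forall>\<tau>. (\<Sum>T\<in>patch \<T> E. ipv (lebesgue_on T) (\<lambda>_. L T) (\<lambda>_. \<tau> T))
        = \<i> * \<beta> * ip (arclen E) (\<lambda>x. complex_of_real (hp \<T> p E) * njump \<T> E (gradh v) x)
                            (njump \<T> E (\<lambda>T _. \<tau> T))))"

definition dg_grad :: "pt set set \<Rightarrow> (pt set \<Rightarrow> nat) \<Rightarrow> real \<Rightarrow> complex broken \<Rightarrow>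
    (complex^2) broken" where
  "dg_grad \<T> p \<beta> u T x = gradh u T x
     - (\<Sum>E\<in>interior_edges \<T>. lift0 \<T> E u T)
     - (\<Sum>E\<in>interior_edges \<T>. lift1 \<T> p \<beta> E u T)"

text \<open>The boundary term \<open>\<gamma> k (h/p) (g - \<nabla>\<^sub>h u \<bullet> n + i k u)\<close> on the boundary edge \<open>E\<close>.\<close>

definition bres :: "pt set set \<Rightarrow> (pt set \<Rightarrow> nat) \<Rightarrow> real \<Rightarrow> real \<Rightarrow> (pt \<Rightarrow> complex) \<Rightarrow>
    complex broken \<Rightarrow> pt set \<Rightarrow> pt \<Rightarrow> complex" where
  "bres \<T> p \<gamma> k g u E x =
     complex_of_real (\<gamma> * k * hp \<T> p E) * (g x - bdn \<T> E u x + \<i> * k * bval \<T> E u x)"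

definition equilibrated_flux :: "pt set \<Rightarrow> pt set set \<Rightarrow> (pt set \<Rightarrow> nat) \<Rightarrow> real \<Rightarrow> real \<Rightarrow>
    (pt \<Rightarrow> complex) \<Rightarrow> (pt \<Rightarrow> complex) \<Rightarrow> complex broken \<Rightarrow> (pt \<Rightarrow> complex^2) \<Rightarrow> bool" where
  "equilibrated_flux \<Omega> \<T> p \<gamma> k f g u \<sigma> \<longleftrightarrow>
     \<sigma> \<in> Hdiv \<Omega> \<and> (\<exists>q. is_ntrace \<Omega> \<T> \<sigma> q) \<and>
     (\<forall>T\<in>\<T>. (\<integral>x. wdiv \<Omega> \<sigma> x \<partial>lebesgue_on T) = (\<integral>x. f x + k\<^sup>2 * u T x \<partial>lebesgue_on T)) \<and>
     (\<forall>E\<in>boundary_edges \<Omega> \<T>. (\<integral>x. ntrace \<Omega> \<T> \<sigma> x \<partial>arclen E)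
        = (\<integral>x. - (g x + \<i> * k * bval \<T> E u x) + bres \<T> p \<gamma> k g u E x \<partial>arclen E))"

definition bessel_J :: "nat \<Rightarrow> real \<Rightarrow> real" where
  "bessel_J n x = (\<Sum>m. (-1) ^ m / (fact m * fact (m + n)) * (x / 2) ^ (2 * m + n))"

definition j11 :: real where
  "j11 = (LEAST x. 0 < x \<and> bessel_J 1 x = 0)"

definition C_tr :: "pt set \<Rightarrow> real" where
  "C_tr T = sqrt ((1 / j11 + 1 / j11\<^sup>2) * (diameter T)\<^sup>2 / measure lebesgue T)"

definition eta_hp :: "pt set \<Rightarrow> pt set set \<Rightarrow> (pt set \<Rightarrow> nat) \<Rightarrow> real \<Rightarrow> real \<Rightarrow> real \<Rightarrow>
    (pt \<Rightarrow> complex) \<Rightarrow> (pt \<Rightarrow> complex) \<Rightarrow> complex broken \<Rightarrow> (pt \<Rightarrow> complex^2) \<Rightarrow> (pt \<Rightarrow> complex) \<Rightarrow>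
    real" where
  "eta_hp \<Omega> \<T> p \<beta> \<gamma> k f g u \<sigma> s = sqrt (
     (\<Sum>T\<in>\<T>. (L2norm (lebesgue_on T) (\<lambda>x. dg_grad \<T> p \<beta> u T x + \<sigma> x)
        + diameter T / j11 * L2norm (lebesgue_on T) (\<lambda>x. f x + k\<^sup>2 * u T x - wdiv \<Omega> \<sigma> x)
        + C_tr T * (\<Sum>E | E edge_of T \<and> E \<in> boundary_edges \<Omega> \<T>.
            sqrt (diameter E) * L2norm (arclen E)
              (\<lambda>x. ntrace \<Omega> \<T> \<sigma> x + g x + \<i> * k * bval \<T> E u x - bres \<T> p \<gamma> k g u E x)))\<^sup>2)
     + (\<Sum>T\<in>\<T>. (L2norm (lebesgue_on T) (\<lambda>x. dg_grad \<T> p \<beta> u T x - wgrad \<Omega> s x))\<^sup>2))"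

text \<open>\<open>L\<^sup>2(\<partial>\<Omega>)\<close> norm of a function given edge by edge.\<close>

definition L2norm_bdry :: "pt set \<Rightarrow> pt set set \<Rightarrow> (pt set \<Rightarrow> pt \<Rightarrow> complex) \<Rightarrow> real" where
  "L2norm_bdry \<Omega> \<T> w = sqrt (\<Sum>E\<in>boundary_edges \<Omega> \<T>. (L2norm (arclen E) (w E))\<^sup>2)"

end

theory Submission
  imports Defs
begin

text \<open>
  Put \<open>e = \<nabla>u - G\<close> with \<open>G\<close> the DG gradient, \<open>w = \<nabla>u - \<nabla>s\<close> and \<open>S\<close> the norm of \<open>G - \<nabla>s\<close>. Then
  \<open>\<parallel>e\<parallel>\<^sup>2 = (e, w) - (e, G - \<nabla>s)\<close> and \<open>\<parallel>w\<parallel> \<le> \<parallel>e\<parallel> + S\<close>, so that a bound \<open>\<bar>(e, w)\<bar> \<le> A \<parallel>w\<parallel>\<close> gives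
  \<open>\<parallel>e\<parallel> \<le> 2 (A + S)\<close>. As smooth functions are dense in \<open>H\<^sup>1\<close>, it suffices to bound \<open>(e, \<nabla>\<phi>)\<close> for smooth
  \<open>\<phi>\<close>, from which a constant may be subtracted. The weak formulation and integration by parts of \<open>\<sigma>\<close>
  express \<open>(e, \<nabla>\<phi>)\<close> by \<open>G + \<sigma>\<close>, the element and boundary residuals, and the terms in \<open>u - u\<^sub>h\<close>. By
  equilibration the residuals have mean zero on each element and each boundary edge, so the mean of
  \<open>\<phi>\<close> on the element can be subtracted there, and the explicit Poincare and trace inequalities on
  triangles apply. The remaining terms need a Poincare and a trace inequality on \<open>\<Omega>\<close> with constants
  that do not depend on the mesh: both are taken from one fixed reference mesh of \<open>\<Omega>\<close>.
\<close>

section \<open>Square-integrable functions\<close>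

text \<open>\<open>wgrad\<close> and \<open>bdry_trace\<close> are choices, so nothing can be
  computed with them until weak gradients are known to be unique and traces to exist and to agree
  with restriction for smooth functions. This forces the long preparation: approximation of
  \<open>H1\<close> functions up to the boundary of a Lipschitz domain, obtained by mollifying with
  kernels shifted into the domain, and a trace inequality for smooth functions. Smooth functions
  have point values, so segments and rays can be integrated along directly. The field
  \<open>w\<close> is itself a gradient and is approximated by admissible ones; hence no Helmholtz
  decomposition of the error is made, and the price is the quadratic inequality behind the factor 2.
  The elementwise inequalities are proved with the numbers 2 in place of \<open>1 / j11\<close> and
  \<open>sqrt 6\<close> in place of the root in \<open>C_tr\<close>; the quotients
  \<open>2 * j11\<close> and \<open>ktr\<close> carry the difference, for which \<open>j11\<close>
  has to be shown positive. One reference mesh suffices because the boundary edges of every mesh lie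
  in the same set \<open>frontier \<Omega>\<close>, and means over any two convex pieces of the
  connected domain can be compared.\<close>

lemma L2norm_nonneg [simp]: "0 \<le> L2norm M f"
  by (simp add: L2norm_def)

lemma L2norm_power2: "(L2norm M f)\<^sup>2 = (\<integral>x. (norm (f x))\<^sup>2 \<partial>M)"
  by (simp add: L2norm_def)

lemma L2D:
  assumes "L2 M f"
  shows "f \<in> borel_measurable M" "integrable M (\<lambda>x. (norm (f x))\<^sup>2)"
  using assms by (auto simp: L2_def)

lemma L2_iff_nn_integral:
  assumes "f \<in> borel_measurable M"
  shows "L2 M f \<longleftrightarrow> (\<integral>\<^sup>+x. ennreal ((norm (f x))\<^sup>2) \<partial>M) < \<infinity>"
  using assms by (auto simp: L2_def integrable_iff_bounded)

lemma nn_integral_L2norm: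
  assumes "L2 M f"
  shows "(\<integral>\<^sup>+x. ennreal ((norm (f x))\<^sup>2) \<partial>M) = ennreal ((L2norm M f)\<^sup>2)"
  unfolding L2norm_power2 using assms by (intro nn_integral_eq_integral) (auto simp: L2_def)

lemma L2_norm_iff: "f \<in> borel_measurable M \<Longrightarrow> L2 M (\<lambda>x. norm (f x)) \<longleftrightarrow> L2 M f"
  by (simp add: L2_def)

lemma L2_norm: "L2 M f \<Longrightarrow> L2 M (\<lambda>x. norm (f x))"
  using L2_norm_iff[of f M] L2D(1)[of M f] by blast

lemma L2norm_norm [simp]: "L2norm M (\<lambda>x. norm (f x)) = L2norm M f"
  by (simp add: L2norm_def)

lemma L2norm_cong_AE:
  assumes "f \<in> borel_measurable M" "g \<in> borel_measurable M" "AE x in M. f x = g x"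
  shows "L2norm M f = L2norm M g"
  unfolding L2norm_def
  by (intro arg_cong[of _ _ sqrt] integral_cong_AE) (use assms in auto)

lemma L2_bound:
  assumes "L2 M g" "f \<in> borel_measurable M" "AE x in M. norm (f x) \<le> norm (g x)"
  shows "L2 M f" "L2norm M f \<le> L2norm M g"
proof -
  show f: "L2 M f"
    unfolding L2_def
    by (intro conjI assms Bochner_Integration.integrable_bound[OF L2D(2)[OF assms(1)]])
       (use assms in \<open>auto elim!: eventually_mono intro: power_mono\<close>)
  show "L2norm M f \<le> L2norm M g"
    unfolding L2norm_def
    by (intro real_sqrt_le_mono integral_mono_AE L2D f assms)
       (use assms in \<open>auto elim!: eventually_mono intro: power_mono\<close>)
qed

lemma L2_zero [simp]: "L2 M (\<lambda>x. 0)" and L2norm_zero [simp]: "L2norm M (\<lambda>x. 0) = 0"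
  by (auto simp: L2_def L2norm_def)

lemma integrable_norm_mult:
  assumes "L2 M f" "L2 M g"
  shows "integrable M (\<lambda>x. norm (f x) * norm (g x))"
proof (rule Bochner_Integration.integrable_bound)
  show "integrable M (\<lambda>x. (norm (f x))\<^sup>2 + (norm (g x))\<^sup>2)"
    using assms by (intro Bochner_Integration.integrable_add L2D)
  show "(\<lambda>x. norm (f x) * norm (g x)) \<in> borel_measurable M"
    using L2D(1)[OF assms(1)] L2D(1)[OF assms(2)] by measurable
  show "AE x in M. norm (norm (f x) * norm (g x)) \<le> norm ((norm (f x))\<^sup>2 + (norm (g x))\<^sup>2)"
  proof (rule AE_I2)
    fix x
    have "2 * (norm (f x) * norm (g x)) \<le> (norm (f x))\<^sup>2 + (norm (g x))\<^sup>2"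
      using sum_squares_bound[of "norm (f x)" "norm (g x)"] by simp
    moreover have "0 \<le> norm (f x) * norm (g x)" by simp
    ultimately have "norm (f x) * norm (g x) \<le> (norm (f x))\<^sup>2 + (norm (g x))\<^sup>2" by linarith
    then show "norm (norm (f x) * norm (g x)) \<le> norm ((norm (f x))\<^sup>2 + (norm (g x))\<^sup>2)"
      by simp
  qed
qed

lemma Cauchy_Schwarz_L2:
  assumes "L2 M f" "L2 M g"
  shows "(\<integral>x. norm (f x) * norm (g x) \<partial>M) \<le> L2norm M f * L2norm M g"
proof -
  have m[measurable]: "f \<in> borel_measurable M" "g \<in> borel_measurable M"
    using assms by (auto simp: L2_def)
  have "(ennreal (\<integral>x. norm (f x) * norm (g x) \<partial>M))\<^sup>2
      = (\<integral>\<^sup>+x. ennreal (norm (f x)) * ennreal (norm (g x)) \<partial>M)\<^sup>2"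
    using integrable_norm_mult[OF assms]
    by (subst nn_integral_eq_integral[symmetric]) (auto simp: ennreal_mult)
  also have "\<dots> \<le> (\<integral>\<^sup>+x. (ennreal (norm (f x)))\<^sup>2 \<partial>M) * (\<integral>\<^sup>+x. (ennreal (norm (g x)))\<^sup>2 \<partial>M)"
    by (intro Cauchy_Schwarz_nn_integral) auto
  also have "\<dots> = ennreal ((L2norm M f * L2norm M g)\<^sup>2)"
    by (simp add: ennreal_power nn_integral_L2norm assms ennreal_mult power_mult_distrib)
  finally have "(\<integral>x. norm (f x) * norm (g x) \<partial>M)\<^sup>2 \<le> (L2norm M f * L2norm M g)\<^sup>2"
    by (simp add: ennreal_power)
  then show ?thesis by (rule power2_le_imp_le) simp
qed

lemma L2_add: assumes "L2 M f" "L2 M g" shows "L2 M (\<lambda>x. f x + g x)"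
proof -
  have m[measurable]: "f \<in> borel_measurable M" "g \<in> borel_measurable M"
    using assms by (auto simp: L2_def)
  show ?thesis unfolding L2_def
  proof (rule conjI, measurable, rule Bochner_Integration.integrable_bound)
    show "integrable M (\<lambda>x. 2 * (norm (f x))\<^sup>2 + 2 * (norm (g x))\<^sup>2)"
      using assms by (auto simp: L2_def)
    show "AE x in M. norm ((norm (f x + g x))\<^sup>2) \<le> norm (2 * (norm (f x))\<^sup>2 + 2 * (norm (g x))\<^sup>2)"
    proof (rule AE_I2)
      fix x
      have "(norm (f x + g x))\<^sup>2 \<le> (norm (f x) + norm (g x))\<^sup>2"
        by (intro power_mono norm_triangle_ineq) auto
      also have "\<dots> \<le> 2 * (norm (f x))\<^sup>2 + 2 * (norm (g x))\<^sup>2"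
        using sum_squares_bound[of "norm (f x)" "norm (g x)"] by (simp add: power2_sum)
      finally show "norm ((norm (f x + g x))\<^sup>2) \<le> norm (2 * (norm (f x))\<^sup>2 + 2 * (norm (g x))\<^sup>2)"
        by simp
    qed
  qed measurable
qed

lemma L2norm_triangle:
  assumes "L2 M f" "L2 M g"
  shows "L2norm M (\<lambda>x. f x + g x) \<le> L2norm M f + L2norm M g"
proof -
  have fg: "L2 M (\<lambda>x. f x + g x)" by (rule L2_add[OF assms])
  have "(L2norm M (\<lambda>x. f x + g x))\<^sup>2
     \<le> (\<integral>x. (norm (f x))\<^sup>2 + 2 * (norm (f x) * norm (g x)) + (norm (g x))\<^sup>2 \<partial>M)"
    unfolding L2norm_power2
  proof (intro integral_mono L2D fg Bochner_Integration.integrable_add assms)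
    show "integrable M (\<lambda>x. 2 * (norm (f x) * norm (g x)))"
      using integrable_norm_mult[OF assms] by simp
    fix x
    have "(norm (f x + g x))\<^sup>2 \<le> (norm (f x) + norm (g x))\<^sup>2"
      by (intro power_mono norm_triangle_ineq) auto
    then show "(norm (f x + g x))\<^sup>2 \<le> (norm (f x))\<^sup>2 + 2 * (norm (f x) * norm (g x)) + (norm (g x))\<^sup>2"
      by (simp add: power2_sum)
  qed
  also have "\<dots> = (L2norm M f)\<^sup>2 + 2 * (\<integral>x. norm (f x) * norm (g x) \<partial>M) + (L2norm M g)\<^sup>2"
    unfolding L2norm_power2 using integrable_norm_mult[OF assms] assms
    by (simp add: L2_def)
  also have "\<dots> \<le> (L2norm M f + L2norm M g)\<^sup>2"
    using Cauchy_Schwarz_L2[OF assms] by (simp add: power2_sum)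
  finally show ?thesis by (rule power2_le_imp_le) simp
qed

lemma L2_scaleR: "L2 M f \<Longrightarrow> L2 M (\<lambda>x. c *\<^sub>R f x)"
  by (auto simp: L2_def power_mult_distrib)

lemma L2_cmult: "L2 M f \<Longrightarrow> L2 M (\<lambda>x. (c::complex) * f x)"
  by (auto simp: L2_def power_mult_distrib norm_mult)

lemma L2_minus: "L2 M f \<Longrightarrow> L2 M (\<lambda>x. - f x)"
  using L2_scaleR[of M f "-1"] by simp

lemma L2norm_minus [simp]: "L2norm M (\<lambda>x. - f x) = L2norm M f"
  by (simp add: L2norm_def)

lemma L2_diff: "L2 M f \<Longrightarrow> L2 M g \<Longrightarrow> L2 M (\<lambda>x. f x - g x)"
  using L2_add[of M f "\<lambda>x. - g x"] by (simp add: L2_minus)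

lemma L2norm_commute: "L2norm M (\<lambda>x. f x - g x) = L2norm M (\<lambda>x. g x - f x)"
  by (simp add: L2norm_def norm_minus_commute)

lemma L2norm_diff_trans:
  assumes "L2 M (\<lambda>x. f x - g x)" "L2 M (\<lambda>x. g x - h x)"
  shows "L2norm M (\<lambda>x. f x - h x) \<le> L2norm M (\<lambda>x. f x - g x) + L2norm M (\<lambda>x. g x - h x)"
  using L2norm_triangle[OF assms] by simp

lemma L2norm_le_add_diff:
  assumes "L2 M f" "L2 M g"
  shows "L2norm M f \<le> L2norm M g + L2norm M (\<lambda>x. f x - g x)"
  using L2norm_triangle[OF assms(2) L2_diff[OF assms]] by simp

lemma L2_sum:
  assumes "finite I" "\<And>i. i \<in> I \<Longrightarrow> L2 M (f i)"
  shows "L2 M (\<lambda>x. \<Sum>i\<in>I. f i x)"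
  using assms by (induction I rule: finite_induct) (auto intro: L2_add)

lemma L2norm_sum_le:
  assumes "finite I" "\<And>i. i \<in> I \<Longrightarrow> L2 M (f i)"
  shows "L2norm M (\<lambda>x. \<Sum>i\<in>I. f i x) \<le> (\<Sum>i\<in>I. L2norm M (f i))"
  using assms
proof (induction I rule: finite_induct)
  case (insert i I)
  have "L2norm M (\<lambda>x. f i x + (\<Sum>i\<in>I. f i x)) \<le> L2norm M (f i) + L2norm M (\<lambda>x. \<Sum>i\<in>I. f i x)"
    by (rule L2norm_triangle) (use insert L2_sum[of I M f] in auto)
  then show ?case using insert by auto
qed simp

lemma (in finite_measure) L2_const: "L2 M (\<lambda>x. c)"
  by (simp add: L2_def)

lemma (in finite_measure) L2_imp_integrable:
  assumes "L2 M f" shows "integrable M f"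
proof (rule Bochner_Integration.integrable_bound)
  show "integrable M (\<lambda>x. norm (f x) * norm (1::real))"
    using integrable_norm_mult[OF assms L2_const] .
qed (use assms in \<open>auto simp: L2_def\<close>)

lemma (in finite_measure) L2_bounded:
  assumes "f \<in> borel_measurable M" "AE x in M. norm (f x) \<le> B"
  shows "L2 M f"
proof (rule L2_bound(1)[OF L2_const assms(1)])
  show "AE x in M. norm (f x) \<le> norm B"
    using assms(2) by eventually_elim auto
qed

lemma (in finite_measure) integral_norm_le_L2norm:
  assumes "L2 M f" shows "(\<integral>x. norm (f x) \<partial>M) \<le> L2norm M f * sqrt (measure M (space M))"
  using Cauchy_Schwarz_L2[OF assms L2_const[of "1::real"]] by (simp add: L2norm_def)

lemma L2_zero_AE:
  assumes "L2 M f" "L2norm M f = 0" shows "AE x in M. f x = 0"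
proof -
  have "(\<integral>x. (norm (f x))\<^sup>2 \<partial>M) = 0" using assms by (simp add: L2norm_power2[symmetric])
  then have "AE x in M. (norm (f x))\<^sup>2 = 0"
    using integral_nonneg_eq_0_iff_AE[OF L2D(2)[OF assms(1)]] by simp
  then show ?thesis by eventually_elim simp
qed

subsection \<open>Hermitian products\<close>

lemma dotc_add_left: "dotc (a + b) c = dotc a c + dotc b c"
  and dotc_diff_left: "dotc (a - b) c = dotc a c - dotc b c"
  and dotc_add_right: "dotc c (a + b) = dotc c a + dotc c b"
  and dotc_diff_right: "dotc c (a - b) = dotc c a - dotc c b"
  by (simp_all add: dotc_def sum.distrib sum_subtractf algebra_simps)

lemma norm_power2_vec: "(norm (a::complex^2))\<^sup>2 = (\<Sum>i\<in>UNIV. (norm (a $ i))\<^sup>2)"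
  by (simp add: norm_vec_def L2_set_def sum_nonneg)

lemma dotc_self: "dotc a a = complex_of_real ((norm a)\<^sup>2)"
  by (simp add: norm_power2_vec dotc_def complex_norm_square del: of_real_power)

lemma norm_dotc_le: "norm (dotc a b) \<le> norm a * norm b"
proof -
  have "norm (dotc a b) \<le> (\<Sum>i\<in>UNIV. norm (a $ i) * norm (b $ i))"
    unfolding dotc_def by (rule order_trans[OF norm_sum]) (simp add: norm_mult)
  also have "\<dots> \<le> norm a * norm b"
    unfolding norm_vec_def using L2_set_mult_ineq[of "\<lambda>i. norm (a $ i)" "\<lambda>i. norm (b $ i)" UNIV] by simp
  finally show ?thesis .
qed

lemma continuous_on_vec_nth' [continuous_intros]: "continuous_on S (\<lambda>x. (x::complex^2) $ i)"
  by (intro continuous_intros)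

lemma borel_measurable_vec_nth [measurable]: "(\<lambda>x. (x::complex^2) $ i) \<in> borel_measurable borel"
  by (intro borel_measurable_continuous_onI continuous_intros)

lemma borel_measurable_cnj [measurable]: "(cnj :: complex \<Rightarrow> complex) \<in> borel_measurable borel"
  by (intro borel_measurable_continuous_onI continuous_intros)

lemma borel_measurable_dotc [measurable]:
  assumes [measurable]: "f \<in> borel_measurable M" "g \<in> borel_measurable M"
  shows "(\<lambda>x. dotc (f x) (g x)) \<in> borel_measurable M"
  unfolding dotc_def by measurable

lemma integrable_mult_cnj:
  assumes "L2 M v" "L2 M w" shows "integrable M (\<lambda>x. v x * cnj (w x))"
  by (rule Bochner_Integration.integrable_bound[OF integrable_norm_mult[OF assms]])
     (use assms in \<open>auto simp: L2_def norm_mult\<close>)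

lemma norm_ip_le:
  assumes "L2 M v" "L2 M w" shows "norm (ip M v w) \<le> L2norm M v * L2norm M w"
proof -
  have "norm (ip M v w) \<le> (\<integral>x. norm (v x * cnj (w x)) \<partial>M)"
    unfolding ip_def by (rule integral_norm_bound)
  also have "\<dots> = (\<integral>x. norm (v x) * norm (w x) \<partial>M)" by (simp add: norm_mult)
  finally show ?thesis using Cauchy_Schwarz_L2[OF assms] by simp
qed

lemma integrable_dotc:
  assumes "L2 M v" "L2 M w" shows "integrable M (\<lambda>x. dotc (v x) (w x))"
  by (rule Bochner_Integration.integrable_bound[OF integrable_norm_mult[OF assms]])
     (use assms in \<open>auto simp: L2_def intro: norm_dotc_le\<close>)

lemma norm_ipv_le:
  assumes "L2 M v" "L2 M w" shows "norm (ipv M v w) \<le> L2norm M v * L2norm M w"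
proof -
  have "norm (ipv M v w) \<le> (\<integral>x. norm (dotc (v x) (w x)) \<partial>M)"
    unfolding ipv_def by (rule integral_norm_bound)
  also have "\<dots> \<le> (\<integral>x. norm (v x) * norm (w x) \<partial>M)"
    by (intro integral_mono integrable_norm integrable_dotc integrable_norm_mult assms norm_dotc_le)
  finally show ?thesis using Cauchy_Schwarz_L2[OF assms] by simp
qed

lemma ip_add_left: "L2 M u \<Longrightarrow> L2 M v \<Longrightarrow> L2 M w \<Longrightarrow> ip M (\<lambda>x. u x + v x) w = ip M u w + ip M v w"
  and ip_diff_left: "L2 M u \<Longrightarrow> L2 M v \<Longrightarrow> L2 M w \<Longrightarrow> ip M (\<lambda>x. u x - v x) w = ip M u w - ip M v w"
  and ip_cmult_left: "ip M (\<lambda>x. c * u x) w = c * ip M u w"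
  and ip_diff_right: "L2 M u \<Longrightarrow> L2 M v \<Longrightarrow> L2 M w \<Longrightarrow> ip M w (\<lambda>x. u x - v x) = ip M w u - ip M w v"
  by (simp_all add: ip_def algebra_simps integrable_mult_cnj)

lemma ipv_add_left: "L2 M u \<Longrightarrow> L2 M v \<Longrightarrow> L2 M w \<Longrightarrow> ipv M (\<lambda>x. u x + v x) w = ipv M u w + ipv M v w"
  and ipv_diff_left: "L2 M u \<Longrightarrow> L2 M v \<Longrightarrow> L2 M w \<Longrightarrow> ipv M (\<lambda>x. u x - v x) w = ipv M u w - ipv M v w"
  and ipv_diff_right: "L2 M u \<Longrightarrow> L2 M v \<Longrightarrow> L2 M w \<Longrightarrow> ipv M w (\<lambda>x. u x - v x) = ipv M w u - ipv M w v"
  by (simp_all add: ipv_def dotc_add_left dotc_diff_left dotc_diff_right integrable_dotc)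

lemma ipv_self: "ipv M v v = complex_of_real ((L2norm M v)\<^sup>2)"
  by (simp add: ipv_def dotc_self L2norm_power2 integral_complex_of_real del: of_real_power)

lemma ip_cong_AE:
  assumes "u \<in> borel_measurable M" "v \<in> borel_measurable M" "w \<in> borel_measurable M"
    and "AE x in M. u x = v x"
  shows "ip M u w = ip M v w" "ip M w u = ip M w v"
  unfolding ip_def by (intro integral_cong_AE; use assms in auto)+

lemma ipv_cong_AE_right:
  assumes "u \<in> borel_measurable M" "v \<in> borel_measurable M" "w \<in> borel_measurable M"
    and "AE x in M. u x = v x"
  shows "ipv M w u = ipv M w v"
  unfolding ipv_def by (intro integral_cong_AE; use assms in auto)

section \<open>Smooth functions\<close>

text \<open>Since \<open>partial\<close> looks at one coordinate line only, Frechet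
  differentiability is what makes partial derivatives obey the chain and product rules; the later
  derivative computations pass through this bridge.\<close>

lemma partial_eq:
  assumes "(f has_derivative D) (at x)" shows "partial i f x = D (axis i 1)"
proof -
  have "((\<lambda>t. f (x + t *\<^sub>R axis i 1)) has_derivative (\<lambda>t. D (t *\<^sub>R axis i 1))) (at 0)"
    by (rule has_derivative_compose[where f="\<lambda>t. x + t *\<^sub>R axis i 1" and g=f])
       (use assms in \<open>auto intro!: derivative_eq_intros\<close>)
  moreover have "D (t *\<^sub>R axis i 1) = t *\<^sub>R D (axis i 1)" for t
    using assms by (simp add: has_derivative_def bounded_linear.linear linear_scale)
  ultimately have "((\<lambda>t. f (x + t *\<^sub>R axis i 1)) has_vector_derivative D (axis i 1)) (at 0)"
    by (simp add: has_vector_derivative_def)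
  then show ?thesis unfolding partial_def by (rule vector_derivative_at)
qed

lemma has_derivative_partial:
  assumes "f differentiable at x"
  shows "(f has_derivative (\<lambda>h. \<Sum>i\<in>UNIV. h $ i *\<^sub>R partial i f x)) (at x)"
proof -
  obtain D where D: "(f has_derivative D) (at x)" using assms by (auto simp: differentiable_def)
  have lin: "linear D" using D by (rule has_derivative_linear)
  have "D h = (\<Sum>i\<in>UNIV. h $ i *\<^sub>R partial i f x)" for h
  proof -
    have h: "(\<Sum>i\<in>UNIV. h $ i *\<^sub>R axis i 1) = h"
      using basis_expansion[of h] unfolding scalar_mult_eq_scaleR .
    have "D h = D (\<Sum>i\<in>UNIV. h $ i *\<^sub>R axis i 1)"
      by (simp only: h)
    also have "\<dots> = (\<Sum>i\<in>UNIV. h $ i *\<^sub>R D (axis i 1))"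
      using lin by (simp add: linear_sum linear_scale)
    finally show ?thesis by (simp add: partial_eq[OF D])
  qed
  then have "D = (\<lambda>h. \<Sum>i\<in>UNIV. h $ i *\<^sub>R partial i f x)" by (rule ext)
  with D show ?thesis by simp
qed

text \<open>The direction is real and the gradient complex, so this is Cauchy-Schwarz on the moduli
  of the components; it bounds derivatives along segments and rays.\<close>

lemma norm_directional_le_grad:
  "norm (\<Sum>i\<in>UNIV. h $ i *\<^sub>R partial i f x) \<le> norm (grad f x) * norm h"
proof -
  have "norm (\<Sum>i\<in>UNIV. h $ i *\<^sub>R partial i f x) \<le> (\<Sum>i\<in>UNIV. norm (grad f x $ i) * norm (h $ i))"
    by (rule order_trans[OF norm_sum]) (simp add: grad_def mult.commute)
  also have "\<dots> \<le> norm (grad f x) * norm h"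
    unfolding norm_vec_def using L2_set_mult_ineq[of "\<lambda>i. norm (grad f x $ i)" "\<lambda>i. norm (h $ i)" UNIV] by simp
  finally show ?thesis .
qed

lemma partial_const: "partial i (\<lambda>x. c) = (\<lambda>x. 0)"
  by (rule ext, subst partial_eq[where D="\<lambda>_. 0"]) auto

lemma partial_add:
  assumes "\<And>x. f differentiable at x" "\<And>x. g differentiable at x"
  shows "partial i (\<lambda>x. f x + g x) = (\<lambda>x. partial i f x + partial i g x)"
proof (rule ext)
  fix x
  show "partial i (\<lambda>x. f x + g x) x = partial i f x + partial i g x"
    by (subst partial_eq[OF has_derivative_add[OF has_derivative_partial has_derivative_partial]])
       (use assms in \<open>auto simp: partial_eq[OF has_derivative_partial, symmetric]\<close>)
qed

lemma partial_mult:
  assumes "\<And>x. f differentiable at x" "\<And>x. g differentiable at x"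
  shows "partial i (\<lambda>x. f x * g x) = (\<lambda>x. partial i f x * g x + f x * partial i g x)"
proof (rule ext)
  fix x
  show "partial i (\<lambda>x. f x * g x) x = partial i f x * g x + f x * partial i g x"
    by (subst partial_eq[OF has_derivative_mult[OF has_derivative_partial has_derivative_partial]])
       (use assms in \<open>auto simp: partial_eq[OF has_derivative_partial, symmetric]\<close>)
qed

text \<open>\<open>Ck (Suc n)\<close> speaks of differentiability and of the partials but not of
  \<open>f\<close> at level \<open>n\<close>, so an induction is needed, with differentiability
  giving continuity at the bottom.\<close>

lemma Ck_mono: "Ck (Suc n) f \<Longrightarrow> Ck n f"
proof (induction n arbitrary: f)
  case 0
  then show ?case
    by (auto simp: continuous_on_eq_continuous_at intro: differentiable_imp_continuous_within)
qed auto

lemma Ck_const: "Ck n (\<lambda>x. c)"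
  by (induction n arbitrary: c) (auto simp: partial_const)

lemma Ck_add: "Ck n f \<Longrightarrow> Ck n g \<Longrightarrow> Ck n (\<lambda>x. f x + g x)"
  by (induction n arbitrary: f g) (auto simp: partial_add intro: continuous_on_add)

lemma Ck_mult: "Ck n f \<Longrightarrow> Ck n g \<Longrightarrow> Ck n (\<lambda>x. f x * g x)"
proof (induction n arbitrary: f g)
  case 0 then show ?case by (auto intro: continuous_on_mult)
next
  case (Suc n)
  \<comment> \<open>The product rule leaves undifferentiated factors, which are needed at level
    \<open>n\<close> only.\<close>
  then have "Ck n f" "Ck n g" by (auto intro: Ck_mono simp del: Ck.simps)
  with Suc show ?case by (auto simp: partial_mult intro!: Ck_add)
qed

lemma smooth_const: "smooth (\<lambda>x. c)"
  by (simp add: smooth_def Ck_const)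

lemma smooth_add: "smooth f \<Longrightarrow> smooth g \<Longrightarrow> smooth (\<lambda>x. f x + g x)"
  by (simp add: smooth_def Ck_add)

lemma smooth_mult: "smooth f \<Longrightarrow> smooth g \<Longrightarrow> smooth (\<lambda>x. f x * g x)"
  by (simp add: smooth_def Ck_mult)

lemma smooth_minus: "smooth f \<Longrightarrow> smooth (\<lambda>x. - f x)"
  using smooth_mult[OF smooth_const[of "-1"], of f] by simp

lemma smooth_diff: "smooth f \<Longrightarrow> smooth g \<Longrightarrow> smooth (\<lambda>x. f x - g x)"
  using smooth_add[OF _ smooth_minus, of f g] by simp

lemma smooth_sum: "(\<And>i. i \<in> I \<Longrightarrow> smooth (f i)) \<Longrightarrow> smooth (\<lambda>x. \<Sum>i\<in>I. f i x)"
  by (induction I rule: infinite_finite_induct) (auto intro: smooth_const smooth_add)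

lemma smooth_differentiable: "smooth f \<Longrightarrow> f differentiable at x"
  unfolding smooth_def using Ck.simps(2)[of 0 f] by blast

lemma smooth_partial: "smooth f \<Longrightarrow> smooth (partial i f)"
  unfolding smooth_def using Ck.simps(2) by blast

lemma smooth_continuous: "smooth f \<Longrightarrow> continuous_on S f"
  unfolding smooth_def using Ck.simps(1)[of f] continuous_on_subset by blast

lemma smooth_borel_measurable: "smooth f \<Longrightarrow> f \<in> borel_measurable borel"
  by (intro borel_measurable_continuous_onI smooth_continuous)

lemma continuous_on_grad: "smooth f \<Longrightarrow> continuous_on S (grad f)"
  unfolding grad_def by (intro continuous_on_vec_lambda smooth_continuous smooth_partial)

lemma grad_borel_measurable: "smooth f \<Longrightarrow> grad f \<in> borel_measurable borel"
  by (intro borel_measurable_continuous_onI continuous_on_grad)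

lemma partial_cmult: "smooth f \<Longrightarrow> partial i (\<lambda>x. c * f x) = (\<lambda>x. c * partial i f x)"
  using partial_mult[of "\<lambda>_. c" f i] by (simp add: smooth_differentiable partial_const)

lemma grad_diff:
  assumes "smooth f" "smooth g"
  shows "grad (\<lambda>x. f x - g x) = (\<lambda>x. grad f x - grad g x)"
proof -
  have "partial i (\<lambda>x. f x + (-1) * g x) = (\<lambda>x. partial i f x + partial i (\<lambda>x. (-1) * g x) x)" for i
    by (intro partial_add smooth_differentiable smooth_mult smooth_const assms)
  then show ?thesis
    unfolding partial_cmult[OF assms(2)] by (auto simp: grad_def vec_eq_iff fun_eq_iff)
qed

lemma grad_const: "grad (\<lambda>x. c) = (\<lambda>x. 0)"
  by (auto simp: grad_def partial_const vec_eq_iff)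

lemma smooth_linear:
  fixes f :: "pt \<Rightarrow> complex" assumes "bounded_linear f" shows "smooth f"
proof -
  have d: "(f has_derivative f) (at x)" for x
    using assms by (rule bounded_linear_imp_has_derivative)
  have p: "partial i f = (\<lambda>x. f (axis i 1))" for i
    using partial_eq[OF d] by blast
  have "Ck n f" for n
    using d by (cases n) (auto simp: p Ck_const differentiable_def linear_continuous_on[OF assms])
  then show ?thesis by (simp add: smooth_def)
qed

text \<open>The derivative of \<open>1 / f\<close> is a polynomial expression in
  \<open>partial i f\<close> and \<open>1 / f\<close>, so the induction on the order closes without
  leaving this one function.\<close>

lemma smooth_inverse:
  assumes "smooth f" "\<And>x. f x \<noteq> 0" shows "smooth (\<lambda>x. inverse (f x))"
proof -
  have p: "partial i (\<lambda>x. inverse (f x)) = (\<lambda>x. - (partial i f x * (inverse (f x) * inverse (f x))))" for i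
  proof (rule ext)
    fix x
    have "((\<lambda>x. inverse (f x)) has_derivative
        (\<lambda>h. - (inverse (f x) * (\<Sum>i\<in>UNIV. h $ i *\<^sub>R partial i f x) * inverse (f x)))) (at x)"
      by (intro Deriv.has_derivative_inverse assms has_derivative_partial smooth_differentiable)
    from partial_eq[OF this, of i] partial_eq[OF has_derivative_partial[OF smooth_differentiable[OF assms(1)]], of i x]
    show "partial i (\<lambda>x. inverse (f x)) x = - (partial i f x * (inverse (f x) * inverse (f x)))"
      by (simp add: mult_ac)
  qed
  have d: "(\<lambda>x. inverse (f x)) differentiable at x" for x
    using Deriv.has_derivative_inverse[OF assms(2) has_derivative_partial[OF smooth_differentiable[OF assms(1)]]]
    unfolding differentiable_def by blast
  have "Ck n (\<lambda>x. inverse (f x))" for n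
  proof (induction n)
    case 0 show ?case using assms by (auto intro!: continuous_on_inverse smooth_continuous[OF assms(1)])
  next
    case (Suc n)
    have "Ck n (\<lambda>x. (-1) * (partial i f x * (inverse (f x) * inverse (f x))))" for i
      using smooth_partial[OF assms(1)] Suc
      by (intro Ck_mult Ck_const) (auto simp: smooth_def)
    then show ?case using d by (simp add: p)
  qed
  then show ?thesis by (simp add: smooth_def)
qed

subsection \<open>A smooth function vanishing on the negative half-line\<close>

text \<open>Admitting a power of \<open>1 / t\<close> as a factor makes the family closed under differentiation.\<close>

definition hfun :: "nat \<Rightarrow> real \<Rightarrow> real" where
  "hfun m t = (if t > 0 then exp (- 1 / t) / t ^ m else 0)"

lemma hfun_nonneg: "0 \<le> hfun m t"
  by (simp add: hfun_def)

lemma hfun_pos_iff: "0 < hfun m t \<longleftrightarrow> 0 < t"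
  by (simp add: hfun_def)

text \<open>From \<open>(1 + x / k) ^ k \<le> exp x\<close> at \<open>x = 1 / t\<close>, after
  dropping the 1: the essential singularity beats every power of \<open>t\<close>.\<close>

lemma exp_minus_inverse_le:
  assumes "0 < t" "0 < k" shows "exp (- 1 / t) \<le> real k ^ k * t ^ k"
proof -
  have "(1 / (t * real k)) ^ k \<le> (1 + (1 / t) / real k) ^ k"
    using assms by (intro power_mono) auto
  also have "\<dots> \<le> exp (1 / t)"
    using assms by (intro exp_ge_one_plus_x_over_n_power_n)
      (auto intro: order_trans[of _ 0])
  finally have "1 \<le> exp (1 / t) * (t * real k) ^ k"
    using assms by (simp add: power_one_over divide_le_eq)
  then show ?thesis
    by (simp add: exp_minus power_mult_distrib field_simps)
qed

text \<open>Of the \<open>m + 2\<close> powers gained from the exponential, \<open>m\<close> pay for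
  the denominator; the remaining two are one more than linear, which is what a vanishing derivative
  at 0 requires.\<close>

lemma hfun_le: "hfun m t \<le> real (m + 2) ^ (m + 2) * t\<^sup>2"
proof (cases "t > 0")
  case True
  have "exp (- 1 / t) \<le> real (m + 2) ^ (m + 2) * t ^ (m + 2)"
    by (rule exp_minus_inverse_le) (use True in auto)
  also have "\<dots> = real (m + 2) ^ (m + 2) * t\<^sup>2 * t ^ m"
    by (simp only: power_add mult_ac)
  finally show ?thesis using True by (simp add: hfun_def divide_le_eq)
qed (simp add: hfun_def)

lemma hfun_deriv: "(hfun m has_real_derivative hfun (m + 2) t - m * hfun (m + 1) t) (at t)"
proof -
  consider "t > 0" | "t < 0" | "t = 0" by linarith
  then show ?thesis
  proof cases
    case 1
    have "((\<lambda>t. exp (- 1 / t) / t ^ m) has_real_derivative hfun (m + 2) t - m * hfun (m + 1) t) (at t)"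
    proof (cases m)
      case 0
      then show ?thesis using 1
        by (auto intro!: derivative_eq_intros simp: hfun_def field_simps power2_eq_square)
    next
      case (Suc j)
      then show ?thesis using 1
        by (auto intro!: derivative_eq_intros simp: hfun_def)
           (cases j; simp add: field_simps power2_eq_square)
    qed
    then show ?thesis
      by (rule DERIV_cong_ev[OF refl _ refl, THEN iffD1, rotated])
         (use 1 in \<open>auto simp: hfun_def eventually_nhds intro!: exI[of _ "{0<..}"]\<close>)
  next
    case 2
    have "((\<lambda>t. 0) has_real_derivative hfun (m + 2) t - m * hfun (m + 1) t) (at t)"
      using 2 by (simp add: hfun_def)
    then show ?thesis
      by (rule DERIV_cong_ev[OF refl _ refl, THEN iffD1, rotated])
         (use 2 in \<open>auto simp: hfun_def eventually_nhds intro!: exI[of _ "{..<0}"]\<close>)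
  next
    \<comment> \<open>At the origin the bound by a multiple of \<open>t\<^sup>2\<close> leaves a
      difference quotient of order \<open>|h|\<close>, from either side.\<close>
    case 3
    let ?K = "real (m + 2) ^ (m + 2)"
    have "((\<lambda>h. (hfun m (0 + h) - hfun m 0) / h) \<longlongrightarrow> 0) (at 0)"
    proof (rule Lim_null_comparison)
      show "\<forall>\<^sub>F h in at 0. norm ((hfun m (0 + h) - hfun m 0) / h) \<le> ?K * \<bar>h\<bar>"
      proof (rule eventually_at_ball'[OF zero_less_one, THEN eventually_mono])
        fix h :: real assume h: "h \<in> ball 0 1 \<and> h \<noteq> 0 \<and> h \<in> UNIV"
        have "\<bar>hfun m h\<bar> \<le> ?K * h\<^sup>2" using hfun_le[of m h] hfun_nonneg[of m h] by simp
        also have "\<dots> = ?K * \<bar>h\<bar> * \<bar>h\<bar>" by (simp add: power2_eq_square)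
        finally show "norm ((hfun m (0 + h) - hfun m 0) / h) \<le> ?K * \<bar>h\<bar>"
          using h by (simp add: hfun_def[of m 0] divide_le_eq)
      qed
      show "((\<lambda>h. ?K * \<bar>h\<bar>) \<longlongrightarrow> 0) (at 0)" by (auto intro!: tendsto_eq_intros)
    qed
    then show ?thesis using 3 by (simp add: DERIV_def hfun_def[of _ 0])
  qed
qed

text \<open>Each derivative trades \<open>hfun m\<close> for \<open>hfun (m + 1)\<close> and
  \<open>hfun (m + 2)\<close> times a partial of \<open>F\<close>, so the induction on the order
  must range over all \<open>m\<close>. Smoothness is defined for complex values only, whence the
  embedding of the real \<open>F\<close>.\<close>

lemma smooth_hfun:
  fixes F :: "pt \<Rightarrow> real"
  assumes "smooth (\<lambda>x. complex_of_real (F x))"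
  shows "smooth (\<lambda>x. complex_of_real (hfun m (F x)))"
proof -
  let ?F = "\<lambda>x. complex_of_real (F x)"
  define G where "G i x = Re (partial i ?F x)" for i x
  have F: "(F has_derivative (\<lambda>h. Re (\<Sum>i\<in>UNIV. h $ i *\<^sub>R partial i ?F x))) (at x)" for x
    using bounded_linear.has_derivative[OF bounded_linear_Re
        has_derivative_partial[OF smooth_differentiable[OF assms]], of x] by simp
  have pF: "partial i ?F x = complex_of_real (G i x)" for i x
    using partial_eq[OF has_derivative_of_real[OF F], of i x]
      partial_eq[OF has_derivative_partial[OF smooth_differentiable[OF assms]], of i x]
    by (simp add: G_def)
  have h: "((\<lambda>x. complex_of_real (hfun m (F x))) has_derivative
      (\<lambda>y. complex_of_real ((hfun (m + 2) (F x) - m * hfun (m + 1) (F x)) *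
         Re (\<Sum>i\<in>UNIV. y $ i *\<^sub>R partial i ?F x)))) (at x)" for x m
    by (rule has_derivative_of_real)
       (use has_derivative_compose[OF F hfun_deriv[unfolded has_field_derivative_def]] in \<open>simp\<close>)
  have p: "partial i (\<lambda>x. complex_of_real (hfun m (F x))) =
      (\<lambda>x. (complex_of_real (hfun (m + 2) (F x)) + (- of_nat m) * complex_of_real (hfun (m + 1) (F x)))
        * partial i ?F x)" for i m
  proof (rule ext)
    fix x
    have "Re (\<Sum>j\<in>UNIV. axis i 1 $ j *\<^sub>R partial j ?F x) = G i x"
      using partial_eq[OF has_derivative_partial[OF smooth_differentiable[OF assms]], of i x]
      by (simp add: G_def)
    then show "partial i (\<lambda>x. complex_of_real (hfun m (F x))) x =
      (complex_of_real (hfun (m + 2) (F x)) + (- of_nat m) * complex_of_real (hfun (m + 1) (F x)))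
        * partial i ?F x"
      using partial_eq[OF h, of i m x] by (simp add: pF)
  qed
  have "Ck n (\<lambda>x. complex_of_real (hfun m (F x)))" for n
  proof (induction n arbitrary: m)
    case 0
    have "continuous_on UNIV (\<lambda>x. complex_of_real (hfun m (F x)))"
      by (intro continuous_at_imp_continuous_on ballI has_derivative_continuous[OF h])
    then show ?case by simp
  next
    case (Suc n)
    have "Ck n (\<lambda>x. (complex_of_real (hfun (m + 2) (F x)) + (- of_nat m) * complex_of_real (hfun (m + 1) (F x)))
        * partial i ?F x)" for i
      using smooth_partial[OF assms, of i] by (intro Ck_mult Ck_add Ck_const Suc) (simp add: smooth_def)
    moreover have "(\<lambda>x. complex_of_real (hfun m (F x))) differentiable at x" for x
      using h[of m x] unfolding differentiable_def by blast
    ultimately show ?case by (simp only: Ck.simps p) blast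
  qed
  then show ?thesis by (simp add: smooth_def)
qed

text \<open>The squared distance makes the argument of \<open>hfun 0\<close> a polynomial, hence
  smooth at the centre \<open>a\<close> too.\<close>

definition bump :: "pt \<Rightarrow> real \<Rightarrow> pt \<Rightarrow> real" where
  "bump a r x = hfun 0 (r\<^sup>2 - (dist x a)\<^sup>2)"

lemma bump_nonneg: "0 \<le> bump a r x"
  by (simp add: bump_def hfun_nonneg)

lemma bump_pos_iff:
  assumes "0 < r" shows "0 < bump a r x \<longleftrightarrow> x \<in> ball a r"
proof -
  have "(dist x a)\<^sup>2 < r\<^sup>2 \<longleftrightarrow> dist x a < r"
    using assms power_strict_mono[of "dist x a" r 2] power2_less_imp_less[of "dist x a" r] by auto
  then show ?thesis by (simp add: bump_def hfun_pos_iff dist_commute)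
qed

lemma bump_eq_0: "0 < r \<Longrightarrow> x \<notin> ball a r \<Longrightarrow> bump a r x = 0"
  using bump_pos_iff[of r a x] bump_nonneg[of a r x] by auto

lemma smooth_bump: "smooth (\<lambda>x. complex_of_real (bump a r x))"
proof -
  have 1: "smooth (\<lambda>x. complex_of_real (x $ i))" for i
    by (intro smooth_linear bounded_linear_compose[OF bounded_linear_of_real] bounded_linear_vec_nth)
  have 2: "complex_of_real (r\<^sup>2 - (dist x a)\<^sup>2)
     = complex_of_real (r\<^sup>2) - (\<Sum>i\<in>UNIV. (complex_of_real (x $ i) - complex_of_real (a $ i)) *
        (complex_of_real (x $ i) - complex_of_real (a $ i)))" for x
    by (simp add: dist_vec_def L2_set_def sum_nonneg dist_real_def power2_eq_square
        flip: of_real_diff of_real_mult of_real_sum)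
  show ?thesis unfolding bump_def
    by (intro smooth_hfun, subst 2) (intro smooth_diff smooth_sum smooth_mult 1 smooth_const)
qed

lemma test_fun_bump:
  assumes "0 < r" "cball a r \<subseteq> \<Omega>" "smooth f"
  shows "test_fun \<Omega> (\<lambda>x. f x * complex_of_real (bump a r x))"
proof -
  have "{x. f x * complex_of_real (bump a r x) \<noteq> 0} \<subseteq> cball a r"
  proof
    fix x assume "x \<in> {x. f x * complex_of_real (bump a r x) \<noteq> 0}"
    then have "bump a r x \<noteq> 0" by auto
    then have "x \<in> ball a r" using bump_eq_0[OF assms(1), of x a] by blast
    then show "x \<in> cball a r" by simp
  qed
  then have cl: "closure {x. f x * complex_of_real (bump a r x) \<noteq> 0} \<subseteq> cball a r"
    by (rule closure_minimal) simp
  then have "compact (closure {x. f x * complex_of_real (bump a r x) \<noteq> 0})"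
    unfolding compact_closure by (rule bounded_subset[OF bounded_cball order_trans[OF closure_subset]])
  then show ?thesis unfolding test_fun_def
    using cl assms by (auto intro!: smooth_mult smooth_bump)
qed

lemma test_fun_mult:
  assumes "test_fun \<Omega> \<phi>" "smooth f" shows "test_fun \<Omega> (\<lambda>x. f x * \<phi> x)"
proof -
  have "closure {x. f x * \<phi> x \<noteq> 0} \<subseteq> closure {x. \<phi> x \<noteq> 0}"
    by (rule closure_mono) auto
  moreover have "bounded {x. f x * \<phi> x \<noteq> 0}"
    by (rule bounded_subset[of "{x. \<phi> x \<noteq> 0}"])
       (use assms(1) in \<open>auto simp: test_fun_def compact_closure\<close>)
  ultimately show ?thesis using assms
    by (auto simp: test_fun_def compact_closure intro: smooth_mult)
qed

text \<open>The sign produced by differentiating \<open>\<rho> (x - y)\<close> in the integration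
  variable cancels the one in \<open>has_weak_grad\<close>.\<close>

lemma partial_reflect:
  assumes "smooth f" shows "partial i (\<lambda>y. f (x - y)) y = - partial i f (x - y)"
proof -
  have d: "((\<lambda>y. x - y) has_derivative (\<lambda>h. - h)) (at y)"
    by (auto intro!: derivative_eq_intros)
  have "((\<lambda>y. f (x - y)) has_derivative (\<lambda>h. \<Sum>i\<in>UNIV. (- h) $ i *\<^sub>R partial i f (x - y))) (at y)"
    using has_derivative_compose[OF d has_derivative_partial[OF smooth_differentiable[OF assms]]] .
  from partial_eq[OF this, of i]
    partial_eq[OF has_derivative_partial[OF smooth_differentiable[OF assms]], of i "x - y"]
  show ?thesis by (simp add: sum_negf)
qed

section \<open>Mollification\<close>

lemma nn_integral_lborel_affine:
  fixes t :: "'a::euclidean_space"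
  assumes [measurable]: "f \<in> borel_measurable borel" and c: "c \<noteq> 0"
  shows "(\<integral>\<^sup>+x. f x \<partial>lborel) = ennreal (\<bar>c\<bar> ^ DIM('a)) * (\<integral>\<^sup>+x. f (t + c *\<^sub>R x) \<partial>lborel)"
  by (subst lborel_affine[OF c, of t])
     (simp add: nn_integral_density nn_integral_distr nn_integral_cmult)

lemma nn_integral_lborel_reflect:
  fixes x :: "'a::euclidean_space"
  assumes "f \<in> borel_measurable borel"
  shows "(\<integral>\<^sup>+y. f (x - y) \<partial>lborel) = (\<integral>\<^sup>+y. f y \<partial>lborel)"
  using nn_integral_lborel_affine[OF assms, where c="-1" and t=x] by simp

text \<open>The point of evaluation enters through the kernel alone, so the result inherits the
  smoothness of \<open>\<rho>\<close> from a merely integrable \<open>F\<close>.\<close>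

definition conv :: "(pt \<Rightarrow> complex) \<Rightarrow> (pt \<Rightarrow> complex) \<Rightarrow> pt \<Rightarrow> complex" where
  "conv \<rho> F x = (\<integral>y. F y * \<rho> (x - y) \<partial>lborel)"

lemma bounded_of_support:
  fixes \<rho> :: "pt \<Rightarrow> 'b::real_normed_vector"
  assumes "continuous_on UNIV \<rho>" "\<And>x. x \<notin> cball 0 R \<Longrightarrow> \<rho> x = 0"
  obtains B where "B > 0" "\<And>x. norm (\<rho> x) \<le> B"
proof -
  have "compact (\<rho> ` cball 0 R)"
    using assms(1) by (intro compact_continuous_image) (auto intro: continuous_on_subset)
  then obtain B where "B > 0" "\<forall>y\<in>\<rho> ` cball 0 R. norm y \<le> B"
    using compact_imp_bounded bounded_pos by blast
  then have "norm (\<rho> x) \<le> B" for x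
    using assms(2)[of x] by (cases "x \<in> cball 0 R") auto
  with \<open>B > 0\<close> show ?thesis by (rule that)
qed

lemma integrable_conv:
  fixes F \<rho> :: "pt \<Rightarrow> complex"
  assumes F: "integrable lborel F" and c: "continuous_on UNIV \<rho>" "\<And>x. x \<notin> cball 0 R \<Longrightarrow> \<rho> x = 0"
  shows "integrable lborel (\<lambda>y. F y * \<rho> (x - y))"
proof -
  obtain B where B: "B > 0" "\<And>x. norm (\<rho> x) \<le> B" using bounded_of_support[OF c] by blast
  have [measurable]: "(\<lambda>y. \<rho> (x - y)) \<in> borel_measurable borel"
    by (intro borel_measurable_continuous_onI continuous_on_compose2[OF c(1)] continuous_intros) auto
  have [measurable]: "F \<in> borel_measurable borel" using F by auto
  show ?thesis
  proof (rule Bochner_Integration.integrable_bound)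
    show "integrable lborel (\<lambda>y. B * norm (F y))" using F by auto
    show "AE y in lborel. norm (F y * \<rho> (x - y)) \<le> norm (B * norm (F y))"
      using B by (auto simp: norm_mult mult.commute[of B] intro!: mult_left_mono AE_I2)
  qed measurable
qed

lemma support_partial:
  assumes "\<And>x. x \<notin> cball 0 R \<Longrightarrow> \<rho> x = 0" "x \<notin> cball 0 R"
  shows "partial i \<rho> x = 0"
proof -
  have "(\<rho> has_derivative (\<lambda>_. 0)) (at x)"
    by (rule has_derivative_transform_within_open[of "\<lambda>_. 0" _ _ _ "- cball 0 R"])
       (use assms in \<open>auto simp: open_Compl\<close>)
  from partial_eq[OF this] show ?thesis by simp
qed

text \<open>Compact support turns continuity of the partials into uniform continuity, so the
  first-order remainder is small uniformly in the base point \<open>z\<close>. This uniformity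
  justifies differentiation under the integral sign.\<close>

lemma uniformly_differentiable:
  assumes s: "smooth \<rho>" and R: "\<And>x. x \<notin> cball 0 R \<Longrightarrow> \<rho> x = 0" and e: "e > 0"
  shows "\<exists>d>0. \<forall>z h. norm h < d \<longrightarrow>
     norm (\<rho> (z + h) - \<rho> z - (\<Sum>i\<in>UNIV. h $ i *\<^sub>R partial i \<rho> z)) \<le> e * norm h"
proof -
  have "uniformly_continuous_on (cball 0 (R + 2)) (partial i \<rho>)" for i
    by (intro compact_uniformly_continuous smooth_continuous smooth_partial s) simp
  then have "\<forall>i. \<exists>d>0. \<forall>x\<in>cball 0 (R+2). \<forall>x'\<in>cball 0 (R+2). dist x' x < d \<longrightarrow> dist (partial i \<rho> x') (partial i \<rho> x) < e / 2"
    unfolding uniformly_continuous_on_def using e by (meson half_gt_zero)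
  then obtain d where d: "\<And>i. d i > 0" "\<And>i x x'. x \<in> cball 0 (R+2) \<Longrightarrow> x' \<in> cball 0 (R+2) \<Longrightarrow> dist x' x < d i
      \<Longrightarrow> dist (partial i \<rho> x') (partial i \<rho> x) < e / 2"
    by metis
  \<comment> \<open>The cap at 1 separates two cases: for \<open>z\<close> outside radius
    \<open>R + 1\<close> every term vanishes, otherwise the whole segment stays inside
    \<open>cball 0 (R + 2)\<close>, where uniform continuity was taken.\<close>
  define d0 where "d0 = min 1 (Min (range d))"
  have d0: "d0 > 0" "d0 \<le> 1" "\<And>i. d0 \<le> d i"
    using d(1) by (auto simp: d0_def min_le_iff_disj)
  have D: "(\<rho> has_derivative (\<lambda>h. \<Sum>i\<in>UNIV. h $ i *\<^sub>R partial i \<rho> x)) (at x)" for x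
    by (intro has_derivative_partial smooth_differentiable s)
  show ?thesis
  proof (intro exI[of _ d0] conjI d0 allI impI)
    fix z h :: pt assume h: "norm h < d0"
    show "norm (\<rho> (z + h) - \<rho> z - (\<Sum>i\<in>UNIV. h $ i *\<^sub>R partial i \<rho> z)) \<le> e * norm h"
    proof (cases "z \<in> cball 0 (R + 1)")
      case False
      then have z: "norm z > R + 1" by simp
      have "norm z \<le> norm (z + h) + norm h" using norm_triangle_ineq4[of "z+h" h] by simp
      then have "z + h \<notin> cball 0 R" "z \<notin> cball 0 R" using h d0(2) z by auto
      then show ?thesis using R support_partial[OF R] e by simp
    next
      case True
      let ?f' = "\<lambda>x h. \<Sum>i\<in>UNIV. h $ i *\<^sub>R partial i \<rho> x"
      let ?S = "ball z d0 \<inter> cball 0 (R + 2)"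
      have "norm (\<rho> (z + h) - \<rho> z - ?f' z ((z + h) - z)) \<le> norm ((z + h) - z) * e"
      proof (rule differentiable_bound_linearization[where S="?S" and f'="?f'"])
        fix t :: real assume t: "t \<in> {0..1}"
        have "norm (t *\<^sub>R h) < d0" using t h mult_left_le_one_le[of "norm h" t] by auto
        moreover have "norm (z + t *\<^sub>R h) \<le> norm z + norm (t *\<^sub>R h)" by (rule norm_triangle_ineq)
        moreover have "norm (- z - t *\<^sub>R h) = norm (z + t *\<^sub>R h)"
          using norm_minus_cancel[of "z + t *\<^sub>R h"] by simp
        ultimately show "z + t *\<^sub>R (z + h - z) \<in> ?S" using True d0(2) by (auto simp: dist_norm)
      next
        fix x assume "x \<in> ?S"
        show "(\<rho> has_derivative ?f' x) (at x within ?S)" using D by (rule has_derivative_at_withinI)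
        have p: "norm (partial i \<rho> x - partial i \<rho> z) \<le> e / 2" for i
          using d(2)[of z x i] True \<open>x \<in> ?S\<close> d0(3)[of i] by (auto simp: dist_norm norm_minus_commute)
        show "onorm (?f' x - ?f' z) \<le> e"
        proof (rule onorm_bound)
          fix y :: pt
          have "norm ((?f' x - ?f' z) y) = norm (\<Sum>i\<in>UNIV. y $ i *\<^sub>R (partial i \<rho> x - partial i \<rho> z))"
            by (simp add: sum_subtractf scaleR_diff_right)
          also have "\<dots> \<le> (\<Sum>i\<in>(UNIV::2 set). norm y * (e / 2))"
          proof (rule sum_norm_le)
            fix i :: 2
            show "norm (y $ i *\<^sub>R (partial i \<rho> x - partial i \<rho> z)) \<le> norm y * (e / 2)"
              unfolding norm_scaleR real_norm_def using e
              by (intro mult_mono p component_le_norm_cart) auto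
          qed
          finally show "norm ((?f' x - ?f' z) y) \<le> e * norm y" by (simp add: mult.commute)
        qed (use e in simp)
      qed (use d0 True in auto)
      then show ?thesis by (simp add: mult.commute)
    qed
  qed
qed

lemma conv_has_derivative:
  assumes F: "integrable lborel F" and s: "smooth \<rho>" and R: "\<And>x. x \<notin> cball 0 R \<Longrightarrow> \<rho> x = 0"
  shows "(conv \<rho> F has_derivative (\<lambda>h. \<Sum>i\<in>UNIV. h $ i *\<^sub>R conv (partial i \<rho>) F x)) (at x)"
  unfolding has_derivative_at_alt
proof (intro conjI allI impI)
  show "bounded_linear (\<lambda>h. \<Sum>i\<in>UNIV. h $ i *\<^sub>R conv (partial i \<rho>) F x)"
    by (intro bounded_linear_sum bounded_linear_scaleR_const bounded_linear_vec_nth)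
  fix e :: real assume e: "e > 0"
  define I where "I = (\<integral>y. norm (F y) \<partial>lborel)"
  have I: "I \<ge> 0" by (simp add: I_def)
  \<comment> \<open>The added 1 covers the case that \<open>F\<close> vanishes almost everywhere,
    where \<open>I\<close> is 0.\<close>
  have "e / (I + 1) > 0" using e I by simp
  from uniformly_differentiable[OF s R this] obtain d where d: "d > 0"
    "\<And>z h. norm h < d \<Longrightarrow>
     norm (\<rho> (z + h) - \<rho> z - (\<Sum>i\<in>UNIV. h $ i *\<^sub>R partial i \<rho> z)) \<le> e / (I + 1) * norm h" by blast
  have i1: "integrable lborel (\<lambda>y. F y * \<rho> (x - y))" for x
    by (rule integrable_conv[OF F smooth_continuous[OF s] R])
  have i2: "integrable lborel (\<lambda>y. F y * partial i \<rho> (x - y))" for x i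
    by (rule integrable_conv[OF F smooth_continuous[OF smooth_partial[OF s]] support_partial[OF R]])
  show "\<exists>d>0. \<forall>y. norm (y - x) < d \<longrightarrow>
    norm (conv \<rho> F y - conv \<rho> F x - (\<Sum>i\<in>UNIV. (y - x) $ i *\<^sub>R conv (partial i \<rho>) F x)) \<le> e * norm (y - x)"
  proof (intro exI[of _ d] conjI d allI impI)
    fix y assume y: "norm (y - x) < d"
    define h where "h = y - x"
    let ?E = "\<lambda>w. \<rho> (x - w + h) - \<rho> (x - w) - (\<Sum>i\<in>UNIV. h $ i *\<^sub>R partial i \<rho> (x - w))"
    have int: "integrable lborel (\<lambda>w. F w * ?E w)"
    proof -
      have eq: "F w * ?E w = F w * \<rho> (y - w) - F w * \<rho> (x - w) - (\<Sum>i\<in>UNIV. h $ i *\<^sub>R (F w * partial i \<rho> (x - w)))" for w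
        by (simp add: h_def algebra_simps sum_distrib_left)
      show ?thesis unfolding eq
        by (intro Bochner_Integration.integrable_diff Bochner_Integration.integrable_sum i1 i2
            Bochner_Integration.integrable_scaleR_right)
    qed
    have "conv \<rho> F y - conv \<rho> F x - (\<Sum>i\<in>UNIV. h $ i *\<^sub>R conv (partial i \<rho>) F x) = (\<integral>w. F w * ?E w \<partial>lborel)"
    proof -
      have eq: "F w * ?E w = F w * \<rho> (y - w) - F w * \<rho> (x - w) - (\<Sum>i\<in>UNIV. h $ i *\<^sub>R (F w * partial i \<rho> (x - w)))" for w
        by (simp add: h_def algebra_simps sum_distrib_left)
      show ?thesis unfolding eq conv_def
        using i1 i2 by (simp add: Bochner_Integration.integral_diff Bochner_Integration.integral_sum
            Bochner_Integration.integrable_sum Bochner_Integration.integrable_diff Bochner_Integration.integrable_scaleR_right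
            del: scaleR_conv_of_real)
    qed
    also have "norm \<dots> \<le> (\<integral>w. norm (F w) * (e / (I + 1) * norm h) \<partial>lborel)"
    proof (rule order_trans[OF integral_norm_bound], rule integral_mono)
      show "integrable lborel (\<lambda>w. norm (F w * ?E w))" using int by simp
      show "integrable lborel (\<lambda>w. norm (F w) * (e / (I + 1) * norm h))" using F by simp
      show "norm (F w * ?E w) \<le> norm (F w) * (e / (I + 1) * norm h)" for w
        unfolding norm_mult by (intro mult_left_mono d(2)) (use y h_def in auto)
    qed
    also have "\<dots> = I / (I + 1) * e * norm h" by (simp add: I_def)
    also have "\<dots> \<le> 1 * e * norm h" using I e by (intro mult_right_mono) auto
    finally show "norm (conv \<rho> F y - conv \<rho> F x - (\<Sum>i\<in>UNIV. (y - x) $ i *\<^sub>R conv (partial i \<rho>) F x)) \<le> e * norm (y - x)"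
      by (simp add: h_def)
  qed
qed

lemma partial_conv:
  assumes "integrable lborel F" "smooth \<rho>" "\<And>x. x \<notin> cball 0 R \<Longrightarrow> \<rho> x = 0"
  shows "partial i (conv \<rho> F) = conv (partial i \<rho>) F"
  using partial_eq[OF conv_has_derivative[OF assms], where i=i] by (auto simp: fun_eq_iff axis_def if_distrib[of "\<lambda>c. c *\<^sub>R _"] cong: if_cong)

text \<open>A partial of the convolution is the convolution with a partial of the kernel, which is
  again smooth and vanishes outside the same ball; so the induction varies
  \<open>\<rho>\<close>.\<close>

lemma smooth_conv:
  assumes F: "integrable lborel F" and s: "smooth \<rho>" and R: "\<And>x. x \<notin> cball 0 R \<Longrightarrow> \<rho> x = 0"
  shows "smooth (conv \<rho> F)"
proof -
  have "Ck n (conv \<rho> F)" for n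
    using s R
  proof (induction n arbitrary: \<rho>)
    case 0
    then show ?case
      using conv_has_derivative[OF F, of \<rho> R]
      by (auto intro!: continuous_at_imp_continuous_on has_derivative_continuous)
  next
    case (Suc n)
    have "conv \<rho> F differentiable at x" for x
      using conv_has_derivative[OF F Suc.prems, where x=x] unfolding differentiable_def by blast
    moreover have "Ck n (partial i (conv \<rho> F))" for i
    proof -
      have "partial i (conv \<rho> F) = conv (partial i \<rho>) F"
        by (rule partial_conv[OF F Suc.prems])
      moreover have "Ck n (conv (partial i \<rho>) F)"
        by (rule Suc.IH[OF smooth_partial[OF Suc.prems(1)] support_partial[OF Suc.prems(2)]])
      ultimately show ?thesis by simp
    qed
    ultimately show ?case by simp
  qed
  then show ?thesis by (simp add: smooth_def)
qed

text \<open>Mass and a radius about the origin are prescribed, but no symmetry: a bump placed off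
  the origin also qualifies, which is how convolution is combined with a translation.\<close>

definition mollifier :: "real \<Rightarrow> (pt \<Rightarrow> real) \<Rightarrow> bool" where
  "mollifier \<delta> \<rho> \<longleftrightarrow> smooth (\<lambda>x. complex_of_real (\<rho> x)) \<and> (\<forall>x. 0 \<le> \<rho> x) \<and>
     (\<forall>x. x \<notin> cball 0 \<delta> \<longrightarrow> \<rho> x = 0) \<and> (\<integral>\<^sup>+x. ennreal (\<rho> x) \<partial>lborel) = 1"

lemma mollifierD:
  assumes "mollifier \<delta> \<rho>"
  shows "smooth (\<lambda>x. complex_of_real (\<rho> x))" "0 \<le> \<rho> x"
    "x \<notin> cball 0 \<delta> \<Longrightarrow> complex_of_real (\<rho> x) = 0" "\<rho> \<in> borel_measurable borel"
    "(\<integral>\<^sup>+y. ennreal (\<rho> y) \<partial>lborel) = 1"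
proof -
  show s: "smooth (\<lambda>x. complex_of_real (\<rho> x))" using assms by (simp add: mollifier_def)
  have "(\<lambda>x. Re (complex_of_real (\<rho> x))) \<in> borel_measurable borel"
    using smooth_borel_measurable[OF s] by measurable
  then show "\<rho> \<in> borel_measurable borel" by simp
qed (use assms in \<open>auto simp: mollifier_def\<close>)

abbreviation mconv :: "(pt \<Rightarrow> real) \<Rightarrow> (pt \<Rightarrow> complex) \<Rightarrow> pt \<Rightarrow> complex" where
  "mconv \<rho> \<equiv> conv (\<lambda>x. complex_of_real (\<rho> x))"

text \<open>Young's inequality for a kernel of mass one: \<open>\<rho>\<close> is split as
  \<open>sqrt \<rho> * sqrt \<rho>\<close> in Cauchy-Schwarz, one factor contributes mass one, and
  Tonelli's theorem integrates the other over \<open>x\<close>.\<close>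

lemma L2norm_mconv_le:
  assumes m: "mollifier \<delta> \<rho>" and i: "integrable lborel F" and F: "L2 lborel F"
  shows "L2 lborel (mconv \<rho> F)" "L2norm lborel (mconv \<rho> F) \<le> L2norm lborel F"
proof -
  note \<rho> = mollifierD[OF m]
  have [measurable]: "F \<in> borel_measurable borel" "\<rho> \<in> borel_measurable borel"
    using F \<rho> by (auto simp: L2_def)
  have meas[measurable]: "mconv \<rho> F \<in> borel_measurable borel"
    by (rule smooth_borel_measurable[OF smooth_conv[OF i \<rho>(1,3)]])
  have pt: "ennreal ((norm (mconv \<rho> F x))\<^sup>2) \<le> (\<integral>\<^sup>+y. ennreal ((norm (F y))\<^sup>2 * \<rho> (x - y)) \<partial>lborel)" for x
  proof -
    have "ennreal (norm (mconv \<rho> F x)) \<le> (\<integral>\<^sup>+y. ennreal (norm (F y * complex_of_real (\<rho> (x - y)))) \<partial>lborel)"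
      unfolding conv_def by (rule integral_norm_bound_ennreal[OF integrable_conv[OF i smooth_continuous[OF \<rho>(1)] \<rho>(3)]])
    also have "\<dots> = (\<integral>\<^sup>+y. ennreal (norm (F y) * sqrt (\<rho> (x - y))) * ennreal (sqrt (\<rho> (x - y))) \<partial>lborel)"
      using \<rho>(2) by (simp add: norm_mult ennreal_mult[symmetric] mult.assoc)
    finally have "(ennreal (norm (mconv \<rho> F x)))\<^sup>2 \<le> (\<integral>\<^sup>+y. ennreal (norm (F y) * sqrt (\<rho> (x - y))) * ennreal (sqrt (\<rho> (x - y))) \<partial>lborel)\<^sup>2"
      by (rule power_mono) simp
    also have "\<dots> \<le> (\<integral>\<^sup>+y. (ennreal (norm (F y) * sqrt (\<rho> (x - y))))\<^sup>2 \<partial>lborel) *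
        (\<integral>\<^sup>+y. (ennreal (sqrt (\<rho> (x - y))))\<^sup>2 \<partial>lborel)"
      by (intro Cauchy_Schwarz_nn_integral) auto
    also have "(\<integral>\<^sup>+y. (ennreal (sqrt (\<rho> (x - y))))\<^sup>2 \<partial>lborel) = 1"
      using nn_integral_lborel_reflect[where f="\<lambda>y. ennreal (\<rho> y)" and x=x] \<rho>(2,5) by (simp add: ennreal_power)
    finally show ?thesis using \<rho>(2) by (simp add: ennreal_power power_mult_distrib)
  qed
  have "(\<integral>\<^sup>+x. ennreal ((norm (mconv \<rho> F x))\<^sup>2) \<partial>lborel)
      \<le> (\<integral>\<^sup>+x. \<integral>\<^sup>+y. ennreal ((norm (F y))\<^sup>2 * \<rho> (x - y)) \<partial>lborel \<partial>lborel)"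
    by (intro nn_integral_mono pt)
  also have "\<dots> = (\<integral>\<^sup>+y. \<integral>\<^sup>+x. ennreal ((norm (F y))\<^sup>2 * \<rho> (x - y)) \<partial>lborel \<partial>lborel)"
    by (rule lborel_pair.Fubini'[symmetric]) measurable
  also have "\<dots> = (\<integral>\<^sup>+y. ennreal ((norm (F y))\<^sup>2) \<partial>lborel)"
  proof (rule nn_integral_cong)
    fix y
    have "(\<integral>\<^sup>+x. ennreal (\<rho> (x - y)) \<partial>lborel) = 1"
      using nn_integral_lborel_affine[where f="\<lambda>x. ennreal (\<rho> x)" and c=1 and t="- y"] \<rho>(5) by simp
    then show "(\<integral>\<^sup>+x. ennreal ((norm (F y))\<^sup>2 * \<rho> (x - y)) \<partial>lborel) = ennreal ((norm (F y))\<^sup>2)"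
      using \<rho>(2) by (simp add: ennreal_mult nn_integral_cmult)
  qed
  finally have le: "(\<integral>\<^sup>+x. ennreal ((norm (mconv \<rho> F x))\<^sup>2) \<partial>lborel) \<le> ennreal ((L2norm lborel F)\<^sup>2)"
    by (simp add: nn_integral_L2norm[OF F])
  show L: "L2 lborel (mconv \<rho> F)"
    by (subst L2_iff_nn_integral) (use le in \<open>auto intro: le_less_trans\<close>)
  have "(L2norm lborel (mconv \<rho> F))\<^sup>2 \<le> (L2norm lborel F)\<^sup>2"
    using le unfolding nn_integral_L2norm[OF L] by simp
  then show "L2norm lborel (mconv \<rho> F) \<le> L2norm lborel F" by (rule power2_le_imp_le) simp
qed

lemma L2_indicator:
  fixes c :: "'b::{banach, second_countable_topology}"
  assumes "A \<in> sets M" "emeasure M A < \<infinity>" shows "L2 M (\<lambda>x. indicator A x *\<^sub>R c)"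
proof -
  have "(\<lambda>x. (norm (indicator A x *\<^sub>R c))\<^sup>2) = (\<lambda>x. indicator A x * (norm c)\<^sup>2)"
    by (auto simp: indicator_def)
  then show ?thesis using assms by (simp add: L2_def)
qed

lemma tendsto_L2norm_dominated:
  assumes [measurable]: "\<And>n. f n \<in> borel_measurable M" "f0 \<in> borel_measurable M" and g: "L2 M g"
    and lim: "AE x in M. (\<lambda>n. f n x) \<longlonglongrightarrow> f0 x" and b: "\<And>n. AE x in M. norm (f n x - f0 x) \<le> norm (g x)"
  shows "(\<lambda>n. L2norm M (\<lambda>x. f n x - f0 x)) \<longlonglongrightarrow> 0"
proof -
  have "(\<lambda>n. \<integral>x. (norm (f n x - f0 x))\<^sup>2 \<partial>M) \<longlonglongrightarrow> (\<integral>x. 0 \<partial>M)"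
  proof (rule integral_dominated_convergence[OF _ _ L2D(2)[OF g]])
    show "AE x in M. (\<lambda>n. (norm (f n x - f0 x))\<^sup>2) \<longlonglongrightarrow> 0"
      using lim by eventually_elim (auto intro!: tendsto_eq_intros simp: LIM_zero_iff)
    show "AE x in M. norm ((norm (f n x - f0 x))\<^sup>2) \<le> (norm (g x))\<^sup>2" for n
      using b[of n] by eventually_elim (auto intro: power_mono)
  qed auto
  then show ?thesis unfolding L2norm_def by (auto intro!: tendsto_eq_intros)
qed

text \<open>Measurable functions are almost everywhere limits of continuous ones; truncating the
  values and cutting off outside a ball supplies the dominating function that turns this into
  \<open>L2\<close> convergence.\<close>

lemma continuous_dense_L2:
  fixes F :: "pt \<Rightarrow> complex"
  assumes F: "L2 lborel F" and supp: "\<And>x. x \<notin> cball 0 R \<Longrightarrow> F x = (0::complex)" and e: "e > 0"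
  obtains G where "continuous_on UNIV G" "\<And>x. x \<notin> cball 0 (R + 1) \<Longrightarrow> G x = 0"
    "L2norm lborel (\<lambda>x. F x - G x) < e"
proof -
  \<comment> \<open>Metric projection onto a disc truncates complex values continuously and fixes
    those already of modulus at most \<open>n\<close>.\<close>
  define tr :: "nat \<Rightarrow> complex \<Rightarrow> complex" where "tr n = closest_point (cball 0 (real n))" for n
  have tr_cont: "continuous_on S (tr n)" for n S
    unfolding tr_def by (intro continuous_on_closest_point) auto
  have tr_in: "norm (tr n z) \<le> n" for n z
    using closest_point_in_set[of "cball 0 (real n)" z] by (auto simp: tr_def)
  have tr_id: "norm z \<le> n \<Longrightarrow> tr n z = z" for n z
    by (simp add: tr_def closest_point_self)
  have [measurable]: "tr n \<in> borel_measurable borel" for n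
    by (rule borel_measurable_continuous_onI[OF tr_cont])
  have [measurable]: "F \<in> borel_measurable borel" using F by (simp add: L2_def)
  have tr_norm_le: "norm (tr n z) \<le> norm z" for n z
    using tr_in[of n z] tr_id[of z n] by (cases "norm z \<le> n") auto
  have tr_le: "norm (tr n z - z) \<le> 2 * norm z" for n z
    using norm_triangle_ineq4[of "tr n z" z] tr_norm_le[of n z] by linarith
  have "(\<lambda>n. L2norm lborel (\<lambda>x. tr n (F x) - F x)) \<longlonglongrightarrow> 0"
  proof (rule tendsto_L2norm_dominated[OF _ _ L2_scaleR[OF F, of 2]])
    show "AE x in lborel. (\<lambda>n. tr n (F x)) \<longlonglongrightarrow> F x"
    proof (rule AE_I2, rule tendsto_eventually, rule eventually_sequentiallyI)
      fix x n assume "nat \<lceil>norm (F x)\<rceil> \<le> n"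
      then show "tr n (F x) = F x" by (intro tr_id) linarith
    qed
    show "AE x in lborel. norm (tr n (F x) - F x) \<le> norm (2 *\<^sub>R F x)" for n
      using tr_le by simp
  qed auto
  from order_tendstoD(2)[OF this, of "e / 2"] e
  obtain n where n: "L2norm lborel (\<lambda>x. tr n (F x) - F x) < e / 2"
    by (auto simp: eventually_sequentially)
  have "F \<in> borel_measurable (lebesgue_on UNIV)"
    by (simp add: lebesgue_on_UNIV_eq measurable_completion)
  then have "F measurable_on UNIV" by (subst measurable_on_iff_borel_measurable) auto
  then obtain N and g :: "nat \<Rightarrow> pt \<Rightarrow> complex" where N: "negligible N" and g: "\<And>k. continuous_on UNIV (g k)"
    "\<And>x. x \<notin> N \<Longrightarrow> (\<lambda>k. g k x) \<longlonglongrightarrow> F x"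
    unfolding measurable_on_def by auto
  \<comment> \<open>A cutoff equal to 1 on \<open>cball 0 R\<close>, so that the truncation of
    \<open>F\<close> is unchanged by it, and equal to 0 outside
    \<open>cball 0 (R + 1)\<close>.\<close>
  define c where "c x = max 0 (min 1 (R + 1 - norm x))" for x :: pt
  have c: "continuous_on S c" for S unfolding c_def by (intro continuous_intros)
  have c01: "0 \<le> c x" "c x \<le> 1" for x by (auto simp: c_def)
  define G where "G k x = c x *\<^sub>R tr n (g k x)" for k x
  have Gc: "continuous_on UNIV (G k)" for k
    unfolding G_def by (intro continuous_intros c continuous_on_compose2[OF tr_cont g(1)]) auto
  have [measurable]: "G k \<in> borel_measurable borel" for k
    by (rule borel_measurable_continuous_onI[OF Gc])
  have G0: "x \<notin> cball 0 (R + 1) \<Longrightarrow> G k x = 0" for x k by (simp add: G_def c_def)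
  have cF: "c x *\<^sub>R tr n (F x) = tr n (F x)" for x
  proof (cases "x \<in> cball 0 R")
    case False then show ?thesis using supp[of x] tr_id[of 0 n] by simp
  qed (simp add: c_def)
  have "(\<lambda>k. L2norm lborel (\<lambda>x. G k x - tr n (F x))) \<longlonglongrightarrow> 0"
  proof (rule tendsto_L2norm_dominated)
    show "L2 lborel (\<lambda>x::pt. indicator (cball 0 (R + 1)) x *\<^sub>R (2 * real n))"
      by (intro L2_indicator) (use emeasure_lborel_cball_finite[of "0::pt" "R + 1"] in auto)
    show "AE x in lborel. (\<lambda>k. G k x) \<longlonglongrightarrow> tr n (F x)"
    proof -
      have "AE x in lborel. x \<notin> N"
        using AE_not_in[of N lebesgue] N by (simp add: negligible_iff_null_sets AE_completion_iff)
      then show ?thesis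
      proof eventually_elim
        case (elim x)
        have "(\<lambda>k. tr n (g k x)) \<longlonglongrightarrow> tr n (F x)"
          by (rule continuous_on_tendsto_compose[OF tr_cont[of UNIV] g(2)[OF elim]]) auto
        then have "(\<lambda>k. c x *\<^sub>R tr n (g k x)) \<longlonglongrightarrow> c x *\<^sub>R tr n (F x)" by (intro tendsto_intros)
        then show ?case by (simp add: G_def cF)
      qed
    qed
    show "AE x in lborel. norm (G k x - tr n (F x)) \<le> norm (indicator (cball 0 (R + 1)) x *\<^sub>R (2 * real n))" for k
    proof (rule AE_I2)
      fix x
      show "norm (G k x - tr n (F x)) \<le> norm (indicator (cball 0 (R + 1)) x *\<^sub>R (2 * real n))"
      proof (cases "x \<in> cball 0 (R + 1)")
        case True
        have "norm (G k x) \<le> 1 * real n"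
          unfolding G_def norm_scaleR using c01[of x] tr_in[of n "g k x"] by (intro mult_mono) auto
        then show ?thesis using True tr_in[of n "F x"] norm_triangle_ineq4[of "G k x" "tr n (F x)"] by simp
      next
        case False
        then have "F x = 0" by (intro supp) auto
        then show ?thesis using False G0[OF False] tr_id[of 0 n] by simp
      qed
    qed
  qed auto
  from order_tendstoD(2)[OF this, of "e / 2"] e
  obtain k where k: "L2norm lborel (\<lambda>x. G k x - tr n (F x)) < e / 2"
    by (auto simp: eventually_sequentially)
  have bG: "L2 lborel (\<lambda>x. tr n (F x))"
    by (rule L2_bound(1)[OF F]) (use tr_norm_le in auto)
  have LG: "L2 lborel (G k)"
  proof -
    have "integrable lborel (\<lambda>x. indicator (cball 0 (R + 1)) x *\<^sub>R (norm (G k x))\<^sup>2)"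
      by (rule borel_integrable_compact) (auto intro!: continuous_intros continuous_on_subset[OF Gc])
    also have "(\<lambda>x. indicator (cball 0 (R + 1)) x *\<^sub>R (norm (G k x))\<^sup>2) = (\<lambda>x. (norm (G k x))\<^sup>2)"
      using G0 by (auto simp: fun_eq_iff indicator_def)
    finally show ?thesis by (simp add: L2_def)
  qed
  have "L2norm lborel (\<lambda>x. F x - G k x) \<le> L2norm lborel (\<lambda>x. F x - tr n (F x)) + L2norm lborel (\<lambda>x. tr n (F x) - G k x)"
    by (intro L2norm_diff_trans L2_diff F bG LG)
  then have "L2norm lborel (\<lambda>x. F x - G k x) < e"
    using n k L2norm_commute[of lborel F "\<lambda>x. tr n (F x)"] L2norm_commute[of lborel "G k" "\<lambda>x. tr n (F x)"] by simp
  with Gc G0 show ?thesis by (rule that)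
qed

lemma vec_expansion: "(z::complex^2) = (\<Sum>i\<in>UNIV. z $ i *s axis i 1)"
  by (simp add: basis_expansion)

lemma borel_measurable_vecI:
  fixes z :: "'a \<Rightarrow> complex^2"
  assumes "\<And>i. (\<lambda>x. z x $ i) \<in> borel_measurable M"
  shows "z \<in> borel_measurable M"
proof -
  have "(\<lambda>c. c *s axis i 1 :: complex^2) \<in> borel_measurable borel" for i
    unfolding vector_scalar_mult_def
    by (intro borel_measurable_continuous_onI continuous_on_vec_lambda continuous_intros)
  from measurable_compose[OF assms this]
  have "(\<lambda>x. \<Sum>i\<in>UNIV. z x $ i *s axis i 1) \<in> borel_measurable M"
    by (intro borel_measurable_sum) auto
  then show ?thesis by (simp flip: vec_expansion)
qed

lemma L2_vecI:
  fixes z :: "'a \<Rightarrow> complex^2"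
  assumes "\<And>i. L2 M (\<lambda>x. z x $ i)"
  shows "L2 M z" "L2norm M z \<le> (\<Sum>i\<in>UNIV. L2norm M (\<lambda>x. z x $ i))"
proof -
  have s: "L2 M (\<lambda>x. \<Sum>i\<in>UNIV. norm (z x $ i))"
    by (intro L2_sum L2_norm assms) auto
  have b: "AE x in M. norm (z x) \<le> norm (\<Sum>i\<in>UNIV. norm (z x $ i))"
    unfolding norm_vec_def by (intro AE_I2 order_trans[OF L2_set_le_sum]) auto
  have m: "z \<in> borel_measurable M" by (intro borel_measurable_vecI L2D(1) assms)
  show "L2 M z" by (rule L2_bound(1)[OF s m b])
  have "L2norm M z \<le> L2norm M (\<lambda>x. \<Sum>i\<in>UNIV. norm (z x $ i))" by (rule L2_bound(2)[OF s m b])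
  also have "\<dots> \<le> (\<Sum>i\<in>UNIV. L2norm M (\<lambda>x. norm (z x $ i)))"
    by (intro L2norm_sum_le L2_norm assms) auto
  finally show "L2norm M z \<le> (\<Sum>i\<in>UNIV. L2norm M (\<lambda>x. z x $ i))" by simp
qed

lemma L2_vec_nth: 
  assumes "L2 M (z :: 'a \<Rightarrow> complex^2)" shows "L2 M (\<lambda>x. z x $ i)"
proof (rule L2_bound(1)[OF assms])
  have [measurable]: "z \<in> borel_measurable M" by (rule L2D(1)[OF assms])
  show "(\<lambda>x. z x $ i) \<in> borel_measurable M" by measurable
  show "AE x in M. norm (z x $ i) \<le> norm (z x)"
    unfolding norm_vec_def by (intro AE_I2 member_le_L2_set) auto
qed

lemma mollifier_mono: "mollifier \<delta> \<rho> \<Longrightarrow> \<delta> \<le> \<delta>' \<Longrightarrow> mollifier \<delta>' \<rho>"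
  by (auto simp: mollifier_def)

text \<open>The radius \<open>norm a + \<epsilon>\<close> accounts for the off-centre position: the
  support is a ball about \<open>a\<close>, while \<open>mollifier\<close> measures distances from
  the origin.\<close>

lemma mollifier_bump:
  assumes "0 < \<epsilon>"
  obtains c where "0 < c" "mollifier (norm a + \<epsilon>) (\<lambda>x. c * bump a \<epsilon> x)"
proof -
  have sm: "smooth (\<lambda>x. complex_of_real (bump a \<epsilon> x))" by (rule smooth_bump)
  have cont: "continuous_on UNIV (bump a \<epsilon>)"
    using continuous_on_Re[OF smooth_continuous[OF sm]] by simp
  have [measurable]: "bump a \<epsilon> \<in> borel_measurable borel"
    by (rule borel_measurable_continuous_onI[OF cont])
  have "integrable lborel (\<lambda>x. indicator (cball a \<epsilon>) x *\<^sub>R bump a \<epsilon> x)"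
    by (rule borel_integrable_compact) (auto intro: continuous_on_subset[OF cont])
  also have "(\<lambda>x. indicator (cball a \<epsilon>) x *\<^sub>R bump a \<epsilon> x) = bump a \<epsilon>"
    using bump_eq_0[OF assms, of _ a] by (auto simp: fun_eq_iff indicator_def)
  finally have i: "integrable lborel (bump a \<epsilon>)" .
  have nn: "(\<integral>\<^sup>+x. ennreal (bump a \<epsilon> x) \<partial>lborel) = ennreal (\<integral>x. bump a \<epsilon> x \<partial>lborel)"
    by (rule nn_integral_eq_integral[OF i]) (simp add: bump_nonneg)
  \<comment> \<open>A vanishing integral of a nonnegative function that is positive on the ball
    would make the ball a null set.\<close>
  have "(\<integral>x. bump a \<epsilon> x \<partial>lborel) \<noteq> 0"
  proof
    assume "(\<integral>x. bump a \<epsilon> x \<partial>lborel) = 0"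
    then have "AE x in lborel. bump a \<epsilon> x = 0"
      using integral_nonneg_eq_0_iff_AE[OF i] by (simp add: bump_nonneg)
    then have "AE x in lborel. x \<notin> ball a \<epsilon>"
      by eventually_elim (use bump_pos_iff[OF assms, of a] in force)
    then have "ball a \<epsilon> \<in> null_sets lborel"
      using AE_iff_null_sets[of "ball a \<epsilon>" lborel] by (simp del: mem_ball)
    then have "emeasure lborel (ball a \<epsilon>) = 0" by (rule null_setsD1)
    then show False using assms
      by (metis content_ball_pos emeasure_eq_measure2 enn2real_0 less_irrefl measure_def)
  qed
  then have I: "0 < (\<integral>x. bump a \<epsilon> x \<partial>lborel)"
    using Bochner_Integration.integral_nonneg[of lborel "bump a \<epsilon>", OF bump_nonneg] by linarith
  define c where "c = 1 / (\<integral>x. bump a \<epsilon> x \<partial>lborel)"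
  have c: "c > 0" using I by (simp add: c_def)
  show ?thesis
  proof (rule that[OF c], unfold mollifier_def, intro conjI allI impI)
    show "smooth (\<lambda>x. complex_of_real (c * bump a \<epsilon> x))"
      using smooth_mult[OF smooth_const[of "complex_of_real c"] sm] by simp
    show "0 \<le> c * bump a \<epsilon> x" for x using c bump_nonneg by simp
    show "c * bump a \<epsilon> x = 0" if "x \<notin> cball 0 (norm a + \<epsilon>)" for x
    proof -
      have "x \<notin> ball a \<epsilon>"
      proof
        assume "x \<in> ball a \<epsilon>"
        then have "norm (x - a) < \<epsilon>" by (simp add: dist_norm norm_minus_commute)
        then show False using that norm_triangle_sub[of x a] by simp
      qed
      then show ?thesis using bump_eq_0[OF assms] by simp
    qed
    show "(\<integral>\<^sup>+x. ennreal (c * bump a \<epsilon> x) \<partial>lborel) = 1"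
      using c I bump_nonneg
      by (simp add: ennreal_mult nn_integral_cmult nn) (simp add: c_def flip: ennreal_mult ennreal_1)
  qed
qed

text \<open>Unit mass writes \<open>mconv \<rho> G x - G x\<close> as an average of
  \<open>G y - G x\<close> over the support of the kernel, so the oscillation there bounds
  it.\<close>

lemma mconv_close:
  assumes m: "mollifier \<delta> \<rho>" and G: "integrable lborel G" "continuous_on UNIV G"
    and w: "\<And>y. dist x y \<le> \<delta> \<Longrightarrow> norm (G y - G x) \<le> \<omega>"
  shows "norm (mconv \<rho> G x - G x) \<le> \<omega>"
proof -
  note \<rho> = mollifierD[OF m]
  have [measurable]: "\<rho> \<in> borel_measurable borel" by (rule \<rho>)
  have nn: "(\<integral>\<^sup>+y. ennreal (\<rho> (x - y)) \<partial>lborel) = 1"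
    using nn_integral_lborel_reflect[where f="\<lambda>y. ennreal (\<rho> y)" and x=x] \<rho>(5) by simp
  have ir: "integrable lborel (\<lambda>y. \<rho> (x - y))"
    by (rule integrableI_nonneg) (use nn \<rho>(2) in auto)
  have Ir: "(\<integral>y. \<rho> (x - y) \<partial>lborel) = 1"
    using nn \<rho>(2) by (simp add: integral_eq_nn_integral)
  have iG: "integrable lborel (\<lambda>y. G y * complex_of_real (\<rho> (x - y)))"
    by (rule integrable_conv[OF G(1) smooth_continuous[OF \<rho>(1)] \<rho>(3)])
  have ic: "integrable lborel (\<lambda>y. G x * complex_of_real (\<rho> (x - y)))"
    using ir by (intro integrable_mult_right) (simp add: integrable_of_real)
  have "mconv \<rho> G x - G x = (\<integral>y. G y * complex_of_real (\<rho> (x - y)) \<partial>lborel) - (\<integral>y. G x * complex_of_real (\<rho> (x - y)) \<partial>lborel)"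
    using Ir by (simp add: conv_def)
  also have "\<dots> = (\<integral>y. G y * complex_of_real (\<rho> (x - y)) - G x * complex_of_real (\<rho> (x - y)) \<partial>lborel)"
    using iG ic by (rule Bochner_Integration.integral_diff[symmetric])
  also have "norm \<dots> \<le> (\<integral>y. \<omega> * \<rho> (x - y) \<partial>lborel)"
  proof (rule order_trans[OF integral_norm_bound], rule integral_mono)
    show "integrable lborel (\<lambda>y. norm (G y * complex_of_real (\<rho> (x - y)) - G x * complex_of_real (\<rho> (x - y))))"
      using iG ic by (intro integrable_norm Bochner_Integration.integrable_diff)
    show "integrable lborel (\<lambda>y. \<omega> * \<rho> (x - y))" using ir by simp
    fix y
    show "norm (G y * complex_of_real (\<rho> (x - y)) - G x * complex_of_real (\<rho> (x - y))) \<le> \<omega> * \<rho> (x - y)"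
    proof (cases "dist x y \<le> \<delta>")
      case True
      have "norm (G y * complex_of_real (\<rho> (x - y)) - G x * complex_of_real (\<rho> (x - y)))
          = norm (G y - G x) * \<rho> (x - y)"
        using \<rho>(2) by (simp add: norm_mult flip: left_diff_distrib)
      then show ?thesis using w[OF True] \<rho>(2) by (simp add: mult_right_mono)
    next
      case False
      then have "x - y \<notin> cball 0 \<delta>" by (simp add: dist_norm norm_minus_commute)
      then have "complex_of_real (\<rho> (x - y)) = 0" by (rule \<rho>(3))
      then show ?thesis by simp
    qed
  qed
  also have "\<dots> = \<omega>" using Ir by simp
  finally show ?thesis .
qed

lemma L2_bounded_support_integrable:
  fixes F :: "pt \<Rightarrow> complex"
  assumes "L2 lborel F" "\<And>x. x \<notin> cball 0 R \<Longrightarrow> F x = 0"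
  shows "integrable lborel F"
proof (rule Bochner_Integration.integrable_bound)
  have "L2 lborel (\<lambda>x::pt. indicator (cball 0 R) x *\<^sub>R (1::real))"
    by (intro L2_indicator) (use emeasure_lborel_cball_finite[of "0::pt" R] in auto)
  from integrable_norm_mult[OF assms(1) this]
  show "integrable lborel (\<lambda>x. norm (F x) * norm (indicator (cball 0 R) x *\<^sub>R (1::real)))" .
  show "F \<in> borel_measurable lborel" using assms(1) by (rule L2D)
  show "AE x in lborel. norm (F x) \<le> norm (norm (F x) * norm (indicator (cball 0 R) x *\<^sub>R (1::real)))"
    using assms(2) by (auto simp: indicator_def intro!: AE_I2)
qed

text \<open>The usual three-term argument: \<open>F\<close> is replaced by a continuous
  \<open>G\<close>, for which mollification is uniformly close, and the contraction property handles
  \<open>F - G\<close>. One \<open>\<delta>\<close> must serve every mollifier of that radius, as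
  the kernel is fixed only later.\<close>

lemma mconv_approx:
  fixes F :: "pt \<Rightarrow> complex"
  assumes F: "L2 lborel F" and supp: "\<And>x. x \<notin> cball 0 R \<Longrightarrow> F x = 0" and e: "e > 0"
  obtains \<delta> where "\<delta> > 0" "\<And>\<rho>. mollifier \<delta> \<rho> \<Longrightarrow> L2norm lborel (\<lambda>x. mconv \<rho> F x - F x) < e"
proof -
  have e4: "e / 4 > 0" using e by simp
  obtain G where G: "continuous_on UNIV G" "\<And>x. x \<notin> cball 0 (R + 1) \<Longrightarrow> G x = 0"
    "L2norm lborel (\<lambda>x. F x - G x) < e / 4"
    by (rule continuous_dense_L2[OF F supp e4, of R]) blast+
  have iF: "integrable lborel F" by (rule L2_bounded_support_integrable[OF F supp])
  have LG: "L2 lborel G"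
  proof -
    have "integrable lborel (\<lambda>x. indicator (cball 0 (R + 1)) x *\<^sub>R (norm (G x))\<^sup>2)"
      by (rule borel_integrable_compact) (auto intro!: continuous_intros continuous_on_subset[OF G(1)])
    also have "(\<lambda>x. indicator (cball 0 (R + 1)) x *\<^sub>R (norm (G x))\<^sup>2) = (\<lambda>x. (norm (G x))\<^sup>2)"
      using G(2) by (auto simp: fun_eq_iff indicator_def)
    finally show ?thesis using borel_measurable_continuous_onI[OF G(1)] by (simp add: L2_def)
  qed
  have iG: "integrable lborel G" by (rule L2_bounded_support_integrable[OF LG G(2)])
  \<comment> \<open>Both \<open>G\<close> and its mollification vanish outside
    \<open>cball 0 (R + 2)\<close>; the number \<open>\<omega>\<close> below is chosen so that the
    constant \<open>\<omega>\<close> on that ball has norm less than \<open>e / 4\<close>.\<close>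
  define K where "K = sqrt (measure lborel (cball (0::pt) (R + 2)))"
  have K: "K \<ge> 0" by (simp add: K_def)
  define \<omega> where "\<omega> = e / (4 * (K + 1))"
  have \<omega>: "\<omega> > 0" using e K by (simp add: \<omega>_def)
  have "uniformly_continuous_on (cball 0 (R + 3)) G"
    by (intro compact_uniformly_continuous continuous_on_subset[OF G(1)]) auto
  then obtain d where d: "d > 0" "\<And>x y. x \<in> cball 0 (R+3) \<Longrightarrow> y \<in> cball 0 (R+3) \<Longrightarrow> dist y x < d \<Longrightarrow> dist (G y) (G x) < \<omega>"
    unfolding uniformly_continuous_on_def using \<omega> by metis
  define \<delta> where "\<delta> = min 1 (d / 2)"
  have \<delta>: "0 < \<delta>" "\<delta> \<le> 1" "\<delta> < d" using d(1) by (auto simp: \<delta>_def)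
  show ?thesis
  proof (rule that[OF \<delta>(1)])
    fix \<rho> assume m: "mollifier \<delta> \<rho>"
    note \<rho> = mollifierD[OF m]
    have cl: "norm (G y - G x) \<le> (if x \<in> cball 0 (R + 2) then \<omega> else 0)" if xy: "dist x y \<le> \<delta>" for x y
    proof (cases "x \<in> cball 0 (R + 2)")
      case True
      have "norm y \<le> norm x + dist x y" by (metis dist_0_norm dist_triangle)
      then have "y \<in> cball 0 (R + 3)" using True xy \<delta> by auto
      then show ?thesis using d(2)[of x y] True xy \<delta> by (auto simp: dist_norm norm_minus_commute)
    next
      case False
      have "norm x \<le> norm y + dist x y" by (metis dist_0_norm dist_commute dist_triangle)
      then have "y \<notin> cball 0 (R + 1)" "x \<notin> cball 0 (R + 1)" using False xy \<delta> by auto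
      then show ?thesis using G(2) \<omega> by auto
    qed
    have mG: "L2 lborel (mconv \<rho> G)" by (rule L2norm_mconv_le(1)[OF m iG LG])
    have mF: "L2 lborel (mconv \<rho> F)" by (rule L2norm_mconv_le(1)[OF m iF F])
    have "L2norm lborel (\<lambda>x. mconv \<rho> G x - G x) \<le> L2norm lborel (\<lambda>x::pt. indicator (cball 0 (R + 2)) x *\<^sub>R \<omega>)"
    proof (rule L2_bound(2)[OF L2_indicator])
      show "(\<lambda>x. mconv \<rho> G x - G x) \<in> borel_measurable lborel" by (intro L2D(1) L2_diff mG LG)
      show "AE x in lborel. norm (mconv \<rho> G x - G x) \<le> norm (indicator (cball 0 (R + 2)) x *\<^sub>R \<omega>)"
      proof (rule AE_I2)
        fix x
        have "norm (mconv \<rho> G x - G x) \<le> (if x \<in> cball 0 (R + 2) then \<omega> else 0)"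
          by (rule mconv_close[OF m iG G(1) cl])
        then show "norm (mconv \<rho> G x - G x) \<le> norm (indicator (cball 0 (R + 2)) x *\<^sub>R \<omega>)"
          using \<omega> by (auto simp: indicator_def)
      qed
    qed (use emeasure_lborel_cball_finite[of "0::pt" "R + 2"] in auto)
    also have "\<dots> = K * \<omega>"
    proof -
      have "(\<lambda>x::pt. (norm (indicator (cball 0 (R + 2)) x *\<^sub>R \<omega>))\<^sup>2) = (\<lambda>x. indicator (cball 0 (R + 2)) x * \<omega>\<^sup>2)"
        by (auto simp: indicator_def)
      then show ?thesis using \<omega> by (simp add: L2norm_def K_def real_sqrt_mult)
    qed
    also have "\<dots> < e / 4" using K e by (simp add: \<omega>_def field_simps)
    finally have 1: "L2norm lborel (\<lambda>x. mconv \<rho> G x - G x) < e / 4" .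
    have "mconv \<rho> F x - mconv \<rho> G x = mconv \<rho> (\<lambda>x. F x - G x) x" for x
      unfolding conv_def left_diff_distrib
      by (rule Bochner_Integration.integral_diff[symmetric])
         (intro integrable_conv[OF iF smooth_continuous[OF \<rho>(1)] \<rho>(3)] integrable_conv[OF iG smooth_continuous[OF \<rho>(1)] \<rho>(3)]; assumption)+
    then have 2: "L2norm lborel (\<lambda>x. mconv \<rho> F x - mconv \<rho> G x) < e / 4"
      using L2norm_mconv_le(2)[OF m Bochner_Integration.integrable_diff[OF iF iG] L2_diff[OF F LG]] G(3)
      by simp
    have "L2norm lborel (\<lambda>x. mconv \<rho> F x - F x)
        \<le> L2norm lborel (\<lambda>x. mconv \<rho> F x - mconv \<rho> G x) + L2norm lborel (\<lambda>x. mconv \<rho> G x - F x)"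
      by (intro L2norm_diff_trans L2_diff mF mG F)
    also have "L2norm lborel (\<lambda>x. mconv \<rho> G x - F x)
        \<le> L2norm lborel (\<lambda>x. mconv \<rho> G x - G x) + L2norm lborel (\<lambda>x. G x - F x)"
      by (intro L2norm_diff_trans L2_diff LG mG F)
    finally show "L2norm lborel (\<lambda>x. mconv \<rho> F x - F x) < e"
      using 1 2 G(3) e L2norm_commute[of lborel F G] by simp
  qed
qed

section \<open>Density of smooth functions\<close>

text \<open>Convolutions are taken over \<open>lborel\<close>, but functions on
  \<open>\<Omega>\<close> are only Lebesgue measurable; a Borel function that equals the zero
  extension almost everywhere replaces them. Real and imaginary parts are treated
  separately.\<close>

lemma borel_representative:
  fixes f :: "pt \<Rightarrow> complex"
  assumes f: "f \<in> borel_measurable (lebesgue_on \<Omega>)" and \<Omega>: "\<Omega> \<in> sets lebesgue" "\<Omega> \<subseteq> cball 0 R"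
  obtains F where "F \<in> borel_measurable borel" "\<And>x. x \<notin> cball 0 R \<Longrightarrow> F x = 0"
    "AE x in lborel. F x = (if x \<in> \<Omega> then f x else 0)"
proof -
  let ?f = "\<lambda>x. if x \<in> \<Omega> then f x else 0"
  have m: "?f \<in> borel_measurable lebesgue"
    using borel_measurable_if[OF \<Omega>(1), of f] f by blast
  have "(\<lambda>x. Re (?f x)) \<in> borel_measurable lebesgue" "(\<lambda>x. Im (?f x)) \<in> borel_measurable lebesgue"
    using m by measurable
  note ab = this[THEN completion_ex_borel_measurable_real]
  obtain a where a: "a \<in> borel_measurable lborel" "AE x in lborel. Re (?f x) = a x"
    using ab(1) by blast
  obtain b where b: "b \<in> borel_measurable lborel" "AE x in lborel. Im (?f x) = b x"
    using ab(2) by blast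
  define F where "F x = indicator (cball 0 R) x *\<^sub>R Complex (a x) (b x)" for x
  have eq: "Complex (a x) (b x) = complex_of_real (a x) + \<i> * complex_of_real (b x)" for x
    by (simp add: complex_eq_iff)
  have [measurable]: "a \<in> borel_measurable borel" "b \<in> borel_measurable borel" using a b by auto
  have of[measurable]: "complex_of_real \<in> borel_measurable borel"
    by (intro borel_measurable_continuous_onI continuous_intros)
  have "F \<in> borel_measurable borel" unfolding F_def eq
    by (intro borel_measurable_scaleR borel_measurable_indicator) measurable
  moreover have "AE x in lborel. F x = ?f x"
    using a(2) b(2)
  proof eventually_elim
    case (elim x)
    then have "Complex (a x) (b x) = ?f x" by (auto simp: complex_eq_iff)
    then show ?case using \<Omega>(2) by (auto simp: F_def indicator_def)
  qed
  moreover have "F x = 0" if "x \<notin> cball 0 R" for x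
    using that by (simp add: F_def)
  ultimately show ?thesis by (intro that)
qed

lemma AE_lebesgue_on_lborel:
  assumes "\<Omega> \<in> sets lebesgue"
  shows "(AE x in lebesgue_on \<Omega>. P x) \<longleftrightarrow> (AE x in lborel. x \<in> \<Omega> \<longrightarrow> P x)"
  using assms by (simp add: AE_restrict_space_iff AE_completion_iff)

lemma integral_representative:
  fixes f F \<psi> :: "pt \<Rightarrow> complex"
  assumes f: "f \<in> borel_measurable (lebesgue_on \<Omega>)" and \<Omega>: "\<Omega> \<in> sets lebesgue"
    and [measurable]: "F \<in> borel_measurable borel" "\<psi> \<in> borel_measurable borel"
    and ae: "AE x in lborel. F x = (if x \<in> \<Omega> then f x else 0)"
  shows "(\<integral>x. f x * \<psi> x \<partial>lebesgue_on \<Omega>) = (\<integral>x. F x * \<psi> x \<partial>lborel)"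
proof -
  have "(\<lambda>x. if x \<in> \<Omega> then f x else 0) \<in> borel_measurable lebesgue"
    using borel_measurable_if[OF \<Omega>(1), of f] f by blast
  then have m: "(\<lambda>x. (if x \<in> \<Omega> then f x else 0) * \<psi> x) \<in> borel_measurable lebesgue"
    by (rule borel_measurable_times[OF _ measurable_completion]) simp
  have "(\<integral>x. f x * \<psi> x \<partial>lebesgue_on \<Omega>) = (\<integral>x. (if x \<in> \<Omega> then f x else 0) * \<psi> x \<partial>lebesgue)"
    using \<Omega> by (auto simp: integral_restrict_space indicator_def intro!: Bochner_Integration.integral_cong)
  also have "\<dots> = (\<integral>x. F x * \<psi> x \<partial>lebesgue)"
    by (rule integral_cong_AE[OF m])
       (use ae in \<open>auto simp: AE_completion_iff measurable_completion elim!: eventually_mono\<close>)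
  also have "\<dots> = (\<integral>x. F x * \<psi> x \<partial>lborel)"
    by (rule integral_completion) measurable
  finally show ?thesis .
qed

lemma L2_representative:
  fixes f F :: "pt \<Rightarrow> complex"
  assumes f: "L2 (lebesgue_on \<Omega>) f" and \<Omega>: "\<Omega> \<in> sets lebesgue"
    and F: "F \<in> borel_measurable borel"
    and ae: "AE x in lborel. F x = (if x \<in> \<Omega> then f x else 0)"
  shows "L2 lborel F"
proof -
  have "(\<integral>\<^sup>+x. ennreal ((norm (F x))\<^sup>2) \<partial>lborel) = (\<integral>\<^sup>+x. ennreal ((norm (F x))\<^sup>2) \<partial>lebesgue)"
    by (simp add: nn_integral_completion)
  also have "\<dots> = (\<integral>\<^sup>+x. ennreal ((norm (f x))\<^sup>2) * indicator \<Omega> x \<partial>lebesgue)"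
    by (rule nn_integral_cong_AE)
       (use ae in \<open>auto simp: AE_completion_iff indicator_def elim!: eventually_mono\<close>)
  also have "\<dots> = (\<integral>\<^sup>+x. ennreal ((norm (f x))\<^sup>2) \<partial>lebesgue_on \<Omega>)"
    using \<Omega> by (simp add: nn_integral_restrict_space)
  also have "\<dots> < \<infinity>" using L2_iff_nn_integral[OF L2D(1)[OF f]] f by simp
  finally show ?thesis using L2_iff_nn_integral[of F lborel] F by simp
qed

lemma L2_lebesgue_on:
  fixes h :: "pt \<Rightarrow> 'b::{banach, second_countable_topology}"
  assumes h: "L2 lborel h" and \<Omega>: "\<Omega> \<in> sets lebesgue"
  shows "L2 (lebesgue_on \<Omega>) h" "L2norm (lebesgue_on \<Omega>) h \<le> L2norm lborel h"
proof -
  have m: "h \<in> borel_measurable borel" using L2D(1)[OF h] by simp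
  have m': "h \<in> borel_measurable (lebesgue_on \<Omega>)"
    using m by (intro measurable_restrict_space1 measurable_completion) simp
  have "(\<integral>\<^sup>+x. ennreal ((norm (h x))\<^sup>2) \<partial>lebesgue_on \<Omega>) = (\<integral>\<^sup>+x. ennreal ((norm (h x))\<^sup>2) * indicator \<Omega> x \<partial>lebesgue)"
    using \<Omega> by (simp add: nn_integral_restrict_space)
  also have "\<dots> \<le> (\<integral>\<^sup>+x. ennreal ((norm (h x))\<^sup>2) \<partial>lebesgue)"
    by (intro nn_integral_mono) (auto simp: indicator_def)
  also have "\<dots> = ennreal ((L2norm lborel h)\<^sup>2)"
    by (simp add: nn_integral_completion nn_integral_L2norm[OF h])
  finally have le: "(\<integral>\<^sup>+x. ennreal ((norm (h x))\<^sup>2) \<partial>lebesgue_on \<Omega>) \<le> ennreal ((L2norm lborel h)\<^sup>2)" .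
  show L: "L2 (lebesgue_on \<Omega>) h"
    using L2_iff_nn_integral[OF m'] le by (auto intro: le_less_trans)
  have "(L2norm (lebesgue_on \<Omega>) h)\<^sup>2 \<le> (L2norm lborel h)\<^sup>2"
    using le unfolding nn_integral_L2norm[OF L] by simp
  then show "L2norm (lebesgue_on \<Omega>) h \<le> L2norm lborel h" by (rule power2_le_imp_le) simp
qed

lemma L2_continuous_lebesgue_on:
  fixes f :: "pt \<Rightarrow> 'b::{banach, second_countable_topology}"
  assumes "continuous_on UNIV f" "\<Omega> \<in> sets lebesgue" "bounded \<Omega>"
  shows "L2 (lebesgue_on \<Omega>) f"
proof -
  have "\<Omega> \<in> lmeasurable" using assms by (simp add: bounded_set_imp_lmeasurable)
  then interpret finite_measure "lebesgue_on \<Omega>" by (rule finite_measure_lebesgue_on)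
  have "compact (f ` closure \<Omega>)"
    using assms by (intro compact_continuous_image continuous_on_subset[OF assms(1)]) (auto simp: compact_closure)
  then obtain B where B: "\<And>x. x \<in> \<Omega> \<Longrightarrow> norm (f x) \<le> B"
    using closure_subset[of \<Omega>] by (fastforce dest!: compact_imp_bounded simp: bounded_iff)
  show ?thesis
  proof (rule L2_bounded)
    show "f \<in> borel_measurable (lebesgue_on \<Omega>)"
      by (intro measurable_restrict_space1 measurable_completion) (simp add: borel_measurable_continuous_onI[OF assms(1)])
    show "AE x in lebesgue_on \<Omega>. norm (f x) \<le> B" using B by (auto intro!: AE_I2)
  qed
qed

lemma L2_bounded_mult:
  fixes f g :: "pt \<Rightarrow> complex"
  assumes "continuous_on UNIV g" "\<Omega> \<in> sets lebesgue" "bounded \<Omega>" "L2 (lebesgue_on \<Omega>) f"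
  shows "L2 (lebesgue_on \<Omega>) (\<lambda>x. g x * f x)"
proof -
  have "compact (g ` closure \<Omega>)"
    using assms by (intro compact_continuous_image continuous_on_subset[OF assms(1)]) (auto simp: compact_closure)
  then obtain B where B: "\<And>x. x \<in> \<Omega> \<Longrightarrow> norm (g x) \<le> B"
    using closure_subset[of \<Omega>] by (fastforce dest!: compact_imp_bounded simp: bounded_iff)
  have [measurable]: "g \<in> borel_measurable (lebesgue_on \<Omega>)" "f \<in> borel_measurable (lebesgue_on \<Omega>)"
    using borel_measurable_continuous_onI[OF assms(1)] L2D(1)[OF assms(4)]
    by (auto intro!: measurable_restrict_space1 measurable_completion)
  show ?thesis
  proof (rule L2_bound(1)[OF L2_scaleR[OF assms(4), of B]])
    show "AE x in lebesgue_on \<Omega>. norm (g x * f x) \<le> norm (B *\<^sub>R f x)"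
    proof (rule AE_I2)
      fix x assume "x \<in> space (lebesgue_on \<Omega>)"
      then have "norm (g x) \<le> \<bar>B\<bar>" using B[of x] by auto
      then show "norm (g x * f x) \<le> norm (B *\<^sub>R f x)" by (simp add: norm_mult mult_right_mono)
    qed
  qed measurable
qed

text \<open>A quantitative interior cone at \<open>x0\<close>: one parameter scales both the shift
  and the radius, and the direction is common to all points near \<open>x0\<close>. This is what
  keeps a shifted kernel inside \<open>\<Omega>\<close> up to the boundary. At interior points the
  direction 0 is allowed.\<close>

definition cone_at :: "pt set \<Rightarrow> pt \<Rightarrow> real \<Rightarrow> pt \<Rightarrow> real \<Rightarrow> bool" where
  "cone_at \<Omega> x0 r e \<epsilon>0 \<longleftrightarrow> r > 0 \<and> \<epsilon>0 > 0 \<and>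
     (\<forall>\<epsilon> x. 0 < \<epsilon> \<and> \<epsilon> < \<epsilon>0 \<and> x \<in> \<Omega> \<inter> ball x0 r \<longrightarrow> cball (x + \<epsilon> *\<^sub>R e) \<epsilon> \<subseteq> \<Omega>)"

text \<open>The weak gradient of \<open>v\<close> is tested with \<open>\<zeta> \<phi>\<close>, and
  the classical product rule is expanded; the term with \<open>grad \<zeta>\<close> moves to the
  other side.\<close>

lemma weak_grad_product:
  assumes \<Omega>: "\<Omega> \<in> sets lebesgue" "bounded \<Omega>"
    and v: "L2 (lebesgue_on \<Omega>) v" and w: "L2 (lebesgue_on \<Omega>) w" "has_weak_grad \<Omega> v w"
    and \<zeta>: "smooth \<zeta>"
  shows "has_weak_grad \<Omega> (\<lambda>x. \<zeta> x * v x) (\<lambda>x. \<zeta> x *s w x + v x *s grad \<zeta> x)"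
  unfolding has_weak_grad_def
proof (intro allI impI)
  fix \<phi> and i :: 2 assume t: "test_fun \<Omega> \<phi>"
  then have s\<phi>: "smooth \<phi>" by (simp add: test_fun_def)
  have p: "partial i (\<lambda>x. \<zeta> x * \<phi> x) = (\<lambda>x. partial i \<zeta> x * \<phi> x + \<zeta> x * partial i \<phi> x)"
    by (intro partial_mult smooth_differentiable s\<phi> \<zeta>)
  have int: "integrable (lebesgue_on \<Omega>) (\<lambda>x. a x * b x)"
    if "L2 (lebesgue_on \<Omega>) a" "smooth b" for a b :: "pt \<Rightarrow> complex"
    using integrable_mult_cnj[OF that(1), of "\<lambda>x. cnj (b x)"]
      L2_continuous_lebesgue_on[OF _ \<Omega>, of "\<lambda>x. cnj (b x)"] smooth_continuous[OF that(2)]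
    by (simp add: continuous_on_cnj)
  have wi: "L2 (lebesgue_on \<Omega>) (\<lambda>x. w x $ i)" by (rule L2_vec_nth[OF w(1)])
  have "(\<integral>x. v x * partial i (\<lambda>x. \<zeta> x * \<phi> x) x \<partial>lebesgue_on \<Omega>)
      = - (\<integral>x. w x $ i * (\<zeta> x * \<phi> x) \<partial>lebesgue_on \<Omega>)"
    using w(2) test_fun_mult[OF t \<zeta>] unfolding has_weak_grad_def by blast
  moreover have "(\<integral>x. v x * partial i (\<lambda>x. \<zeta> x * \<phi> x) x \<partial>lebesgue_on \<Omega>)
     = (\<integral>x. v x * (partial i \<zeta> x * \<phi> x) + v x * (\<zeta> x * partial i \<phi> x) \<partial>lebesgue_on \<Omega>)"
    unfolding p by (simp add: algebra_simps)
  moreover have "\<dots> = (\<integral>x. v x * (partial i \<zeta> x * \<phi> x) \<partial>lebesgue_on \<Omega>) + (\<integral>x. v x * (\<zeta> x * partial i \<phi> x) \<partial>lebesgue_on \<Omega>)"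
    by (intro Bochner_Integration.integral_add int v smooth_mult smooth_partial \<zeta> s\<phi>)
  moreover have "(\<integral>x. (\<zeta> x *s w x + v x *s grad \<zeta> x) $ i * \<phi> x \<partial>lebesgue_on \<Omega>)
     = (\<integral>x. w x $ i * (\<zeta> x * \<phi> x) + v x * (partial i \<zeta> x * \<phi> x) \<partial>lebesgue_on \<Omega>)"
    by (simp add: grad_def algebra_simps)
  moreover have "\<dots> = (\<integral>x. w x $ i * (\<zeta> x * \<phi> x) \<partial>lebesgue_on \<Omega>) + (\<integral>x. v x * (partial i \<zeta> x * \<phi> x) \<partial>lebesgue_on \<Omega>)"
    by (intro Bochner_Integration.integral_add int v wi smooth_mult smooth_partial \<zeta> s\<phi>)
  ultimately show "(\<integral>x. \<zeta> x * v x * partial i \<phi> x \<partial>lebesgue_on \<Omega>)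
     = - (\<integral>x. (\<zeta> x *s w x + v x *s grad \<zeta> x) $ i * \<phi> x \<partial>lebesgue_on \<Omega>)"
    by (simp add: mult_ac)
qed

text \<open>The support condition concerns the kernel as seen from \<open>x\<close>, not a
  neighbourhood of \<open>x\<close>; hence it can hold at points arbitrarily close to the
  boundary.\<close>

lemma partial_mconv_in:
  fixes f F W :: "pt \<Rightarrow> complex"
  assumes \<Omega>: "\<Omega> \<in> sets lebesgue"
    and wg: "\<And>\<phi>. test_fun \<Omega> \<phi> \<Longrightarrow> (\<integral>x. f x * partial i \<phi> x \<partial>lebesgue_on \<Omega>) = - (\<integral>x. wi x * \<phi> x \<partial>lebesgue_on \<Omega>)"
    and f: "f \<in> borel_measurable (lebesgue_on \<Omega>)" "F \<in> borel_measurable borel" "AE x in lborel. F x = (if x \<in> \<Omega> then f x else 0)"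
    and w: "wi \<in> borel_measurable (lebesgue_on \<Omega>)" "W \<in> borel_measurable borel" "AE x in lborel. W x = (if x \<in> \<Omega> then wi x else 0)"
    and s: "smooth \<rho>" and t: "test_fun \<Omega> (\<lambda>y. \<rho> (x - y))"
  shows "conv (partial i \<rho>) F x = conv \<rho> W x"
proof -
  have sr: "smooth (\<lambda>y. \<rho> (x - y))" using t by (simp add: test_fun_def)
  have "conv (partial i \<rho>) F x = - (\<integral>y. F y * partial i (\<lambda>y. \<rho> (x - y)) y \<partial>lborel)"
    by (simp add: conv_def partial_reflect[OF s])
  also have "\<dots> = - (\<integral>y. f y * partial i (\<lambda>y. \<rho> (x - y)) y \<partial>lebesgue_on \<Omega>)"
    by (subst integral_representative[OF f(1) \<Omega> f(2) _ f(3)])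
       (auto intro!: smooth_borel_measurable smooth_partial sr)
  also have "\<dots> = (\<integral>y. wi y * \<rho> (x - y) \<partial>lebesgue_on \<Omega>)" using wg[OF t] by simp
  also have "\<dots> = conv \<rho> W x" unfolding conv_def
    by (rule integral_representative[OF w(1) \<Omega> w(2) _ w(3)]) (auto intro!: smooth_borel_measurable sr)
  finally show ?thesis .
qed

text \<open>Mollification with a kernel centred at \<open>- \<epsilon> e\<close> samples the
  function in the ball of radius \<open>\<epsilon>\<close> about \<open>x + \<epsilon> e\<close>,
  which the cone condition places inside \<open>\<Omega>\<close> for every \<open>x\<close> of
  \<open>\<Omega>\<close> near \<open>x0\<close>. So the jump of the zero extension across the
  boundary does not enter the gradient on \<open>\<Omega>\<close>, although the result is smooth on
  the whole plane.\<close>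

lemma local_density:
  assumes \<Omega>: "open \<Omega>" "bounded \<Omega>" and cone: "cone_at \<Omega> x0 r e \<epsilon>0" and r1: "r1 < r"
    and \<zeta>: "smooth \<zeta>" "\<And>x. x \<notin> cball x0 r1 \<Longrightarrow> \<zeta> x = 0"
    and v: "L2 (lebesgue_on \<Omega>) v" and w: "L2 (lebesgue_on \<Omega>) w" "has_weak_grad \<Omega> v w" and \<eta>: "\<eta> > 0"
  obtains \<phi> where "smooth \<phi>" "L2norm (lebesgue_on \<Omega>) (\<lambda>x. \<phi> x - \<zeta> x * v x) < \<eta>"
    "L2norm (lebesgue_on \<Omega>) (\<lambda>x. grad \<phi> x - (\<zeta> x *s w x + v x *s grad \<zeta> x)) < \<eta>"
    "(AE x in lebesgue_on \<Omega>. v x = 0) \<Longrightarrow> \<phi> = (\<lambda>x. 0)"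
proof -
  have \<Omega>l: "\<Omega> \<in> sets lebesgue" using \<Omega>(1) by (simp add: lmeasurable_open)
  obtain R where R: "\<Omega> \<subseteq> cball 0 R" using \<Omega>(2) unfolding bounded_iff by (metis mem_cball_0 subsetI)
  let ?f = "\<lambda>x. \<zeta> x * v x" and ?w = "\<lambda>x. \<zeta> x *s w x + v x *s grad \<zeta> x"
  have Lf: "L2 (lebesgue_on \<Omega>) ?f" by (rule L2_bounded_mult[OF smooth_continuous[OF \<zeta>(1)] \<Omega>l \<Omega>(2) v])
  have Lw: "L2 (lebesgue_on \<Omega>) (\<lambda>x. ?w x $ i)" for i
    using L2_add[OF L2_bounded_mult[OF smooth_continuous[OF \<zeta>(1)] \<Omega>l \<Omega>(2) L2_vec_nth[OF w(1)]]
        L2_bounded_mult[OF smooth_continuous[OF smooth_partial[OF \<zeta>(1)]] \<Omega>l \<Omega>(2) v], of i i]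
    by (simp add: grad_def mult.commute)
  have wg: "(\<integral>x. ?f x * partial i \<phi> x \<partial>lebesgue_on \<Omega>) = - (\<integral>x. ?w x $ i * \<phi> x \<partial>lebesgue_on \<Omega>)"
    if "test_fun \<Omega> \<phi>" for \<phi> i
    using weak_grad_product[OF \<Omega>l \<Omega>(2) v w \<zeta>(1)] that unfolding has_weak_grad_def by blast
  obtain F where F: "F \<in> borel_measurable borel" "\<And>x. x \<notin> cball 0 R \<Longrightarrow> F x = 0"
    "AE x in lborel. F x = (if x \<in> \<Omega> then ?f x else 0)"
    using borel_representative[OF L2D(1)[OF Lf] \<Omega>l R] by blast
  \<comment> \<open>The three properties are packed together so that a single choice yields a
    representative for each component.\<close>
  define Q where "Q i W \<longleftrightarrow> W \<in> borel_measurable borel \<and> (\<forall>x. x \<notin> cball 0 R \<longrightarrow> W x = 0) \<and>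
    (AE x in lborel. W x = (if x \<in> \<Omega> then ?w x $ i else 0))" for i and W :: "pt \<Rightarrow> complex"
  have "\<forall>i. \<exists>W. Q i W"
  proof
    fix i
    obtain V where "V \<in> borel_measurable borel" "\<And>x. x \<notin> cball 0 R \<Longrightarrow> V x = 0"
      "AE x in lborel. V x = (if x \<in> \<Omega> then ?w x $ i else 0)"
      using borel_representative[OF L2D(1)[OF Lw[of i]] \<Omega>l R] by blast
    then show "\<exists>W. Q i W" unfolding Q_def by blast
  qed
  from choice[OF this] obtain W where Q: "\<And>i. Q i (W i)" by blast
  have W: "\<And>i. W i \<in> borel_measurable borel" "\<And>i x. x \<notin> cball 0 R \<Longrightarrow> W i x = 0"
    "\<And>i. AE x in lborel. W i x = (if x \<in> \<Omega> then ?w x $ i else 0)"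
    using Q unfolding Q_def by blast+
  have LF: "L2 lborel F" by (rule L2_representative[OF Lf \<Omega>l F(1,3)])
  have LW: "L2 lborel (W i)" for i by (rule L2_representative[OF Lw \<Omega>l W(1,3)])
  have iF: "integrable lborel F" by (rule L2_bounded_support_integrable[OF LF F(2)])
  have iW: "integrable lborel (W i)" for i by (rule L2_bounded_support_integrable[OF LW W(2)])
  obtain \<delta>1 where \<delta>1: "\<delta>1 > 0" "\<And>\<rho>. mollifier \<delta>1 \<rho> \<Longrightarrow> L2norm lborel (\<lambda>x. mconv \<rho> F x - F x) < \<eta>"
    using mconv_approx[OF LF F(2) \<eta>] by blast
  have "\<forall>i. \<exists>d>0. \<forall>\<rho>. mollifier d \<rho> \<longrightarrow> L2norm lborel (\<lambda>x. mconv \<rho> (W i) x - W i x) < \<eta> / 2"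
  proof
    fix i
    obtain d where "d > 0" "\<And>\<rho>. mollifier d \<rho> \<Longrightarrow> L2norm lborel (\<lambda>x. mconv \<rho> (W i) x - W i x) < \<eta> / 2"
      using mconv_approx[OF LW[of i] W(2)[where i=i], of R "\<eta> / 2"] \<eta> by (auto simp del: mem_cball)
    then show "\<exists>d>0. \<forall>\<rho>. mollifier d \<rho> \<longrightarrow> L2norm lborel (\<lambda>x. mconv \<rho> (W i) x - W i x) < \<eta> / 2" by blast
  qed
  from choice[OF this] obtain \<delta>2 where \<delta>2: "\<And>i. \<delta>2 i > 0"
    "\<And>i \<rho>. mollifier (\<delta>2 i) \<rho> \<Longrightarrow> L2norm lborel (\<lambda>x. mconv \<rho> (W i) x - W i x) < \<eta> / 2" by blast
  \<comment> \<open>The last entry makes the mollified function vanish outside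
    \<open>ball x0 r\<close>, where the cone condition says nothing; the others deliver the two
    approximation estimates.\<close>
  define \<delta> where "\<delta> = min (min \<delta>1 (Min (range \<delta>2))) ((r - r1) / 2)"
  have "\<delta> \<le> (r - r1) / 2" unfolding \<delta>_def by (rule min.cobounded2)
  moreover have "\<delta> > 0" "\<delta> \<le> \<delta>1" "\<And>i. \<delta> \<le> \<delta>2 i"
    using \<delta>1(1) \<delta>2(1) r1 by (auto simp: \<delta>_def min_le_iff_disj)
  ultimately have \<delta>: "\<delta> > 0" "\<delta> \<le> \<delta>1" "\<And>i. \<delta> \<le> \<delta>2 i" "\<delta> < r - r1"
    by (auto simp: field_simps)
  \<comment> \<open>Shift plus radius, \<open>\<epsilon> * (norm e + 1)\<close>, must not exceed
    \<open>\<delta>\<close>, while \<open>\<epsilon> < \<epsilon>0\<close> admits the cone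
    condition.\<close>
  define \<epsilon> where "\<epsilon> = min (\<delta> / (norm e + 1)) (\<epsilon>0 / 2)"
  have e0: "\<epsilon>0 > 0" "r > 0" and cone': "\<And>\<epsilon> x. 0 < \<epsilon> \<Longrightarrow> \<epsilon> < \<epsilon>0 \<Longrightarrow> x \<in> \<Omega> \<Longrightarrow> x \<in> ball x0 r \<Longrightarrow> cball (x + \<epsilon> *\<^sub>R e) \<epsilon> \<subseteq> \<Omega>"
    using cone unfolding cone_at_def by blast+
  have n1: "norm e + 1 > 0" by (simp add: add_nonneg_pos)
  have \<epsilon>: "\<epsilon> > 0" "\<epsilon> < \<epsilon>0" using \<delta>(1) e0 n1 by (auto simp: \<epsilon>_def)
  have "\<epsilon> * (norm e + 1) \<le> \<delta> / (norm e + 1) * (norm e + 1)"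
    using n1 by (intro mult_right_mono) (auto simp: \<epsilon>_def)
  moreover have "\<delta> / (norm e + 1) * (norm e + 1) = \<delta>" using n1 by simp
  ultimately have "\<epsilon> * (norm e + 1) \<le> \<delta>" by simp
  then have \<epsilon>\<delta>: "norm (- (\<epsilon> *\<^sub>R e)) + \<epsilon> \<le> \<delta>" using \<epsilon>(1) n1 by (simp add: algebra_simps)
  obtain c where c: "0 < c" "mollifier (norm (- (\<epsilon> *\<^sub>R e)) + \<epsilon>) (\<lambda>x. c * bump (- (\<epsilon> *\<^sub>R e)) \<epsilon> x)"
    using mollifier_bump[OF \<epsilon>(1)] by blast
  define \<rho> where "\<rho> x = c * bump (- (\<epsilon> *\<^sub>R e)) \<epsilon> x" for x
  have m: "mollifier \<delta> \<rho>" unfolding \<rho>_def by (rule mollifier_mono[OF c(2) \<epsilon>\<delta>])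
  note mD = mollifierD[OF m]
  define \<phi> where "\<phi> = mconv \<rho> F"
  have s\<phi>: "smooth \<phi>" unfolding \<phi>_def by (rule smooth_conv[OF iF mD(1,3)])
  have p\<phi>: "partial i \<phi> = conv (partial i (\<lambda>x. complex_of_real (\<rho> x))) F" for i
    unfolding \<phi>_def by (rule partial_conv[OF iF mD(1,3)])
  have supp: "AE y in lborel. y \<notin> cball x0 r1 \<longrightarrow> F y = 0" "AE y in lborel. y \<notin> cball x0 r1 \<longrightarrow> W i y = 0" for i
  proof -
    show "AE y in lborel. y \<notin> cball x0 r1 \<longrightarrow> F y = 0"
      using F(3) by eventually_elim (use \<zeta>(2) in auto)
    have "partial i \<zeta> y = 0" if "y \<notin> cball x0 r1" for y
    proof -
      have "(\<zeta> has_derivative (\<lambda>_. 0)) (at y)"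
        by (rule has_derivative_transform_within_open[of "\<lambda>_. 0" _ _ _ "- cball x0 r1"])
           (use \<zeta>(2) that in \<open>auto simp: open_Compl\<close>)
      from partial_eq[OF this] show ?thesis by simp
    qed
    then show "AE y in lborel. y \<notin> cball x0 r1 \<longrightarrow> W i y = 0"
      using W(3)[of i] by (auto elim!: eventually_mono simp: \<zeta>(2) grad_def)
  qed
  have zero: "conv \<psi> H x = 0"
    if "AE y in lborel. y \<notin> cball x0 r1 \<longrightarrow> H y = 0" "\<And>z. z \<notin> cball 0 \<delta> \<Longrightarrow> \<psi> z = 0"
      "x \<notin> ball x0 r" for \<psi> H x
  proof -
    show ?thesis unfolding conv_def
    proof (rule integral_eq_zero_AE)
      show "AE y in lborel. H y * \<psi> (x - y) = 0" using that(1)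
      proof eventually_elim
        case (elim y)
        show ?case
        proof (cases "y \<in> cball x0 r1")
          case True
          have "dist x0 x \<le> dist x0 y + dist y x" by (rule dist_triangle)
          then have "x - y \<notin> cball 0 \<delta>" using True that(3) \<delta>(4) by (simp add: dist_norm norm_minus_commute)
          then show ?thesis using that(2) by simp
        qed (use elim in simp)
      qed
    qed
  qed
  \<comment> \<open>Inside \<open>ball x0 r\<close> the shifted kernel is a test function on
    \<open>\<Omega>\<close>; outside, both sides vanish by \<open>zero\<close>.\<close>
  have pW: "partial i \<phi> x = mconv \<rho> (W i) x" if x: "x \<in> \<Omega>" for i x
  proof (cases "x \<in> ball x0 r")
    case True
    have "cball (x + \<epsilon> *\<^sub>R e) \<epsilon> \<subseteq> \<Omega>" by (rule cone'[OF \<epsilon> x True])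
    from test_fun_bump[OF \<epsilon>(1) this smooth_const[of "complex_of_real c"]]
    have "test_fun \<Omega> (\<lambda>y. complex_of_real (\<rho> (x - y)))"
      by (simp add: \<rho>_def bump_def dist_norm norm_minus_commute algebra_simps)
    from partial_mconv_in[OF \<Omega>l wg L2D(1)[OF Lf] F(1,3) L2D(1)[OF Lw] W(1,3) mD(1) this]
    show ?thesis by (simp add: p\<phi>)
  next
    case False
    show ?thesis unfolding p\<phi>
      using zero[OF supp(1) support_partial[OF mD(3)] False]
        zero[OF supp(2) mD(3) False] by simp
  qed
  show ?thesis
  proof (rule that[OF s\<phi>])
    have mF: "L2 lborel (mconv \<rho> F)" by (rule L2norm_mconv_le(1)[OF m iF LF])
    have d1: "L2 lborel (\<lambda>x. \<phi> x - F x)" unfolding \<phi>_def by (rule L2_diff[OF mF LF])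
    have L\<phi>: "L2 (lebesgue_on \<Omega>) (\<lambda>x. \<phi> x - ?f x)"
      by (intro L2_diff Lf L2_continuous_lebesgue_on[OF smooth_continuous[OF s\<phi>] \<Omega>l \<Omega>(2)])
    have "L2norm (lebesgue_on \<Omega>) (\<lambda>x. \<phi> x - ?f x) = L2norm (lebesgue_on \<Omega>) (\<lambda>x. \<phi> x - F x)"
      by (rule L2norm_cong_AE[OF L2D(1)[OF L\<phi>] L2D(1)[OF L2_lebesgue_on(1)[OF d1 \<Omega>l]]])
         (use F(3) in \<open>auto simp: AE_lebesgue_on_lborel[OF \<Omega>l] elim!: eventually_mono\<close>)
    also have "\<dots> \<le> L2norm lborel (\<lambda>x. \<phi> x - F x)" by (rule L2_lebesgue_on(2)[OF d1 \<Omega>l])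
    also have "\<dots> < \<eta>" unfolding \<phi>_def by (rule \<delta>1(2)[OF mollifier_mono[OF m \<delta>(2)]])
    finally show "L2norm (lebesgue_on \<Omega>) (\<lambda>x. \<phi> x - ?f x) < \<eta>" .
    have Lg: "L2 (lebesgue_on \<Omega>) (\<lambda>x. (grad \<phi> x - ?w x) $ i)" for i
      using L2_diff[OF L2_continuous_lebesgue_on[OF smooth_continuous[OF smooth_partial[OF s\<phi>]] \<Omega>l \<Omega>(2)] Lw, of i i]
      by (simp add: grad_def)
    have comp: "L2norm (lebesgue_on \<Omega>) (\<lambda>x. (grad \<phi> x - ?w x) $ i) < \<eta> / 2" for i
    proof -
      have d2: "L2 lborel (\<lambda>x. mconv \<rho> (W i) x - W i x)"
        by (intro L2_diff LW L2norm_mconv_le(1)[OF m iW LW])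
      have "AE x in lebesgue_on \<Omega>. (grad \<phi> x - ?w x) $ i = mconv \<rho> (W i) x - W i x"
        unfolding AE_lebesgue_on_lborel[OF \<Omega>l] using W(3)[of i]
        by eventually_elim (use pW in \<open>auto simp: grad_def\<close>)
      then have "L2norm (lebesgue_on \<Omega>) (\<lambda>x. (grad \<phi> x - ?w x) $ i) = L2norm (lebesgue_on \<Omega>) (\<lambda>x. mconv \<rho> (W i) x - W i x)"
        by (rule L2norm_cong_AE[OF L2D(1)[OF Lg] L2D(1)[OF L2_lebesgue_on(1)[OF d2 \<Omega>l]]])
      also have "\<dots> \<le> L2norm lborel (\<lambda>x. mconv \<rho> (W i) x - W i x)" by (rule L2_lebesgue_on(2)[OF d2 \<Omega>l])
      also have "\<dots> < \<eta> / 2" by (rule \<delta>2(2)[OF mollifier_mono[OF m \<delta>(3)]])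
      finally show ?thesis .
    qed
    have "L2norm (lebesgue_on \<Omega>) (\<lambda>x. grad \<phi> x - ?w x) \<le> (\<Sum>i\<in>UNIV. L2norm (lebesgue_on \<Omega>) (\<lambda>x. (grad \<phi> x - ?w x) $ i))"
      by (rule L2_vecI(2)[OF Lg])
    also have "\<dots> < (\<Sum>i\<in>(UNIV::2 set). \<eta> / 2)" by (rule sum_strict_mono) (use comp in auto)
    also have "\<dots> = \<eta>" by simp
    finally show "L2norm (lebesgue_on \<Omega>) (\<lambda>x. grad \<phi> x - ?w x) < \<eta>" .
  next
    assume "AE x in lebesgue_on \<Omega>. v x = 0"
    then have ae: "AE x in lborel. F x = 0"
      unfolding AE_lebesgue_on_lborel[OF \<Omega>l] using F(3) by eventually_elim auto
    have "\<phi> x = 0" for x unfolding \<phi>_def conv_def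
      by (rule integral_eq_zero_AE) (use ae in \<open>auto elim!: eventually_mono\<close>)
    then show "\<phi> = (\<lambda>x. 0)" by auto
  qed
qed

lemma L2norm_cong: "(\<And>x. x \<in> space M \<Longrightarrow> f x = g x) \<Longrightarrow> L2norm M f = L2norm M g"
  unfolding L2norm_def by (intro arg_cong[of _ _ sqrt] Bochner_Integration.integral_cong) auto

text \<open>Above a Lipschitz graph the vertical direction stretched by \<open>L + 1\<close> works:
  a horizontal move by \<open>\<epsilon>\<close> raises the graph by at most
  \<open>L * \<epsilon>\<close>, and the extra \<open>\<epsilon>\<close> absorbs the vertical extent
  of the ball.\<close>

lemma lipschitz_domain_cone:
  assumes L: "lipschitz_domain \<Omega>" and x0: "x0 \<in> closure \<Omega>"
  shows "\<exists>r e \<epsilon>0. cone_at \<Omega> x0 r e \<epsilon>0"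
proof (cases "x0 \<in> \<Omega>")
  case True
  have "open \<Omega>" using L by (simp add: lipschitz_domain_def)
  then obtain s where s: "s > 0" "ball x0 s \<subseteq> \<Omega>" using True by (meson openE)
  have "cball x \<epsilon> \<subseteq> \<Omega>" if "\<epsilon> < s / 2" "x \<in> ball x0 (s / 2)" for x \<epsilon>
  proof
    fix y assume "y \<in> cball x \<epsilon>"
    then have "dist x0 y < s" using that dist_triangle[of x0 y x] by simp
    then show "y \<in> \<Omega>" using s by auto
  qed
  then have "cone_at \<Omega> x0 (s / 2) 0 (s / 2)" unfolding cone_at_def using s by auto
  then show ?thesis by blast
next
  case False
  then have "x0 \<in> frontier \<Omega>" using x0 L by (simp add: frontier_def lipschitz_domain_def interior_open)
  then obtain r e1 e2 L \<psi> where r: "r > 0" and e: "norm e1 = 1" "norm e2 = 1" "e1 \<bullet> e2 = 0"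
    and lip: "L-lipschitz_on UNIV \<psi>" and graph: "\<Omega> \<inter> ball x0 r = {y \<in> ball x0 r. \<psi> (e1 \<bullet> y) < e2 \<bullet> y}"
    using L unfolding lipschitz_domain_def by blast
  have L0: "L \<ge> 0" using lip by (rule lipschitz_on_nonneg)
  \<comment> \<open>The bound on \<open>\<epsilon>\<close> limits the displacement
    \<open>\<epsilon> * (L + 2)\<close> to less than \<open>r / 2\<close>, so that \<open>y\<close>
    stays in the ball where the graph describes \<open>\<Omega>\<close>.\<close>
  have "cball (x + \<epsilon> *\<^sub>R ((L + 1) *\<^sub>R e2)) \<epsilon> \<subseteq> \<Omega>"
    if \<epsilon>: "0 < \<epsilon>" "\<epsilon> < r / (2 * (L + 2))" and x: "x \<in> \<Omega>" "x \<in> ball x0 (r / 2)" for x \<epsilon>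
  proof
    fix y assume y: "y \<in> cball (x + \<epsilon> *\<^sub>R ((L + 1) *\<^sub>R e2)) \<epsilon>"
    define z where "z = y - (x + \<epsilon> *\<^sub>R ((L + 1) *\<^sub>R e2))"
    have z: "norm z \<le> \<epsilon>" using y by (simp add: z_def dist_norm norm_minus_commute)
    have y_eq: "y = x + (\<epsilon> * (L + 1)) *\<^sub>R e2 + z" by (simp add: z_def)
    have ez: "\<bar>e1 \<bullet> z\<bar> \<le> \<epsilon>" "\<bar>e2 \<bullet> z\<bar> \<le> \<epsilon>"
      using Cauchy_Schwarz_ineq2[of e1 z] Cauchy_Schwarz_ineq2[of e2 z] e z by auto
    have "dist x y = norm ((\<epsilon> * (L + 1)) *\<^sub>R e2 + z)" by (subst dist_commute) (simp add: y_eq dist_norm)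
    also have "\<dots> \<le> \<epsilon> * (L + 1) + \<epsilon>"
      using norm_triangle_ineq[of "(\<epsilon> * (L + 1)) *\<^sub>R e2" z] z e \<epsilon>(1) L0 by simp
    also have "\<dots> < r / 2" using \<epsilon> L0 by (simp add: field_simps)
    finally have "dist x0 y < r" using x(2) dist_triangle[of x0 y x] by simp
    then have yb: "y \<in> ball x0 r" by simp
    have xb: "x \<in> ball x0 r" using x(2) r by simp
    have e2e2: "e2 \<bullet> e2 = 1" using e(2) by (simp add: dot_square_norm)
    have e1y: "e1 \<bullet> y = e1 \<bullet> x + e1 \<bullet> z" using e(3) by (simp add: y_eq inner_add_right)
    have e2y: "e2 \<bullet> y = e2 \<bullet> x + \<epsilon> * (L + 1) + e2 \<bullet> z" using e2e2 by (simp add: y_eq inner_add_right)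
    have "dist (\<psi> (e1 \<bullet> y)) (\<psi> (e1 \<bullet> x)) \<le> L * dist (e1 \<bullet> y) (e1 \<bullet> x)"
      by (rule lipschitz_onD[OF lip]) auto
    also have "\<dots> \<le> L * \<epsilon>" using ez(1) L0 by (intro mult_left_mono) (auto simp: e1y dist_real_def)
    finally have "\<psi> (e1 \<bullet> y) \<le> \<psi> (e1 \<bullet> x) + L * \<epsilon>" by (simp add: dist_real_def abs_le_iff)
    moreover have "\<psi> (e1 \<bullet> x) < e2 \<bullet> x" using graph x(1) xb by blast
    ultimately have "\<psi> (e1 \<bullet> y) < e2 \<bullet> y" using ez(2) by (simp add: e2y algebra_simps abs_le_iff)
    then show "y \<in> \<Omega>" using graph yb by blast
  qed
  then have "cone_at \<Omega> x0 (r / 2) ((L + 1) *\<^sub>R e2) (r / (2 * (L + 2)))"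
    unfolding cone_at_def using r L0 by auto
  then show ?thesis by blast
qed

lemma partial_sum:
  assumes "finite I" "\<And>j. j \<in> I \<Longrightarrow> smooth (f j)"
  shows "partial i (\<lambda>x. \<Sum>j\<in>I. f j x) = (\<lambda>x. \<Sum>j\<in>I. partial i (f j) x)"
  using assms
proof (induction I rule: finite_induct)
  case (insert j I)
  have "partial i (\<lambda>x. f j x + (\<Sum>j\<in>I. f j x)) = (\<lambda>x. partial i (f j) x + partial i (\<lambda>x. \<Sum>j\<in>I. f j x) x)"
    using insert by (intro partial_add smooth_differentiable smooth_sum) auto
  then show ?case using insert by simp
qed (simp add: partial_const)

lemma partial_locally_const:
  assumes "open U" "x \<in> U" "\<And>y. y \<in> U \<Longrightarrow> f y = c"
  shows "partial i f x = 0"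
proof -
  have "(f has_derivative (\<lambda>_. 0)) (at x)"
    by (rule has_derivative_transform_within_open[of "\<lambda>_. c" _ _ _ U]) (use assms in auto)
  from partial_eq[OF this] show ?thesis by simp
qed

lemma partition_of_unity:
  assumes "compact K" "finite D" "\<And>d. d \<in> D \<Longrightarrow> r d > 0" "K \<subseteq> (\<Union>d\<in>D. ball d (r d))"
  obtains \<zeta> :: "pt \<Rightarrow> pt \<Rightarrow> complex" where "\<And>d. smooth (\<zeta> d)" "\<And>d x. d \<in> D \<Longrightarrow> x \<notin> cball d (r d) \<Longrightarrow> \<zeta> d x = 0"
    "\<And>x. x \<in> K \<Longrightarrow> (\<Sum>d\<in>D. \<zeta> d x) = 1"
proof -
  define S where "S x = (\<Sum>d\<in>D. bump d (r d) x)" for x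
  have S0: "S x \<ge> 0" for x unfolding S_def by (intro sum_nonneg bump_nonneg)
  have sS: "smooth (\<lambda>x. complex_of_real (S x))" unfolding S_def of_real_sum by (intro smooth_sum smooth_bump)
  have cS: "continuous_on A S" for A using continuous_on_Re[OF smooth_continuous[OF sS]] by simp
  have Spos: "S x > 0" if x: "x \<in> K" for x
  proof -
    obtain d where "d \<in> D" "x \<in> ball d (r d)" using x assms(4) by blast
    then show ?thesis unfolding S_def
      using assms(2,3) bump_pos_iff[of "r d" d x] by (intro sum_pos2[of D d] bump_nonneg) auto
  qed
  obtain c where c: "c > 0" "\<And>x. x \<in> K \<Longrightarrow> c \<le> S x"
  proof (cases "K = {}")
    case False
    from continuous_attains_inf[OF assms(1) this cS] obtain x where "x \<in> K" "\<And>y. y \<in> K \<Longrightarrow> S x \<le> S y" by blast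
    then show ?thesis using Spos by (intro that[of "S x"]) auto
  qed (auto intro: that[of 1])
  \<comment> \<open>The sum \<open>S\<close> vanishes away from the bumps and cannot be divided by.
    Adding \<open>hfun 0 (c - S x)\<close> makes it positive everywhere and changes nothing on
    \<open>K\<close>, where \<open>S x \<ge> c\<close>.\<close>
  define P where "P x = S x + hfun 0 (c - S x)" for x
  have Ppos: "P x > 0" for x
  proof (cases "S x = 0")
    case True then show ?thesis using c(1) by (simp add: P_def hfun_pos_iff)
  next
    case False then show ?thesis using S0[of x] hfun_nonneg[of 0 "c - S x"] by (simp add: P_def)
  qed
  have sP: "smooth (\<lambda>x. complex_of_real (P x))"
    unfolding P_def of_real_add
    by (intro smooth_add sS smooth_hfun) (simp add: smooth_diff smooth_const sS)
  define \<zeta> where "\<zeta> d x = complex_of_real (bump d (r d) x) * inverse (complex_of_real (P x))" for d x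
  show ?thesis
  proof (rule that)
    show "smooth (\<zeta> d)" for d unfolding \<zeta>_def
      by (intro smooth_mult smooth_bump smooth_inverse sP) (use Ppos in \<open>simp add: less_imp_neq[symmetric]\<close>)
    show "\<zeta> d x = 0" if "d \<in> D" "x \<notin> cball d (r d)" for d x
      using bump_eq_0[OF assms(3)[OF that(1)], of x d] that(2) by (simp add: \<zeta>_def)
    show "(\<Sum>d\<in>D. \<zeta> d x) = 1" if "x \<in> K" for x
    proof -
      have "hfun 0 (c - S x) = 0" using c(2)[OF that] by (simp add: hfun_def)
      then have "P x = S x" by (simp add: P_def)
      moreover have "(\<Sum>d\<in>D. \<zeta> d x) = complex_of_real (S x) * inverse (complex_of_real (P x))"
        by (simp add: \<zeta>_def S_def sum_distrib_right)
      ultimately show ?thesis using Spos[OF that] by simp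
    qed
  qed
qed

text \<open>The last claim keeps the approximants of the zero function zero, whatever weak gradient it is
  paired with; uniqueness of weak gradients follows from it.\<close>

lemma smooth_dense:
  assumes L: "lipschitz_domain \<Omega>"
    and v: "L2 (lebesgue_on \<Omega>) v" and w: "L2 (lebesgue_on \<Omega>) w" "has_weak_grad \<Omega> v w" and \<eta>: "\<eta> > 0"
  obtains \<phi> where "smooth \<phi>" "L2norm (lebesgue_on \<Omega>) (\<lambda>x. \<phi> x - v x) < \<eta>"
    "L2norm (lebesgue_on \<Omega>) (\<lambda>x. grad \<phi> x - w x) < \<eta>"
    "(AE x in lebesgue_on \<Omega>. v x = 0) \<Longrightarrow> \<phi> = (\<lambda>x. 0)"
proof -
  have \<Omega>: "open \<Omega>" "bounded \<Omega>" using L by (auto simp: lipschitz_domain_def)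
  have \<Omega>l: "\<Omega> \<in> sets lebesgue" using \<Omega>(1) by (simp add: lmeasurable_open)
  have "\<forall>x\<in>closure \<Omega>. \<exists>q. cone_at \<Omega> x (fst q) (fst (snd q)) (snd (snd q))"
    using lipschitz_domain_cone[OF L] by (metis fst_conv snd_conv)
  from bchoice[OF this] obtain q where
    q: "\<And>x. x \<in> closure \<Omega> \<Longrightarrow> cone_at \<Omega> x (fst (q x)) (fst (snd (q x))) (snd (snd (q x)))" by blast
  define r e \<epsilon>0 where "r x = fst (q x)" and "e x = fst (snd (q x))" and "\<epsilon>0 x = snd (snd (q x))" for x
  have cone: "cone_at \<Omega> x (r x) (e x) (\<epsilon>0 x)" if "x \<in> closure \<Omega>" for x
    using q[OF that] by (simp add: r_def e_def \<epsilon>0_def)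
  have r: "r x > 0" if "x \<in> closure \<Omega>" for x using cone[OF that] by (simp add: cone_at_def)
  have cp: "compact (closure \<Omega>)" using \<Omega> by (simp add: compact_closure)
  have "closure \<Omega> \<subseteq> (\<Union>x\<in>closure \<Omega>. ball x (r x / 2))" using r by fastforce
  then obtain D where D: "D \<subseteq> closure \<Omega>" "finite D" "closure \<Omega> \<subseteq> (\<Union>x\<in>D. ball x (r x / 2))"
    using compactE_image[OF cp, of "closure \<Omega>" "\<lambda>x. ball x (r x / 2)"] by auto
  obtain \<zeta> where \<zeta>: "\<And>d. smooth (\<zeta> d)" "\<And>d x. d \<in> D \<Longrightarrow> x \<notin> cball d (r d / 2) \<Longrightarrow> \<zeta> d x = 0"
    "\<And>x. x \<in> closure \<Omega> \<Longrightarrow> (\<Sum>d\<in>D. \<zeta> d x) = 1"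
    using partition_of_unity[OF cp D(2), of "\<lambda>d. r d / 2"] D r by (auto simp: subset_iff)
  \<comment> \<open>The added 1 keeps the sum of the errors strictly below \<open>\<eta>\<close> and
    covers an empty \<open>D\<close>.\<close>
  define \<eta>' where "\<eta>' = \<eta> / (real (card D) + 1)"
  have \<eta>': "\<eta>' > 0" using \<eta> by (simp add: \<eta>'_def)
  let ?w = "\<lambda>d x. \<zeta> d x *s w x + v x *s grad (\<zeta> d) x"
  have "\<forall>d. \<exists>\<phi>. d \<in> D \<longrightarrow> smooth \<phi> \<and> L2norm (lebesgue_on \<Omega>) (\<lambda>x. \<phi> x - \<zeta> d x * v x) < \<eta>' \<and>
    L2norm (lebesgue_on \<Omega>) (\<lambda>x. grad \<phi> x - ?w d x) < \<eta>' \<and>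
    ((AE x in lebesgue_on \<Omega>. v x = 0) \<longrightarrow> \<phi> = (\<lambda>x. 0))" (is "\<forall>d. ?P d")
  proof (rule allI)
    fix d show "?P d"
  proof (cases "d \<in> D")
    case True
    then have d: "d \<in> closure \<Omega>" using D by blast
    have "r d / 2 < r d" using r[OF d] by simp
    from local_density[OF \<Omega> cone[OF d] this \<zeta>(1) \<zeta>(2)[OF True] v w \<eta>'] obtain \<phi> where
      "smooth \<phi>" "L2norm (lebesgue_on \<Omega>) (\<lambda>x. \<phi> x - \<zeta> d x * v x) < \<eta>'"
      "L2norm (lebesgue_on \<Omega>) (\<lambda>x. grad \<phi> x - ?w d x) < \<eta>'"
      "(AE x in lebesgue_on \<Omega>. v x = 0) \<Longrightarrow> \<phi> = (\<lambda>x. 0)" by blast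
    then show ?thesis by blast
  qed simp
  qed
  from choice[OF this] obtain \<Phi> where \<Phi>:
    "\<And>d. d \<in> D \<Longrightarrow> smooth (\<Phi> d)" "\<And>d. d \<in> D \<Longrightarrow> L2norm (lebesgue_on \<Omega>) (\<lambda>x. \<Phi> d x - \<zeta> d x * v x) < \<eta>'"
    "\<And>d. d \<in> D \<Longrightarrow> L2norm (lebesgue_on \<Omega>) (\<lambda>x. grad (\<Phi> d) x - ?w d x) < \<eta>'"
    "\<And>d. d \<in> D \<Longrightarrow> (AE x in lebesgue_on \<Omega>. v x = 0) \<Longrightarrow> \<Phi> d = (\<lambda>x. 0)" by blast
  define \<phi> where "\<phi> x = (\<Sum>d\<in>D. \<Phi> d x)" for x
  have s\<phi>: "smooth \<phi>" unfolding \<phi>_def by (intro smooth_sum \<Phi>(1))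
  have sum_le: "(\<Sum>d\<in>D. a d) < \<eta>" if "\<And>d. d \<in> D \<Longrightarrow> a d < \<eta>'" for a :: "pt \<Rightarrow> real"
  proof -
    have "(\<Sum>d\<in>D. a d) \<le> (\<Sum>d\<in>D. \<eta>')" by (intro sum_mono less_imp_le that)
    also have "\<dots> < \<eta>" using \<eta> by (simp add: \<eta>'_def field_simps)
    finally show ?thesis .
  qed
  show ?thesis
  proof (rule that[OF s\<phi>])
    have "L2norm (lebesgue_on \<Omega>) (\<lambda>x. \<phi> x - v x) = L2norm (lebesgue_on \<Omega>) (\<lambda>x. \<Sum>d\<in>D. \<Phi> d x - \<zeta> d x * v x)"
    proof (rule L2norm_cong)
      fix x assume "x \<in> space (lebesgue_on \<Omega>)"
      then have "(\<Sum>d\<in>D. \<zeta> d x) = 1" using \<zeta>(3) closure_subset by auto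
      then show "\<phi> x - v x = (\<Sum>d\<in>D. \<Phi> d x - \<zeta> d x * v x)"
        by (simp add: \<phi>_def sum_subtractf flip: sum_distrib_right)
    qed
    also have "\<dots> \<le> (\<Sum>d\<in>D. L2norm (lebesgue_on \<Omega>) (\<lambda>x. \<Phi> d x - \<zeta> d x * v x))"
      by (intro L2norm_sum_le D L2_diff L2_bounded_mult smooth_continuous \<zeta>(1) \<Omega>l \<Omega> v L2_continuous_lebesgue_on \<Phi>)
    also have "\<dots> < \<eta>" by (rule sum_le[OF \<Phi>(2)])
    finally show "L2norm (lebesgue_on \<Omega>) (\<lambda>x. \<phi> x - v x) < \<eta>" .
    have "L2norm (lebesgue_on \<Omega>) (\<lambda>x. grad \<phi> x - w x) = L2norm (lebesgue_on \<Omega>) (\<lambda>x. \<Sum>d\<in>D. grad (\<Phi> d) x - ?w d x)"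
    proof (rule L2norm_cong)
      fix x assume "x \<in> space (lebesgue_on \<Omega>)"
      then have x: "x \<in> \<Omega>" by simp
      have 1: "(\<Sum>d\<in>D. \<zeta> d x) = 1" using \<zeta>(3) x closure_subset by auto
      \<comment> \<open>The weights sum to the constant 1 on the open set \<open>\<Omega>\<close>,
        so the terms \<open>v x *s grad (\<zeta> d) x\<close> cancel in the sum over
        \<open>d\<close>.\<close>
      have 2: "(\<Sum>d\<in>D. partial i (\<zeta> d) x) = 0" for i
      proof -
        have "partial i (\<lambda>x. \<Sum>d\<in>D. \<zeta> d x) x = 0"
          by (rule partial_locally_const[OF \<Omega>(1) x, where c=1]) (use \<zeta>(3) closure_subset in blast)
        then show ?thesis by (simp add: partial_sum[OF D(2) \<zeta>(1)])
      qed
      have 3: "partial i \<phi> x = (\<Sum>d\<in>D. partial i (\<Phi> d) x)" for i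
        unfolding \<phi>_def by (simp add: partial_sum[OF D(2) \<Phi>(1)])
      show "grad \<phi> x - w x = (\<Sum>d\<in>D. grad (\<Phi> d) x - ?w d x)"
        by (simp add: vec_eq_iff grad_def 3 sum_subtractf sum.distrib 1 2 flip: sum_distrib_right sum_distrib_left)
    qed
    also have "\<dots> \<le> (\<Sum>d\<in>D. L2norm (lebesgue_on \<Omega>) (\<lambda>x. grad (\<Phi> d) x - ?w d x))"
    proof (rule L2norm_sum_le[OF D(2)])
      fix d assume "d \<in> D"
      have "L2 (lebesgue_on \<Omega>) (?w d)"
        using L2_add[OF L2_bounded_mult[OF smooth_continuous[OF \<zeta>(1)] \<Omega>l \<Omega>(2) L2_vec_nth[OF w(1)]]
          L2_bounded_mult[OF smooth_continuous[OF smooth_partial[OF \<zeta>(1)]] \<Omega>l \<Omega>(2) v]]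
        by (intro L2_vecI(1)) (simp add: grad_def mult.commute)
      then show "L2 (lebesgue_on \<Omega>) (\<lambda>x. grad (\<Phi> d) x - ?w d x)"
        by (rule L2_diff[OF L2_continuous_lebesgue_on[OF continuous_on_grad[OF \<Phi>(1)[OF \<open>d \<in> D\<close>]] \<Omega>l \<Omega>(2)]])
    qed
    also have "\<dots> < \<eta>" by (rule sum_le[OF \<Phi>(3)])
    finally show "L2norm (lebesgue_on \<Omega>) (\<lambda>x. grad \<phi> x - w x) < \<eta>" .
  next
    assume "AE x in lebesgue_on \<Omega>. v x = 0"
    then have "\<phi> x = 0" for x unfolding \<phi>_def by (intro sum.neutral ballI) (simp add: \<Phi>(4))
    then show "\<phi> = (\<lambda>x. 0)" by auto
  qed
qed

section \<open>Uniqueness of weak gradients and agreement with classical gradients\<close>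

lemma has_weak_grad_diff:
  assumes \<Omega>: "\<Omega> \<in> sets lebesgue" "bounded \<Omega>"
    and v: "L2 (lebesgue_on \<Omega>) v" "L2 (lebesgue_on \<Omega>) v'"
    and w: "L2 (lebesgue_on \<Omega>) w" "L2 (lebesgue_on \<Omega>) w'" "has_weak_grad \<Omega> v w" "has_weak_grad \<Omega> v' w'"
  shows "has_weak_grad \<Omega> (\<lambda>x. v x - v' x) (\<lambda>x. w x - w' x)"
  unfolding has_weak_grad_def
proof (intro allI impI)
  fix \<phi> and i :: 2 assume t: "test_fun \<Omega> \<phi>"
  then have s\<phi>: "smooth \<phi>" by (simp add: test_fun_def)
  have int: "integrable (lebesgue_on \<Omega>) (\<lambda>x. a x * b x)"
    if "L2 (lebesgue_on \<Omega>) a" "smooth b" for a b :: "pt \<Rightarrow> complex"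
    using integrable_mult_cnj[OF that(1), of "\<lambda>x. cnj (b x)"]
      L2_continuous_lebesgue_on[OF _ \<Omega>, of "\<lambda>x. cnj (b x)"] smooth_continuous[OF that(2)]
    by (simp add: continuous_on_cnj)
  have "(\<integral>x. (v x - v' x) * partial i \<phi> x \<partial>lebesgue_on \<Omega>)
      = (\<integral>x. v x * partial i \<phi> x \<partial>lebesgue_on \<Omega>) - (\<integral>x. v' x * partial i \<phi> x \<partial>lebesgue_on \<Omega>)"
    unfolding left_diff_distrib by (intro Bochner_Integration.integral_diff int v smooth_partial s\<phi>)
  moreover have "(\<integral>x. (w x - w' x) $ i * \<phi> x \<partial>lebesgue_on \<Omega>)
      = (\<integral>x. w x $ i * \<phi> x \<partial>lebesgue_on \<Omega>) - (\<integral>x. w' x $ i * \<phi> x \<partial>lebesgue_on \<Omega>)"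
    unfolding left_diff_distrib vector_minus_component
    by (intro Bochner_Integration.integral_diff int L2_vec_nth w s\<phi>)
  ultimately show "(\<integral>x. (v x - v' x) * partial i \<phi> x \<partial>lebesgue_on \<Omega>) = - (\<integral>x. (w x - w' x) $ i * \<phi> x \<partial>lebesgue_on \<Omega>)"
    using w(3,4) t unfolding has_weak_grad_def by simp
qed

text \<open>Density takes the place of the fundamental lemma of the calculus of variations: the
  difference is a weak gradient of 0, whose smooth approximants are identically 0, so its norm lies
  below every \<open>\<eta>\<close>.\<close>

lemma weak_grad_unique:
  assumes L: "lipschitz_domain \<Omega>" and v: "L2 (lebesgue_on \<Omega>) v"
    and w: "L2 (lebesgue_on \<Omega>) w" "L2 (lebesgue_on \<Omega>) w'" "has_weak_grad \<Omega> v w" "has_weak_grad \<Omega> v w'"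
  shows "AE x in lebesgue_on \<Omega>. w x = w' x"
proof -
  have \<Omega>: "open \<Omega>" "bounded \<Omega>" using L by (auto simp: lipschitz_domain_def)
  have \<Omega>l: "\<Omega> \<in> sets lebesgue" using \<Omega>(1) by (simp add: lmeasurable_open)
  have h: "has_weak_grad \<Omega> (\<lambda>x. 0) (\<lambda>x. w x - w' x)"
    using has_weak_grad_diff[OF \<Omega>l \<Omega>(2) v v w] by simp
  have Ld: "L2 (lebesgue_on \<Omega>) (\<lambda>x. w x - w' x)" by (rule L2_diff[OF w(1,2)])
  have "L2norm (lebesgue_on \<Omega>) (\<lambda>x. w x - w' x) < \<eta>" if \<eta>: "\<eta> > 0" for \<eta>
  proof -
    obtain \<phi> where "smooth \<phi>" "L2norm (lebesgue_on \<Omega>) (\<lambda>x. grad \<phi> x - (w x - w' x)) < \<eta>" "\<phi> = (\<lambda>x. 0)"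
      by (rule smooth_dense[OF L L2_zero Ld h \<eta>]) auto
    then show ?thesis using L2norm_minus[of "lebesgue_on \<Omega>" "\<lambda>x. w x - w' x"] by (simp add: grad_const)
  qed
  from this[of "L2norm (lebesgue_on \<Omega>) (\<lambda>x. w x - w' x)"]
  have "L2norm (lebesgue_on \<Omega>) (\<lambda>x. w x - w' x) = 0"
    using L2norm_nonneg[of "lebesgue_on \<Omega>" "\<lambda>x. w x - w' x"] by linarith
  from L2_zero_AE[OF Ld this] show ?thesis by eventually_elim simp
qed

lemma integral_lborel_reflect:
  fixes f :: "'a::euclidean_space \<Rightarrow> 'b::{banach, second_countable_topology}"
  assumes "f \<in> borel_measurable borel"
  shows "(\<integral>y. f (x - y) \<partial>lborel) = (\<integral>y. f y \<partial>lborel)"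
proof -
  have "distr lborel borel (\<lambda>y. x - y) = (lborel :: 'a measure)"
    using lborel_affine[of "-1" x] by (simp add: density_1)
  then have "(\<integral>y. f y \<partial>lborel) = (\<integral>y. f y \<partial>distr lborel borel (\<lambda>y. x - y))" by simp
  also have "\<dots> = (\<integral>y. f (x - y) \<partial>lborel)" by (rule integral_distr) (use assms in auto)
  finally show ?thesis by simp
qed

text \<open>Convolution with the indicator of a large ball is locally constant, so its derivative,
  the integral of \<open>\<partial>\<^sub>i f\<close>, vanishes.\<close>

lemma integral_partial_eq_0:
  assumes s: "smooth f" and R: "\<And>x. x \<notin> cball 0 R \<Longrightarrow> f x = 0"
  shows "(\<integral>x. partial i f x \<partial>lborel) = 0"
proof -
  define F :: "pt \<Rightarrow> complex" where "F y = indicat_real (cball 0 (R + 1)) y *\<^sub>R 1" for y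
  have F: "integrable lborel F" unfolding F_def
    using emeasure_lborel_cball_finite[of "0::pt" "R + 1"]
    by (intro integrable_scaleR_left integrable_real_indicator) auto
  have c: "conv g F x = (\<integral>y. g y \<partial>lborel)"
    if g: "\<And>z. z \<notin> cball 0 R \<Longrightarrow> g z = 0" "g \<in> borel_measurable borel" and x: "x \<in> ball 0 1" for g x
  proof -
    have eq: "F y * g (x - y) = g (x - y)" for y
    proof (cases "y \<in> cball 0 (R + 1)")
      case False
      then have "x - y \<notin> cball 0 R" using x norm_triangle_ineq2[of y x] by (auto simp: norm_minus_commute)
      then show ?thesis using g(1) by simp
    qed (simp add: F_def)
    show ?thesis unfolding conv_def eq by (rule integral_lborel_reflect[OF g(2)])
  qed
  have "partial i (conv f F) 0 = 0"
    by (rule partial_locally_const[of "ball 0 1"]) (auto intro!: c R smooth_borel_measurable s)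
  moreover have "partial i (conv f F) 0 = conv (partial i f) F 0"
    using partial_conv[OF F s R] by simp
  moreover have "\<dots> = (\<integral>x. partial i f x \<partial>lborel)"
    by (rule c) (auto intro!: support_partial R smooth_borel_measurable smooth_partial s)
  ultimately show ?thesis by simp
qed

text \<open>The product \<open>f \<phi>\<close> has compact support in \<open>\<Omega>\<close>, so
  its partial derivative has integral zero; the product rule does the rest.\<close>

lemma has_weak_grad_smooth:
  assumes \<Omega>: "open \<Omega>" "bounded \<Omega>" and s: "smooth f"
  shows "has_weak_grad \<Omega> f (grad f)"
  unfolding has_weak_grad_def
proof (intro allI impI)
  fix \<phi> and i :: 2 assume t: "test_fun \<Omega> \<phi>"
  have \<Omega>l: "\<Omega> \<in> sets lebesgue" using \<Omega>(1) by (simp add: lmeasurable_open)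
  have s\<phi>: "smooth \<phi>" using t by (simp add: test_fun_def)
  let ?g = "\<lambda>x. f x * \<phi> x"
  have sg: "smooth ?g" by (intro smooth_mult s s\<phi>)
  define K where "K = closure {x. \<phi> x \<noteq> 0}"
  have K: "compact K" "K \<subseteq> \<Omega>" "\<And>x. x \<notin> K \<Longrightarrow> \<phi> x = 0"
    using t closure_subset[of "{x. \<phi> x \<noteq> 0}"] unfolding test_fun_def K_def by auto
  obtain R where R: "K \<subseteq> cball 0 R"
    using compact_imp_bounded[OF K(1)] by (auto simp: bounded_iff subset_iff)
  have p: "partial i ?g = (\<lambda>x. partial i f x * \<phi> x + f x * partial i \<phi> x)"
    by (intro partial_mult smooth_differentiable s s\<phi>)
  have z: "partial i ?g x = 0" if "x \<notin> \<Omega>" for x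
    by (rule partial_locally_const[of "- K"]) (use K that in \<open>auto simp: open_Compl compact_imp_closed\<close>)
  have int: "integrable (lebesgue_on \<Omega>) g" if "smooth g" for g
  proof -
    have "\<Omega> \<in> lmeasurable" using \<Omega> by (simp add: lmeasurable_open)
    then interpret finite_measure "lebesgue_on \<Omega>" by (rule finite_measure_lebesgue_on)
    show ?thesis by (intro L2_imp_integrable L2_continuous_lebesgue_on smooth_continuous that \<Omega>l \<Omega>)
  qed
  have "(\<integral>x. partial i ?g x \<partial>lebesgue_on \<Omega>) = (\<integral>x. indicator \<Omega> x *\<^sub>R partial i ?g x \<partial>lebesgue)"
    using \<Omega>l by (simp add: integral_restrict_space)
  also have "\<dots> = (\<integral>x. partial i ?g x \<partial>lebesgue)"
    by (intro Bochner_Integration.integral_cong refl) (use z in \<open>auto simp: indicator_def\<close>)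
  also have "\<dots> = (\<integral>x. partial i ?g x \<partial>lborel)"
    by (rule integral_completion) (simp add: smooth_borel_measurable smooth_partial sg)
  also have "\<dots> = 0"
  proof (rule integral_partial_eq_0[OF sg])
    fix x :: pt assume "x \<notin> cball 0 R"
    then have "x \<notin> K" using R by blast
    then show "f x * \<phi> x = 0" using K(3) by simp
  qed
  finally have "0 = (\<integral>x. partial i f x * \<phi> x + f x * partial i \<phi> x \<partial>lebesgue_on \<Omega>)" by (simp add: p)
  also have "\<dots> = (\<integral>x. partial i f x * \<phi> x \<partial>lebesgue_on \<Omega>) + (\<integral>x. f x * partial i \<phi> x \<partial>lebesgue_on \<Omega>)"
    by (intro Bochner_Integration.integral_add int smooth_mult smooth_partial s s\<phi>)
  finally show "(\<integral>x. f x * partial i \<phi> x \<partial>lebesgue_on \<Omega>) = - (\<integral>x. grad f x $ i * \<phi> x \<partial>lebesgue_on \<Omega>)"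
    by (simp add: grad_def add_eq_0_iff)
qed

lemma wgrad_props:
  assumes "v \<in> H1 \<Omega>"
  shows "L2 (lebesgue_on \<Omega>) v" "L2 (lebesgue_on \<Omega>) (wgrad \<Omega> v)" "has_weak_grad \<Omega> v (wgrad \<Omega> v)"
proof -
  show "L2 (lebesgue_on \<Omega>) v" using assms by (simp add: H1_def)
  have "\<exists>w. L2 (lebesgue_on \<Omega>) w \<and> has_weak_grad \<Omega> v w" using assms by (simp add: H1_def)
  from someI_ex[OF this]
  show "L2 (lebesgue_on \<Omega>) (wgrad \<Omega> v)" "has_weak_grad \<Omega> v (wgrad \<Omega> v)" by (simp_all add: wgrad_def)
qed

text \<open>The chosen \<open>wgrad\<close> of a smooth function is tied to the classical gradient
  through uniqueness, hence only almost everywhere.\<close>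

lemma smooth_H1:
  assumes L: "lipschitz_domain \<Omega>" and s: "smooth f"
  shows "f \<in> H1 \<Omega>" "AE x in lebesgue_on \<Omega>. wgrad \<Omega> f x = grad f x"
proof -
  have \<Omega>: "open \<Omega>" "bounded \<Omega>" using L by (auto simp: lipschitz_domain_def)
  have \<Omega>l: "\<Omega> \<in> sets lebesgue" using \<Omega>(1) by (simp add: lmeasurable_open)
  have f: "L2 (lebesgue_on \<Omega>) f" "L2 (lebesgue_on \<Omega>) (grad f)"
    by (intro L2_continuous_lebesgue_on smooth_continuous continuous_on_grad s \<Omega>l \<Omega>)+
  have g: "has_weak_grad \<Omega> f (grad f)" by (rule has_weak_grad_smooth[OF \<Omega> s])
  show H: "f \<in> H1 \<Omega>" using f g by (auto simp: H1_def)
  show "AE x in lebesgue_on \<Omega>. wgrad \<Omega> f x = grad f x"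
    by (rule weak_grad_unique[OF L f(1) wgrad_props(2)[OF H] f(2) wgrad_props(3)[OF H] g])
qed

section \<open>Poincare inequality on convex sets\<close>

text \<open>Fundamental theorem of calculus along the segment, then Cauchy-Schwarz on the unit
  interval.\<close>

lemma smooth_segment_bound:
  assumes s: "smooth \<phi>"
  shows "ennreal ((norm (\<phi> y - \<phi> x))\<^sup>2)
    \<le> (\<integral>\<^sup>+t. indicator {0..1} t * ennreal ((norm (grad \<phi> (x + t *\<^sub>R (y - x))))\<^sup>2 * (norm (y - x))\<^sup>2) \<partial>lborel)"
proof -
  let ?f = "\<lambda>t. \<Sum>i\<in>UNIV. (y - x) $ i *\<^sub>R partial i \<phi> (x + t *\<^sub>R (y - x))"
  have cf: "continuous_on A ?f" for A
    by (intro continuous_intros continuous_on_compose2[OF smooth_continuous[OF smooth_partial[OF s], of UNIV]]) auto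
  have "((\<lambda>t. \<phi> (x + t *\<^sub>R (y - x))) has_vector_derivative ?f t) (at t within {0..1})" for t
  proof -
    have 1: "((\<lambda>t. x + t *\<^sub>R (y - x)) has_derivative (\<lambda>h. h *\<^sub>R (y - x))) (at t)"
      by (auto intro!: derivative_eq_intros)
    have "((\<lambda>t. \<phi> (x + t *\<^sub>R (y - x))) has_derivative
        (\<lambda>h. \<Sum>i\<in>UNIV. (h *\<^sub>R (y - x)) $ i *\<^sub>R partial i \<phi> (x + t *\<^sub>R (y - x)))) (at t)"
      by (rule has_derivative_compose[OF 1 has_derivative_partial[OF smooth_differentiable[OF s]]])
    then show ?thesis
      unfolding has_vector_derivative_def
      by (rule has_derivative_at_withinI[THEN has_derivative_eq_rhs]) (simp add: fun_eq_iff scaleR_sum_right)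
  qed
  then have I: "(\<integral>t. indicator {0..1} t *\<^sub>R ?f t \<partial>lborel) = \<phi> (x + 1 *\<^sub>R (y - x)) - \<phi> (x + 0 *\<^sub>R (y - x))"
    by (intro integral_FTC_Icc cf) auto
  have int: "integrable lborel (\<lambda>t. indicator {0..1} t *\<^sub>R ?f t)"
    by (intro borel_integrable_compact cf) auto
  have [measurable]: "?f \<in> borel_measurable borel" by (rule borel_measurable_continuous_onI[OF cf])
  have [measurable]: "(\<lambda>t. grad \<phi> (x + t *\<^sub>R (y - x))) \<in> borel_measurable borel"
    by (intro borel_measurable_continuous_onI continuous_on_compose2[OF continuous_on_grad[OF s, of UNIV]] continuous_intros) auto
  have "ennreal (norm (\<phi> y - \<phi> x)) \<le> (\<integral>\<^sup>+t. ennreal (norm (indicator {0..1} t *\<^sub>R ?f t)) \<partial>lborel)"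
    using integral_norm_bound_ennreal[OF int] I by simp
  \<comment> \<open>The indicator is written twice so that Cauchy-Schwarz can pair it with the
    integrand restricted to the unit interval.\<close>
  also have "\<dots> \<le> (\<integral>\<^sup>+t. indicator {0..1} t * (indicator {0..1} t * ennreal (norm (grad \<phi> (x + t *\<^sub>R (y - x))) * norm (y - x))) \<partial>lborel)"
    using norm_directional_le_grad[where h="y - x" and f=\<phi>]
    by (intro nn_integral_mono) (auto simp: indicator_def intro!: ennreal_leI)
  finally have "(ennreal (norm (\<phi> y - \<phi> x)))\<^sup>2 \<le> (\<integral>\<^sup>+t. indicator {0..1} t * (indicator {0..1} t * ennreal (norm (grad \<phi> (x + t *\<^sub>R (y - x))) * norm (y - x))) \<partial>lborel)\<^sup>2"
    by (rule power_mono) simp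
  also have "\<dots> \<le> (\<integral>\<^sup>+t. (indicator {0..1::real} t)\<^sup>2 \<partial>lborel) *
     (\<integral>\<^sup>+t. (indicator {0..1::real} t * ennreal (norm (grad \<phi> (x + t *\<^sub>R (y - x))) * norm (y - x)))\<^sup>2 \<partial>lborel)"
    by (intro Cauchy_Schwarz_nn_integral) measurable
  also have "(\<integral>\<^sup>+t. (indicator {0..1::real} t :: ennreal)\<^sup>2 \<partial>lborel) = 1"
  proof -
    have "(\<lambda>t. (indicator {0..1::real} t :: ennreal)\<^sup>2) = indicator {0..1}" by (auto simp: indicator_def)
    then show ?thesis by simp
  qed
  also have "(\<integral>\<^sup>+t. (indicator {0..1::real} t * ennreal (norm (grad \<phi> (x + t *\<^sub>R (y - x))) * norm (y - x)))\<^sup>2 \<partial>lborel)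
     = (\<integral>\<^sup>+t. indicator {0..1} t * ennreal ((norm (grad \<phi> (x + t *\<^sub>R (y - x))))\<^sup>2 * (norm (y - x))\<^sup>2) \<partial>lborel)"
    by (intro nn_integral_cong) (auto simp: indicator_def ennreal_power power_mult_distrib)
  finally show ?thesis by (simp add: ennreal_power)
qed

lemma nn_integral_affine_le:
  fixes g :: "pt \<Rightarrow> ennreal"
  assumes [measurable]: "g \<in> borel_measurable borel" and t: "1 / 2 \<le> t"
  shows "(\<integral>\<^sup>+y. g (a + t *\<^sub>R y) \<partial>lborel) \<le> 4 * (\<integral>\<^sup>+y. g y \<partial>lborel)"
proof -
  have "(\<integral>\<^sup>+y. g y \<partial>lborel) = ennreal (t\<^sup>2) * (\<integral>\<^sup>+y. g (a + t *\<^sub>R y) \<partial>lborel)"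
    using nn_integral_lborel_affine[where f=g and c=t and t=a] t by simp
  moreover have "1 \<le> 4 * t\<^sup>2"
    using power_mono[OF t, of 2] by (simp add: power2_eq_square)
  then have "1 \<le> ennreal (4 * t\<^sup>2)" by simp
  then have "1 * (\<integral>\<^sup>+y. g (a + t *\<^sub>R y) \<partial>lborel) \<le> ennreal (4 * t\<^sup>2) * (\<integral>\<^sup>+y. g (a + t *\<^sub>R y) \<partial>lborel)"
    by (rule mult_right_mono) simp
  moreover have "ennreal (4 * t\<^sup>2) = 4 * ennreal (t\<^sup>2)" by (simp add: ennreal_mult)
  ultimately show ?thesis by (simp add: mult.assoc)
qed

text \<open>A substitution in \<open>y\<close> costs \<open>1 / t\<^sup>2\<close> and one in
  \<open>x\<close> costs \<open>1 / (1 - t)\<^sup>2\<close>; one of \<open>t\<close> and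
  \<open>1 - t\<close> is at least one half, so the cheaper choice costs at most 4. Convexity keeps
  the intermediate point in \<open>T\<close>.\<close>

lemma convex_double_integral:
  fixes g :: "pt \<Rightarrow> ennreal"
  assumes [measurable]: "T \<in> sets borel" "g \<in> borel_measurable borel" and T: "convex T" and t: "0 \<le> t" "t \<le> 1"
  shows "(\<integral>\<^sup>+x. \<integral>\<^sup>+y. indicator T x * (indicator T y * g (x + t *\<^sub>R (y - x))) \<partial>lborel \<partial>lborel)
     \<le> 4 * emeasure lborel T * (\<integral>\<^sup>+x. indicator T x * g x \<partial>lborel)"
proof -
  have in_T: "x + t *\<^sub>R (y - x) \<in> T" if "x \<in> T" "y \<in> T" for x y
  proof -
    have "(1 - t) *\<^sub>R x + t *\<^sub>R y \<in> T" using T that t by (intro convexD) auto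
    then show ?thesis by (simp add: algebra_simps)
  qed
  let ?G = "\<lambda>z. indicator T z * g z"
  have le: "indicator T x * (indicator T y * g (x + t *\<^sub>R (y - x))) \<le> indicator T y * ?G (x + t *\<^sub>R (y - x))"
    "indicator T x * (indicator T y * g (x + t *\<^sub>R (y - x))) \<le> indicator T x * ?G (x + t *\<^sub>R (y - x))" for x y
    using in_T[of x y] by (auto simp: indicator_def)
  show ?thesis
  proof (cases "1 / 2 \<le> t")
    case True
    have "(\<integral>\<^sup>+x. \<integral>\<^sup>+y. indicator T x * (indicator T y * g (x + t *\<^sub>R (y - x))) \<partial>lborel \<partial>lborel)
      \<le> (\<integral>\<^sup>+x. \<integral>\<^sup>+y. indicator T x * ?G (x + t *\<^sub>R (y - x)) \<partial>lborel \<partial>lborel)"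
      by (intro nn_integral_mono le)
    also have "\<dots> \<le> (\<integral>\<^sup>+x. indicator T x * (4 * (\<integral>\<^sup>+y. ?G y \<partial>lborel)) \<partial>lborel)"
    proof (rule nn_integral_mono)
      fix x :: pt
      have "(\<integral>\<^sup>+y. indicator T x * ?G (x + t *\<^sub>R (y - x)) \<partial>lborel) = indicator T x * (\<integral>\<^sup>+y. ?G ((x - t *\<^sub>R x) + t *\<^sub>R y) \<partial>lborel)"
        by (subst nn_integral_cmult[symmetric]) (auto simp: algebra_simps)
      also have "\<dots> \<le> indicator T x * (4 * (\<integral>\<^sup>+y. ?G y \<partial>lborel))"
        by (intro mult_left_mono nn_integral_affine_le True) auto
      finally show "(\<integral>\<^sup>+y. indicator T x * ?G (x + t *\<^sub>R (y - x)) \<partial>lborel) \<le> indicator T x * (4 * (\<integral>\<^sup>+y. ?G y \<partial>lborel))" .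
    qed
    also have "\<dots> = 4 * emeasure lborel T * (\<integral>\<^sup>+x. ?G x \<partial>lborel)"
      by (subst nn_integral_multc) (auto simp: mult_ac)
    finally show ?thesis .
  next
    case False
    then have t': "1 / 2 \<le> 1 - t" by simp
    have "(\<integral>\<^sup>+x. \<integral>\<^sup>+y. indicator T x * (indicator T y * g (x + t *\<^sub>R (y - x))) \<partial>lborel \<partial>lborel)
      \<le> (\<integral>\<^sup>+x. \<integral>\<^sup>+y. indicator T y * ?G (x + t *\<^sub>R (y - x)) \<partial>lborel \<partial>lborel)"
      by (intro nn_integral_mono le)
    also have "\<dots> = (\<integral>\<^sup>+y. \<integral>\<^sup>+x. indicator T y * ?G (x + t *\<^sub>R (y - x)) \<partial>lborel \<partial>lborel)"
      by (rule lborel_pair.Fubini'[symmetric]) measurable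
    also have "\<dots> \<le> (\<integral>\<^sup>+y. indicator T y * (4 * (\<integral>\<^sup>+x. ?G x \<partial>lborel)) \<partial>lborel)"
    proof (rule nn_integral_mono)
      fix y :: pt
      have "(\<integral>\<^sup>+x. indicator T y * ?G (x + t *\<^sub>R (y - x)) \<partial>lborel) = indicator T y * (\<integral>\<^sup>+x. ?G (t *\<^sub>R y + (1 - t) *\<^sub>R x) \<partial>lborel)"
        by (subst nn_integral_cmult[symmetric]) (auto simp: algebra_simps)
      also have "\<dots> \<le> indicator T y * (4 * (\<integral>\<^sup>+x. ?G x \<partial>lborel))"
        by (intro mult_left_mono nn_integral_affine_le t') auto
      finally show "(\<integral>\<^sup>+x. indicator T y * ?G (x + t *\<^sub>R (y - x)) \<partial>lborel) \<le> indicator T y * (4 * (\<integral>\<^sup>+x. ?G x \<partial>lborel))" .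
    qed
    also have "\<dots> = 4 * emeasure lborel T * (\<integral>\<^sup>+x. ?G x \<partial>lborel)"
      by (subst nn_integral_multc) (auto simp: mult_ac)
    finally show ?thesis .
  qed
qed

text \<open>The segment bound is integrated over all pairs of points; Tonelli's theorem moves the
  segment parameter outside, where \<open>convex_double_integral\<close> holds uniformly in
  it.\<close>

lemma poincare_double:
  assumes [measurable]: "T \<in> sets borel" and T: "convex T" and s: "smooth \<phi>"
    and d: "\<And>x y. x \<in> T \<Longrightarrow> y \<in> T \<Longrightarrow> dist x y \<le> d"
  shows "(\<integral>\<^sup>+x. \<integral>\<^sup>+y. indicator T x * (indicator T y * ennreal ((norm (\<phi> x - \<phi> y))\<^sup>2)) \<partial>lborel \<partial>lborel)
     \<le> ennreal (4 * d\<^sup>2) * emeasure lborel T * (\<integral>\<^sup>+x. indicator T x * ennreal ((norm (grad \<phi> x))\<^sup>2) \<partial>lborel)"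
proof -
  have [measurable]: "grad \<phi> \<in> borel_measurable borel" by (rule grad_borel_measurable[OF s])
  define g where "g z = ennreal (d\<^sup>2 * (norm (grad \<phi> z))\<^sup>2)" for z
  have [measurable]: "g \<in> borel_measurable borel" unfolding g_def by measurable
  have ae: "AE t in lborel. t \<in> {0..1::real} \<longrightarrow> P t" if "\<And>t. t \<in> {0..1} \<Longrightarrow> P t" for P
    using that by (intro AE_I2) auto
  have "(\<integral>\<^sup>+x. \<integral>\<^sup>+y. indicator T x * (indicator T y * ennreal ((norm (\<phi> x - \<phi> y))\<^sup>2)) \<partial>lborel \<partial>lborel)
    \<le> (\<integral>\<^sup>+x. \<integral>\<^sup>+y. \<integral>\<^sup>+t. indicator {0..1} t * (indicator T x * (indicator T y * g (x + t *\<^sub>R (y - x)))) \<partial>lborel \<partial>lborel \<partial>lborel)"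
  proof (intro nn_integral_mono)
    fix x y :: pt
    have "indicator T x * (indicator T y * ennreal ((norm (\<phi> x - \<phi> y))\<^sup>2))
      \<le> indicator T x * (indicator T y * (\<integral>\<^sup>+t. indicator {0..1} t * g (x + t *\<^sub>R (y - x)) \<partial>lborel))"
    proof (cases "x \<in> T \<and> y \<in> T")
      case True
      have "ennreal ((norm (\<phi> x - \<phi> y))\<^sup>2) \<le> (\<integral>\<^sup>+t. indicator {0..1} t * ennreal ((norm (grad \<phi> (x + t *\<^sub>R (y - x))))\<^sup>2 * (norm (y - x))\<^sup>2) \<partial>lborel)"
        using smooth_segment_bound[OF s, of y x] by (simp add: norm_minus_commute)
      also have "\<dots> \<le> (\<integral>\<^sup>+t. indicator {0..1} t * g (x + t *\<^sub>R (y - x)) \<partial>lborel)"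
      proof (intro nn_integral_mono mult_left_mono)
        fix t
        have "(norm (y - x))\<^sup>2 \<le> d\<^sup>2" using d[of x y] True by (intro power_mono) (auto simp: dist_norm norm_minus_commute)
        then show "ennreal ((norm (grad \<phi> (x + t *\<^sub>R (y - x))))\<^sup>2 * (norm (y - x))\<^sup>2) \<le> g (x + t *\<^sub>R (y - x))"
          unfolding g_def by (intro ennreal_leI) (simp add: mult.commute mult_right_mono)
      qed auto
      finally show ?thesis using True by simp
    qed (auto simp: indicator_def)
    also have "\<dots> = (\<integral>\<^sup>+t. indicator {0..1} t * (indicator T x * (indicator T y * g (x + t *\<^sub>R (y - x)))) \<partial>lborel)"
      by (simp add: nn_integral_cmult[symmetric] mult_ac)
    finally show "indicator T x * (indicator T y * ennreal ((norm (\<phi> x - \<phi> y))\<^sup>2)) \<le> \<dots>" .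
  qed
  also have "\<dots> = (\<integral>\<^sup>+x. \<integral>\<^sup>+t. \<integral>\<^sup>+y. indicator {0..1} t * (indicator T x * (indicator T y * g (x + t *\<^sub>R (y - x)))) \<partial>lborel \<partial>lborel \<partial>lborel)"
    by (intro nn_integral_cong lborel_pair.Fubini') measurable
  also have "\<dots> = (\<integral>\<^sup>+t. \<integral>\<^sup>+x. \<integral>\<^sup>+y. indicator {0..1} t * (indicator T x * (indicator T y * g (x + t *\<^sub>R (y - x)))) \<partial>lborel \<partial>lborel \<partial>lborel)"
    by (rule lborel_pair.Fubini') measurable
  also have "\<dots> \<le> (\<integral>\<^sup>+t. indicator {0..1::real} t * (4 * emeasure lborel T * (\<integral>\<^sup>+x. indicator T x * g x \<partial>lborel)) \<partial>lborel)"
  proof (rule nn_integral_mono)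
    fix t :: real
    show "(\<integral>\<^sup>+x. \<integral>\<^sup>+y. indicator {0..1} t * (indicator T x * (indicator T y * g (x + t *\<^sub>R (y - x)))) \<partial>lborel \<partial>lborel)
       \<le> indicator {0..1} t * (4 * emeasure lborel T * (\<integral>\<^sup>+x. indicator T x * g x \<partial>lborel))"
      using convex_double_integral[of T g t] T by (cases "t \<in> {0..1}") auto
  qed
  also have "\<dots> = 4 * emeasure lborel T * (\<integral>\<^sup>+x. indicator T x * g x \<partial>lborel)"
    by (subst nn_integral_multc) auto
  also have "(\<integral>\<^sup>+x. indicator T x * g x \<partial>lborel) = ennreal (d\<^sup>2) * (\<integral>\<^sup>+x. indicator T x * ennreal ((norm (grad \<phi> x))\<^sup>2) \<partial>lborel)"
    by (subst nn_integral_cmult[symmetric]) (auto simp: g_def ennreal_mult mult_ac)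
  finally show ?thesis by (simp add: ennreal_mult mult_ac)
qed

lemma nn_integral_L2norm_lebesgue_on:
  fixes f :: "pt \<Rightarrow> 'b::{banach, second_countable_topology}"
  assumes "T \<in> sets borel" "bounded T" "continuous_on UNIV f"
  shows "(\<integral>\<^sup>+x. indicator T x * ennreal ((norm (f x))\<^sup>2) \<partial>lborel) = ennreal ((L2norm (lebesgue_on T) f)\<^sup>2)"
proof -
  have Tl: "T \<in> sets lebesgue" using assms(1) by simp
  have "ennreal ((L2norm (lebesgue_on T) f)\<^sup>2) = (\<integral>\<^sup>+x. ennreal ((norm (f x))\<^sup>2) \<partial>lebesgue_on T)"
    by (rule nn_integral_L2norm[symmetric, OF L2_continuous_lebesgue_on[OF assms(3) Tl assms(2)]])
  also have "\<dots> = (\<integral>\<^sup>+x. ennreal ((norm (f x))\<^sup>2) * indicator T x \<partial>lebesgue)"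
    using Tl by (simp add: nn_integral_restrict_space)
  finally show ?thesis by (simp add: nn_integral_completion mult.commute)
qed

definition mean :: "pt set \<Rightarrow> (pt \<Rightarrow> complex) \<Rightarrow> complex" where
  "mean T f = (\<integral>x. f x \<partial>lebesgue_on T) / complex_of_real (measure lebesgue T)"

text \<open>The deviation from the mean is the average over \<open>y\<close> of
  \<open>\<phi> x - \<phi> y\<close>, so Cauchy-Schwarz bounds its norm by the double integral. The
  factor 2 is the root of the substitution factor 4; the constant sees \<open>T\<close> through
  \<open>d\<close> alone, not through its shape.\<close>

theorem poincare_convex:
  assumes T: "T \<in> sets borel" "bounded T" "convex T" "measure lebesgue T > 0"
    and s: "smooth \<phi>" and d: "\<And>x y. x \<in> T \<Longrightarrow> y \<in> T \<Longrightarrow> dist x y \<le> d" "0 \<le> d"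
  shows "L2norm (lebesgue_on T) (\<lambda>x. \<phi> x - mean T \<phi>) \<le> 2 * d * L2norm (lebesgue_on T) (grad \<phi>)"
proof -
  have [measurable]: "T \<in> sets borel" "\<phi> \<in> borel_measurable borel" using T smooth_borel_measurable[OF s] by auto
  have Tl: "T \<in> sets lebesgue" "T \<in> lmeasurable" using T by (auto simp: bounded_set_imp_lmeasurable)
  interpret finite_measure "lebesgue_on T" by (rule finite_measure_lebesgue_on[OF Tl(2)])
  define V where "V = measure lebesgue T"
  have V: "V > 0" using T by (simp add: V_def)
  have VT: "measure (lebesgue_on T) (space (lebesgue_on T)) = V"
    using Tl by (simp add: V_def measure_restrict_space)
  have eV: "emeasure lborel T = ennreal V"
    using emeasure_eq_measure2[OF Tl(2)] T(1) by (simp add: V_def)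
  have c\<phi>: "continuous_on UNIV \<phi>" by (rule smooth_continuous[OF s])
  have L2c: "L2 (lebesgue_on T) (\<lambda>y. \<phi> x - \<phi> y)" for x
    by (intro L2_continuous_lebesgue_on[OF _ Tl(1) T(2)] continuous_intros c\<phi>)
  have pt: "ennreal (V * (norm (\<phi> x - mean T \<phi>))\<^sup>2) \<le> (\<integral>\<^sup>+y. indicator T y * ennreal ((norm (\<phi> x - \<phi> y))\<^sup>2) \<partial>lborel)" for x
  proof -
    have int: "integrable (lebesgue_on T) \<phi>"
      by (rule L2_imp_integrable[OF L2_continuous_lebesgue_on[OF c\<phi> Tl(1) T(2)]])
    have "complex_of_real V * (\<phi> x - mean T \<phi>) = (\<integral>y. \<phi> x - \<phi> y \<partial>lebesgue_on T)"
      using V int by (simp add: mean_def V_def[symmetric] VT[simplified] algebra_simps scaleR_conv_of_real)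
    then have "V * norm (\<phi> x - mean T \<phi>) \<le> (\<integral>y. norm (\<phi> x - \<phi> y) \<partial>lebesgue_on T)"
      using integral_norm_bound[of "lebesgue_on T" "\<lambda>y. \<phi> x - \<phi> y"] V by (metis abs_of_pos norm_mult norm_of_real)
    also have "\<dots> \<le> L2norm (lebesgue_on T) (\<lambda>y. \<phi> x - \<phi> y) * sqrt V"
      using integral_norm_le_L2norm[OF L2c] VT by simp
    finally have "(V * norm (\<phi> x - mean T \<phi>))\<^sup>2 \<le> (L2norm (lebesgue_on T) (\<lambda>y. \<phi> x - \<phi> y) * sqrt V)\<^sup>2"
      using V by (intro power_mono) auto
    then have "V * (V * (norm (\<phi> x - mean T \<phi>))\<^sup>2) \<le> V * (L2norm (lebesgue_on T) (\<lambda>y. \<phi> x - \<phi> y))\<^sup>2"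
    proof -
      have "(V * norm (\<phi> x - mean T \<phi>))\<^sup>2 = V * (V * (norm (\<phi> x - mean T \<phi>))\<^sup>2)"
        by (simp add: power2_eq_square)
      moreover have "(L2norm (lebesgue_on T) (\<lambda>y. \<phi> x - \<phi> y) * sqrt V)\<^sup>2 = V * (L2norm (lebesgue_on T) (\<lambda>y. \<phi> x - \<phi> y))\<^sup>2"
        using V by (simp add: power_mult_distrib)
      ultimately show ?thesis
        using \<open>(V * norm (\<phi> x - mean T \<phi>))\<^sup>2 \<le> _\<close> by simp
    qed
    then have "V * (norm (\<phi> x - mean T \<phi>))\<^sup>2 \<le> (L2norm (lebesgue_on T) (\<lambda>y. \<phi> x - \<phi> y))\<^sup>2"
      using V by (rule mult_left_le_imp_le)
    then show ?thesis
      using nn_integral_L2norm_lebesgue_on[OF T(1,2), of "\<lambda>y. \<phi> x - \<phi> y"] c\<phi>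
      by (simp add: continuous_on_diff ennreal_leI)
  qed
  define A where "A = L2norm (lebesgue_on T) (\<lambda>x. \<phi> x - mean T \<phi>)"
  define B where "B = L2norm (lebesgue_on T) (grad \<phi>)"
  have "ennreal (V * A\<^sup>2) = ennreal V * (\<integral>\<^sup>+x. indicator T x * ennreal ((norm (\<phi> x - mean T \<phi>))\<^sup>2) \<partial>lborel)"
    using V by (subst nn_integral_L2norm_lebesgue_on[OF T(1,2)]) (auto simp: A_def ennreal_mult intro!: continuous_intros c\<phi>)
  also have "\<dots> = (\<integral>\<^sup>+x. indicator T x * ennreal (V * (norm (\<phi> x - mean T \<phi>))\<^sup>2) \<partial>lborel)"
    using V by (subst nn_integral_cmult[symmetric]) (auto simp: ennreal_mult mult_ac)
  also have "\<dots> \<le> (\<integral>\<^sup>+x. indicator T x * (\<integral>\<^sup>+y. indicator T y * ennreal ((norm (\<phi> x - \<phi> y))\<^sup>2) \<partial>lborel) \<partial>lborel)"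
    by (intro nn_integral_mono mult_left_mono pt) auto
  also have "\<dots> = (\<integral>\<^sup>+x. \<integral>\<^sup>+y. indicator T x * (indicator T y * ennreal ((norm (\<phi> x - \<phi> y))\<^sup>2)) \<partial>lborel \<partial>lborel)"
    by (intro nn_integral_cong nn_integral_cmult[symmetric]) measurable
  also have "\<dots> \<le> ennreal (4 * d\<^sup>2) * emeasure lborel T * (\<integral>\<^sup>+x. indicator T x * ennreal ((norm (grad \<phi> x))\<^sup>2) \<partial>lborel)"
    by (rule poincare_double[OF T(1,3) s d(1)])
  also have "\<dots> = ennreal (4 * d\<^sup>2 * V * B\<^sup>2)"
    using V by (simp add: nn_integral_L2norm_lebesgue_on[OF T(1,2) continuous_on_grad[OF s]] B_def eV ennreal_mult)
  finally have "V * A\<^sup>2 \<le> 4 * d\<^sup>2 * V * B\<^sup>2" using V by simp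
  then have "V * A\<^sup>2 \<le> V * (2 * d * B)\<^sup>2" by (simp add: power_mult_distrib mult_ac)
  then have "A\<^sup>2 \<le> (2 * d * B)\<^sup>2" using V by (rule mult_left_le_imp_le)
  then have "A \<le> 2 * d * B" by (rule power2_le_imp_le) (use d(2) in \<open>simp add: B_def\<close>)
  then show ?thesis by (simp add: A_def B_def)
qed

section \<open>Integration over triangles and edges\<close>

lemma borel_measurable_vec2: "(\<lambda>p::real\<times>real. vector [fst p, snd p] :: real^2) \<in> borel_measurable borel"
proof -
  have "continuous_on UNIV (\<lambda>p::real\<times>real. \<chi> i::2. if i = 1 then fst p else snd p)"
  proof (rule continuous_on_vec_lambda)
    fix i :: 2
    show "continuous_on UNIV (\<lambda>p::real\<times>real. if i = 1 then fst p else snd p)"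
      by (cases "i = 1") (auto intro!: continuous_intros)
  qed
  moreover have "(\<lambda>p::real\<times>real. vector [fst p, snd p] :: real^2) = (\<lambda>p. \<chi> i::2. if i = 1 then fst p else snd p)"
    by (auto simp: fun_eq_iff vec_eq_iff forall_2)
  ultimately show ?thesis by (simp add: borel_measurable_continuous_onI)
qed

text \<open>Lebesgue measure is characterised by its values on boxes, and the preimage of a box is a
  product of two intervals. Iterated integrals in the plane rest on this.\<close>

lemma lborel_vec2: "distr lborel borel (\<lambda>p::real\<times>real. vector [fst p, snd p] :: real^2) = lborel"
proof (rule lborel_eqI[symmetric])
  fix l u :: "real^2" assume lu: "\<And>b. b \<in> Basis \<Longrightarrow> l \<bullet> b \<le> u \<bullet> b"
  have le: "l $ i \<le> u $ i" for i
    using lu[of "axis i 1"] by (simp add: inner_axis axis_in_Basis_iff)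
  have m: "(\<lambda>p::real\<times>real. vector [fst p, snd p] :: real^2) \<in> borel_measurable borel"
    by (rule borel_measurable_vec2)
  have "(\<lambda>p::real\<times>real. vector [fst p, snd p] :: real^2) -` box l u = box (l $ 1) (u $ 1) \<times> box (l $ 2) (u $ 2)"
    by (auto simp: box_vec_eq_empty mem_box_cart forall_2)
  then have "emeasure (distr lborel borel (\<lambda>p::real\<times>real. vector [fst p, snd p] :: real^2)) (box l u)
     = emeasure (lborel :: (real\<times>real) measure) (box (l $ 1) (u $ 1) \<times> box (l $ 2) (u $ 2))"
    using m by (simp add: emeasure_distr)
  also have "\<dots> = emeasure lborel (box (l $ 1) (u $ 1)) * emeasure lborel (box (l $ 2) (u $ 2))"
    unfolding lborel_prod[symmetric] by (rule lborel.emeasure_pair_measure_Times) auto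
  also have "\<dots> = ennreal ((u $ 1 - l $ 1) * (u $ 2 - l $ 2))"
    using le by (simp add: ennreal_mult box_real)
  also have "(u $ 1 - l $ 1) * (u $ 2 - l $ 2) = (\<Prod>b\<in>Basis. (u - l) \<bullet> b)"
    by (simp add: Basis_vec_def UNIV_2 inner_axis prod.union_disjoint axis_eq_axis)
  finally show "emeasure (distr lborel borel (\<lambda>p::real\<times>real. vector [fst p, snd p] :: real^2)) (box l u) = (\<Prod>b\<in>Basis. (u - l) \<bullet> b)" .
qed simp

text \<open>Again boxes suffice: the preimage of a box is its image under the inverse map, whose
  volume carries the reciprocal determinant.\<close>

lemma lborel_linear_distr:
  fixes A :: "real^2 \<Rightarrow> real^2"
  assumes A: "linear A" "det (matrix A) \<noteq> 0"
  shows "lborel = scale_measure (ennreal \<bar>det (matrix A)\<bar>) (distr lborel borel A)"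
proof (rule lborel_eqI)
  fix l u :: "real^2" assume lu: "\<And>b. b \<in> Basis \<Longrightarrow> l \<bullet> b \<le> u \<bullet> b"
  have "invertible (matrix A)" using A(2) by (simp add: invertible_det_nz)
  then obtain B where B: "linear B" "A \<circ> B = id" "B \<circ> A = id"
    using matrix_invertible[OF A(1)] by auto
  have "matrix A ** matrix B = mat 1"
    using matrix_compose[OF B(1) A(1)] B(2) by (simp add: matrix_id_mat_1)
  then have "det (matrix A) * det (matrix B) = 1" by (metis det_I det_mul)
  then have dd: "\<bar>det (matrix A)\<bar> * \<bar>det (matrix B)\<bar> = 1" by (metis abs_mult abs_one)
  have pre: "A -` box l u = B ` box l u"
  proof
    show "A -` box l u \<subseteq> B ` box l u"
    proof
      fix x assume "x \<in> A -` box l u"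
      moreover have "B (A x) = x" using B(3) by (simp add: fun_eq_iff)
      ultimately show "x \<in> B ` box l u" by (metis imageI vimageD)
    qed
    show "B ` box l u \<subseteq> A -` box l u"
      using B(2) by (auto simp: fun_eq_iff)
  qed
  have [measurable]: "A \<in> borel_measurable borel"
    by (intro borel_measurable_continuous_onI linear_continuous_on linear_conv_bounded_linear[THEN iffD1] A)
  have Bl: "B ` box l u \<in> lmeasurable" by (rule measurable_linear_image[OF B(1)]) simp
  have sB: "B ` box l u \<in> sets borel"
    using measurable_sets_borel[of A borel "box l u"] by (simp add: pre[symmetric])
  have "emeasure lborel (A -` box l u) = ennreal (measure lebesgue (B ` box l u))"
    using emeasure_eq_measure2[OF Bl] sB by (simp add: pre)
  also have "measure lebesgue (B ` box l u) = \<bar>det (matrix B)\<bar> * measure lborel (box l u)"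
    by (simp add: measure_linear_image[OF B(1)])
  finally have "emeasure (scale_measure (ennreal \<bar>det (matrix A)\<bar>) (distr lborel borel A)) (box l u)
     = ennreal ((\<bar>det (matrix A)\<bar> * \<bar>det (matrix B)\<bar>) * measure lborel (box l u))"
    by (simp add: emeasure_distr ennreal_mult mult.assoc)
  also have "\<dots> = ennreal (\<Prod>b\<in>Basis. (u - l) \<bullet> b)"
    unfolding dd using lu by (simp add: measure_lborel_box)
  finally show "emeasure (scale_measure (ennreal \<bar>det (matrix A)\<bar>) (distr lborel borel A)) (box l u) = ennreal (\<Prod>b\<in>Basis. (u - l) \<bullet> b)" .
qed simp

lemma nn_integral_linear:
  fixes A :: "real^2 \<Rightarrow> real^2"
  assumes A: "linear A" "det (matrix A) \<noteq> 0" and f[measurable]: "f \<in> borel_measurable borel"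
  shows "(\<integral>\<^sup>+x. f x \<partial>lborel) = ennreal \<bar>det (matrix A)\<bar> * (\<integral>\<^sup>+x. f (A x) \<partial>lborel)"
proof -
  have [measurable]: "A \<in> borel_measurable borel"
    by (intro borel_measurable_continuous_onI linear_continuous_on linear_conv_bounded_linear[THEN iffD1] A)
  show ?thesis
    by (subst lborel_linear_distr[OF A]) (simp add: nn_integral_scale_measure nn_integral_distr)
qed

lemma nn_integral_vec2:
  fixes f :: "real^2 \<Rightarrow> ennreal"
  assumes [measurable]: "f \<in> borel_measurable borel"
  shows "(\<integral>\<^sup>+x. f x \<partial>lborel) = (\<integral>\<^sup>+s. \<integral>\<^sup>+m. f (vector [s, m]) \<partial>lborel \<partial>lborel)"
proof -
  note borel_measurable_vec2[measurable]
  have "(\<integral>\<^sup>+x. f x \<partial>lborel) = (\<integral>\<^sup>+p. f (vector [fst p, snd p]) \<partial>(lborel :: (real\<times>real) measure))"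
    by (subst lborel_vec2[symmetric]) (simp add: nn_integral_distr)
  also have "\<dots> = (\<integral>\<^sup>+s. \<integral>\<^sup>+m. f (vector [s, m]) \<partial>lborel \<partial>lborel)"
    unfolding lborel_prod[symmetric]
    by (subst lborel.nn_integral_fst[symmetric]) (simp_all add: lborel_prod)
  finally show ?thesis .
qed

text \<open>The substitution \<open>m = s l\<close> stretches the slice of length \<open>s\<close>
  to the unit interval and is the source of the weight \<open>s\<close> in the triangle
  formula.\<close>

lemma nn_integral_reference_triangle:
  fixes f :: "real \<Rightarrow> real \<Rightarrow> ennreal"
  assumes [measurable]: "(\<lambda>p. f (fst p) (snd p)) \<in> borel_measurable borel" and s: "s > 0"
  shows "(\<integral>\<^sup>+m. indicator {0..s} m * f s m \<partial>lborel) = ennreal s * (\<integral>\<^sup>+l. indicator {0..1} l * f s (s * l) \<partial>lborel)"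
proof -
  have "(\<lambda>m. f s m) \<in> borel_measurable borel"
    using measurable_compose[of "\<lambda>m. (s, m)" borel borel "\<lambda>p. f (fst p) (snd p)"]
    by (simp add: borel_measurable_continuous_onI continuous_on_Pair)
  then have "(\<integral>\<^sup>+m. indicator {0..s} m * f s m \<partial>lborel) = ennreal s * (\<integral>\<^sup>+l. indicator {0..s} (s * l) * f s (s * l) \<partial>lborel)"
    using s by (subst nn_integral_real_affine[where c=s and t=0]) auto
  also have "(\<lambda>l. indicator {0..s} (s * l) :: ennreal) = indicator {0..1}"
    using s by (auto simp: indicator_def fun_eq_iff zero_le_mult_iff)
  finally show ?thesis by (simp add: fun_eq_iff)
qed

text \<open>Coordinates with apex \<open>c\<close>: the unit square is mapped onto the triangle, and \<open>s = 1\<close> is the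
  edge \<open>ab\<close>. Radial lines towards \<open>c\<close> turn the trace inequality into a one-dimensional one.\<close>

definition tri_map :: "pt \<Rightarrow> pt \<Rightarrow> pt \<Rightarrow> real \<Rightarrow> real \<Rightarrow> pt" where
  "tri_map a b c s l = c + s *\<^sub>R (a - c) + (s * l) *\<^sub>R (b - a)"

lemma affine_dependent_det:
  fixes a b c :: pt
  assumes nd: "\<not> affine_dependent {a, b, c}" and distinct: "a \<noteq> b" "b \<noteq> c" "a \<noteq> c"
  shows "linear (\<lambda>x::pt. x $ 1 *\<^sub>R (a - c) + x $ 2 *\<^sub>R (b - a))"
    "det (matrix (\<lambda>x::pt. x $ 1 *\<^sub>R (a - c) + x $ 2 *\<^sub>R (b - a))) \<noteq> 0"
proof -
  let ?A = "\<lambda>x::pt. x $ 1 *\<^sub>R (a - c) + x $ 2 *\<^sub>R (b - a)"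
  show lin: "linear ?A" by (intro linearI) (auto simp: algebra_simps)
  have "inj ?A"
  proof (subst linear_injective_0[OF lin], intro allI impI)
    fix x :: pt assume x: "?A x = 0"
    \<comment> \<open>Expanding \<open>?A x\<close> in the vertices gives the coefficients
      \<open>x $ 1 - x $ 2\<close>, \<open>x $ 2\<close> and \<open>- x $ 1\<close>, which sum to
      zero: an affine dependence.\<close>
    define U where "U v = (if v = a then x $ 1 - x $ 2 else if v = b then x $ 2 else - x $ 1)" for v
    have U: "sum U {a, b, c} = 0" "(\<Sum>v\<in>{a, b, c}. U v *\<^sub>R v) = 0"
      using distinct x by (auto simp: U_def algebra_simps)
    have "U v = 0" if "v \<in> {a, b, c}" for v
      using nd U that affine_dependent_explicit_finite[of "{a, b, c}"] by blast
    from this[of b] this[of c] distinct have "x $ 1 = 0" "x $ 2 = 0" by (auto simp: U_def)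
    then show "x = 0" by (simp add: vec_eq_iff forall_2)
  qed
  then show "det (matrix ?A) \<noteq> 0"
    using det_nz_iff_inj[OF lin] by simp
qed

text \<open>The barycentric coordinates of the point are \<open>s - m\<close>, \<open>m\<close> and
  \<open>1 - s\<close>, and affine independence makes them unique.\<close>

lemma tri_map_in_hull_iff:
  fixes a b c :: pt
  assumes nd: "\<not> affine_dependent {a, b, c}" and distinct: "a \<noteq> b" "b \<noteq> c" "a \<noteq> c"
  shows "c + s *\<^sub>R (a - c) + m *\<^sub>R (b - a) \<in> convex hull {a, b, c} \<longleftrightarrow> 0 \<le> m \<and> m \<le> s \<and> s \<le> 1"
proof -
  have eq: "c + s *\<^sub>R (a - c) + m *\<^sub>R (b - a) = (s - m) *\<^sub>R a + m *\<^sub>R b + (1 - s) *\<^sub>R c" for s m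
    by (simp add: algebra_simps)
  show ?thesis
  proof
    assume "c + s *\<^sub>R (a - c) + m *\<^sub>R (b - a) \<in> convex hull {a, b, c}"
    then obtain p q r where pqr: "p \<ge> 0" "q \<ge> 0" "r \<ge> 0" "p + q + r = 1"
      "c + s *\<^sub>R (a - c) + m *\<^sub>R (b - a) = p *\<^sub>R a + q *\<^sub>R b + r *\<^sub>R c"
      unfolding convex_hull_3 by auto
    let ?A = "\<lambda>x::pt. x $ 1 *\<^sub>R (a - c) + x $ 2 *\<^sub>R (b - a)"
    have lin: "linear ?A" and "inj ?A"
      using affine_dependent_det[OF assms] det_nz_iff_inj by blast+
    have "p *\<^sub>R a + q *\<^sub>R b + r *\<^sub>R c = c + (p + q) *\<^sub>R (a - c) + q *\<^sub>R (b - a)"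
    proof -
      have r: "r = 1 - p - q" using pqr(4) by simp
      show ?thesis unfolding r by (simp add: algebra_simps)
    qed
    then have "?A (vector [s, m]) = ?A (vector [p + q, q])" using pqr(5) by simp
    then have "vector [s, m] = (vector [p + q, q] :: pt)" using \<open>inj ?A\<close> by (rule injD[rotated])
    then have "s = p + q" "m = q" by (auto simp: vec_eq_iff forall_2)
    then show "0 \<le> m \<and> m \<le> s \<and> s \<le> 1" using pqr by auto
  next
    assume "0 \<le> m \<and> m \<le> s \<and> s \<le> 1"
    then show "c + s *\<^sub>R (a - c) + m *\<^sub>R (b - a) \<in> convex hull {a, b, c}"
      unfolding eq convex_hull_3 by (intro CollectI exI[of _ "s - m"] exI[of _ m] exI[of _ "1 - s"]) auto
  qed
qed

text \<open>The determinant is never evaluated: applying the formula to the constant 1 identifies it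
  as twice the area, which yields positivity of the area at the same time.\<close>

lemma nn_integral_triangle:
  fixes a b c :: pt and f :: "pt \<Rightarrow> ennreal"
  assumes nd: "\<not> affine_dependent {a, b, c}" and distinct: "a \<noteq> b" "b \<noteq> c" "a \<noteq> c"
    and f[measurable]: "f \<in> borel_measurable borel"
  defines "T \<equiv> convex hull {a, b, c}"
  shows "(\<integral>\<^sup>+x. indicator T x * f x \<partial>lborel)
      = ennreal (2 * measure lebesgue T) * (\<integral>\<^sup>+s. indicator {0..1} s * (ennreal s * (\<integral>\<^sup>+l. indicator {0..1} l * f (tri_map a b c s l) \<partial>lborel)) \<partial>lborel)"
    and "measure lebesgue T > 0"
proof -
  let ?A = "\<lambda>x::pt. x $ 1 *\<^sub>R (a - c) + x $ 2 *\<^sub>R (b - a)"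
  have A: "linear ?A" "det (matrix ?A) \<noteq> 0" using affine_dependent_det[OF nd distinct] by blast+
  define D where "D = \<bar>det (matrix ?A)\<bar>"
  have D: "D > 0" using A by (simp add: D_def)
  have "compact T" unfolding T_def by (intro finite_imp_compact_convex_hull) simp
  then have [measurable]: "T \<in> sets borel" by (simp add: compact_imp_closed borel_closed)
  have Tl: "T \<in> lmeasurable" using \<open>compact T\<close> by (rule lmeasurable_compact)
  have main: "(\<integral>\<^sup>+x. indicator T x * g x \<partial>lborel)
      = ennreal D * (\<integral>\<^sup>+s. indicator {0..1} s * (ennreal s * (\<integral>\<^sup>+l. indicator {0..1} l * g (tri_map a b c s l) \<partial>lborel)) \<partial>lborel)"
    if [measurable]: "g \<in> borel_measurable borel" for g :: "pt \<Rightarrow> ennreal"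
  proof -
    define G where "G x = indicator T x * g x" for x
    have [measurable]: "G \<in> borel_measurable borel" unfolding G_def by measurable
    have "(\<integral>\<^sup>+x. G x \<partial>lborel) = (\<integral>\<^sup>+x. G (c + x) \<partial>lborel)"
      using nn_integral_lborel_affine[where f=G and c=1 and t=c] by simp
    also have "\<dots> = ennreal D * (\<integral>\<^sup>+x. G (c + ?A x) \<partial>lborel)"
      unfolding D_def by (rule nn_integral_linear[OF A, where f="\<lambda>x. G (c + x)"]) measurable
    also have "(\<integral>\<^sup>+x. G (c + ?A x) \<partial>lborel) = (\<integral>\<^sup>+s. \<integral>\<^sup>+m. G (c + ?A (vector [s, m])) \<partial>lborel \<partial>lborel)"
    proof (rule nn_integral_vec2)
      have [measurable]: "?A \<in> borel_measurable borel"
        by (intro borel_measurable_continuous_onI linear_continuous_on linear_conv_bounded_linear[THEN iffD1] A)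
      show "(\<lambda>x. G (c + ?A x)) \<in> borel_measurable borel" by measurable
    qed
    also have "\<dots> = (\<integral>\<^sup>+s. indicator {0..1} s * (\<integral>\<^sup>+m. indicator {0..s} m * g (c + s *\<^sub>R (a - c) + m *\<^sub>R (b - a)) \<partial>lborel) \<partial>lborel)"
    proof (rule nn_integral_cong)
      fix s :: real
      have "G (c + ?A (vector [s, m])) = indicator {0..1} s * (indicator {0..s} m * g (c + s *\<^sub>R (a - c) + m *\<^sub>R (b - a)))" for m
        using tri_map_in_hull_iff[OF nd distinct, of s m]
        by (auto simp: G_def T_def indicator_def add.assoc)
      then show "(\<integral>\<^sup>+m. G (c + ?A (vector [s, m])) \<partial>lborel) = indicator {0..1} s * (\<integral>\<^sup>+m. indicator {0..s} m * g (c + s *\<^sub>R (a - c) + m *\<^sub>R (b - a)) \<partial>lborel)"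
        by (subst nn_integral_cmult[symmetric]) auto
    qed
    also have "\<dots> = (\<integral>\<^sup>+s. indicator {0..1} s * (ennreal s * (\<integral>\<^sup>+l. indicator {0..1} l * g (tri_map a b c s l) \<partial>lborel)) \<partial>lborel)"
    proof (rule nn_integral_cong_AE)
      have m: "(\<lambda>p. g (c + fst p *\<^sub>R (a - c) + snd p *\<^sub>R (b - a))) \<in> borel_measurable borel"
        by (rule measurable_compose[OF borel_measurable_continuous_onI that]) (intro continuous_intros)
      have "AE s in lborel. s \<noteq> (0::real)" by (rule AE_lborel_singleton)
      then show "AE s in lborel. indicator {0..1} s * (\<integral>\<^sup>+m. indicator {0..s} m * g (c + s *\<^sub>R (a - c) + m *\<^sub>R (b - a)) \<partial>lborel)
         = indicator {0..1} s * (ennreal s * (\<integral>\<^sup>+l. indicator {0..1} l * g (tri_map a b c s l) \<partial>lborel))"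
      proof eventually_elim
        case (elim s)
        show ?case
          using nn_integral_reference_triangle[OF m, of s] elim
          by (cases "s > 0") (auto simp: tri_map_def indicator_def)
      qed
    qed
    finally show ?thesis by (simp add: G_def)
  qed
  have half: "(\<integral>\<^sup>+s. indicator {0..1} s * ennreal s \<partial>lborel) = ennreal (1 / 2)"
  proof -
    have "(\<integral>\<^sup>+s. ennreal s * indicator {0..1} s \<partial>lborel) = ennreal (1\<^sup>2 / 2 - 0\<^sup>2 / 2)"
      by (rule nn_integral_FTC_Icc) (auto intro!: derivative_eq_intros simp: has_real_derivative_iff_has_vector_derivative[symmetric])
    then show ?thesis by (simp add: mult.commute)
  qed
  have "emeasure lborel T = ennreal D * ennreal (1 / 2)"
    using main[of "\<lambda>_. 1"] by (simp add: half)
  also have "\<dots> = ennreal (D * (1 / 2))"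
    by (rule ennreal_mult[symmetric]) (use D in auto)
  finally have "ennreal (measure lebesgue T) = ennreal (D * (1 / 2))"
    using emeasure_eq_measure2[OF Tl] by simp
  then have "measure lebesgue T = D / 2" using D by simp
  then show "measure lebesgue T > 0"
    "(\<integral>\<^sup>+x. indicator T x * f x \<partial>lborel)
      = ennreal (2 * measure lebesgue T) * (\<integral>\<^sup>+s. indicator {0..1} s * (ennreal s * (\<integral>\<^sup>+l. indicator {0..1} l * f (tri_map a b c s l) \<partial>lborel)) \<partial>lborel)"
    using D main[OF f] by (auto simp: mult.commute)
qed

section \<open>Arc length on segments\<close>

lemma arclen_eq:
  obtains a' b' where "closed_segment a b = closed_segment a' b'" "{a, b} = {a', b'}"
    "arclen (closed_segment a b) = completion (scale_measure (ennreal (dist a b))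
       (distr (restrict_space lborel {0..1}) borel (linepath a' b')))"
proof -
  let ?P = "\<lambda>ab. closed_segment a b = closed_segment (fst ab) (snd ab)"
  define ab where "ab = (SOME ab. ?P ab)"
  have P: "?P ab" unfolding ab_def by (rule someI[of ?P "(a, b)"]) simp
  \<comment> \<open>Whatever representation of the segment \<open>arclen\<close> has chosen, its
    endpoints agree with \<open>a\<close> and \<open>b\<close> up to order.\<close>
  then have ab: "{a, b} = {fst ab, snd ab}" by (simp add: closed_segment_eq)
  then have d: "dist a b = dist (fst ab) (snd ab)" by (auto simp: doubleton_eq_iff dist_commute)
  have "arclen (closed_segment a b) = completion (scale_measure (ennreal (dist (fst ab) (snd ab)))
       (distr (restrict_space lborel {0..1}) borel (linepath (fst ab) (snd ab))))"
    unfolding arclen_def ab_def Let_def ..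
  then show ?thesis unfolding d[symmetric] by (rule that[OF P ab])
qed

lemma linepath_measurable: "linepath a b \<in> borel_measurable borel"
  by (intro borel_measurable_continuous_onI) (simp add: linepath_def continuous_intros)

lemma nn_integral_arclen:
  assumes f[measurable]: "f \<in> borel_measurable borel"
  shows "(\<integral>\<^sup>+x. f x \<partial>arclen (closed_segment a b))
    = ennreal (dist a b) * (\<integral>\<^sup>+t. indicator {0..1} t * f (linepath a b t) \<partial>lborel)"
proof -
  obtain a' b' where ab: "{a, b} = {a', b'}" and
    e: "arclen (closed_segment a b) = completion (scale_measure (ennreal (dist a b))
       (distr (restrict_space lborel {0..1}) borel (linepath a' b')))"
    using arclen_eq[of a b] by metis
  note linepath_measurable[measurable]
  have m: "linepath a' b' \<in> measurable (restrict_space lborel {0..1}) borel"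
    by (rule measurable_restrict_space1) simp
  have "(\<integral>\<^sup>+x. f x \<partial>arclen (closed_segment a b)) = ennreal (dist a b) * (\<integral>\<^sup>+t. f (linepath a' b' t) * indicator {0..1} t \<partial>lborel)"
    unfolding e nn_integral_completion
    by (simp add: nn_integral_scale_measure nn_integral_distr[OF m] nn_integral_restrict_space)
  also have "(\<integral>\<^sup>+t. f (linepath a' b' t) * indicator {0..1} t \<partial>lborel) = (\<integral>\<^sup>+t. indicator {0..1} t * f (linepath a b t) \<partial>lborel)"
  proof (cases "a = a'")
    case True
    then have "b = b'" using ab by (auto simp: doubleton_eq_iff)
    then show ?thesis using True by (simp add: mult.commute)
  next
    \<comment> \<open>The chosen parametrisation runs backwards; reflecting the unit interval
      repairs this.\<close>
    case False
    then have ab': "a = b'" "b = a'" using ab by (auto simp: doubleton_eq_iff)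
    have "(\<integral>\<^sup>+t. f (linepath b a t) * indicator {0..1} t \<partial>lborel) = (\<integral>\<^sup>+t. f (linepath b a (1 - t)) * indicator {0..1} (1 - t) \<partial>lborel)"
      by (rule nn_integral_lborel_reflect[symmetric]) measurable
    also have "\<dots> = (\<integral>\<^sup>+t. indicator {0..1} t * f (linepath a b t) \<partial>lborel)"
      by (intro nn_integral_cong) (auto simp: linepath_def indicator_def algebra_simps)
    finally show ?thesis using ab' by simp
  qed
  finally show ?thesis .
qed

lemma sets_arclen: "sets borel \<subseteq> sets (arclen (closed_segment a b))" "space (arclen (closed_segment a b)) = UNIV"
proof -
  obtain a' b' where e: "arclen (closed_segment a b) = completion (scale_measure (ennreal (dist a b))
       (distr (restrict_space lborel {0..1}) borel (linepath a' b')))"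
    using arclen_eq[of a b] by metis
  show "sets borel \<subseteq> sets (arclen (closed_segment a b))" unfolding e
    by (auto intro: sets_completionI_sets)
  show "space (arclen (closed_segment a b)) = UNIV" unfolding e by (simp add: space_scale_measure)
qed

lemma measurable_arclen:
  assumes "f \<in> borel_measurable borel" shows "f \<in> borel_measurable (arclen (closed_segment a b))"
  by (rule measurableI) (use measurable_sets[OF assms] sets_arclen in auto)

lemma emeasure_arclen:
  assumes "A \<in> sets borel"
  shows "emeasure (arclen (closed_segment a b)) A
    = ennreal (dist a b) * (\<integral>\<^sup>+t. indicator {0..1} t * indicator A (linepath a b t) \<partial>lborel)"
  using nn_integral_arclen[of "indicator A" a b] assms sets_arclen(1)[of a b]
  by (subst nn_integral_indicator[symmetric]) auto

lemma finite_measure_arclen: "finite_measure (arclen (closed_segment a b))"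
proof (rule finite_measureI)
  have "(\<integral>\<^sup>+t. indicator {0..1::real} t * indicator UNIV (linepath a b t) \<partial>lborel) = 1" by simp
  then show "emeasure (arclen (closed_segment a b)) (space (arclen (closed_segment a b))) \<noteq> \<infinity>"
    using emeasure_arclen[of UNIV a b] by (simp add: sets_arclen(2))
qed

lemma AE_arclen_segment: "AE x in arclen (closed_segment a b). x \<in> closed_segment a b"
proof -
  have c: "- closed_segment a b \<in> sets borel" by (simp add: borel_open open_Compl)
  have "(\<integral>\<^sup>+t. indicator {0..1} t * indicator (- closed_segment a b) (linepath a b t) \<partial>lborel) = (\<integral>\<^sup>+t. 0 \<partial>(lborel::real measure))"
    by (intro nn_integral_cong) (auto simp: indicator_def linepath_in_path)
  then have "emeasure (arclen (closed_segment a b)) (- closed_segment a b) = 0"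
    using emeasure_arclen[OF c, of a b] by simp
  then have "- closed_segment a b \<in> null_sets (arclen (closed_segment a b))"
    by (rule null_setsI[OF _ subsetD[OF sets_arclen(1) c]])
  from AE_not_in[OF this] show ?thesis by simp
qed

lemma L2_arclen_continuous:
  fixes f :: "pt \<Rightarrow> 'b::{banach, second_countable_topology}"
  assumes "continuous_on UNIV f"
  shows "L2 (arclen (closed_segment a b)) f"
proof -
  interpret finite_measure "arclen (closed_segment a b)" by (rule finite_measure_arclen)
  have "compact (f ` closed_segment a b)"
    by (intro compact_continuous_image continuous_on_subset[OF assms]) auto
  then obtain B where B: "\<And>x. x \<in> closed_segment a b \<Longrightarrow> norm (f x) \<le> B"
    by (fastforce dest!: compact_imp_bounded simp: bounded_iff)
  show ?thesis
  proof (rule L2_bounded)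
    show "f \<in> borel_measurable (arclen (closed_segment a b))"
      by (intro measurable_arclen borel_measurable_continuous_onI assms)
    show "AE x in arclen (closed_segment a b). norm (f x) \<le> B"
      using AE_arclen_segment by eventually_elim (rule B)
  qed
qed

section \<open>Trace inequality on a triangle\<close>

lemma triangle_ray_bound:
  fixes a b c :: pt
  assumes s: "smooth \<phi>" and h: "norm ((a - c) + l *\<^sub>R (b - a)) \<le> h"
  shows "ennreal ((norm (\<phi> (tri_map a b c 1 l)))\<^sup>2) \<le> 2 * (\<integral>\<^sup>+s. indicator {0..1} s * (ennreal s *
    ennreal ((norm (\<phi> (tri_map a b c s l)))\<^sup>2 + h * (norm (\<phi> (tri_map a b c s l)) * norm (grad \<phi> (tri_map a b c s l))))) \<partial>lborel)"
proof -
  define w where "w = (a - c) + l *\<^sub>R (b - a)"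
  have tm: "tri_map a b c s l = c + s *\<^sub>R w" for s by (simp add: tri_map_def w_def algebra_simps)
  let ?p = "\<lambda>s. \<phi> (c + s *\<^sub>R w)"
  let ?D = "\<lambda>s. \<Sum>i\<in>UNIV. w $ i *\<^sub>R partial i \<phi> (c + s *\<^sub>R w)"
  \<comment> \<open>The derivative of \<open>s\<^sup>2 |\<phi>|\<^sup>2\<close> along the ray. The
    weight removes the contribution of the apex \<open>s = 0\<close>, and one factor
    \<open>s\<close> left in the derivative matches the weight in
    \<open>nn_integral_triangle\<close>.\<close>
  let ?g' = "\<lambda>s. 2 * s * (?p s \<bullet> ?p s) + s\<^sup>2 * (2 * (?p s \<bullet> ?D s))"
  have cp: "continuous_on A ?p" for A
    by (intro continuous_on_compose2[OF smooth_continuous[OF s, of UNIV]] continuous_intros) auto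
  have cD: "continuous_on A ?D" for A
    by (intro continuous_intros continuous_on_compose2[OF smooth_continuous[OF smooth_partial[OF s], of UNIV]]) auto
  have cg: "continuous_on A (\<lambda>s. grad \<phi> (c + s *\<^sub>R w))" for A
    by (intro continuous_on_compose2[OF continuous_on_grad[OF s, of UNIV]] continuous_intros) auto
  have cg': "continuous_on A ?g'" for A by (intro continuous_intros cp cD)
  have dp: "(?p has_derivative (\<lambda>r. r *\<^sub>R ?D s)) (at s)" for s
  proof -
    have 1: "((\<lambda>t. c + t *\<^sub>R w) has_derivative (\<lambda>h. h *\<^sub>R w)) (at s)"
      by (auto intro!: derivative_eq_intros)
    show ?thesis
      by (rule has_derivative_eq_rhs[OF has_derivative_compose[OF 1 has_derivative_partial[OF smooth_differentiable[OF s]]]])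
         (simp add: fun_eq_iff scaleR_sum_right)
  qed
  have dg: "((\<lambda>s. s\<^sup>2 * (?p s \<bullet> ?p s)) has_vector_derivative ?g' s) (at s within {0..1})" for s
  proof -
    have "((\<lambda>s. s\<^sup>2 * (?p s \<bullet> ?p s)) has_derivative (\<lambda>r. r *\<^sub>R ?g' s)) (at s)"
      by (rule has_derivative_eq_rhs, rule has_derivative_mult, (rule has_derivative_power has_derivative_ident)+,
          rule has_derivative_inner[OF dp dp])
         (simp add: fun_eq_iff algebra_simps power2_eq_square inner_commute)
    then show ?thesis unfolding has_vector_derivative_def by (rule has_derivative_at_withinI)
  qed
  have I: "(\<integral>s. indicator {0..1} s *\<^sub>R ?g' s \<partial>lborel) = 1\<^sup>2 * (?p 1 \<bullet> ?p 1) - 0\<^sup>2 * (?p 0 \<bullet> ?p 0)"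
    by (rule integral_FTC_Icc[OF _ dg cg']) auto
  have int: "integrable lborel (\<lambda>s. indicator {0..1} s *\<^sub>R ?g' s)"
    by (intro borel_integrable_compact cg') auto
  have [measurable]: "?p \<in> borel_measurable borel" "(\<lambda>s. grad \<phi> (c + s *\<^sub>R w)) \<in> borel_measurable borel"
    by (rule borel_measurable_continuous_onI[OF cp] borel_measurable_continuous_onI[OF cg])+
  have "ennreal ((norm (?p 1))\<^sup>2) = ennreal (norm (\<integral>s. indicator {0..1} s *\<^sub>R ?g' s \<partial>lborel))"
    unfolding I by (simp add: dot_square_norm)
  also have "\<dots> \<le> (\<integral>\<^sup>+s. ennreal (norm (indicator {0..1} s *\<^sub>R ?g' s)) \<partial>lborel)"
    by (rule integral_norm_bound_ennreal[OF int])
  also have "\<dots> \<le> (\<integral>\<^sup>+s. 2 * (indicator {0..1} s * (ennreal s * ennreal ((norm (?p s))\<^sup>2 + h * (norm (?p s) * norm (grad \<phi> (c + s *\<^sub>R w)))))) \<partial>lborel)"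
  proof (rule nn_integral_mono)
    fix s :: real
    show "ennreal (norm (indicator {0..1} s *\<^sub>R ?g' s)) \<le> 2 * (indicator {0..1} s * (ennreal s * ennreal ((norm (?p s))\<^sup>2 + h * (norm (?p s) * norm (grad \<phi> (c + s *\<^sub>R w))))))"
    proof (cases "s \<in> {0..1}")
      case True
      then have s01: "0 \<le> s" "s \<le> 1" by auto
      have h0: "0 \<le> h" using h norm_ge_zero order_trans by blast
      let ?g = "norm (grad \<phi> (c + s *\<^sub>R w))"
      have "norm (?D s) \<le> ?g * norm w" by (rule norm_directional_le_grad)
      also have "\<dots> \<le> ?g * h" using h by (intro mult_left_mono) (auto simp: w_def)
      finally have "\<bar>?p s \<bullet> ?D s\<bar> \<le> norm (?p s) * (?g * h)"
        by (intro order_trans[OF Cauchy_Schwarz_ineq2] mult_left_mono) auto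
      then have "s * \<bar>?p s \<bullet> ?D s\<bar> \<le> 1 * (norm (?p s) * (?g * h))"
        using s01 by (intro mult_mono) auto
      then have "2 * s * (s * \<bar>?p s \<bullet> ?D s\<bar>) \<le> 2 * s * (h * (norm (?p s) * ?g))"
        using s01 by (intro mult_left_mono) (auto simp: mult_ac)
      moreover have "\<bar>?g' s\<bar> \<le> 2 * s * (norm (?p s))\<^sup>2 + 2 * s * (s * \<bar>?p s \<bullet> ?D s\<bar>)"
        using s01 by (intro order_trans[OF abs_triangle_ineq])
          (auto simp: abs_mult dot_square_norm power2_eq_square)
      ultimately have "\<bar>?g' s\<bar> \<le> 2 * (s * ((norm (?p s))\<^sup>2 + h * (norm (?p s) * ?g)))"
        by (simp add: algebra_simps)
      then have "ennreal \<bar>?g' s\<bar> \<le> ennreal (2 * (s * ((norm (?p s))\<^sup>2 + h * (norm (?p s) * ?g))))"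
        by (rule ennreal_leI)
      also have "\<dots> = 2 * (ennreal s * ennreal ((norm (?p s))\<^sup>2 + h * (norm (?p s) * ?g)))"
        using s01 h0 by (simp add: ennreal_mult)
      finally show ?thesis using True by simp
    qed simp
  qed
  also have "\<dots> = 2 * (\<integral>\<^sup>+s. indicator {0..1} s * (ennreal s * ennreal ((norm (?p s))\<^sup>2 + h * (norm (?p s) * norm (grad \<phi> (c + s *\<^sub>R w))))) \<partial>lborel)"
    by (rule nn_integral_cmult) measurable
  finally show ?thesis by (simp add: tm)
qed

text \<open>Integrating the ray bound over the edge parameter yields the area integral of the same
  integrand; the 2 of the ray bound cancels against the Jacobian, which is twice the area.\<close>

lemma triangle_trace:
  fixes a b c :: pt
  assumes nd: "\<not> affine_dependent {a, b, c}" and distinct: "a \<noteq> b" "b \<noteq> c" "a \<noteq> c"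
    and s: "smooth \<phi>"
  defines "T \<equiv> convex hull {a, b, c}" and "E \<equiv> closed_segment a b"
  assumes h: "\<And>x y. x \<in> T \<Longrightarrow> y \<in> T \<Longrightarrow> dist x y \<le> h"
  shows "measure lebesgue T * (L2norm (arclen E) \<phi>)\<^sup>2
    \<le> dist a b * ((L2norm (lebesgue_on T) \<phi>)\<^sup>2 + h * (L2norm (lebesgue_on T) \<phi> * L2norm (lebesgue_on T) (grad \<phi>)))"
proof -
  define V where "V = measure lebesgue T"
  have V: "V > 0" unfolding V_def T_def by (rule nn_integral_triangle(2)[OF nd distinct borel_measurable_const[of 0]])
  have [measurable]: "\<phi> \<in> borel_measurable borel" "grad \<phi> \<in> borel_measurable borel"
    by (rule smooth_borel_measurable[OF s] grad_borel_measurable[OF s])+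
  have cT: "compact T" unfolding T_def by (intro finite_imp_compact_convex_hull) simp
  then have T: "T \<in> sets borel" "bounded T" by (auto simp: compact_imp_closed borel_closed compact_imp_bounded)
  then have Tl: "T \<in> sets lebesgue" by simp
  have h0: "0 \<le> h" using h[of a a] by (simp add: T_def hull_inc)
  define A where "A = L2norm (lebesgue_on T) \<phi>"
  define B where "B = L2norm (lebesgue_on T) (grad \<phi>)"
  define H where "H x = (norm (\<phi> x))\<^sup>2 + h * (norm (\<phi> x) * norm (grad \<phi> x))" for x
  have H0: "0 \<le> H x" for x using h0 by (simp add: H_def)
  have [measurable]: "H \<in> borel_measurable borel" unfolding H_def by measurable
  have L\<phi>: "L2 (lebesgue_on T) \<phi>" "L2 (lebesgue_on T) (grad \<phi>)"
    by (intro L2_continuous_lebesgue_on smooth_continuous continuous_on_grad s Tl T)+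
  have H_le: "(\<integral>\<^sup>+x. indicator T x * ennreal (H x) \<partial>lborel) \<le> ennreal (A\<^sup>2 + h * (A * B))"
  proof -
    have i: "integrable (lebesgue_on T) H" unfolding H_def
      by (intro Bochner_Integration.integrable_add L2D L\<phi> integrable_mult_right integrable_norm_mult)
    have "(\<integral>\<^sup>+x. indicator T x * ennreal (H x) \<partial>lborel) = (\<integral>\<^sup>+x. ennreal (H x) \<partial>lebesgue_on T)"
      using Tl by (simp add: nn_integral_restrict_space nn_integral_completion mult.commute)
    also have "\<dots> = ennreal (\<integral>x. H x \<partial>lebesgue_on T)"
      by (rule nn_integral_eq_integral[OF i]) (simp add: H0)
    also have "(\<integral>x. H x \<partial>lebesgue_on T) = A\<^sup>2 + h * (\<integral>x. norm (\<phi> x) * norm (grad \<phi> x) \<partial>lebesgue_on T)"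
      unfolding H_def A_def L2norm_power2 using L2D(2)[OF L\<phi>(1)] integrable_norm_mult[OF L\<phi>] by simp
    also have "ennreal \<dots> \<le> ennreal (A\<^sup>2 + h * (A * B))"
      unfolding A_def B_def by (intro ennreal_leI add_left_mono mult_left_mono Cauchy_Schwarz_L2 L\<phi> h0)
    finally show ?thesis .
  qed
  define X where "X = (\<integral>\<^sup>+s. indicator {0..1} s * (ennreal s * (\<integral>\<^sup>+l. indicator {0..1} l * ennreal (H (tri_map a b c s l)) \<partial>lborel)) \<partial>lborel)"
  have TX: "(\<integral>\<^sup>+x. indicator T x * ennreal (H x) \<partial>lborel) = ennreal (2 * V) * X"
    unfolding X_def V_def T_def by (rule nn_integral_triangle(1)[OF nd distinct]) measurable
  have mt[measurable]: "(\<lambda>p. tri_map a b c (fst p) (snd p)) \<in> borel_measurable (borel \<Otimes>\<^sub>M borel)"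
    unfolding borel_prod tri_map_def by (intro borel_measurable_continuous_onI continuous_intros)
  have "(\<integral>\<^sup>+l. indicator {0..1} l * ennreal ((norm (\<phi> (linepath a b l)))\<^sup>2) \<partial>lborel)
    \<le> (\<integral>\<^sup>+l. 2 * (\<integral>\<^sup>+s. indicator {0..1} l * (indicator {0..1} s * (ennreal s * ennreal (H (tri_map a b c s l)))) \<partial>lborel) \<partial>lborel)"
  proof (rule nn_integral_mono)
    fix l :: real
    have ms: "(\<lambda>s. tri_map a b c s l) \<in> borel_measurable borel"
      unfolding tri_map_def by (intro borel_measurable_continuous_onI continuous_intros)
    show "indicator {0..1} l * ennreal ((norm (\<phi> (linepath a b l)))\<^sup>2)
      \<le> 2 * (\<integral>\<^sup>+s. indicator {0..1} l * (indicator {0..1} s * (ennreal s * ennreal (H (tri_map a b c s l)))) \<partial>lborel)"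
    proof (cases "l \<in> {0..1}")
      case True
      have lp: "linepath a b l = tri_map a b c 1 l" by (simp add: linepath_def tri_map_def algebra_simps)
      have "linepath a b l \<in> T"
        using linepath_in_path[OF True, of a b] hull_mono[of "{a, b}" "{a, b, c}" convex]
        unfolding T_def segment_convex_hull by blast
      then have "norm ((a - c) + l *\<^sub>R (b - a)) \<le> h"
        using h[of "linepath a b l" c] by (simp add: T_def hull_inc dist_norm linepath_def algebra_simps)
      from triangle_ray_bound[OF s this] show ?thesis
        using True by (simp add: lp H_def)
    qed simp
  qed
  also have "\<dots> = 2 * (\<integral>\<^sup>+l. \<integral>\<^sup>+s. indicator {0..1} l * (indicator {0..1} s * (ennreal s * ennreal (H (tri_map a b c s l)))) \<partial>lborel \<partial>lborel)"
  proof (rule nn_integral_cmult)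
    have [measurable]: "(\<lambda>p. tri_map a b c (snd p) (fst p)) \<in> borel_measurable (borel \<Otimes>\<^sub>M borel)"
      unfolding borel_prod tri_map_def by (intro borel_measurable_continuous_onI continuous_intros)
    show "(\<lambda>l. \<integral>\<^sup>+s. indicator {0..1} l * (indicator {0..1} s * (ennreal s * ennreal (H (tri_map a b c s l)))) \<partial>lborel) \<in> borel_measurable lborel"
      by (rule lborel.borel_measurable_nn_integral) (simp add: split_beta', measurable)
  qed
  also have "(\<integral>\<^sup>+l. \<integral>\<^sup>+s. indicator {0..1} l * (indicator {0..1} s * (ennreal s * ennreal (H (tri_map a b c s l)))) \<partial>lborel \<partial>lborel)
     = (\<integral>\<^sup>+s. \<integral>\<^sup>+l. indicator {0..1} l * (indicator {0..1} s * (ennreal s * ennreal (H (tri_map a b c s l)))) \<partial>lborel \<partial>lborel)"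
    by (rule lborel_pair.Fubini') (simp add: split_beta', measurable)
  also have "\<dots> = X" unfolding X_def
  proof (rule nn_integral_cong)
    fix s :: real
    have ms: "(\<lambda>l. tri_map a b c s l) \<in> borel_measurable borel"
      unfolding tri_map_def by (intro borel_measurable_continuous_onI continuous_intros)
    have [measurable]: "(\<lambda>l. H (tri_map a b c s l)) \<in> borel_measurable borel"
      by (rule measurable_compose[OF ms]) measurable
    have "(\<integral>\<^sup>+l. indicator {0..1} l * (indicator {0..1} s * (ennreal s * ennreal (H (tri_map a b c s l)))) \<partial>lborel)
       = (\<integral>\<^sup>+l. (indicator {0..1} s * ennreal s) * (indicator {0..1} l * ennreal (H (tri_map a b c s l))) \<partial>lborel)"
      by (simp add: mult_ac)
    also have "\<dots> = (indicator {0..1} s * ennreal s) * (\<integral>\<^sup>+l. indicator {0..1} l * ennreal (H (tri_map a b c s l)) \<partial>lborel)"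
      by (rule nn_integral_cmult) measurable
    finally show "(\<integral>\<^sup>+l. indicator {0..1} l * (indicator {0..1} s * (ennreal s * ennreal (H (tri_map a b c s l)))) \<partial>lborel)
       = indicator {0..1} s * (ennreal s * (\<integral>\<^sup>+l. indicator {0..1} l * ennreal (H (tri_map a b c s l)) \<partial>lborel))"
      by (simp add: mult.assoc)
  qed
  finally have le: "(\<integral>\<^sup>+l. indicator {0..1} l * ennreal ((norm (\<phi> (linepath a b l)))\<^sup>2) \<partial>lborel) \<le> 2 * X" .
  have "ennreal ((L2norm (arclen E) \<phi>)\<^sup>2) = (\<integral>\<^sup>+x. ennreal ((norm (\<phi> x))\<^sup>2) \<partial>arclen E)"
    unfolding E_def by (rule nn_integral_L2norm[symmetric, OF L2_arclen_continuous[OF smooth_continuous[OF s]]])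
  also have "\<dots> = ennreal (dist a b) * (\<integral>\<^sup>+l. indicator {0..1} l * ennreal ((norm (\<phi> (linepath a b l)))\<^sup>2) \<partial>lborel)"
    unfolding E_def by (rule nn_integral_arclen) measurable
  also have "\<dots> \<le> ennreal (dist a b) * (2 * X)" by (rule mult_left_mono[OF le]) simp
  finally have "ennreal V * ennreal ((L2norm (arclen E) \<phi>)\<^sup>2) \<le> ennreal V * (ennreal (dist a b) * (2 * X))"
    by (rule mult_left_mono) simp
  also have "\<dots> = ennreal (dist a b) * (ennreal (2 * V) * X)"
    using V by (simp add: ennreal_mult mult_ac)
  also have "\<dots> \<le> ennreal (dist a b) * ennreal (A\<^sup>2 + h * (A * B))"
    using H_le unfolding TX by (rule mult_left_mono) simp
  also have "\<dots> = ennreal (dist a b * (A\<^sup>2 + h * (A * B)))"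
    using h0 by (intro ennreal_mult[symmetric]) (auto simp: A_def B_def)
  finally have "ennreal (V * (L2norm (arclen E) \<phi>)\<^sup>2) \<le> ennreal (dist a b * (A\<^sup>2 + h * (A * B)))"
    using V by (simp add: ennreal_mult)
  then show ?thesis
    using h0 by (subst (asm) ennreal_le_iff) (auto simp: A_def B_def V_def)
qed

text \<open>With \<open>A \<le> 2 h B\<close> from the Poincare inequality,
  \<open>A\<^sup>2 + h A B\<close> is at most \<open>(4 + 2) h\<^sup>2 B\<^sup>2\<close>, which is
  the origin of the 6.\<close>

lemma triangle_trace_mean:
  fixes a b c :: pt
  assumes nd: "\<not> affine_dependent {a, b, c}" and distinct: "a \<noteq> b" "b \<noteq> c" "a \<noteq> c"
    and s: "smooth \<phi>"
  defines "T \<equiv> convex hull {a, b, c}" and "E \<equiv> closed_segment a b"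
  assumes h: "\<And>x y. x \<in> T \<Longrightarrow> y \<in> T \<Longrightarrow> dist x y \<le> h"
  shows "L2norm (lebesgue_on T) (\<lambda>x. \<phi> x - mean T \<phi>) \<le> 2 * h * L2norm (lebesgue_on T) (grad \<phi>)"
    and "measure lebesgue T * (L2norm (arclen E) (\<lambda>x. \<phi> x - mean T \<phi>))\<^sup>2
    \<le> 6 * h\<^sup>2 * dist a b * (L2norm (lebesgue_on T) (grad \<phi>))\<^sup>2"
proof -
  have cT: "compact T" unfolding T_def by (intro finite_imp_compact_convex_hull) simp
  then have T: "T \<in> sets borel" "bounded T" by (auto simp: compact_imp_closed borel_closed compact_imp_bounded)
  have V: "measure lebesgue T > 0" unfolding T_def by (rule nn_integral_triangle(2)[OF nd distinct borel_measurable_const[of 0]])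
  have h0: "0 \<le> h" using h[of a a] by (simp add: T_def hull_inc)
  define B where "B = L2norm (lebesgue_on T) (grad \<phi>)"
  define A where "A = L2norm (lebesgue_on T) (\<lambda>x. \<phi> x - mean T \<phi>)"
  have cvx: "convex T" by (simp add: T_def)
  have A: "A \<le> 2 * h * B"
    unfolding A_def B_def by (rule poincare_convex[OF T cvx V s h h0])
  then show "L2norm (lebesgue_on T) (\<lambda>x. \<phi> x - mean T \<phi>) \<le> 2 * h * L2norm (lebesgue_on T) (grad \<phi>)"
    by (simp add: A_def B_def)
  have g: "grad (\<lambda>x. \<phi> x - mean T \<phi>) = grad \<phi>"
    using grad_diff[OF s smooth_const[of "mean T \<phi>"]] by (simp add: grad_const)
  have "measure lebesgue T * (L2norm (arclen E) (\<lambda>x. \<phi> x - mean T \<phi>))\<^sup>2 \<le> dist a b * (A\<^sup>2 + h * (A * B))"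
    using triangle_trace[OF nd distinct smooth_diff[OF s smooth_const[of "mean T \<phi>"]], of h] h
    unfolding g[unfolded T_def] A_def B_def T_def E_def by blast
  also have "\<dots> \<le> dist a b * ((2 * h * B)\<^sup>2 + h * ((2 * h * B) * B))"
  proof -
    have "0 \<le> A" "0 \<le> B" by (auto simp: A_def B_def)
    then show ?thesis using A h0
      by (intro mult_left_mono add_mono power_mono mult_right_mono) auto
  qed
  also have "\<dots> = 6 * h\<^sup>2 * dist a b * B\<^sup>2" by (simp add: power2_eq_square algebra_simps)
  finally show "measure lebesgue T * (L2norm (arclen E) (\<lambda>x. \<phi> x - mean T \<phi>))\<^sup>2
    \<le> 6 * h\<^sup>2 * dist a b * (L2norm (lebesgue_on T) (grad \<phi>))\<^sup>2" by (simp add: B_def)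
qed

section \<open>Geometry of the mesh\<close>

text \<open>A Lipschitz boundary excludes slits and punctures: just below the graph there are points
  with a neighbourhood missing \<open>\<Omega>\<close>. This permits passing from
  \<open>closure \<Omega>\<close>, which the mesh covers, back to \<open>\<Omega>\<close>.\<close>

lemma lipschitz_domain_interior_closure:
  assumes L: "lipschitz_domain \<Omega>" shows "interior (closure \<Omega>) = \<Omega>"
proof
  have o: "open \<Omega>" using L by (simp add: lipschitz_domain_def)
  then show "\<Omega> \<subseteq> interior (closure \<Omega>)" by (simp add: interior_maximal closure_subset)
  show "interior (closure \<Omega>) \<subseteq> \<Omega>"
  proof
    fix x assume x: "x \<in> interior (closure \<Omega>)"
    show "x \<in> \<Omega>"
    proof (rule ccontr)
      assume nx: "x \<notin> \<Omega>"
      then have "x \<in> frontier \<Omega>" using x o interior_subset by (auto simp: frontier_def interior_open)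
      then obtain r e1 e2 L \<psi> where r: "r > 0" and e: "norm e1 = 1" "norm e2 = 1" "e1 \<bullet> e2 = 0"
        and lip: "L-lipschitz_on UNIV \<psi>" and graph: "\<Omega> \<inter> ball x r = {y \<in> ball x r. \<psi> (e1 \<bullet> y) < e2 \<bullet> y}"
        using L unfolding lipschitz_domain_def by blast
      obtain s where s: "s > 0" "ball x s \<subseteq> closure \<Omega>" using x by (auto simp: mem_interior)
      define t where "t = min r s / 2"
      have t: "t > 0" "t < r" "t < s" using r s by (auto simp: t_def min_def)
      \<comment> \<open>A step along \<open>- e2\<close> from \<open>x\<close>, which is on or below
        the graph; so \<open>y\<close> is strictly below it.\<close>
      define y where "y = x - t *\<^sub>R e2"
      have yb: "y \<in> ball x r" "y \<in> ball x s" using t e by (auto simp: y_def dist_norm)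
      have c\<psi>: "continuous_on A \<psi>" for A
        using lipschitz_on_continuous_on[OF lip] continuous_on_subset by blast
      let ?U = "ball x r \<inter> {z. e2 \<bullet> z < \<psi> (e1 \<bullet> z)}"
      have "open ?U"
        by (intro open_Int open_ball open_Collect_less continuous_intros continuous_on_compose2[OF c\<psi>[of UNIV]]) auto
      moreover have "?U \<inter> \<Omega> = {}"
      proof -
        have False if z: "z \<in> ?U" "z \<in> \<Omega>" for z
        proof -
          have "z \<in> {y \<in> ball x r. \<psi> (e1 \<bullet> y) < e2 \<bullet> y}" using graph z by blast
          then show False using z by auto
        qed
        then show ?thesis by blast
      qed
      ultimately have "?U \<inter> closure \<Omega> = {}" by (simp add: open_Int_closure_eq_empty)
      moreover have "y \<in> ?U"
      proof -
        have "x \<in> ball x r" using r by simp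
        then have "\<not> \<psi> (e1 \<bullet> x) < e2 \<bullet> x" using graph nx by blast
        moreover have "e1 \<bullet> y = e1 \<bullet> x" using e by (simp add: y_def inner_diff_right)
        moreover have "e2 \<bullet> y < e2 \<bullet> x" using e t by (simp add: y_def inner_diff_right dot_square_norm)
        ultimately show ?thesis using yb by simp
      qed
      ultimately show False using yb(2) s(2) by blast
    qed
  qed
qed

text \<open>The coordinates are continuous functions on the whole plane, so their signs decide on
  which side of an edge a point lies, and strict inequalities cut out open sets.\<close>

lemma barycentric:
  fixes a b c :: pt
  assumes nd: "\<not> affine_dependent {a, b, c}" and distinct: "a \<noteq> b" "b \<noteq> c" "a \<noteq> c"
  obtains p q r :: "pt \<Rightarrow> real" where "continuous_on UNIV p" "continuous_on UNIV q" "continuous_on UNIV r"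
    "\<And>x. x = p x *\<^sub>R a + q x *\<^sub>R b + r x *\<^sub>R c" "\<And>x. p x + q x + r x = 1"
    "\<And>p' q' r'. p' + q' + r' = 1 \<Longrightarrow> p (p' *\<^sub>R a + q' *\<^sub>R b + r' *\<^sub>R c) = p' \<and>
       q (p' *\<^sub>R a + q' *\<^sub>R b + r' *\<^sub>R c) = q' \<and> r (p' *\<^sub>R a + q' *\<^sub>R b + r' *\<^sub>R c) = r'"
proof -
  let ?A = "\<lambda>x::pt. x $ 1 *\<^sub>R (a - c) + x $ 2 *\<^sub>R (b - a)"
  have A: "linear ?A" and "inj ?A"
    using affine_dependent_det[OF assms] det_nz_iff_inj by blast+
  then obtain B where B: "linear B" "\<And>x. B (?A x) = x" "\<And>x. ?A (B x) = x"
    using linear_injective_isomorphism by blast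
  have cB: "continuous_on UNIV B" using B(1) by (simp add: linear_continuous_on linear_conv_bounded_linear)
  have c: "continuous_on UNIV (\<lambda>x. B (x - c) $ i)" for i
    by (intro continuous_intros continuous_on_compose2[OF cB]) auto
  show ?thesis
  proof (rule that[of "\<lambda>x. B (x - c) $ 1 - B (x - c) $ 2" "\<lambda>x. B (x - c) $ 2" "\<lambda>x. 1 - B (x - c) $ 1"])
    show "x = (B (x - c) $ 1 - B (x - c) $ 2) *\<^sub>R a + B (x - c) $ 2 *\<^sub>R b + (1 - B (x - c) $ 1) *\<^sub>R c" for x
    proof -
      have "x = c + ?A (B (x - c))" unfolding B(3) by simp
      also have "\<dots> = (B (x - c) $ 1 - B (x - c) $ 2) *\<^sub>R a + B (x - c) $ 2 *\<^sub>R b + (1 - B (x - c) $ 1) *\<^sub>R c"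
        by (simp add: algebra_simps)
      finally show ?thesis .
    qed
    fix p' q' r' :: real assume 1: "p' + q' + r' = 1"
    have r': "r' = 1 - p' - q'" using 1 by simp
    have "p' *\<^sub>R a + q' *\<^sub>R b + r' *\<^sub>R c - c = ?A (vector [p' + q', q'])"
      unfolding r' by (simp add: algebra_simps)
    then have "B (p' *\<^sub>R a + q' *\<^sub>R b + r' *\<^sub>R c - c) = vector [p' + q', q']" by (simp only: B(2))
    then show "B (p' *\<^sub>R a + q' *\<^sub>R b + r' *\<^sub>R c - c) $ 1 - B (p' *\<^sub>R a + q' *\<^sub>R b + r' *\<^sub>R c - c) $ 2 = p' \<and>
      B (p' *\<^sub>R a + q' *\<^sub>R b + r' *\<^sub>R c - c) $ 2 = q' \<and> 1 - B (p' *\<^sub>R a + q' *\<^sub>R b + r' *\<^sub>R c - c) $ 1 = r'"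
      using 1 by simp
  qed (auto intro!: continuous_intros c)
qed

definition triangle :: "pt \<Rightarrow> pt \<Rightarrow> pt \<Rightarrow> bool" where
  "triangle a b c \<longleftrightarrow> \<not> affine_dependent {a, b, c} \<and> a \<noteq> b \<and> b \<noteq> c \<and> a \<noteq> c"

lemma triangleD:
  assumes "triangle a b c"
  shows "\<not> affine_dependent {a, b, c}" "a \<noteq> b" "b \<noteq> c" "a \<noteq> c"
  using assms by (auto simp: triangle_def)

lemma simplex2_triangle:
  assumes "2 simplex (T :: pt set)" obtains a b c where "triangle a b c" "T = convex hull {a, b, c}"
proof -
  obtain C where C: "\<not> affine_dependent C" "int (card C) = 3" "T = convex hull C"
    using assms by (auto simp: simplex_def)
  then have "card C = 3" by simp
  then obtain a b c where "C = {a, b, c}" "a \<noteq> b" "b \<noteq> c" "a \<noteq> c"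
    by (auto simp: card_3_iff)
  then show ?thesis using C by (intro that[of a b c]) (auto simp: triangle_def)
qed

text \<open>Faces of the hull of affinely independent points are hulls of subsets, and dimension one
  means two vertices; the remaining vertex becomes the apex opposite the edge.\<close>

lemma edge_of_triangle:
  assumes T: "2 simplex (T :: pt set)" and E: "E edge_of T"
  obtains a b c where "triangle a b c" "T = convex hull {a, b, c}" "E = closed_segment a b"
proof -
  obtain C where C: "\<not> affine_dependent C" "int (card C) = 3" "T = convex hull C"
    using T by (auto simp: simplex_def)
  have cC: "card C = 3" using C by simp
  then have fC: "finite C" using card.infinite by fastforce
  have "E face_of convex hull C" "aff_dim E = 1" using E C by (auto simp: edge_of_def)
  then obtain S where S: "S \<subseteq> C" "E = convex hull S"
    using face_of_convex_hull_affine_independent[OF C(1)] by auto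
  have "\<not> affine_dependent S" using C(1) S(1) affine_independent_subset by blast
  then have "card S = 2" using aff_dim_affine_independent[of S] \<open>aff_dim E = 1\<close> S(2) by (simp add: aff_dim_convex_hull)
  then obtain a b where ab: "S = {a, b}" "a \<noteq> b" by (auto simp: card_2_iff)
  have "card (C - S) = 1" using card_Diff_subset[of S C] fC S(1) cC \<open>card S = 2\<close> finite_subset by fastforce
  then obtain c where c: "C - S = {c}" by (auto simp: card_1_singleton_iff)
  then have "C = {a, b, c}" "c \<noteq> a" "c \<noteq> b" using S(1) ab by auto
  then show ?thesis using C S(2) ab
    by (intro that[of a b c]) (auto simp: triangle_def segment_convex_hull)
qed

lemma triangle_compact: "compact (convex hull {a, b, c::pt})"
  by (intro finite_imp_compact_convex_hull) simp

lemma diameter_closed_segment: "diameter (closed_segment a b) = dist a (b :: pt)"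
proof (rule antisym)
  show "diameter (closed_segment a b) \<le> dist a b"
  proof (rule diameter_le)
    fix x y assume "x \<in> closed_segment a b" "y \<in> closed_segment a b"
    then show "norm (x - y) \<le> dist a b"
      using segment_furthest_le[of x a b y] segment_bound[of y a b]
      by (auto simp: dist_norm norm_minus_commute)
  qed simp
  show "dist a b \<le> diameter (closed_segment a b)"
    by (rule diameter_bounded_bound) (auto intro: compact_imp_bounded)
qed

text \<open>The intersection is a common face, and a face that contains an interior point is the
  whole element.\<close>

lemma mesh_disjoint_interiors:
  assumes m: "mesh \<Omega> \<T>" and T: "T \<in> \<T>" "T' \<in> \<T>" "T \<noteq> T'"
  shows "interior T \<inter> interior T' = {}"
proof (rule ccontr)
  assume ne: "interior T \<inter> interior T' \<noteq> {}"
  have f: "(T \<inter> T') face_of T" "(T' \<inter> T) face_of T'" using m T by (auto simp: mesh_def triangulation_def)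
  have "T \<inter> T' = T" using face_of_disjoint_interior[OF f(1)] ne interior_subset by blast
  moreover have "T' \<inter> T = T'" using face_of_disjoint_interior[OF f(2)] ne interior_subset by blast
  ultimately show False using T(3) by blast
qed

lemma mesh_element:
  assumes L: "lipschitz_domain \<Omega>" and m: "mesh \<Omega> \<T>" and T: "T \<in> \<T>"
  shows "2 simplex T" "compact T" "convex T" "interior T \<subseteq> \<Omega>" "T \<subseteq> closure \<Omega>"
proof -
  show s: "2 simplex T" using m T by (auto simp: mesh_def)
  obtain a b c where "T = convex hull {a, b, c}" by (rule simplex2_triangle[OF s])
  then show "compact T" "convex T" using triangle_compact by auto
  show "T \<subseteq> closure \<Omega>" using m T by (auto simp: mesh_def)
  then have "interior T \<subseteq> interior (closure \<Omega>)" by (rule interior_mono)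
  then show "interior T \<subseteq> \<Omega>" by (simp add: lipschitz_domain_interior_closure[OF L])
qed

lemma mesh_finite: "mesh \<Omega> \<T> \<Longrightarrow> finite \<T>"
  by (simp add: mesh_def triangulation_def)

lemma mesh_AE:
  assumes L: "lipschitz_domain \<Omega>" and m: "mesh \<Omega> \<T>"
  shows "AE x in lebesgue. \<forall>T\<in>\<T>. x \<notin> frontier T"
proof -
  have "negligible (\<Union>T\<in>\<T>. frontier T)"
    by (rule negligible_Union)
       (use mesh_finite[OF m] mesh_element(3)[OF L m] negligible_convex_frontier in auto)
  then have "(\<Union>T\<in>\<T>. frontier T) \<in> null_sets lebesgue" by (simp add: negligible_iff_null_sets)
  from AE_not_in[OF this] show ?thesis by eventually_elim auto
qed

text \<open>Closed elements share edges, but off their frontiers membership means interior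
  membership, and interiors are disjoint; so indicators add up without overlap.\<close>

lemma mesh_partition:
  assumes L: "lipschitz_domain \<Omega>" and m: "mesh \<Omega> \<T>" and x: "\<forall>T\<in>\<T>. x \<notin> frontier T"
  shows "indicator \<Omega> x = (\<Sum>T\<in>\<T>. indicator T x :: real)"
    "\<And>T. T \<in> \<T> \<Longrightarrow> x \<in> T \<Longrightarrow> x \<in> interior T"
proof -
  show int: "x \<in> interior T" if "T \<in> \<T>" "x \<in> T" for T
    using x that mesh_element(2)[OF L m that(1)] closure_closed compact_imp_closed
    unfolding frontier_def by fastforce
  show "indicator \<Omega> x = (\<Sum>T\<in>\<T>. indicator T x :: real)"
  proof (cases "x \<in> \<Omega>")
    case True
    then have "x \<in> \<Union>\<T>" using m closure_subset by (auto simp: mesh_def)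
    then obtain T where T: "T \<in> \<T>" "x \<in> T" by auto
    have "indicator T' x = (if T' = T then 1 else 0 :: real)" if "T' \<in> \<T>" for T'
      using mesh_disjoint_interiors[OF m T(1) that] int[OF T] int[OF that] T by (auto simp: indicator_def)
    then have "(\<Sum>T'\<in>\<T>. indicator T' x :: real) = (\<Sum>T'\<in>\<T>. if T' = T then 1 else 0)" by (intro sum.cong) auto
    then show ?thesis using T True mesh_finite[OF m] by simp
  next
    case False
    then have "x \<notin> T" if "T \<in> \<T>" for T using int[OF that] mesh_element(4)[OF L m that] by auto
    then show ?thesis using False by (auto simp: indicator_def)
  qed
qed

text \<open>Two triangles on the same edge lie either on the same side, and then their interiors
  overlap, or on opposite sides, and then they fill a neighbourhood of the midpoint, which would be
  interior to \<open>closure \<Omega>\<close> and hence belong to \<open>\<Omega>\<close>. Both are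
  impossible on the boundary. This makes \<open>bdry_elt\<close> well defined.\<close>

lemma boundary_edge_unique:
  assumes L: "lipschitz_domain \<Omega>" and m: "mesh \<Omega> \<T>" and E: "E \<in> boundary_edges \<Omega> \<T>"
    and T: "T \<in> \<T>" "T' \<in> \<T>" "E edge_of T" "E edge_of T'"
  shows "T = T'"
proof (rule ccontr)
  assume ne: "T \<noteq> T'"
  obtain a b c where abc: "triangle a b c" "T = convex hull {a, b, c}" "E = closed_segment a b"
    using edge_of_triangle[OF mesh_element(1)[OF L m T(1)] T(3)] by blast
  obtain a' b' c' where abc': "triangle a' b' c'" "T' = convex hull {a', b', c'}" "E = closed_segment a' b'"
    using edge_of_triangle[OF mesh_element(1)[OF L m T(2)] T(4)] by blast
  have "{a, b} = {a', b'}" using abc(3) abc'(3) by (simp add: closed_segment_eq)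
  then have T': "T' = convex hull {a, b, c'}" and tri': "triangle a b c'"
    using abc' by (auto simp: doubleton_eq_iff triangle_def insert_commute)
  obtain p q r where bc: "continuous_on UNIV p" "continuous_on UNIV q" "continuous_on UNIV r"
    "\<And>x. x = p x *\<^sub>R a + q x *\<^sub>R b + r x *\<^sub>R c" "\<And>x. p x + q x + r x = 1"
    "\<And>p' q' r'. p' + q' + r' = 1 \<Longrightarrow> p (p' *\<^sub>R a + q' *\<^sub>R b + r' *\<^sub>R c) = p' \<and>
       q (p' *\<^sub>R a + q' *\<^sub>R b + r' *\<^sub>R c) = q' \<and> r (p' *\<^sub>R a + q' *\<^sub>R b + r' *\<^sub>R c) = r'"
    using barycentric[OF triangleD[OF abc(1)]] by blast
  obtain p2 q2 r2 where bc2: "continuous_on UNIV p2" "continuous_on UNIV q2" "continuous_on UNIV r2"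
    "\<And>x. x = p2 x *\<^sub>R a + q2 x *\<^sub>R b + r2 x *\<^sub>R c'" "\<And>x. p2 x + q2 x + r2 x = 1"
    "\<And>p' q' r'. p' + q' + r' = 1 \<Longrightarrow> p2 (p' *\<^sub>R a + q' *\<^sub>R b + r' *\<^sub>R c') = p' \<and>
       q2 (p' *\<^sub>R a + q' *\<^sub>R b + r' *\<^sub>R c') = q' \<and> r2 (p' *\<^sub>R a + q' *\<^sub>R b + r' *\<^sub>R c') = r'"
    using barycentric[OF triangleD[OF tri']] by blast
  define \<gamma> where "\<gamma> = r c'"
  \<comment> \<open>Both third coordinates are affine and vanish on the line through
    \<open>a\<close> and \<open>b\<close>, so they are proportional; the sign of
    \<open>\<gamma>\<close> tells on which side of it \<open>c'\<close> lies.\<close>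
  have r_r2: "r x = r2 x * \<gamma>" for x
  proof -
    have "x = p2 x *\<^sub>R a + q2 x *\<^sub>R b + r2 x *\<^sub>R (p c' *\<^sub>R a + q c' *\<^sub>R b + r c' *\<^sub>R c)"
      using bc2(4)[of x] bc(4)[of c'] by simp
    also have "\<dots> = (p2 x + r2 x * p c') *\<^sub>R a + (q2 x + r2 x * q c') *\<^sub>R b + (r2 x * r c') *\<^sub>R c"
      by (simp add: algebra_simps)
    finally have x: "x = (p2 x + r2 x * p c') *\<^sub>R a + (q2 x + r2 x * q c') *\<^sub>R b + (r2 x * r c') *\<^sub>R c" .
    have "(p2 x + r2 x * p c') + (q2 x + r2 x * q c') + r2 x * r c' = p2 x + q2 x + r2 x * (p c' + q c' + r c')"
      by (simp add: algebra_simps)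
    also have "\<dots> = 1" using bc(5)[of c'] bc2(5)[of x] by simp
    finally show ?thesis using bc(6)[of "p2 x + r2 x * p c'" "q2 x + r2 x * q c'" "r2 x * r c'"] x
      by (simp add: \<gamma>_def)
  qed
  have inT: "x \<in> T" if "p x \<ge> 0" "q x \<ge> 0" "r x \<ge> 0" for x
    unfolding abc(2) convex_hull_3 using that bc(4,5)[of x] by blast
  have inT': "x \<in> T'" if "p2 x \<ge> 0" "q2 x \<ge> 0" "r2 x \<ge> 0" for x
    unfolding T' convex_hull_3 using that bc2(4,5)[of x] by blast
  have openP: "open {x. f x > (0::real)}" if "continuous_on UNIV f" for f :: "pt \<Rightarrow> real"
    by (intro open_Collect_less continuous_intros that)
  define W where "W = {x. p x > 0} \<inter> {x. q x > 0} \<inter> {x. p2 x > 0} \<inter> {x. q2 x > 0}"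
  have oW: "open W" unfolding W_def by (intro open_Int openP bc bc2)
  define mid where "mid = (1/2) *\<^sub>R a + (1/2) *\<^sub>R b"
  have mid: "p mid = 1/2" "q mid = 1/2" "p2 mid = 1/2" "q2 mid = 1/2" "r mid = 0"
    using bc(6)[of "1/2" "1/2" 0] bc2(6)[of "1/2" "1/2" 0] by (auto simp: mid_def)
  have midW: "mid \<in> W" by (simp add: W_def mid)
  have midE: "mid \<in> E" unfolding abc(3) mid_def closed_segment_def by (auto intro!: exI[of _ "1/2"])
  show False
  proof (cases "\<gamma> > 0")
    case True
    have "r2 mid = 0" using r_r2[of mid] mid True by simp
    obtain e where e: "e > 0" "ball mid e \<subseteq> W" using oW midW by (meson openE)
    define d where "d = min 1 (e / (2 * (norm (c - mid) + 1)))"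
    have d: "0 < d" "d * norm (c - mid) < e"
    proof -
      have n: "norm (c - mid) + 1 > 0" by (simp add: add_nonneg_pos)
      show "0 < d" using e n by (simp add: d_def)
      have "d * norm (c - mid) \<le> (e / (2 * (norm (c - mid) + 1))) * norm (c - mid)"
        by (intro mult_right_mono) (auto simp: d_def)
      also have "\<dots> < e" using e n by (simp add: field_simps add_pos_nonneg)
      finally show "d * norm (c - mid) < e" .
    qed
    \<comment> \<open>A small step from the midpoint towards \<open>c\<close> makes both third
      coordinates positive without leaving \<open>W\<close>.\<close>
    define z where "z = mid + d *\<^sub>R (c - mid)"
    have zW: "z \<in> W" using e d by (intro subsetD[OF e(2)]) (simp add: z_def dist_norm)
    have z_eq: "z = ((1 - d) / 2) *\<^sub>R a + ((1 - d) / 2) *\<^sub>R b + d *\<^sub>R c"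
      by (simp add: z_def mid_def algebra_simps diff_divide_distrib)
    have "r z = d" using bc(6)[of "(1-d)/2" "(1-d)/2" d] z_eq by (simp add: field_simps)
    then have rz: "r z > 0" "r2 z > 0" using d True r_r2[of z] by (auto simp: zero_less_mult_iff)
    let ?V = "W \<inter> {x. r x > 0} \<inter> {x. r2 x > 0}"
    have "open ?V" by (intro open_Int oW openP bc bc2)
    moreover have "?V \<subseteq> T" "?V \<subseteq> T'" using inT inT' by (auto simp: W_def less_imp_le)
    ultimately have "?V \<subseteq> interior T" "?V \<subseteq> interior T'"
      using interior_maximal[of ?V T] interior_maximal[of ?V T'] by blast+
    moreover have "z \<in> ?V" using zW rz by simp
    ultimately show False using mesh_disjoint_interiors[OF m T(1,2) ne] by blast
  next
    case False
    \<comment> \<open>Since \<open>\<gamma>\<close> is not positive, \<open>r x < 0\<close> forces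
      \<open>r2 x \<ge> 0\<close>; each point of \<open>W\<close> lies in one of the two
      triangles.\<close>
    have "W \<subseteq> T \<union> T'"
    proof
      fix x assume x: "x \<in> W"
      show "x \<in> T \<union> T'"
      proof (cases "r x \<ge> 0")
        case True then show ?thesis using x inT[of x] by (simp add: W_def)
      next
        case False2: False
        then have "r2 x \<ge> 0" using r_r2[of x] \<open>\<not> \<gamma> > 0\<close> by (metis linear mult_nonpos_nonpos not_le)
        then show ?thesis using x inT'[of x] by (simp add: W_def)
      qed
    qed
    also have "\<dots> \<subseteq> closure \<Omega>" using mesh_element(5)[OF L m] T by blast
    finally have "W \<subseteq> interior (closure \<Omega>)" using oW by (intro interior_maximal)
    then have "mid \<in> \<Omega>" using midW lipschitz_domain_interior_closure[OF L] by blast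
    moreover have "mid \<in> frontier \<Omega>" using E midE by (auto simp: boundary_edges_def)
    moreover have "open \<Omega>" using L by (simp add: lipschitz_domain_def)
    ultimately show False by (simp add: frontier_def interior_open)
  qed
qed

lemma bdry_elt_eq:
  assumes L: "lipschitz_domain \<Omega>" and m: "mesh \<Omega> \<T>" and E: "E \<in> boundary_edges \<Omega> \<T>" and T: "T \<in> \<T>" "E edge_of T"
  shows "bdry_elt \<T> E = T"
  unfolding bdry_elt_def patch_def
  by (rule the_equality) (use boundary_edge_unique[OF L m E] T in auto)

text \<open>Two common points make the intersection of the edges a face of
  \<open>T \<inter> T'\<close> of dimension at least one, whereas a proper face of an edge has
  smaller dimension. Thus distinct edges overlap in a set without arc length.\<close>

lemma distinct_edges_finite_Int:
  assumes L: "lipschitz_domain \<Omega>" and m: "mesh \<Omega> \<T>" and T: "T \<in> \<T>" "T' \<in> \<T>" "E edge_of T" "E' edge_of T'" "E \<noteq> E'"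
  shows "p \<in> E \<inter> E' \<Longrightarrow> q \<in> E \<inter> E' \<Longrightarrow> p = q"
proof (rule ccontr)
  assume pq: "p \<in> E \<inter> E'" "q \<in> E \<inter> E'" "p \<noteq> q"
  have f: "(T \<inter> T') face_of T" "(T' \<inter> T) face_of T'"
    using m T by (auto simp: mesh_def triangulation_def)
  then have f: "(T \<inter> T') face_of T" "(T \<inter> T') face_of T'" by (simp_all add: Int_commute)
  have E: "E face_of T" "E' face_of T'" "aff_dim E = 1" "aff_dim E' = 1" using T by (auto simp: edge_of_def)
  have cvx: "convex E" "convex E'" using E face_of_imp_convex mesh_element(3)[OF L m] T by blast+
  have sub: "E \<subseteq> T" "E' \<subseteq> T'" using E face_of_imp_subset by auto
  have dim: "1 \<le> aff_dim S" if "p \<in> S" "q \<in> S" for S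
  proof -
    have "aff_dim {p, q} = 1" using pq(3) by (simp add: aff_dim_2)
    then show ?thesis using aff_dim_subset[of "{p, q}" S] that by simp
  qed
  have 1: "E \<inter> (T \<inter> T') = E"
  proof (rule ccontr)
    assume n: "E \<inter> (T \<inter> T') \<noteq> E"
    have "(E \<inter> (T \<inter> T')) face_of T" by (rule face_of_Int[OF E(1) f(1)])
    then have "(E \<inter> (T \<inter> T')) face_of E" using sub by (meson face_of_subset inf_le1)
    from face_of_aff_dim_lt[OF cvx(1) this n] dim[of "E \<inter> (T \<inter> T')"] pq sub E(3) show False by auto
  qed
  have 2: "E' \<inter> (T \<inter> T') = E'"
  proof (rule ccontr)
    assume n: "E' \<inter> (T \<inter> T') \<noteq> E'"
    have "(E' \<inter> (T \<inter> T')) face_of T'" by (rule face_of_Int[OF E(2) f(2)])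
    then have "(E' \<inter> (T \<inter> T')) face_of E'" using sub by (meson face_of_subset inf_le1)
    from face_of_aff_dim_lt[OF cvx(2) this n] dim[of "E' \<inter> (T \<inter> T')"] pq sub E(4) show False by auto
  qed
  have fE: "E face_of (T \<inter> T')" using face_of_subset[OF E(1)] 1 by blast
  have fE': "E' face_of (T \<inter> T')" using face_of_subset[OF E(2)] 2 by blast
  have EE: "(E \<inter> E') face_of (T \<inter> T')" by (rule face_of_Int[OF fE fE'])
  have "E \<inter> E' = E"
    using face_of_aff_dim_lt[OF cvx(1) face_of_subset[OF EE]] dim[of "E \<inter> E'"] pq 1 E(3) by fastforce
  moreover have "E \<inter> E' = E'"
    using face_of_aff_dim_lt[OF cvx(2) face_of_subset[OF EE]] dim[of "E \<inter> E'"] pq 2 E(4) by fastforce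
  ultimately show False using T(5) by blast
qed

text \<open>A boundary point lies in some element of the mesh but not in its interior, which is
  inside \<open>\<Omega>\<close>; so it is on one of the three sides. Nothing is claimed about that
  side being a boundary edge, hence the later covering by all edges.\<close>

lemma boundary_edge_covered:
  assumes L: "lipschitz_domain \<Omega>" and m0: "mesh \<Omega> \<T>0" and E: "E \<subseteq> frontier \<Omega>" and x: "x \<in> E"
  shows "\<exists>T\<in>\<T>0. \<exists>E'. E' edge_of T \<and> x \<in> E'"
proof -
  have "x \<in> closure \<Omega>" "x \<notin> \<Omega>" using E x L by (auto simp: frontier_def interior_open lipschitz_domain_def)
  then obtain T where T: "T \<in> \<T>0" "x \<in> T" using m0 by (auto simp: mesh_def)
  have "x \<notin> interior T" using mesh_element(4)[OF L m0 T(1)] \<open>x \<notin> \<Omega>\<close> by blast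
  obtain a b c where abc: "triangle a b c" "T = convex hull {a, b, c}"
    using simplex2_triangle[OF mesh_element(1)[OF L m0 T(1)]] by blast
  have nd: "\<not> affine_dependent {a, b, c}" using abc(1) by (rule triangleD)
  have "x \<in> frontier T" using T \<open>x \<notin> interior T\<close> closure_subset by (auto simp: frontier_def)
  moreover have "frontier T = closed_segment a b \<union> closed_segment b c \<union> closed_segment c a"
    unfolding abc(2) by (rule frontier_of_triangle) simp
  ultimately have x3: "x \<in> closed_segment a b \<or> x \<in> closed_segment b c \<or> x \<in> closed_segment c a" by blast
  have ed: "closed_segment u v edge_of T" if "u \<in> {a, b, c}" "v \<in> {a, b, c}" "u \<noteq> v" for u v
  proof -
    have "convex hull {u, v} face_of T"
      unfolding abc(2) face_of_convex_hull_affine_independent[OF nd]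
      by (rule exI[of _ "{u, v}"]) (use that in auto)
    then show ?thesis unfolding edge_of_def segment_convex_hull
      using that(3) by (simp add: aff_dim_convex_hull aff_dim_2)
  qed
  from x3 show ?thesis
    using T(1) ed[of a b] ed[of b c] ed[of c a] triangleD(2-4)[OF abc(1)] by auto
qed

section \<open>Integrals over the mesh\<close>

text \<open>Elements are closed and may reach the boundary of \<open>\<Omega>\<close>, where nothing
  is known about \<open>f\<close>; the frontier of a convex set is negligible, so measurability on
  the interior is enough.\<close>

lemma mesh_measurable:
  fixes f :: "pt \<Rightarrow> 'b::euclidean_space"
  assumes L: "lipschitz_domain \<Omega>" and m: "mesh \<Omega> \<T>" and T: "T \<in> \<T>"
    and f: "f \<in> borel_measurable (lebesgue_on \<Omega>)"
  shows "f \<in> borel_measurable (lebesgue_on T)"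
proof -
  note me = mesh_element[OF L m T]
  have Tl: "T \<in> sets lebesgue" using me(2) by (simp add: lmeasurable_compact fmeasurableD)
  have "f \<in> borel_measurable (lebesgue_on (interior T))"
    using measurable_restrict_mono[OF f me(4)] .
  then have "f measurable_on interior T" by (subst measurable_on_iff_borel_measurable) (auto simp: lmeasurable_open)
  moreover have "negligible ((interior T - T) \<union> (T - interior T))"
  proof (rule negligible_subset[OF negligible_convex_frontier[OF me(3)]])
    show "(interior T - T) \<union> (T - interior T) \<subseteq> frontier T"
      using interior_subset closure_subset by (auto simp: frontier_def)
  qed
  ultimately have "f measurable_on T" by (rule measurable_on_spike_set)
  then show ?thesis using Tl by (simp add: measurable_on_iff_borel_measurable)
qed

lemma mesh_sets: 
  assumes L: "lipschitz_domain \<Omega>" and m: "mesh \<Omega> \<T>" and T: "T \<in> \<T>"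
  shows "T \<in> sets borel" "T \<in> sets lebesgue" "T \<in> lmeasurable" "bounded T"
  using mesh_element(2)[OF L m T] by (auto simp: compact_imp_closed borel_closed lmeasurable_compact compact_imp_bounded)

text \<open>Element frontiers are null sets, so almost everywhere the indicator of
  \<open>\<Omega>\<close> is the sum of the indicators of the elements.\<close>

lemma mesh_integral:
  fixes f :: "pt \<Rightarrow> 'b::euclidean_space"
  assumes L: "lipschitz_domain \<Omega>" and m: "mesh \<Omega> \<T>" and f: "integrable (lebesgue_on \<Omega>) f"
  shows "\<And>T. T \<in> \<T> \<Longrightarrow> integrable (lebesgue_on T) f"
    "(\<integral>x. f x \<partial>lebesgue_on \<Omega>) = (\<Sum>T\<in>\<T>. \<integral>x. f x \<partial>lebesgue_on T)"
proof -
  have \<Omega>l: "\<Omega> \<in> sets lebesgue" using L by (simp add: lipschitz_domain_def lmeasurable_open)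
  let ?g = "\<lambda>x. indicat_real \<Omega> x *\<^sub>R f x"
  have g: "integrable lebesgue ?g" using f \<Omega>l by (simp add: integrable_restrict_space)
  have fm: "f \<in> borel_measurable (lebesgue_on \<Omega>)" using f by simp
  have mT: "(\<lambda>x. indicat_real T x *\<^sub>R f x) \<in> borel_measurable lebesgue" if "T \<in> \<T>" for T
    using mesh_measurable[OF L m that fm] mesh_sets(2)[OF L m that]
    by (simp add: borel_measurable_restrict_space_iff)
  have ae: "AE x in lebesgue. indicat_real T x *\<^sub>R f x = indicat_real T x *\<^sub>R ?g x" if T: "T \<in> \<T>" for T
    using mesh_AE[OF L m]
  proof eventually_elim
    case (elim x)
    then show ?case using mesh_partition(2)[OF L m elim T] mesh_element(4)[OF L m T] by (auto simp: indicator_def)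
  qed
  have iT: "integrable lebesgue (\<lambda>x. indicat_real T x *\<^sub>R f x)" if T: "T \<in> \<T>" for T
  proof (rule integrable_cong_AE_imp[OF _ mT[OF T]])
    show "integrable lebesgue (\<lambda>x. indicat_real T x *\<^sub>R ?g x)"
      by (rule integrable_mult_indicator[OF mesh_sets(2)[OF L m T] g])
    show "AE x in lebesgue. indicat_real T x *\<^sub>R ?g x = indicat_real T x *\<^sub>R f x"
      using ae[OF T] by eventually_elim (rule sym)
  qed
  show "integrable (lebesgue_on T) f" if T: "T \<in> \<T>" for T
    using iT[OF T] mesh_sets(2)[OF L m T] by (simp add: integrable_restrict_space)
  have "(\<integral>x. f x \<partial>lebesgue_on \<Omega>) = (\<integral>x. ?g x \<partial>lebesgue)"
    using \<Omega>l by (simp add: integral_restrict_space)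
  also have "\<dots> = (\<integral>x. (\<Sum>T\<in>\<T>. indicat_real T x *\<^sub>R f x) \<partial>lebesgue)"
  proof (rule integral_cong_AE)
    show "?g \<in> borel_measurable lebesgue" using g by simp
    show "(\<lambda>x. \<Sum>T\<in>\<T>. indicat_real T x *\<^sub>R f x) \<in> borel_measurable lebesgue"
      by (intro borel_measurable_sum mT)
    show "AE x in lebesgue. ?g x = (\<Sum>T\<in>\<T>. indicat_real T x *\<^sub>R f x)"
      using mesh_AE[OF L m] by eventually_elim (simp add: mesh_partition(1)[OF L m] scaleR_sum_left)
  qed
  also have "\<dots> = (\<Sum>T\<in>\<T>. \<integral>x. indicat_real T x *\<^sub>R f x \<partial>lebesgue)"
    by (rule Bochner_Integration.integral_sum) (rule iT)
  also have "\<dots> = (\<Sum>T\<in>\<T>. \<integral>x. f x \<partial>lebesgue_on T)"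
    by (intro sum.cong refl) (use mesh_sets(2)[OF L m] in \<open>simp add: integral_restrict_space\<close>)
  finally show "(\<integral>x. f x \<partial>lebesgue_on \<Omega>) = (\<Sum>T\<in>\<T>. \<integral>x. f x \<partial>lebesgue_on T)" .
qed

lemma mesh_L2:
  fixes f :: "pt \<Rightarrow> 'b::euclidean_space"
  assumes L: "lipschitz_domain \<Omega>" and m: "mesh \<Omega> \<T>" and f: "L2 (lebesgue_on \<Omega>) f"
  shows "\<And>T. T \<in> \<T> \<Longrightarrow> L2 (lebesgue_on T) f"
    "(L2norm (lebesgue_on \<Omega>) f)\<^sup>2 = (\<Sum>T\<in>\<T>. (L2norm (lebesgue_on T) f)\<^sup>2)"
  using mesh_integral[OF L m L2D(2)[OF f]] mesh_measurable[OF L m _ L2D(1)[OF f]]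
  by (auto simp: L2_def L2norm_power2)

lemma glue_interior:
  assumes m: "mesh \<Omega> \<T>" and T: "T \<in> \<T>" and x: "x \<in> interior T"
  shows "glue \<T> v x = v T x"
proof -
  have "indicator (interior T') x *\<^sub>R v T' x = (if T' = T then v T x else 0)" if "T' \<in> \<T>" for T'
    using mesh_disjoint_interiors[OF m T that] x by (auto simp: indicator_def)
  then have "glue \<T> v x = (\<Sum>T'\<in>\<T>. if T' = T then v T x else 0)" unfolding glue_def by (intro sum.cong) auto
  then show ?thesis using T mesh_finite[OF m] by simp
qed

lemma glue_AE:
  assumes L: "lipschitz_domain \<Omega>" and m: "mesh \<Omega> \<T>" and T: "T \<in> \<T>"
  shows "AE x in lebesgue_on T. glue \<T> v x = v T x"
proof -
  have "AE x in lebesgue. x \<in> T \<longrightarrow> glue \<T> v x = v T x"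
    using mesh_AE[OF L m]
    by eventually_elim (use glue_interior[OF m T] mesh_partition(2)[OF L m _ T] in blast)
  then show ?thesis using mesh_sets(2)[OF L m T] by (simp add: AE_restrict_space_iff)
qed

lemma glue_L2:
  fixes v :: "pt set \<Rightarrow> pt \<Rightarrow> 'b::euclidean_space"
  assumes L: "lipschitz_domain \<Omega>" and m: "mesh \<Omega> \<T>" and v: "\<And>T. T \<in> \<T> \<Longrightarrow> continuous_on UNIV (v T)"
  shows "L2 (lebesgue_on \<Omega>) (glue \<T> v)"
proof -
  have \<Omega>: "\<Omega> \<in> sets lebesgue" "bounded \<Omega>" using L by (auto simp: lipschitz_domain_def lmeasurable_open)
  have "L2 (lebesgue_on \<Omega>) (\<lambda>x. \<Sum>T\<in>\<T>. indicator (interior T) x *\<^sub>R v T x)"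
  proof (rule L2_sum[OF mesh_finite[OF m]])
    fix T assume T: "T \<in> \<T>"
    show "L2 (lebesgue_on \<Omega>) (\<lambda>x. indicator (interior T) x *\<^sub>R v T x)"
    proof (rule L2_bound(1)[OF L2_continuous_lebesgue_on[OF v[OF T] \<Omega>]])
      show "(\<lambda>x. indicator (interior T) x *\<^sub>R v T x) \<in> borel_measurable (lebesgue_on \<Omega>)"
        by (intro measurable_restrict_space1 measurable_completion)
           (simp add: borel_measurable_continuous_onI[OF v[OF T]] borel_measurable_scaleR borel_measurable_indicator borel_open)
    qed (auto simp: indicator_def intro!: AE_I2)
  qed
  then show ?thesis by (simp add: glue_def[abs_def])
qed

section \<open>Comparison of boundary integrals of two meshes\<close>

text \<open>All segments on one line are given the same arc length parameter \<open>t\<close>, which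
  makes edges of different meshes comparable.\<close>

lemma nn_integral_arclen_line:
  fixes p d :: pt
  assumes d: "norm d = 1" and f: "f \<in> borel_measurable borel" and ab: "\<alpha> \<noteq> \<beta>"
    and E: "E = closed_segment (p + \<alpha> *\<^sub>R d) (p + \<beta> *\<^sub>R d)"
  shows "(\<integral>\<^sup>+x. f x \<partial>arclen E) = (\<integral>\<^sup>+t. indicator E (p + t *\<^sub>R d) * f (p + t *\<^sub>R d) \<partial>lborel)"
proof -
  have main: "(\<integral>\<^sup>+x. f x \<partial>arclen (closed_segment (p + \<alpha> *\<^sub>R d) (p + \<beta> *\<^sub>R d)))
    = (\<integral>\<^sup>+t. indicator (closed_segment (p + \<alpha> *\<^sub>R d) (p + \<beta> *\<^sub>R d)) (p + t *\<^sub>R d) * f (p + t *\<^sub>R d) \<partial>lborel)"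
    if lt: "\<alpha> < \<beta>" for \<alpha> \<beta>
  proof -
    have mf: "(\<lambda>t. f (p + t *\<^sub>R d)) \<in> borel_measurable borel"
      by (rule measurable_compose[OF _ f]) (intro borel_measurable_continuous_onI continuous_intros)
    have d0: "d \<noteq> 0" using d by auto
    have dist: "dist (p + \<alpha> *\<^sub>R d) (p + \<beta> *\<^sub>R d) = \<beta> - \<alpha>"
      using lt d by (simp add: dist_norm flip: scaleR_diff_left)
    have ind: "indicator (closed_segment (p + \<alpha> *\<^sub>R d) (p + \<beta> *\<^sub>R d)) (p + t *\<^sub>R d) = (indicator {\<alpha>..\<beta>} t :: ennreal)" for t
    proof -
      have "p + t *\<^sub>R d \<in> closed_segment (p + \<alpha> *\<^sub>R d) (p + \<beta> *\<^sub>R d) \<longleftrightarrow> t \<in> closed_segment \<alpha> \<beta>"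
      proof
        assume "p + t *\<^sub>R d \<in> closed_segment (p + \<alpha> *\<^sub>R d) (p + \<beta> *\<^sub>R d)"
        then obtain u where u: "0 \<le> u" "u \<le> 1" "p + t *\<^sub>R d = (1 - u) *\<^sub>R (p + \<alpha> *\<^sub>R d) + u *\<^sub>R (p + \<beta> *\<^sub>R d)"
          by (auto simp: closed_segment_def)
        have "(1 - u) *\<^sub>R (p + \<alpha> *\<^sub>R d) + u *\<^sub>R (p + \<beta> *\<^sub>R d) = p + ((1 - u) * \<alpha> + u * \<beta>) *\<^sub>R d"
          by (simp add: algebra_simps)
        then have "t *\<^sub>R d = ((1 - u) * \<alpha> + u * \<beta>) *\<^sub>R d" using u(3) by simp
        then have "t = (1 - u) * \<alpha> + u * \<beta>" using d0 by simp
        then show "t \<in> closed_segment \<alpha> \<beta>" using u by (auto simp: closed_segment_def)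
      next
        assume "t \<in> closed_segment \<alpha> \<beta>"
        then obtain u where u: "0 \<le> u" "u \<le> 1" "t = (1 - u) * \<alpha> + u * \<beta>"
          by (auto simp: closed_segment_def)
        have "p + t *\<^sub>R d = (1 - u) *\<^sub>R (p + \<alpha> *\<^sub>R d) + u *\<^sub>R (p + \<beta> *\<^sub>R d)"
          unfolding u(3) by (simp add: algebra_simps)
        then show "p + t *\<^sub>R d \<in> closed_segment (p + \<alpha> *\<^sub>R d) (p + \<beta> *\<^sub>R d)"
          unfolding closed_segment_def using u by blast
      qed
      also have "closed_segment \<alpha> \<beta> = {\<alpha>..\<beta>}" using lt by (simp add: closed_segment_eq_real_ivl)
      finally show ?thesis by (simp add: indicator_def)
    qed
    have "(\<integral>\<^sup>+t. indicator {\<alpha>..\<beta>} t * f (p + t *\<^sub>R d) \<partial>lborel)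
      = ennreal (\<beta> - \<alpha>) * (\<integral>\<^sup>+u. indicator {\<alpha>..\<beta>} (\<alpha> + (\<beta> - \<alpha>) * u) * f (p + (\<alpha> + (\<beta> - \<alpha>) * u) *\<^sub>R d) \<partial>lborel)"
      using lt mf by (subst nn_integral_real_affine[where c="\<beta> - \<alpha>" and t=\<alpha>]) auto
    also have "(\<lambda>u. indicator {\<alpha>..\<beta>} (\<alpha> + (\<beta> - \<alpha>) * u) * f (p + (\<alpha> + (\<beta> - \<alpha>) * u) *\<^sub>R d))
      = (\<lambda>u. indicator {0..1} u * f (linepath (p + \<alpha> *\<^sub>R d) (p + \<beta> *\<^sub>R d) u))"
    proof (rule ext)
      fix u :: real
      have lp: "linepath (p + \<alpha> *\<^sub>R d) (p + \<beta> *\<^sub>R d) u = p + (\<alpha> + (\<beta> - \<alpha>) * u) *\<^sub>R d"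
        by (simp add: linepath_def algebra_simps)
      have "(\<beta> - \<alpha>) * u \<le> \<beta> - \<alpha> \<longleftrightarrow> u \<le> 1" using lt by (metis diff_gt_0_iff_gt mult.right_neutral mult_le_cancel_left_pos)
      moreover have "\<alpha> + (\<beta> - \<alpha>) * u \<le> \<beta> \<longleftrightarrow> (\<beta> - \<alpha>) * u \<le> \<beta> - \<alpha>" by linarith
      ultimately have "\<alpha> + (\<beta> - \<alpha>) * u \<in> {\<alpha>..\<beta>} \<longleftrightarrow> u \<in> {0..1}" using lt
        by (auto simp: zero_le_mult_iff)
      with lp show "indicator {\<alpha>..\<beta>} (\<alpha> + (\<beta> - \<alpha>) * u) * f (p + (\<alpha> + (\<beta> - \<alpha>) * u) *\<^sub>R d)
        = indicator {0..1} u * f (linepath (p + \<alpha> *\<^sub>R d) (p + \<beta> *\<^sub>R d) u)"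
        by (simp add: indicator_def)
    qed
    finally show ?thesis unfolding ind nn_integral_arclen[OF f] dist by simp
  qed
  show ?thesis
  proof (cases "\<alpha> < \<beta>")
    case True then show ?thesis using main[OF True] E by simp
  next
    case False
    then have "\<beta> < \<alpha>" using ab by simp
    from main[OF this] show ?thesis using E by (simp add: closed_segment_commute)
  qed
qed

lemma segment_line_Int:
  fixes p d u v :: pt
  assumes d: "d \<noteq> 0" and t: "t1 \<noteq> t2" "p + t1 *\<^sub>R d \<in> closed_segment u v" "p + t2 *\<^sub>R d \<in> closed_segment u v"
  obtains \<alpha> \<beta> where "u = p + \<alpha> *\<^sub>R d" "v = p + \<beta> *\<^sub>R d"
proof -
  obtain s1 s2 where s: "p + t1 *\<^sub>R d = u + s1 *\<^sub>R (v - u)" "p + t2 *\<^sub>R d = u + s2 *\<^sub>R (v - u)"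
    using t(2,3) by (auto simp: closed_segment_def algebra_simps)
  have "(t2 - t1) *\<^sub>R d = (s2 - s1) *\<^sub>R (v - u)"
  proof -
    have "(t2 - t1) *\<^sub>R d = (p + t2 *\<^sub>R d) - (p + t1 *\<^sub>R d)" by (simp add: algebra_simps)
    also have "\<dots> = (s2 - s1) *\<^sub>R (v - u)" unfolding s by (simp add: algebra_simps)
    finally show ?thesis .
  qed
  moreover from this have "s2 \<noteq> s1" using t(1) d by auto
  ultimately have vu: "v - u = ((t2 - t1) / (s2 - s1)) *\<^sub>R d"
    by (metis (no_types, opaque_lifting) divide_inverse_commute eq_iff_diff_eq_0 scaleR_scaleR left_inverse scaleR_one)
  define k where "k = (t2 - t1) / (s2 - s1)"
  have u: "u = p + (t1 - s1 * k) *\<^sub>R d"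
    using s(1) unfolding vu k_def[symmetric] by (simp add: algebra_simps)
  have "v = p + (t1 - s1 * k + k) *\<^sub>R d"
    using vu u unfolding k_def[symmetric] by (simp add: algebra_simps)
  with u show ?thesis by (rule that)
qed

lemma arclen_finite_AE:
  fixes u v :: pt
  assumes "u \<noteq> v" "finite A" shows "AE x in arclen (closed_segment u v). x \<notin> A"
proof -
  have "AE x in arclen (closed_segment u v). x \<noteq> y" for y
  proof -
    have y: "{y} \<in> sets borel" by simp
    have lp: "linepath u v s = linepath u v t \<Longrightarrow> s = t" for s t
    proof -
      assume "linepath u v s = linepath u v t"
      then have "(s - t) *\<^sub>R (v - u) = 0" by (simp add: linepath_def algebra_simps)
      then show "s = t" using assms(1) by simp
    qed
    have "finite {t. linepath u v t = y}"
    proof (cases "\<exists>t. linepath u v t = y")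
      case True
      then obtain t where "linepath u v t = y" by blast
      then have "{t. linepath u v t = y} \<subseteq> {t}" using lp by auto
      then show ?thesis by (rule finite_subset) simp
    qed simp
    then have "AE t in lborel. t \<notin> {t. linepath u v t = y}"
      by (intro AE_not_in finite_imp_null_set_lborel)
    then have "(\<integral>\<^sup>+t. indicator {0..1} t * indicator {y} (linepath u v t) \<partial>lborel) = (\<integral>\<^sup>+t. 0 \<partial>(lborel::real measure))"
      by (intro nn_integral_cong_AE) (auto simp: indicator_def elim!: eventually_mono)
    then have "emeasure (arclen (closed_segment u v)) {y} = 0"
      using emeasure_arclen[OF y, of u v] by simp
    then have "{y} \<in> null_sets (arclen (closed_segment u v))"
      by (rule null_setsI[OF _ subsetD[OF sets_arclen(1) y]])
    from AE_not_in[OF this] show ?thesis by simp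
  qed
  then have "AE x in arclen (closed_segment u v). \<forall>y\<in>A. x \<noteq> y"
    by (subst AE_finite_all[OF assms(2)]) simp
  then show ?thesis by eventually_elim auto
qed

definition proper_segment :: "pt set \<Rightarrow> bool" where
  "proper_segment E \<longleftrightarrow> (\<exists>u v. u \<noteq> v \<and> E = closed_segment u v)"

text \<open>Only the covering segments collinear with \<open>E\<close>, collected in
  \<open>C\<close>, matter: every other one meets the line of \<open>E\<close> at finitely many
  parameters, so all of these together form a null set.\<close>

lemma arclen_covering:
  assumes E: "proper_segment E" and S: "finite S" "\<And>E0. E0 \<in> S \<Longrightarrow> proper_segment E0" and cov: "E \<subseteq> \<Union>S"
    and f: "f \<in> borel_measurable borel"
  shows "(\<integral>\<^sup>+x. f x \<partial>arclen E) \<le> (\<Sum>E0\<in>S. \<integral>\<^sup>+x. indicator E x * f x \<partial>arclen E0)"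
proof -
  obtain p q where pq: "p \<noteq> q" "E = closed_segment p q" using E by (auto simp: proper_segment_def)
  define d where "d = (1 / norm (q - p)) *\<^sub>R (q - p)"
  have d: "norm d = 1" "d \<noteq> 0" using pq by (auto simp: d_def)
  have E_line: "E = closed_segment (p + 0 *\<^sub>R d) (p + norm (q - p) *\<^sub>R d)" using pq by (simp add: d_def)
  have E_borel: "E \<in> sets borel" using pq by (simp add: borel_closed)
  define C where "C = {E0\<in>S. \<exists>\<alpha> \<beta>. E0 = closed_segment (p + \<alpha> *\<^sub>R d) (p + \<beta> *\<^sub>R d)}"
  have mP: "(\<lambda>t. p + t *\<^sub>R d) \<in> borel_measurable borel" by (intro borel_measurable_continuous_onI continuous_intros)
  have mf: "(\<lambda>t. f (p + t *\<^sub>R d)) \<in> borel_measurable borel"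
    by (rule measurable_compose[OF mP f])
  have mi: "(\<lambda>t. indicator A (p + t *\<^sub>R d) :: ennreal) \<in> borel_measurable borel" if "A \<in> sets borel" for A
    by (rule measurable_compose[OF mP]) (use that in simp)
  have S_borel: "E0 \<in> sets borel" if "E0 \<in> S" for E0
    using S(2)[OF that] by (auto simp: proper_segment_def borel_closed)
  have fin: "finite {t. p + t *\<^sub>R d \<in> E0}" if E0: "E0 \<in> S - C" for E0
  proof (rule ccontr)
    assume inf: "infinite {t. p + t *\<^sub>R d \<in> E0}"
    then obtain t1 where t1: "p + t1 *\<^sub>R d \<in> E0" by (metis (mono_tags, lifting) Collect_empty_eq finite.emptyI)
    have "infinite ({t. p + t *\<^sub>R d \<in> E0} - {t1})" using inf by simp
    then obtain t2 where t2: "t2 \<in> {t. p + t *\<^sub>R d \<in> E0} - {t1}" using infinite_imp_nonempty by blast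
    obtain u v where uv: "E0 = closed_segment u v" using S(2)[of E0] E0 unfolding proper_segment_def by blast
    obtain \<alpha> \<beta> where "u = p + \<alpha> *\<^sub>R d" "v = p + \<beta> *\<^sub>R d"
      using segment_line_Int[OF d(2), of t1 t2 p u v] t1 t2 uv by auto
    then show False using E0 uv by (auto simp: C_def)
  qed
  have "finite (\<Union>E0\<in>S - C. {t. p + t *\<^sub>R d \<in> E0})" using S(1) fin by blast
  then have ae: "AE t in lborel. t \<notin> (\<Union>E0\<in>S - C. {t. p + t *\<^sub>R d \<in> E0})"
    by (intro AE_not_in finite_imp_null_set_lborel)
  have "(\<integral>\<^sup>+x. f x \<partial>arclen E) = (\<integral>\<^sup>+t. indicator E (p + t *\<^sub>R d) * f (p + t *\<^sub>R d) \<partial>lborel)"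
    by (rule nn_integral_arclen_line[OF d(1) f _ E_line]) (use pq in simp)
  also have "\<dots> \<le> (\<integral>\<^sup>+t. (\<Sum>E0\<in>C. indicator E0 (p + t *\<^sub>R d) * (indicator E (p + t *\<^sub>R d) * f (p + t *\<^sub>R d))) \<partial>lborel)"
  proof (rule nn_integral_mono_AE)
    show "AE t in lborel. indicator E (p + t *\<^sub>R d) * f (p + t *\<^sub>R d)
      \<le> (\<Sum>E0\<in>C. indicator E0 (p + t *\<^sub>R d) * (indicator E (p + t *\<^sub>R d) * f (p + t *\<^sub>R d)))"
      using ae
    proof eventually_elim
      case (elim t)
      show ?case
      proof (cases "p + t *\<^sub>R d \<in> E")
        case True
        then obtain E0 where E0: "E0 \<in> S" "p + t *\<^sub>R d \<in> E0" using cov by blast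
        then have "E0 \<in> C" using elim by blast
        then have "indicator E0 (p + t *\<^sub>R d) * (indicator E (p + t *\<^sub>R d) * f (p + t *\<^sub>R d))
          \<le> (\<Sum>E0\<in>C. indicator E0 (p + t *\<^sub>R d) * (indicator E (p + t *\<^sub>R d) * f (p + t *\<^sub>R d)))"
          by (intro member_le_sum) (use S(1) in \<open>auto simp: C_def\<close>)
        then show ?thesis using E0 True by simp
      qed simp
    qed
  qed
  also have "\<dots> = (\<Sum>E0\<in>C. \<integral>\<^sup>+t. indicator E0 (p + t *\<^sub>R d) * (indicator E (p + t *\<^sub>R d) * f (p + t *\<^sub>R d)) \<partial>lborel)"
    by (rule nn_integral_sum)
       (use mf mi[OF E_borel] mi[OF S_borel] in \<open>auto simp: C_def intro!: borel_measurable_times_ennreal\<close>)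
  also have "\<dots> = (\<Sum>E0\<in>C. \<integral>\<^sup>+x. indicator E x * f x \<partial>arclen E0)"
  proof (rule sum.cong[OF refl])
    fix E0 assume "E0 \<in> C"
    then obtain \<alpha> \<beta> where E0: "E0 \<in> S" "E0 = closed_segment (p + \<alpha> *\<^sub>R d) (p + \<beta> *\<^sub>R d)" by (auto simp: C_def)
    have "\<alpha> \<noteq> \<beta>"
    proof
      assume "\<alpha> = \<beta>"
      then have "E0 = {p + \<alpha> *\<^sub>R d}" using E0 by simp
      then show False using S(2)[OF E0(1)] closed_segment_eq_sing unfolding proper_segment_def by metis
    qed
    from nn_integral_arclen_line[OF d(1) _ this E0(2), of "\<lambda>x. indicator E x * f x"] E_borel f
    show "(\<integral>\<^sup>+t. indicator E0 (p + t *\<^sub>R d) * (indicator E (p + t *\<^sub>R d) * f (p + t *\<^sub>R d)) \<partial>lborel)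
       = (\<integral>\<^sup>+x. indicator E x * f x \<partial>arclen E0)" by simp
  qed
  also have "\<dots> \<le> (\<Sum>E0\<in>S. \<integral>\<^sup>+x. indicator E x * f x \<partial>arclen E0)"
    by (rule sum_mono2) (use S(1) in \<open>auto simp: C_def\<close>)
  finally show ?thesis .
qed

text \<open>After covering each \<open>E\<close> separately the order of summation is exchanged:
  almost every point of a fixed \<open>E0\<close> lies in at most one \<open>E\<close>, so the
  indicators sum to at most 1 there, and the number of edges in \<open>I\<close> does not
  enter.\<close>

lemma arclen_sum_covering:
  assumes I: "finite I" "\<And>E. E \<in> I \<Longrightarrow> proper_segment E" "\<And>E. E \<in> I \<Longrightarrow> E \<subseteq> \<Union>S"
    and disj: "\<And>E E' x y. E \<in> I \<Longrightarrow> E' \<in> I \<Longrightarrow> E \<noteq> E' \<Longrightarrow> x \<in> E \<inter> E' \<Longrightarrow> y \<in> E \<inter> E' \<Longrightarrow> x = y"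
    and S: "finite S" "\<And>E0. E0 \<in> S \<Longrightarrow> proper_segment E0"
    and f: "f \<in> borel_measurable borel"
  shows "(\<Sum>E\<in>I. \<integral>\<^sup>+x. f x \<partial>arclen E) \<le> (\<Sum>E0\<in>S. \<integral>\<^sup>+x. f x \<partial>arclen E0)"
proof -
  have borel: "E \<in> sets borel" if "proper_segment E" for E
    using that by (auto simp: proper_segment_def borel_closed)
  have "(\<Sum>E\<in>I. \<integral>\<^sup>+x. f x \<partial>arclen E) \<le> (\<Sum>E\<in>I. \<Sum>E0\<in>S. \<integral>\<^sup>+x. indicator E x * f x \<partial>arclen E0)"
    by (intro sum_mono arclen_covering I S f)
  also have "\<dots> = (\<Sum>E0\<in>S. \<Sum>E\<in>I. \<integral>\<^sup>+x. indicator E x * f x \<partial>arclen E0)" by (rule sum.swap)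
  also have "\<dots> \<le> (\<Sum>E0\<in>S. \<integral>\<^sup>+x. f x \<partial>arclen E0)"
  proof (rule sum_mono)
    fix E0 assume "E0 \<in> S"
    obtain u v where uv: "u \<noteq> v" "E0 = closed_segment u v"
      using S(2)[OF \<open>E0 \<in> S\<close>] unfolding proper_segment_def by blast
    have meas: "(\<lambda>x. indicator E x * f x) \<in> borel_measurable (arclen E0)" if "E \<in> I" for E
      unfolding uv(2) by (rule measurable_arclen) (use borel[OF I(2)[OF that]] f in simp)
    define A where "A = (\<Union>(E, E')\<in>{(E, E'). E \<in> I \<and> E' \<in> I \<and> E \<noteq> E'}. E \<inter> E')"
    have fA: "finite A" unfolding A_def
    proof (rule finite_UN_I)
      show "finite {(E, E'). E \<in> I \<and> E' \<in> I \<and> E \<noteq> E'}"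
        by (rule finite_subset[of _ "I \<times> I"]) (use I(1) in auto)
      fix P assume "P \<in> {(E, E'). E \<in> I \<and> E' \<in> I \<and> E \<noteq> E'}"
      then obtain E E' where P: "P = (E, E')" "E \<in> I" "E' \<in> I" "E \<noteq> E'" by auto
      have "finite (E \<inter> E')"
      proof (cases "E \<inter> E' = {}")
        case False
        then obtain x where "x \<in> E \<inter> E'" by blast
        then have "E \<inter> E' \<subseteq> {x}" using disj[OF P(2-4)] by blast
        then show ?thesis by (rule finite_subset) simp
      qed simp
      then show "finite (case P of (E, E') \<Rightarrow> E \<inter> E')" using P by simp
    qed
    have "(\<Sum>E\<in>I. \<integral>\<^sup>+x. indicator E x * f x \<partial>arclen E0) = (\<integral>\<^sup>+x. (\<Sum>E\<in>I. indicator E x * f x) \<partial>arclen E0)"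
      by (rule nn_integral_sum[symmetric]) (rule meas)
    also have "\<dots> \<le> (\<integral>\<^sup>+x. f x \<partial>arclen E0)"
    proof (rule nn_integral_mono_AE)
      show "AE x in arclen E0. (\<Sum>E\<in>I. indicator E x * f x) \<le> f x"
        using arclen_finite_AE[OF uv(1) fA] unfolding uv(2)
      proof eventually_elim
        case (elim x)
        show ?case
        proof (cases "\<exists>E\<in>I. x \<in> E")
          case True
          then obtain E where E: "E \<in> I" "x \<in> E" by blast
          have "indicator E' x * f x = (if E' = E then f x else 0)" if "E' \<in> I" for E'
            using elim E that unfolding A_def by (auto simp: indicator_def)
          then have "(\<Sum>E\<in>I. indicator E x * f x) = (\<Sum>E'\<in>I. if E' = E then f x else 0)" by (intro sum.cong) auto
          then show ?thesis using E I(1) by simp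
        qed (simp add: indicator_def)
      qed
    qed
    finally show "(\<Sum>E\<in>I. \<integral>\<^sup>+x. indicator E x * f x \<partial>arclen E0) \<le> (\<integral>\<^sup>+x. f x \<partial>arclen E0)" .
  qed
  finally show ?thesis .
qed

section \<open>The first positive root of the Bessel function\<close>

text \<open>With \<open>y = (x / 2)\<^sup>2\<close> these are the moduli of the terms in the power
  series of \<open>bessel_J 1 x\<close> after division by \<open>x / 2\<close>.\<close>

definition bessel_a :: "real \<Rightarrow> nat \<Rightarrow> real" where
  "bessel_a y m = y ^ m / (fact m * fact (m + 1))"

lemma bessel_a_summable: "summable (\<lambda>m. (-1) ^ m * bessel_a y m)" if "0 \<le> y"
proof (rule summable_comparison_test')
  show "summable (\<lambda>m. inverse (fact m) * y ^ m)" by (rule summable_exp)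
  show "norm ((-1) ^ m * bessel_a y m) \<le> inverse (fact m) * y ^ m" for m :: nat
  proof -
    have "1 \<le> (fact (m + 1) :: real)" by (rule fact_ge_1)
    then have "inverse (fact m * fact (m + 1) :: real) \<le> inverse (fact m)"
      by (intro le_imp_inverse_le) auto
    then have "inverse (fact m * fact (m + 1)) * y ^ m \<le> inverse (fact m) * y ^ m"
      using that by (intro mult_right_mono) auto
    moreover have "norm ((-1) ^ m * bessel_a y m) = inverse (fact m * fact (m + 1)) * y ^ m"
      using that unfolding bessel_a_def real_norm_def abs_mult by (simp add: divide_inverse del: fact_Suc)
    ultimately show ?thesis by simp
  qed
qed

lemma odd_power: "(z::real) ^ (2 * m + 1) = z * (z\<^sup>2) ^ m" "z ^ Suc (2 * m) = z * (z\<^sup>2) ^ m"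
  using power_mult[of z 2 m] by simp_all

lemma bessel_J1_eq: "bessel_J 1 x = x / 2 * (\<Sum>m. (-1) ^ m * bessel_a ((x / 2)\<^sup>2) m)"
proof -
  have s: "summable (\<lambda>m. (-1) ^ m * bessel_a ((x / 2)\<^sup>2) m)"
    by (rule bessel_a_summable) simp
  have "bessel_J 1 x = (\<Sum>m. x / 2 * ((-1) ^ m * bessel_a ((x / 2)\<^sup>2) m))"
    unfolding bessel_J_def bessel_a_def
  proof (rule suminf_cong)
    fix m
    have "(x / 2) ^ (2 * m + 1) = x / 2 * ((x / 2)\<^sup>2) ^ m" by (rule odd_power)
    then show "(-1) ^ m / (fact m * fact (m + 1)) * (x / 2) ^ (2 * m + 1)
      = x / 2 * ((-1) ^ m * (((x / 2)\<^sup>2) ^ m / (fact m * fact (m + 1))))"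
      by (simp only: divide_inverse mult_ac)
  qed
  also have "\<dots> = x / 2 * (\<Sum>m. (-1) ^ m * bessel_a ((x / 2)\<^sup>2) m)"
    by (rule suminf_mult[OF s])
  finally show ?thesis .
qed

text \<open>Consecutive terms have the ratio \<open>y / ((m + 1) * (m + 2))\<close>.\<close>

lemma bessel_a_decreasing:
  assumes "0 \<le> y" "y \<le> real ((m + 1) * (m + 2))"
  shows "bessel_a y (Suc m) \<le> bessel_a y m"
proof -
  have "bessel_a y (Suc m) = bessel_a y m * (y / real ((m + 1) * (m + 2)))"
    by (simp add: bessel_a_def field_simps)
  also have "\<dots> \<le> bessel_a y m * 1"
    using assms by (intro mult_left_mono) (auto simp: bessel_a_def divide_le_eq)
  finally show ?thesis by simp
qed

text \<open>Pairing consecutive terms of the alternating series bounds it by partial sums.\<close>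

lemma bessel_partial_sum:
  assumes y: "0 \<le> y" "y \<le> real ((2 * k + 1) * (2 * k + 2))"
  shows "(\<Sum>m<2 * k. (-1) ^ m * bessel_a y m) \<le> (\<Sum>m. (-1) ^ m * bessel_a y m)"
    "(\<Sum>m. (-1) ^ m * bessel_a y m) \<le> (\<Sum>m<2 * k + 1. (-1) ^ m * bessel_a y m)"
proof -
  let ?t = "\<lambda>m. (-1) ^ m * bessel_a y m"
  have s: "summable ?t" by (rule bessel_a_summable[OF y(1)])
  have dec: "bessel_a y (Suc m) \<le> bessel_a y m" if "2 * k \<le> m" for m
  proof (rule bessel_a_decreasing[OF y(1)])
    have "(2 * k + 1) * (2 * k + 2) \<le> (m + 1) * (m + 2)" using that by (intro mult_le_mono) auto
    then show "y \<le> real ((m + 1) * (m + 2))" using y(2) by (meson of_nat_le_iff order_trans)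
  qed
  have lim: "(\<lambda>n. \<Sum>m<n. ?t m) \<longlonglongrightarrow> (\<Sum>m. ?t m)" using s by (rule summable_LIMSEQ)
  have "(\<Sum>m<2 * k. ?t m) \<le> (\<Sum>m<2 * k + 2 * j. ?t m)" for j
  proof (induction j)
    case (Suc j)
    have "(\<Sum>m<2 * k + 2 * Suc j. ?t m) = (\<Sum>m<2 * k + 2 * j. ?t m) + (bessel_a y (2 * k + 2 * j) - bessel_a y (Suc (2 * k + 2 * j)))"
      by simp
    then show ?case using Suc dec[of "2 * k + 2 * j"] by linarith
  qed simp
  moreover have "(\<lambda>j. \<Sum>m<2 * k + 2 * j. ?t m) \<longlonglongrightarrow> (\<Sum>m. ?t m)"
    by (rule filterlim_compose[OF lim]) (rule filterlim_subseq, auto simp: strict_mono_def)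
  ultimately show "(\<Sum>m<2 * k. ?t m) \<le> (\<Sum>m. ?t m)" by (intro LIMSEQ_le_const) auto
  have "(\<Sum>m<2 * k + 1 + 2 * j. ?t m) \<le> (\<Sum>m<2 * k + 1. ?t m)" for j
  proof (induction j)
    case (Suc j)
    have "(\<Sum>m<2 * k + 1 + 2 * Suc j. ?t m) = (\<Sum>m<2 * k + 1 + 2 * j. ?t m) - (bessel_a y (2 * k + 1 + 2 * j) - bessel_a y (Suc (2 * k + 1 + 2 * j)))"
      by simp
    then show ?case using Suc dec[of "2 * k + 1 + 2 * j"] by linarith
  qed simp
  moreover have "(\<lambda>j. \<Sum>m<2 * k + 1 + 2 * j. ?t m) \<longlonglongrightarrow> (\<Sum>m. ?t m)"
    by (rule filterlim_compose[OF lim]) (rule filterlim_subseq, auto simp: strict_mono_def)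
  ultimately show "(\<Sum>m. ?t m) \<le> (\<Sum>m<2 * k + 1. ?t m)" by (intro LIMSEQ_le_const2) auto
qed

text \<open>With \<open>y = (x / 2)\<^sup>2 \<le> 1\<close> the first two terms already give the
  lower bound \<open>1 - y / 2 \<ge> 1 / 2\<close> for the series.\<close>

lemma bessel_J1_pos: "0 < x \<Longrightarrow> x \<le> 2 \<Longrightarrow> 0 < bessel_J 1 x"
proof -
  assume x: "0 < x" "x \<le> 2"
  have y: "(x / 2)\<^sup>2 \<le> 1" using x by (intro power_le_one) auto
  have "1 - (x / 2)\<^sup>2 / 2 = (\<Sum>m<2 * 1. (-1) ^ m * bessel_a ((x / 2)\<^sup>2) m)"
    by (simp add: bessel_a_def numeral_2_eq_2)
  also have "\<dots> \<le> (\<Sum>m. (-1) ^ m * bessel_a ((x / 2)\<^sup>2) m)"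
    by (rule bessel_partial_sum(1)) (use y in auto)
  finally have "0 < (\<Sum>m. (-1) ^ m * bessel_a ((x / 2)\<^sup>2) m)" using y by linarith
  then show ?thesis using x unfolding bessel_J1_eq by simp
qed

text \<open>At \<open>y = 4\<close> the first five terms are
  \<open>1 - 2 + 4/3 - 4/9 + 4/45 = - 1/45\<close>.\<close>

lemma bessel_J1_4: "bessel_J 1 4 < 0"
proof -
  have "(\<Sum>m. (-1) ^ m * bessel_a 4 m) \<le> (\<Sum>m<2 * 2 + 1. (-1) ^ m * bessel_a 4 m)"
    by (rule bessel_partial_sum(2)) auto
  also have "\<dots> < 0" by (simp add: bessel_a_def eval_nat_numeral fact_numeral)
  finally show ?thesis unfolding bessel_J1_eq by (simp add: power2_eq_square)
qed

lemma continuous_on_bessel_J1: "continuous_on UNIV (bessel_J 1)"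
proof -
  have "isCont (\<lambda>x. \<Sum>m. ((-1) ^ m / (fact m * fact (m + 1))) * x ^ m) y" for y :: real
  proof (rule isCont_powser')
    show "summable (\<lambda>m. ((-1) ^ m / (fact m * fact (m + 1))) * (\<bar>y\<bar> + 1) ^ m)"
      using bessel_a_summable[of "\<bar>y\<bar> + 1"] by (simp add: bessel_a_def)
  qed (auto)
  then have c: "continuous_on UNIV (\<lambda>y. \<Sum>m. (-1) ^ m * bessel_a y m)"
    by (intro continuous_at_imp_continuous_on) (simp add: bessel_a_def)
  have "bessel_J 1 = (\<lambda>x. x / 2 * (\<Sum>m. (-1) ^ m * bessel_a ((x / 2)\<^sup>2) m))"
    by (rule ext) (rule bessel_J1_eq)
  then show ?thesis
    by (simp only:) (intro continuous_intros continuous_on_compose2[OF c]; simp)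
qed

text \<open>\<open>j11\<close> is a \<open>LEAST\<close> over the reals, which is meaningful only if
  a smallest positive root exists. There is none up to 2, a sign change occurs between 2 and 4, and
  the roots in that interval form a compact set.\<close>

lemma j11_pos: "0 < j11"
proof -
  define Z where "Z = {x \<in> {2..4}. bessel_J 1 x = 0}"
  have Z: "compact Z"
  proof -
    have "closed {x. bessel_J 1 x = 0}"
      using continuous_on_bessel_J1 by (intro closed_Collect_eq continuous_on_const)
    then have "compact ({2..4} \<inter> {x. bessel_J 1 x = 0})" by (intro compact_Int_closed) auto
    also have "{2..4} \<inter> {x. bessel_J 1 x = 0} = Z" by (auto simp: Z_def)
    finally show ?thesis .
  qed
  have "\<exists>x\<ge>2. x \<le> 4 \<and> bessel_J 1 x = 0"
    by (rule IVT2') (use bessel_J1_4 bessel_J1_pos[of 2] continuous_on_bessel_J1 continuous_on_subset in auto)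
  then have "Z \<noteq> {}" by (auto simp: Z_def)
  from compact_attains_inf[OF Z this] obtain z where z: "z \<in> Z" "\<And>x. x \<in> Z \<Longrightarrow> z \<le> x" by blast
  have "j11 = z" unfolding j11_def
  proof (rule Least_equality)
    show "0 < z \<and> bessel_J 1 z = 0" using z(1) by (auto simp: Z_def)
    fix y :: real assume y: "0 < y \<and> bessel_J 1 y = 0"
    then have "2 < y" using bessel_J1_pos[of y] by force
    then show "z \<le> y" using y z z(2)[of y] by (cases "y \<le> 4") (auto simp: Z_def)
  qed
  then show ?thesis using z(1) by (auto simp: Z_def)
qed

section \<open>Poincare and trace inequalities on the domain\<close>

lemma grad_minus_const: "smooth \<phi> \<Longrightarrow> grad (\<lambda>x. \<phi> x - c) = grad \<phi>"
  using grad_diff[of \<phi> "\<lambda>_. c"] by (simp add: smooth_const grad_const)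

lemma simplex2_diameter:
  assumes "compact T" "x \<in> T" "y \<in> T" shows "dist x y \<le> diameter T"
  using assms by (intro diameter_bounded_bound compact_imp_bounded)

lemma mesh_positive:
  assumes L: "lipschitz_domain \<Omega>" and m: "mesh \<Omega> \<T>" and T: "T \<in> \<T>"
  shows "measure lebesgue T > 0"
proof -
  obtain a b c where "triangle a b c" "T = convex hull {a, b, c}"
    using simplex2_triangle[OF mesh_element(1)[OF L m T]] by blast
  then show ?thesis using nn_integral_triangle(2)[OF triangleD[of a b c], where f="\<lambda>_. 0"] by simp
qed

lemma mesh_elt_bound:
  assumes L: "lipschitz_domain \<Omega>" and m: "mesh \<Omega> \<T>" and T: "T \<in> \<T>" and s: "smooth \<phi>"
  shows "L2norm (lebesgue_on T) (\<lambda>x. \<phi> x - mean T \<phi>) \<le> 2 * diameter T * L2norm (lebesgue_on T) (grad \<phi>)"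
proof -
  note c = mesh_element(2)[OF L m T]
  show ?thesis
    by (rule poincare_convex[OF mesh_sets(1)[OF L m T] mesh_sets(4)[OF L m T] mesh_element(3)[OF L m T] mesh_positive[OF L m T] s])
       (use simplex2_diameter[OF c] diameter_ge_0[OF mesh_sets(4)[OF L m T]] in auto)
qed

text \<open>The explicit constant \<open>sqrt 6\<close> of the trace inequality on a triangle, measured in units of the
  coefficient of \<open>C_tr\<close>.\<close>

definition ktr :: real where "ktr = sqrt 6 / sqrt (1 / j11 + 1 / j11\<^sup>2)"

lemma ktr_nonneg: "0 \<le> ktr"
  using j11_pos by (simp add: ktr_def)

text \<open>The triangle estimate divides by the area. Since \<open>(C_tr T)\<^sup>2\<close> is
  \<open>J\<close> times squared diameter over area and \<open>ktr\<^sup>2 = 6 / J\<close>, the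
  product absorbs exactly this factor, and the bound acquires the weights of the estimator.\<close>

lemma mesh_edge_bound:
  assumes L: "lipschitz_domain \<Omega>" and m: "mesh \<Omega> \<T>" and T: "T \<in> \<T>" and E: "E edge_of T" and s: "smooth \<phi>"
  shows "L2norm (arclen E) (\<lambda>x. \<phi> x - mean T \<phi>) \<le> ktr * (C_tr T * sqrt (diameter E)) * L2norm (lebesgue_on T) (grad \<phi>)"
proof -
  obtain a b c where abc: "triangle a b c" "T = convex hull {a, b, c}" "E = closed_segment a b"
    using edge_of_triangle[OF mesh_element(1)[OF L m T] E] by blast
  define V where "V = measure lebesgue T"
  have V: "V > 0" using mesh_positive[OF L m T] by (simp add: V_def)
  define B where "B = L2norm (lebesgue_on T) (grad \<phi>)"
  define J where "J = 1 / j11 + 1 / j11\<^sup>2"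
  have J: "J > 0" using j11_pos by (simp add: J_def add_pos_pos)
  have "V * (L2norm (arclen E) (\<lambda>x. \<phi> x - mean T \<phi>))\<^sup>2 \<le> 6 * (diameter T)\<^sup>2 * dist a b * B\<^sup>2"
    unfolding V_def B_def abc(2,3)
    by (rule triangle_trace_mean(2)[OF triangleD[OF abc(1)] s])
       (use simplex2_diameter[OF mesh_element(2)[OF L m T]] abc(2) in auto)
  then have "(L2norm (arclen E) (\<lambda>x. \<phi> x - mean T \<phi>))\<^sup>2 \<le> 6 * (diameter T)\<^sup>2 * diameter E * B\<^sup>2 / V"
    using V by (simp add: abc(3) diameter_closed_segment pos_le_divide_eq mult.commute)
  also have "\<dots> = (ktr * (C_tr T * sqrt (diameter E)) * B)\<^sup>2"
  proof -
    have "0 \<le> J * (diameter T)\<^sup>2 / V" using J V by simp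
    then have "(C_tr T)\<^sup>2 = J * (diameter T)\<^sup>2 / V" by (simp add: C_tr_def J_def V_def)
    moreover have "ktr\<^sup>2 = 6 / J" using J by (simp add: ktr_def power_divide flip: J_def)
    moreover have "(sqrt (diameter E))\<^sup>2 = diameter E" by (simp add: abc(3) diameter_closed_segment)
    ultimately show ?thesis using J by (simp add: power_mult_distrib)
  qed
  finally have "L2norm (arclen E) (\<lambda>x. \<phi> x - mean T \<phi>) \<le> \<bar>ktr * (C_tr T * sqrt (diameter E)) * B\<bar>"
    by (simp add: abs_le_square_iff[symmetric])
  also have "\<dots> = ktr * (C_tr T * sqrt (diameter E)) * B"
    using ktr_nonneg J V by (simp add: B_def C_tr_def J_def V_def abc(3) diameter_closed_segment)
  finally show ?thesis by (simp add: B_def)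
qed

lemma finite_edges:
  assumes L: "lipschitz_domain \<Omega>" and m: "mesh \<Omega> \<T>"
  shows "finite {E. \<exists>T\<in>\<T>. E edge_of T}"
proof -
  have "finite {E. E edge_of T}" if T: "T \<in> \<T>" for T
  proof -
    obtain a b c where "T = convex hull {a, b, c}" using simplex2_triangle[OF mesh_element(1)[OF L m T]] by blast
    then have "polytope T" unfolding polytope_def by (intro exI[of _ "{a, b, c}"]) simp
    then have "finite {E. E face_of T}" by (rule finite_polytope_faces)
    then show ?thesis by (rule finite_subset[rotated]) (auto simp: edge_of_def)
  qed
  then have "finite (\<Union>T\<in>\<T>. {E. E edge_of T})" using mesh_finite[OF m] by blast
  then show ?thesis by (rule finite_subset[rotated]) auto
qed

lemma finite_boundary_edges:
  assumes "lipschitz_domain \<Omega>" "mesh \<Omega> \<T>" shows "finite (boundary_edges \<Omega> \<T>)"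
  by (rule finite_subset[OF _ finite_edges[OF assms]]) (auto simp: boundary_edges_def)

lemma edge_proper_segment:
  assumes "lipschitz_domain \<Omega>" "mesh \<Omega> \<T>" "T \<in> \<T>" "E edge_of T" shows "proper_segment E"
  using edge_of_triangle[OF mesh_element(1)[OF assms(1-3)] assms(4)]
  by (metis proper_segment_def triangle_def)

lemma boundary_edgeE:
  assumes "E \<in> boundary_edges \<Omega> \<T>" obtains T where "T \<in> \<T>" "E edge_of T" "E \<subseteq> frontier \<Omega>"
  using assms by (auto simp: boundary_edges_def)

section \<open>Trace inequality on the domain\<close>

lemma edge_trace_const:
  assumes L: "lipschitz_domain \<Omega>" and m: "mesh \<Omega> \<T>" and E: "E \<in> {E. \<exists>T\<in>\<T>. E edge_of T}"
  shows "\<exists>C\<ge>0. \<forall>\<phi>. smooth \<phi> \<longrightarrow> (L2norm (arclen E) \<phi>)\<^sup>2 \<le> C * ((L2norm (lebesgue_on \<Omega>) \<phi>)\<^sup>2 + (L2norm (lebesgue_on \<Omega>) (grad \<phi>))\<^sup>2)"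
proof -
  obtain T where T: "T \<in> \<T>" "E edge_of T" using E by blast
  obtain a b c where abc: "triangle a b c" "T = convex hull {a, b, c}" "E = closed_segment a b"
    using edge_of_triangle[OF mesh_element(1)[OF L m T(1)] T(2)] by blast
  have \<Omega>: "\<Omega> \<in> sets lebesgue" "bounded \<Omega>" using L by (auto simp: lipschitz_domain_def lmeasurable_open)
  define V where "V = measure lebesgue T"
  have V: "V > 0" using mesh_positive[OF L m T(1)] by (simp add: V_def)
  define h where "h = diameter T"
  have h: "h \<ge> 0" unfolding h_def by (rule diameter_ge_0[OF mesh_sets(4)[OF L m T(1)]])
  define C where "C = dist a b / V * (1 + h)"
  have C: "C \<ge> 0" using V h by (simp add: C_def)
  have "(L2norm (arclen E) \<phi>)\<^sup>2 \<le> C * ((L2norm (lebesgue_on \<Omega>) \<phi>)\<^sup>2 + (L2norm (lebesgue_on \<Omega>) (grad \<phi>))\<^sup>2)" if s: "smooth \<phi>" for \<phi>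
  proof -
    define A B where "A = L2norm (lebesgue_on T) \<phi>" and "B = L2norm (lebesgue_on T) (grad \<phi>)"
    have "V * (L2norm (arclen E) \<phi>)\<^sup>2 \<le> dist a b * (A\<^sup>2 + h * (A * B))"
      unfolding V_def A_def B_def abc(2,3)
      by (rule triangle_trace[OF triangleD[OF abc(1)] s])
         (use simplex2_diameter[OF mesh_element(2)[OF L m T(1)]] abc(2) h_def in auto)
    also have "\<dots> \<le> dist a b * ((1 + h) * (A\<^sup>2 + B\<^sup>2))"
    proof (rule mult_left_mono)
      have "2 * (A * B) \<le> A\<^sup>2 + B\<^sup>2" using sum_squares_bound[of A B] by simp
      moreover have "0 \<le> A\<^sup>2 + B\<^sup>2" by simp
      ultimately have "A * B \<le> A\<^sup>2 + B\<^sup>2" by linarith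
      then have "h * (A * B) \<le> h * (A\<^sup>2 + B\<^sup>2)" using h by (rule mult_left_mono)
      moreover have "0 \<le> B\<^sup>2" by simp
      moreover have "(1 + h) * (A\<^sup>2 + B\<^sup>2) = A\<^sup>2 + B\<^sup>2 + h * (A\<^sup>2 + B\<^sup>2)" by (simp add: distrib_right)
      ultimately show "A\<^sup>2 + h * (A * B) \<le> (1 + h) * (A\<^sup>2 + B\<^sup>2)" by linarith
    qed simp
    finally have "(L2norm (arclen E) \<phi>)\<^sup>2 \<le> C * (A\<^sup>2 + B\<^sup>2)"
      using V by (simp add: C_def field_simps)
    also have "\<dots> \<le> C * ((L2norm (lebesgue_on \<Omega>) \<phi>)\<^sup>2 + (L2norm (lebesgue_on \<Omega>) (grad \<phi>))\<^sup>2)"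
    proof (intro mult_left_mono add_mono C)
      show "A\<^sup>2 \<le> (L2norm (lebesgue_on \<Omega>) \<phi>)\<^sup>2"
        unfolding mesh_L2(2)[OF L m L2_continuous_lebesgue_on[OF smooth_continuous[OF s] \<Omega>]] A_def
        by (rule member_le_sum) (use T(1) mesh_finite[OF m] in auto)
      show "B\<^sup>2 \<le> (L2norm (lebesgue_on \<Omega>) (grad \<phi>))\<^sup>2"
        unfolding mesh_L2(2)[OF L m L2_continuous_lebesgue_on[OF continuous_on_grad[OF s] \<Omega>]] B_def
        by (rule member_le_sum) (use T(1) mesh_finite[OF m] in auto)
    qed
    finally show ?thesis .
  qed
  then show ?thesis using C by blast
qed

text \<open>The constant is assembled from the finitely many edges of \<open>\<T>0\<close> alone.
  Boundary edges of any other mesh are covered by those edges and overlap in finitely many points,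
  so their arc length integrals are dominated without further constants.\<close>

lemma trace_domain:
  assumes L: "lipschitz_domain \<Omega>" and m0: "mesh \<Omega> \<T>0"
  obtains C where "C \<ge> 0" "\<And>\<T> \<phi>. mesh \<Omega> \<T> \<Longrightarrow> smooth \<phi> \<Longrightarrow>
    (\<Sum>E\<in>boundary_edges \<Omega> \<T>. (L2norm (arclen E) \<phi>)\<^sup>2) \<le> C * ((L2norm (lebesgue_on \<Omega>) \<phi>)\<^sup>2 + (L2norm (lebesgue_on \<Omega>) (grad \<phi>))\<^sup>2)"
proof -
  define S where "S = {E. \<exists>T\<in>\<T>0. E edge_of T}"
  have S: "finite S" unfolding S_def by (rule finite_edges[OF L m0])
  have "\<forall>E\<in>S. \<exists>C\<ge>0. \<forall>\<phi>. smooth \<phi> \<longrightarrow> (L2norm (arclen E) \<phi>)\<^sup>2 \<le> C * ((L2norm (lebesgue_on \<Omega>) \<phi>)\<^sup>2 + (L2norm (lebesgue_on \<Omega>) (grad \<phi>))\<^sup>2)"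
    using edge_trace_const[OF L m0] unfolding S_def by blast
  from bchoice[OF this] obtain C where C: "\<And>E. E \<in> S \<Longrightarrow> C E \<ge> (0::real)"
    "\<And>E \<phi>. E \<in> S \<Longrightarrow> smooth \<phi> \<Longrightarrow> (L2norm (arclen E) \<phi>)\<^sup>2 \<le> C E * ((L2norm (lebesgue_on \<Omega>) \<phi>)\<^sup>2 + (L2norm (lebesgue_on \<Omega>) (grad \<phi>))\<^sup>2)"
    by blast
  show ?thesis
  proof (rule that[of "\<Sum>E\<in>S. C E"])
    show "0 \<le> (\<Sum>E\<in>S. C E)" by (intro sum_nonneg C)
    fix \<T> and \<phi> :: "pt \<Rightarrow> complex" assume m: "mesh \<Omega> \<T>" and s: "smooth \<phi>"
    have nn: "(\<integral>\<^sup>+x. ennreal ((norm (\<phi> x))\<^sup>2) \<partial>arclen E) = ennreal ((L2norm (arclen E) \<phi>)\<^sup>2)" if E: "proper_segment E" for E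
    proof -
      obtain u v where "E = closed_segment u v" using E unfolding proper_segment_def by blast
      then show ?thesis using nn_integral_L2norm[OF L2_arclen_continuous[OF smooth_continuous[OF s]]] by simp
    qed
    have ps: "proper_segment E" if E: "E \<in> S" for E
      using E edge_proper_segment[OF L m0] unfolding S_def by blast
    have pb: "proper_segment E" if E: "E \<in> boundary_edges \<Omega> \<T>" for E
      using E edge_proper_segment[OF L m] by (rule boundary_edgeE)
    have "(\<Sum>E\<in>boundary_edges \<Omega> \<T>. \<integral>\<^sup>+x. ennreal ((norm (\<phi> x))\<^sup>2) \<partial>arclen E) \<le> (\<Sum>E\<in>S. \<integral>\<^sup>+x. ennreal ((norm (\<phi> x))\<^sup>2) \<partial>arclen E)"
    proof (rule arclen_sum_covering[OF finite_boundary_edges[OF L m] pb _ _ S ps])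
      show "(\<lambda>x. ennreal ((norm (\<phi> x))\<^sup>2)) \<in> borel_measurable borel"
        using smooth_borel_measurable[OF s] by measurable
      fix E assume E: "E \<in> boundary_edges \<Omega> \<T>"
      then have "E \<subseteq> frontier \<Omega>" by (simp add: boundary_edges_def)
      then show "E \<subseteq> \<Union>S" using boundary_edge_covered[OF L m0] unfolding S_def by blast
    next
      fix E E' x y assume E: "E \<in> boundary_edges \<Omega> \<T>" "E' \<in> boundary_edges \<Omega> \<T>" "E \<noteq> E'" "x \<in> E \<inter> E'" "y \<in> E \<inter> E'"
      obtain T where T: "T \<in> \<T>" "E edge_of T" using E(1) by (rule boundary_edgeE)
      obtain T' where T': "T' \<in> \<T>" "E' edge_of T'" using E(2) by (rule boundary_edgeE)
      show "x = y" by (rule distinct_edges_finite_Int[OF L m T(1) T'(1) T(2) T'(2) E(3-5)])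
    qed
    then have "ennreal (\<Sum>E\<in>boundary_edges \<Omega> \<T>. (L2norm (arclen E) \<phi>)\<^sup>2) \<le> ennreal (\<Sum>E\<in>S. (L2norm (arclen E) \<phi>)\<^sup>2)"
      using nn pb ps by (simp add: sum_ennreal cong: sum.cong)
    then have "(\<Sum>E\<in>boundary_edges \<Omega> \<T>. (L2norm (arclen E) \<phi>)\<^sup>2) \<le> (\<Sum>E\<in>S. (L2norm (arclen E) \<phi>)\<^sup>2)"
      by (subst (asm) ennreal_le_iff) (auto intro: sum_nonneg)
    also have "\<dots> \<le> (\<Sum>E\<in>S. C E * ((L2norm (lebesgue_on \<Omega>) \<phi>)\<^sup>2 + (L2norm (lebesgue_on \<Omega>) (grad \<phi>))\<^sup>2))"
      by (intro sum_mono C s)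
    finally show "(\<Sum>E\<in>boundary_edges \<Omega> \<T>. (L2norm (arclen E) \<phi>)\<^sup>2) \<le> (\<Sum>E\<in>S. C E) * ((L2norm (lebesgue_on \<Omega>) \<phi>)\<^sup>2 + (L2norm (lebesgue_on \<Omega>) (grad \<phi>))\<^sup>2)"
      by (simp add: sum_distrib_right)
  qed
qed

text \<open>This admits open convex subsets of \<open>\<Omega>\<close> along with closed elements,
  which may contain boundary points of \<open>\<Omega>\<close> and thus need not be subsets.\<close>

definition grad_dom :: "pt set \<Rightarrow> pt set \<Rightarrow> bool" where
  "grad_dom \<Omega> A \<longleftrightarrow> A \<in> sets borel \<and> bounded A \<and> convex A \<and>
     (\<forall>\<phi>. smooth \<phi> \<longrightarrow> L2norm (lebesgue_on A) (grad \<phi>) \<le> L2norm (lebesgue_on \<Omega>) (grad \<phi>))"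

lemma L2norm_subset:
  fixes f :: "pt \<Rightarrow> 'b::{banach, second_countable_topology}"
  assumes "A \<in> sets borel" "B \<in> sets borel" "A \<subseteq> B" "bounded B" "continuous_on UNIV f"
  shows "L2norm (lebesgue_on A) f \<le> L2norm (lebesgue_on B) f"
proof -
  have bA: "bounded A" using assms bounded_subset by blast
  have "ennreal ((L2norm (lebesgue_on A) f)\<^sup>2) \<le> ennreal ((L2norm (lebesgue_on B) f)\<^sup>2)"
    unfolding nn_integral_L2norm_lebesgue_on[OF assms(1) bA assms(5), symmetric]
      nn_integral_L2norm_lebesgue_on[OF assms(2,4,5), symmetric]
    using assms(3) by (intro nn_integral_mono mult_right_mono) (auto simp: indicator_def)
  then have "(L2norm (lebesgue_on A) f)\<^sup>2 \<le> (L2norm (lebesgue_on B) f)\<^sup>2" by simp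
  then show ?thesis by (rule power2_le_imp_le) simp
qed

lemma L2norm_const_lebesgue_on:
  assumes "A \<in> lmeasurable"
  shows "L2norm (lebesgue_on A) (\<lambda>x. c) = norm c * sqrt (measure lebesgue A)"
  using assms by (simp add: L2norm_def measure_restrict_space real_sqrt_mult mult.commute fmeasurableD)

text \<open>On the overlap the difference of the means is the sum of
  \<open>mean A \<phi> - \<phi>\<close> and \<open>\<phi> - mean B \<phi>\<close>, each bounded by
  the Poincare inequality on its own convex set; dividing by the norm of 1 on the overlap gives the
  constant.\<close>

lemma mean_difference:
  assumes A: "grad_dom \<Omega> A" and B: "grad_dom \<Omega> B" and p: "measure lebesgue (A \<inter> B) > 0"
  shows "\<exists>C\<ge>0. \<forall>\<phi>. smooth \<phi> \<longrightarrow> norm (mean A \<phi> - mean B \<phi>) \<le> C * L2norm (lebesgue_on \<Omega>) (grad \<phi>)"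
proof -
  have set: "A \<in> sets borel" "B \<in> sets borel" "bounded A" "bounded B" "convex A" "convex B"
    using A B by (auto simp: grad_dom_def)
  have lm: "A \<in> lmeasurable" "B \<in> lmeasurable" "A \<inter> B \<in> lmeasurable"
    using set by (auto intro!: bounded_set_imp_lmeasurable bounded_Int)
  have pA: "measure lebesgue A > 0"
    using p measure_mono_fmeasurable[of "A \<inter> B" A lebesgue] lm by (auto simp: fmeasurableD)
  have pB: "measure lebesgue B > 0"
    using p measure_mono_fmeasurable[of "A \<inter> B" B lebesgue] lm by (auto simp: fmeasurableD)
  define k where "k = sqrt (measure lebesgue (A \<inter> B))"
  have k: "k > 0" using p by (simp add: k_def)
  define D where "D = 2 * diameter A + 2 * diameter B"
  have dia: "0 \<le> diameter A" "0 \<le> diameter B" using set by (auto intro: diameter_ge_0)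
  have D: "D \<ge> 0" using dia by (simp add: D_def)
  have "norm (mean A \<phi> - mean B \<phi>) \<le> D / k * L2norm (lebesgue_on \<Omega>) (grad \<phi>)" if s: "smooth \<phi>" for \<phi>
  proof -
    let ?N = "L2norm (lebesgue_on \<Omega>) (grad \<phi>)"
    have c: "continuous_on UNIV (\<lambda>x. \<phi> x - m)" "continuous_on UNIV (\<lambda>x. m - \<phi> x)" for m
      by (intro continuous_intros smooth_continuous s)+
    have Il: "A \<inter> B \<in> sets lebesgue" "bounded (A \<inter> B)" "A \<inter> B \<in> sets borel" using set by (auto intro: bounded_Int)
    have "norm (mean A \<phi> - mean B \<phi>) * k = L2norm (lebesgue_on (A \<inter> B)) (\<lambda>x. mean A \<phi> - mean B \<phi>)"
      unfolding k_def by (rule L2norm_const_lebesgue_on[OF lm(3), symmetric])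
    also have "\<dots> \<le> L2norm (lebesgue_on (A \<inter> B)) (\<lambda>x. mean A \<phi> - \<phi> x) + L2norm (lebesgue_on (A \<inter> B)) (\<lambda>x. \<phi> x - mean B \<phi>)"
      by (rule L2norm_diff_trans) (intro L2_continuous_lebesgue_on c Il)+
    also have "L2norm (lebesgue_on (A \<inter> B)) (\<lambda>x. mean A \<phi> - \<phi> x) = L2norm (lebesgue_on (A \<inter> B)) (\<lambda>x. \<phi> x - mean A \<phi>)"
      by (rule L2norm_commute)
    also have "\<dots> \<le> L2norm (lebesgue_on A) (\<lambda>x. \<phi> x - mean A \<phi>)"
      by (rule L2norm_subset[OF Il(3) set(1) _ set(3) c(1)]) simp
    also have "\<dots> \<le> 2 * diameter A * L2norm (lebesgue_on A) (grad \<phi>)"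
      by (rule poincare_convex[OF set(1,3,5) pA s _ dia(1)]) (rule diameter_bounded_bound[OF set(3)])
    also have "\<dots> \<le> 2 * diameter A * ?N"
      using A s dia by (intro mult_left_mono) (auto simp: grad_dom_def)
    also have "L2norm (lebesgue_on (A \<inter> B)) (\<lambda>x. \<phi> x - mean B \<phi>) \<le> L2norm (lebesgue_on B) (\<lambda>x. \<phi> x - mean B \<phi>)"
      by (rule L2norm_subset[OF Il(3) set(2) _ set(4) c(1)]) simp
    also have "\<dots> \<le> 2 * diameter B * L2norm (lebesgue_on B) (grad \<phi>)"
      by (rule poincare_convex[OF set(2,4,6) pB s _ dia(2)]) (rule diameter_bounded_bound[OF set(4)])
    also have "\<dots> \<le> 2 * diameter B * ?N"
      using B s dia by (intro mult_left_mono) (auto simp: grad_dom_def)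
    finally have "norm (mean A \<phi> - mean B \<phi>) * k \<le> D * ?N" by (simp add: D_def algebra_simps)
    then show ?thesis using k by (simp add: field_simps)
  qed
  then show ?thesis using D k by (intro exI[of _ "D / k"]) simp
qed

lemma open_measure_pos:
  fixes A :: "pt set" assumes "open A" "A \<noteq> {}" "bounded A" shows "measure lebesgue A > 0"
proof -
  have "A \<in> lmeasurable" using assms by (simp add: lmeasurable_open)
  moreover have "\<not> negligible A" using open_not_negligible assms by blast
  ultimately show ?thesis using negligible_iff_measure0 by (metis measure_nonneg order_le_less)
qed

lemma grad_dom_open:
  assumes L: "lipschitz_domain \<Omega>" and A: "open A" "convex A" "A \<subseteq> \<Omega>"
  shows "grad_dom \<Omega> A"
proof -
  have \<Omega>: "open \<Omega>" "bounded \<Omega>" using L by (auto simp: lipschitz_domain_def)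
  show ?thesis unfolding grad_dom_def
    using A \<Omega> bounded_subset[OF \<Omega>(2) A(3)]
    by (auto intro!: L2norm_subset continuous_on_grad simp: borel_open)
qed

text \<open>Connectedness replaces an explicit chain of balls: having comparable means is symmetric
  and transitive and holds locally, because overlapping convex sets are comparable.\<close>

lemma mean_connected:
  assumes L: "lipschitz_domain \<Omega>" and A: "open A" "convex A" "A \<subseteq> \<Omega>" "A \<noteq> {}"
    and B: "open B" "convex B" "B \<subseteq> \<Omega>" "B \<noteq> {}"
  shows "\<exists>C\<ge>0. \<forall>\<phi>. smooth \<phi> \<longrightarrow> norm (mean A \<phi> - mean B \<phi>) \<le> C * L2norm (lebesgue_on \<Omega>) (grad \<phi>)"
proof -
  have \<Omega>: "open \<Omega>" "bounded \<Omega>" "connected \<Omega>" using L by (auto simp: lipschitz_domain_def)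
  let ?N = "\<lambda>\<phi>. L2norm (lebesgue_on \<Omega>) (grad \<phi>)"
  define P where "P A B \<longleftrightarrow> (\<exists>C\<ge>0. \<forall>\<phi>. smooth \<phi> \<longrightarrow> norm (mean A \<phi> - mean B \<phi>) \<le> C * ?N \<phi>)" for A B
  define ok where "ok A \<longleftrightarrow> open A \<and> convex A \<and> A \<subseteq> \<Omega>" for A
  \<comment> \<open>Quantifying over all admissible sets around the two points turns comparability
    of sets into a relation between points.\<close>
  define R where "R x y \<longleftrightarrow> (\<forall>A B. ok A \<and> ok B \<and> x \<in> A \<and> y \<in> B \<longrightarrow> P A B)" for x y
  have P_sym: "P A B \<Longrightarrow> P B A" for A B unfolding P_def by (simp add: norm_minus_commute)
  have P_trans: "P A D" if "P A B" "P B D" for A B D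
  proof -
    obtain C1 where C1: "C1 \<ge> 0" "\<And>\<phi>. smooth \<phi> \<Longrightarrow> norm (mean A \<phi> - mean B \<phi>) \<le> C1 * ?N \<phi>"
      using \<open>P A B\<close> unfolding P_def by blast
    obtain C2 where C2: "C2 \<ge> 0" "\<And>\<phi>. smooth \<phi> \<Longrightarrow> norm (mean B \<phi> - mean D \<phi>) \<le> C2 * ?N \<phi>"
      using \<open>P B D\<close> unfolding P_def by blast
    have "norm (mean A \<phi> - mean D \<phi>) \<le> (C1 + C2) * ?N \<phi>" if "smooth \<phi>" for \<phi>
      using norm_triangle_ineq[of "mean A \<phi> - mean B \<phi>" "mean B \<phi> - mean D \<phi>"] C1(2)[OF that] C2(2)[OF that]
      by (simp add: distrib_right)
    then show ?thesis unfolding P_def using C1 C2 by (intro exI[of _ "C1 + C2"]) auto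
  qed
  have P_overlap: "P A B" if "ok A" "ok B" "x \<in> A" "x \<in> B" for A B x
  proof -
    have "measure lebesgue (A \<inter> B) > 0"
      using that \<Omega>(2) by (intro open_measure_pos) (auto simp: ok_def intro: bounded_subset)
    then show ?thesis unfolding P_def
      using mean_difference[OF grad_dom_open[OF L] grad_dom_open[OF L]] that unfolding ok_def by blast
  qed
  obtain a where a: "a \<in> A" using A by blast
  obtain b where b: "b \<in> B" using B by blast
  have ball: "\<exists>e>0. ok (ball x e)" if "x \<in> \<Omega>" for x
    using \<Omega>(1) that unfolding ok_def by (meson convex_ball open_ball openE)
  have "R a b"
  proof (rule connected_equivalence_relation[OF \<Omega>(3)])
    show "a \<in> \<Omega>" "b \<in> \<Omega>" using a b A B by auto
    show "R y x" if "R x y" for x y using that P_sym unfolding R_def by blast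
    show "R x z" if xyz: "R x y" "R y z" "y \<in> \<Omega>" for x y z
      unfolding R_def
    proof (intro allI impI, elim conjE)
      fix A D assume AD: "ok A" "ok D" "x \<in> A" "z \<in> D"
      obtain e where e: "e > 0" "ok (ball y e)" using ball[OF xyz(3)] by blast
      then have "y \<in> ball y e" by simp
      then have "P A (ball y e)" "P (ball y e) D" using xyz(1,2) AD e(2) unfolding R_def by blast+
      then show "P A D" by (rule P_trans)
    qed
    fix x assume x: "x \<in> \<Omega>"
    obtain e where e: "e > 0" "ok (ball x e)" using ball[OF x] by blast
    have "R x y" if y: "y \<in> ball x e" for y
      unfolding R_def
    proof (intro allI impI, elim conjE)
      fix A D assume AD: "ok A" "ok D" "x \<in> A" "y \<in> D"
      have "P A (ball x e)" by (rule P_overlap[OF AD(1) e(2) AD(3)]) (use e in simp)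
      moreover have "P (ball x e) D" by (rule P_overlap[OF e(2) AD(2) y AD(4)])
      ultimately show "P A D" by (rule P_trans)
    qed
    moreover have "openin (top_of_set \<Omega>) (ball x e)" using e(2) \<Omega>(1) by (simp add: ok_def openin_open_eq)
    ultimately show "\<exists>T. openin (top_of_set \<Omega>) T \<and> x \<in> T \<and> (\<forall>y\<in>T. R x y)" using e(1) by (intro exI[of _ "ball x e"]) auto
  qed
  then show ?thesis using A B a b unfolding R_def ok_def P_def by blast
qed

text \<open>The constant subtracted is the mean over one fixed ball. Each element is linked to the
  ball through its interior, an open convex subset of \<open>\<Omega>\<close> to which
  \<open>mean_connected\<close> applies; there are finitely many elements, so the constants
  combine.\<close>

lemma poincare_domain:
  assumes L: "lipschitz_domain \<Omega>" and m: "mesh \<Omega> \<T>"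
  obtains C where "C \<ge> 0" "\<And>\<phi>. smooth \<phi> \<Longrightarrow> \<exists>c. L2norm (lebesgue_on \<Omega>) (\<lambda>x. \<phi> x - c) \<le> C * L2norm (lebesgue_on \<Omega>) (grad \<phi>)"
proof -
  have \<Omega>: "open \<Omega>" "bounded \<Omega>" "\<Omega> \<noteq> {}" using L by (auto simp: lipschitz_domain_def)
  have \<Omega>l: "\<Omega> \<in> sets lebesgue" using \<Omega> by (simp add: lmeasurable_open)
  let ?N = "\<lambda>\<phi>. L2norm (lebesgue_on \<Omega>) (grad \<phi>)"
  obtain z e where z: "e > 0" "ball z e \<subseteq> \<Omega>" using \<Omega> by (meson all_not_in_conv openE)
  let ?A = "ball z e"
  have "\<forall>T\<in>\<T>. \<exists>C\<ge>0. \<forall>\<phi>. smooth \<phi> \<longrightarrow> L2norm (lebesgue_on T) (\<lambda>x. \<phi> x - mean ?A \<phi>) \<le> C * ?N \<phi>"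
  proof
    fix T assume T: "T \<in> \<T>"
    note me = mesh_element[OF L m T] and ms = mesh_sets[OF L m T]
    have gl: "L2norm (lebesgue_on T) (grad \<phi>) \<le> ?N \<phi>" if s: "smooth \<phi>" for \<phi>
    proof -
      have "(L2norm (lebesgue_on T) (grad \<phi>))\<^sup>2 \<le> (?N \<phi>)\<^sup>2"
        unfolding mesh_L2(2)[OF L m L2_continuous_lebesgue_on[OF continuous_on_grad[OF s] \<Omega>l \<Omega>(2)]]
        by (rule member_le_sum) (use T mesh_finite[OF m] in auto)
      then show ?thesis by (rule power2_le_imp_le) simp
    qed
    have gT: "grad_dom \<Omega> T" unfolding grad_dom_def using ms me gl by auto
    have pT: "measure lebesgue T > 0" by (rule mesh_positive[OF L m T])
    have "interior T \<noteq> {}"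
    proof
      assume "interior T = {}"
      then have "negligible T" using negligible_convex_interior[OF me(3)] by blast
      then show False using pT negligible_imp_measure0 by fastforce
    qed
    then have I: "open (interior T)" "convex (interior T)" "interior T \<subseteq> \<Omega>" "interior T \<noteq> {}"
      using me by (auto simp: convex_interior)
    have "measure lebesgue (T \<inter> interior T) > 0"
      using open_measure_pos[OF I(1,4)] ms(4) interior_subset[of T] bounded_subset[OF ms(4)] by (simp add: Int_absorb1)
    from mean_difference[OF gT grad_dom_open[OF L I(1-3)] this]
    obtain C1 where C1: "C1 \<ge> 0" "\<And>\<phi>. smooth \<phi> \<Longrightarrow> norm (mean T \<phi> - mean (interior T) \<phi>) \<le> C1 * ?N \<phi>" by blast
    from mean_connected[OF L I, of ?A] z
    obtain C2 where C2: "C2 \<ge> 0" "\<And>\<phi>. smooth \<phi> \<Longrightarrow> norm (mean (interior T) \<phi> - mean ?A \<phi>) \<le> C2 * ?N \<phi>" by auto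
    define k where "k = sqrt (measure lebesgue T)"
    have k: "k \<ge> 0" by (simp add: k_def)
    have dT: "diameter T \<ge> 0" by (rule diameter_ge_0[OF ms(4)])
    have "L2norm (lebesgue_on T) (\<lambda>x. \<phi> x - mean ?A \<phi>) \<le> (2 * diameter T + (C1 + C2) * k) * ?N \<phi>" if s: "smooth \<phi>" for \<phi>
    proof -
      have "L2norm (lebesgue_on T) (\<lambda>x. \<phi> x - mean ?A \<phi>)
        \<le> L2norm (lebesgue_on T) (\<lambda>x. \<phi> x - mean T \<phi>) + L2norm (lebesgue_on T) (\<lambda>x. mean T \<phi> - mean ?A \<phi>)"
        by (rule L2norm_diff_trans) (intro L2_continuous_lebesgue_on continuous_intros smooth_continuous s ms)+
      also have "L2norm (lebesgue_on T) (\<lambda>x. mean T \<phi> - mean ?A \<phi>) = norm (mean T \<phi> - mean ?A \<phi>) * k"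
        unfolding k_def by (rule L2norm_const_lebesgue_on[OF ms(3)])
      also have "norm (mean T \<phi> - mean ?A \<phi>) * k \<le> ((C1 + C2) * ?N \<phi>) * k"
        using norm_triangle_ineq[of "mean T \<phi> - mean (interior T) \<phi>" "mean (interior T) \<phi> - mean ?A \<phi>"]
          C1(2)[OF s] C2(2)[OF s] k by (intro mult_right_mono) (auto simp: distrib_right)
      also have "L2norm (lebesgue_on T) (\<lambda>x. \<phi> x - mean T \<phi>) \<le> 2 * diameter T * L2norm (lebesgue_on T) (grad \<phi>)"
        by (rule mesh_elt_bound[OF L m T s])
      also have "\<dots> \<le> 2 * diameter T * ?N \<phi>" using gl[OF s] dT by (intro mult_left_mono) auto
      finally show ?thesis by (simp add: algebra_simps)
    qed
    then show "\<exists>C\<ge>0. \<forall>\<phi>. smooth \<phi> \<longrightarrow> L2norm (lebesgue_on T) (\<lambda>x. \<phi> x - mean ?A \<phi>) \<le> C * ?N \<phi>"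
      using C1 C2 k dT by (intro exI[of _ "2 * diameter T + (C1 + C2) * k"]) auto
  qed
  from bchoice[OF this] obtain C where C: "\<And>T. T \<in> \<T> \<Longrightarrow> C T \<ge> (0::real)"
    "\<And>T \<phi>. T \<in> \<T> \<Longrightarrow> smooth \<phi> \<Longrightarrow> L2norm (lebesgue_on T) (\<lambda>x. \<phi> x - mean ?A \<phi>) \<le> C T * ?N \<phi>" by blast
  show ?thesis
  proof (rule that[of "sqrt (\<Sum>T\<in>\<T>. (C T)\<^sup>2)"])
    show "0 \<le> sqrt (\<Sum>T\<in>\<T>. (C T)\<^sup>2)" by (simp add: sum_nonneg)
    fix \<phi> :: "pt \<Rightarrow> complex" assume s: "smooth \<phi>"
    have "(L2norm (lebesgue_on \<Omega>) (\<lambda>x. \<phi> x - mean ?A \<phi>))\<^sup>2 = (\<Sum>T\<in>\<T>. (L2norm (lebesgue_on T) (\<lambda>x. \<phi> x - mean ?A \<phi>))\<^sup>2)"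
      by (rule mesh_L2(2)[OF L m]) (intro L2_continuous_lebesgue_on continuous_intros smooth_continuous s \<Omega>l \<Omega>)
    also have "\<dots> \<le> (\<Sum>T\<in>\<T>. (C T * ?N \<phi>)\<^sup>2)" by (intro sum_mono power_mono C s) auto
    also have "\<dots> = (sqrt (\<Sum>T\<in>\<T>. (C T)\<^sup>2) * ?N \<phi>)\<^sup>2"
      by (simp add: power_mult_distrib sum_distrib_right sum_nonneg)
    finally have "L2norm (lebesgue_on \<Omega>) (\<lambda>x. \<phi> x - mean ?A \<phi>) \<le> sqrt (\<Sum>T\<in>\<T>. (C T)\<^sup>2) * ?N \<phi>"
      by (rule power2_le_imp_le) (simp add: sum_nonneg)
    then show "\<exists>c. L2norm (lebesgue_on \<Omega>) (\<lambda>x. \<phi> x - c) \<le> sqrt (\<Sum>T\<in>\<T>. (C T)\<^sup>2) * ?N \<phi>" by blast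
  qed
qed

section \<open>Boundary traces\<close>

text \<open>The right side is the exact geometric partial sum, which lets the induction
  close.\<close>

lemma L2norm_fast_Cauchy:
  assumes f: "\<And>n. L2 M (f n)" and fast: "\<And>n. L2norm M (\<lambda>x. f (Suc n) x - f n x) \<le> (1 / 2) ^ n"
  shows "L2norm M (\<lambda>x. f (n + k) x - f n x) \<le> 2 * (1 / 2) ^ n - 2 * (1 / 2) ^ (n + k)"
proof (induction k)
  case (Suc k)
  have "L2norm M (\<lambda>x. f (n + Suc k) x - f n x) \<le> L2norm M (\<lambda>x. f (Suc (n + k)) x - f (n + k) x) + L2norm M (\<lambda>x. f (n + k) x - f n x)"
    using L2norm_diff_trans[of M "f (Suc (n + k))" "f (n + k)" "f n", OF L2_diff[OF f f] L2_diff[OF f f]] by simp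
  also have "\<dots> \<le> (1 / 2) ^ (n + k) + (2 * (1 / 2) ^ n - 2 * (1 / 2) ^ (n + k))"
    by (intro add_mono fast Suc)
  also have "\<dots> = 2 * (1 / 2) ^ n - 2 * (1 / 2) ^ (n + Suc k)" by simp
  finally show ?case .
qed simp

text \<open>On a finite measure the increments are summable in mean, so the series converges
  absolutely almost everywhere; Fatou's lemma then turns the Cauchy estimate into one against the
  pointwise limit.\<close>

lemma (in finite_measure) L2_fast_limit:
  fixes f :: "nat \<Rightarrow> 'a \<Rightarrow> complex"
  assumes f: "\<And>n. L2 M (f n)" and fast: "\<And>n. L2norm M (\<lambda>x. f (Suc n) x - f n x) \<le> (1 / 2) ^ n"
  defines "t \<equiv> \<lambda>x. lim (\<lambda>n. f n x)"
  shows "L2 M t" "(\<lambda>n. L2norm M (\<lambda>x. f n x - t x)) \<longlonglongrightarrow> 0"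
proof -
  have [measurable]: "f n \<in> borel_measurable M" for n using f by (rule L2D)
  have tm[measurable]: "t \<in> borel_measurable M" unfolding t_def by (rule borel_measurable_lim_metric) simp
  define K where "K = sqrt (measure M (space M))"
  have K: "K \<ge> 0" by (simp add: K_def)
  have "(\<integral>\<^sup>+x. (\<Sum>n. ennreal (norm (f (Suc n) x - f n x))) \<partial>M) = (\<Sum>n. \<integral>\<^sup>+x. ennreal (norm (f (Suc n) x - f n x)) \<partial>M)"
    by (rule nn_integral_suminf) measurable
  also have "\<dots> \<le> (\<Sum>n. ennreal ((1 / 2) ^ n * K))"
  proof (rule suminf_le)
    fix n
    have d: "L2 M (\<lambda>x. f (Suc n) x - f n x)" by (intro L2_diff f)
    have "(\<integral>\<^sup>+x. ennreal (norm (f (Suc n) x - f n x)) \<partial>M) = ennreal (\<integral>x. norm (f (Suc n) x - f n x) \<partial>M)"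
      by (rule nn_integral_eq_integral) (auto intro!: integrable_norm L2_imp_integrable[OF d])
    also have "\<dots> \<le> ennreal ((1 / 2) ^ n * K)"
      using integral_norm_le_L2norm[OF d] fast[of n] K unfolding K_def[symmetric]
      by (intro ennreal_leI order_trans[OF _ mult_right_mono[OF fast]]) auto
    finally show "(\<integral>\<^sup>+x. ennreal (norm (f (Suc n) x - f n x)) \<partial>M) \<le> ennreal ((1 / 2) ^ n * K)" .
  qed auto
  also have "\<dots> = ennreal (\<Sum>n. (1 / 2) ^ n * K)"
    by (rule suminf_ennreal2) (use K in \<open>auto intro!: summable_mult2 summable_geometric\<close>)
  finally have fin: "(\<integral>\<^sup>+x. (\<Sum>n. ennreal (norm (f (Suc n) x - f n x))) \<partial>M) \<noteq> \<infinity>"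
    by (auto simp: top_unique)
  have "AE x in M. (\<Sum>n. ennreal (norm (f (Suc n) x - f n x))) \<noteq> \<infinity>"
    by (rule nn_integral_PInf_AE[OF _ fin]) measurable
  then have conv: "AE x in M. (\<lambda>n. f n x) \<longlonglongrightarrow> t x"
  proof eventually_elim
    case (elim x)
    have "summable (\<lambda>n. norm (f (Suc n) x - f n x))"
      by (rule summable_suminf_not_top) (use elim in auto)
    then have "summable (\<lambda>n. f (Suc n) x - f n x)" by (rule summable_norm_cancel)
    then have "convergent (\<lambda>n. f n x - f 0 x)"
      using sum_lessThan_telescope[of "\<lambda>n. f n x"] by (simp add: summable_iff_convergent)
    then have "convergent (\<lambda>n. (f n x - f 0 x) + f 0 x)" by (intro convergent_add convergent_const)
    then show ?case unfolding t_def by (simp add: convergent_LIMSEQ_iff)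
  qed
  have bound: "(\<integral>\<^sup>+x. ennreal ((norm (f n x - t x))\<^sup>2) \<partial>M) \<le> ennreal ((2 * (1 / 2) ^ n)\<^sup>2)" for n
  proof -
    have "(\<integral>\<^sup>+x. ennreal ((norm (f n x - t x))\<^sup>2) \<partial>M) = (\<integral>\<^sup>+x. liminf (\<lambda>k. ennreal ((norm (f (n + k) x - f n x))\<^sup>2)) \<partial>M)"
    proof (rule nn_integral_cong_AE)
      show "AE x in M. ennreal ((norm (f n x - t x))\<^sup>2) = liminf (\<lambda>k. ennreal ((norm (f (n + k) x - f n x))\<^sup>2))"
        using conv
      proof eventually_elim
        case (elim x)
        have "(\<lambda>k. f (n + k) x) \<longlonglongrightarrow> t x" using LIMSEQ_ignore_initial_segment[OF elim, of n] by (simp add: add.commute)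
        then have "(\<lambda>k. ennreal ((norm (f (n + k) x - f n x))\<^sup>2)) \<longlonglongrightarrow> ennreal ((norm (t x - f n x))\<^sup>2)"
          by (intro tendsto_ennrealI tendsto_intros)
        from lim_imp_Liminf[OF _ this] show ?case by (simp add: norm_minus_commute)
      qed
    qed
    also have "\<dots> \<le> liminf (\<lambda>k. \<integral>\<^sup>+x. ennreal ((norm (f (n + k) x - f n x))\<^sup>2) \<partial>M)"
      by (rule nn_integral_liminf) measurable
    also have "\<dots> \<le> liminf (\<lambda>k. ennreal ((2 * (1 / 2) ^ n)\<^sup>2))"
    proof (rule Liminf_mono, rule always_eventually, rule allI)
      fix k
      have "(\<integral>\<^sup>+x. ennreal ((norm (f (n + k) x - f n x))\<^sup>2) \<partial>M) = ennreal ((L2norm M (\<lambda>x. f (n + k) x - f n x))\<^sup>2)"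
        by (rule nn_integral_L2norm[OF L2_diff[OF f f]])
      also have "\<dots> \<le> ennreal ((2 * (1 / 2) ^ n)\<^sup>2)"
      proof (rule ennreal_leI, rule power_mono)
        have "0 \<le> (1 / 2 :: real) ^ (n + k)" by simp
        then show "L2norm M (\<lambda>x. f (n + k) x - f n x) \<le> 2 * (1 / 2) ^ n"
          using L2norm_fast_Cauchy[OF f fast, of n k] by linarith
      qed simp
      finally show "(\<integral>\<^sup>+x. ennreal ((norm (f (n + k) x - f n x))\<^sup>2) \<partial>M) \<le> ennreal ((2 * (1 / 2) ^ n)\<^sup>2)" .
    qed
    also have "\<dots> = ennreal ((2 * (1 / 2) ^ n)\<^sup>2)" by (rule lim_imp_Liminf) auto
    finally show ?thesis .
  qed
  have Ld: "L2 M (\<lambda>x. f n x - t x)" for n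
    by (subst L2_iff_nn_integral) (use bound[of n] in \<open>auto intro: le_less_trans\<close>)
  from L2_diff[OF f[of 0] Ld[of 0]] show "L2 M t" by simp
  have le: "L2norm M (\<lambda>x. f n x - t x) \<le> 2 * (1 / 2) ^ n" for n
  proof -
    have "(L2norm M (\<lambda>x. f n x - t x))\<^sup>2 \<le> (2 * (1 / 2) ^ n)\<^sup>2"
      using bound[of n] unfolding nn_integral_L2norm[OF Ld] by (subst (asm) ennreal_le_iff) auto
    then show ?thesis by (rule power2_le_imp_le) simp
  qed
  have lim: "(\<lambda>n. 2 * (1 / 2 :: real) ^ n) \<longlonglongrightarrow> 2 * 0"
    by (intro tendsto_mult tendsto_const LIMSEQ_power_zero) simp
  show "(\<lambda>n. L2norm M (\<lambda>x. f n x - t x)) \<longlonglongrightarrow> 0"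
    by (rule tendsto_sandwich[OF always_eventually always_eventually tendsto_const lim[unfolded mult_zero_right]])
       (use le in auto)
qed

lemma arclen_L2_smooth:
  assumes L: "lipschitz_domain \<Omega>" and m: "mesh \<Omega> \<T>" and E: "E \<in> boundary_edges \<Omega> \<T>" and c: "continuous_on UNIV f"
  shows "L2 (arclen E) (f :: pt \<Rightarrow> 'b::{banach, second_countable_topology})" "finite_measure (arclen E)"
proof -
  have "proper_segment E" using E edge_proper_segment[OF L m] by (rule boundary_edgeE)
  then obtain u v where "E = closed_segment u v" unfolding proper_segment_def by blast
  then show "L2 (arclen E) f" "finite_measure (arclen E)"
    using L2_arclen_continuous[OF c] finite_measure_arclen by auto
qed

text \<open>Linear instead of squared form; \<open>C + 1\<close> dominates the root of
  \<open>C\<close>.\<close>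

lemma trace_edge_le:
  assumes L: "lipschitz_domain \<Omega>" and m: "mesh \<Omega> \<T>"
    and C: "C \<ge> 0" "\<And>\<phi>. smooth \<phi> \<Longrightarrow> (\<Sum>E\<in>boundary_edges \<Omega> \<T>. (L2norm (arclen E) \<phi>)\<^sup>2)
      \<le> C * ((L2norm (lebesgue_on \<Omega>) \<phi>)\<^sup>2 + (L2norm (lebesgue_on \<Omega>) (grad \<phi>))\<^sup>2)"
    and s: "smooth \<phi>" and E: "E \<in> boundary_edges \<Omega> \<T>"
  shows "L2norm (arclen E) \<phi> \<le> (C + 1) * (L2norm (lebesgue_on \<Omega>) \<phi> + L2norm (lebesgue_on \<Omega>) (grad \<phi>))"
proof -
  let ?a = "L2norm (lebesgue_on \<Omega>) \<phi>" and ?b = "L2norm (lebesgue_on \<Omega>) (grad \<phi>)"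
  have "(L2norm (arclen E) \<phi>)\<^sup>2 \<le> (\<Sum>E\<in>boundary_edges \<Omega> \<T>. (L2norm (arclen E) \<phi>)\<^sup>2)"
    by (rule member_le_sum[OF E]) (use finite_boundary_edges[OF L m] in auto)
  also have "\<dots> \<le> C * (?a\<^sup>2 + ?b\<^sup>2)" by (rule C(2)[OF s])
  also have "\<dots> \<le> (C + 1)\<^sup>2 * (?a + ?b)\<^sup>2"
  proof (rule mult_mono)
    have "(C + 1)\<^sup>2 = C + (C\<^sup>2 + C + 1)" by (simp add: power2_eq_square algebra_simps)
    then show "C \<le> (C + 1)\<^sup>2" using C(1) by simp
    show "?a\<^sup>2 + ?b\<^sup>2 \<le> (?a + ?b)\<^sup>2" by (simp add: power2_sum)
  qed auto
  finally have "(L2norm (arclen E) \<phi>)\<^sup>2 \<le> ((C + 1) * (?a + ?b))\<^sup>2" by (simp add: power_mult_distrib)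
  then show ?thesis by (rule power2_le_imp_le) (use C(1) in simp)
qed

lemma trace_exists:
  assumes L: "lipschitz_domain \<Omega>" and m: "mesh \<Omega> \<T>" and u: "u \<in> H1 \<Omega>"
  shows "\<exists>t. is_trace \<Omega> \<T> u t"
proof -
  have \<Omega>: "\<Omega> \<in> sets lebesgue" "bounded \<Omega>" using L by (auto simp: lipschitz_domain_def lmeasurable_open)
  note wp = wgrad_props[OF u]
  obtain C where C: "C \<ge> 0" "\<And>\<T> \<phi>. mesh \<Omega> \<T> \<Longrightarrow> smooth \<phi> \<Longrightarrow>
    (\<Sum>E\<in>boundary_edges \<Omega> \<T>. (L2norm (arclen E) \<phi>)\<^sup>2) \<le> C * ((L2norm (lebesgue_on \<Omega>) \<phi>)\<^sup>2 + (L2norm (lebesgue_on \<Omega>) (grad \<phi>))\<^sup>2)"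
    using trace_domain[OF L m] by blast
  \<comment> \<open>The factor \<open>4 * (C + 1)\<close> is the total loss: values and gradients
    each cost \<open>2 * \<eta> n\<close> between consecutive approximants, and passing to an edge
    costs \<open>C + 1\<close>.\<close>
  define \<eta> where "\<eta> n = (1 / 2) ^ n / (4 * (C + 1))" for n :: nat
  have \<eta>: "\<eta> n > 0" "\<eta> (Suc n) \<le> \<eta> n" for n
  proof -
    show "\<eta> n > 0" using C(1) by (simp add: \<eta>_def)
    moreover have "\<eta> (Suc n) = \<eta> n / 2" by (simp add: \<eta>_def)
    ultimately show "\<eta> (Suc n) \<le> \<eta> n" by simp
  qed
  have "\<forall>n. \<exists>\<phi>. smooth \<phi> \<and> L2norm (lebesgue_on \<Omega>) (\<lambda>x. \<phi> x - u x) < \<eta> n \<and> L2norm (lebesgue_on \<Omega>) (\<lambda>x. grad \<phi> x - wgrad \<Omega> u x) < \<eta> n"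
  proof
    fix n
    obtain \<phi> where "smooth \<phi>" "L2norm (lebesgue_on \<Omega>) (\<lambda>x. \<phi> x - u x) < \<eta> n" "L2norm (lebesgue_on \<Omega>) (\<lambda>x. grad \<phi> x - wgrad \<Omega> u x) < \<eta> n"
      using smooth_dense[OF L wp \<eta>(1)] by blast
    then show "\<exists>\<phi>. smooth \<phi> \<and> L2norm (lebesgue_on \<Omega>) (\<lambda>x. \<phi> x - u x) < \<eta> n \<and> L2norm (lebesgue_on \<Omega>) (\<lambda>x. grad \<phi> x - wgrad \<Omega> u x) < \<eta> n" by blast
  qed
  from choice[OF this] obtain \<phi> where \<phi>: "\<And>n. smooth (\<phi> n)" "\<And>n. L2norm (lebesgue_on \<Omega>) (\<lambda>x. \<phi> n x - u x) < \<eta> n"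
    "\<And>n. L2norm (lebesgue_on \<Omega>) (\<lambda>x. grad (\<phi> n) x - wgrad \<Omega> u x) < \<eta> n" by blast
  have L\<phi>: "L2 (lebesgue_on \<Omega>) (\<phi> n)" "L2 (lebesgue_on \<Omega>) (grad (\<phi> n))" for n
    by (intro L2_continuous_lebesgue_on smooth_continuous continuous_on_grad \<phi> \<Omega>)+
  have fast: "L2norm (arclen E) (\<lambda>x. \<phi> (Suc n) x - \<phi> n x) \<le> (1 / 2) ^ n" if E: "E \<in> boundary_edges \<Omega> \<T>" for E n
  proof -
    have a: "L2norm (lebesgue_on \<Omega>) (\<lambda>x. \<phi> (Suc n) x - \<phi> n x) \<le> 2 * \<eta> n"
      using L2norm_diff_trans[OF L2_diff[OF L\<phi>(1) wp(1)] L2_diff[OF wp(1) L\<phi>(1)], of "Suc n" n]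
        L2norm_commute[of "lebesgue_on \<Omega>" u "\<phi> n"] \<phi>(2)[of n] \<phi>(2)[of "Suc n"] \<eta>(2)[of n] by linarith
    have b: "L2norm (lebesgue_on \<Omega>) (\<lambda>x. grad (\<phi> (Suc n)) x - grad (\<phi> n) x) \<le> 2 * \<eta> n"
      using L2norm_diff_trans[OF L2_diff[OF L\<phi>(2) wp(2)] L2_diff[OF wp(2) L\<phi>(2)], of "Suc n" n]
        L2norm_commute[of "lebesgue_on \<Omega>" "wgrad \<Omega> u" "grad (\<phi> n)"] \<phi>(3)[of n] \<phi>(3)[of "Suc n"] \<eta>(2)[of n] by linarith
    have "L2norm (arclen E) (\<lambda>x. \<phi> (Suc n) x - \<phi> n x) \<le> (C + 1) * (L2norm (lebesgue_on \<Omega>) (\<lambda>x. \<phi> (Suc n) x - \<phi> n x) + L2norm (lebesgue_on \<Omega>) (grad (\<lambda>x. \<phi> (Suc n) x - \<phi> n x)))"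
      by (rule trace_edge_le[OF L m C(1) C(2)[OF m] smooth_diff[OF \<phi>(1) \<phi>(1)] E])
    also have "\<dots> \<le> (C + 1) * (2 * \<eta> n + 2 * \<eta> n)"
      unfolding grad_diff[OF \<phi>(1) \<phi>(1)] using C(1) by (intro mult_left_mono add_mono a b) auto
    also have "\<dots> = (4 * (C + 1)) * \<eta> n" by (simp add: algebra_simps)
    also have "\<dots> = (1 / 2) ^ n"
    proof -
      have "0 < C + 1" using C(1) by linarith
      then have "4 * (C + 1) \<noteq> 0" by simp
      then show ?thesis by (simp add: \<eta>_def)
    qed
    finally show ?thesis .
  qed
  \<comment> \<open>The pointwise limit of a fast Cauchy sequence serves all edges at once, although they may meet.\<close>
  define t where "t = (\<lambda>x. lim (\<lambda>n. \<phi> n x))"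
  have t: "L2 (arclen E) t" "(\<lambda>n. L2norm (arclen E) (\<lambda>x. \<phi> n x - t x)) \<longlonglongrightarrow> 0" if E: "E \<in> boundary_edges \<Omega> \<T>" for E
    using finite_measure.L2_fast_limit[OF arclen_L2_smooth(2)[OF L m E continuous_on_const] arclen_L2_smooth(1)[OF L m E smooth_continuous[OF \<phi>(1)]] fast[OF E]]
    unfolding t_def by blast+
  have \<eta>0: "\<eta> \<longlonglongrightarrow> 0"
  proof -
    have "(\<lambda>n. (1 / 2 :: real) ^ n / (4 * (C + 1))) \<longlonglongrightarrow> 0 / (4 * (C + 1))"
      by (intro tendsto_divide tendsto_const LIMSEQ_power_zero) (use C(1) in auto)
    then show ?thesis by (simp add: \<eta>_def[abs_def])
  qed
  have "is_trace \<Omega> \<T> u t" unfolding is_trace_def L2_bdry_def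
  proof (intro conjI exI[of _ \<phi>] ballI allI)
    show "(\<lambda>n. L2norm (lebesgue_on \<Omega>) (\<lambda>x. \<phi> n x - u x)) \<longlonglongrightarrow> 0"
      by (rule tendsto_sandwich[OF always_eventually always_eventually tendsto_const \<eta>0]) (use \<phi>(2) in \<open>auto intro: less_imp_le\<close>)
    show "(\<lambda>n. L2norm (lebesgue_on \<Omega>) (\<lambda>x. grad (\<phi> n) x - wgrad \<Omega> u x)) \<longlonglongrightarrow> 0"
      by (rule tendsto_sandwich[OF always_eventually always_eventually tendsto_const \<eta>0]) (use \<phi>(3) in \<open>auto intro: less_imp_le\<close>)
  qed (use t \<phi> in auto)
  then show ?thesis by blast
qed

lemma bdry_trace_is_trace:
  assumes "lipschitz_domain \<Omega>" "mesh \<Omega> \<T>" "u \<in> H1 \<Omega>"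
  shows "is_trace \<Omega> \<T> u (bdry_trace \<Omega> \<T> u)"
  unfolding bdry_trace_def using trace_exists[OF assms] by (rule someI_ex)

lemma bdry_trace_L2:
  assumes "lipschitz_domain \<Omega>" "mesh \<Omega> \<T>" "u \<in> H1 \<Omega>" "E \<in> boundary_edges \<Omega> \<T>"
  shows "L2 (arclen E) (bdry_trace \<Omega> \<T> u)"
  using bdry_trace_is_trace[OF assms(1-3)] assms(4) by (auto simp: is_trace_def L2_bdry_def)

text \<open>The chosen trace comes with an unknown approximating sequence \<open>\<psi>\<close>. The
  trace inequality for \<open>\<psi> n - \<phi>\<close> shows that the limit of this sequence on
  each edge must be \<open>\<phi>\<close> itself.\<close>

lemma bdry_trace_smooth:
  assumes L: "lipschitz_domain \<Omega>" and m: "mesh \<Omega> \<T>" and s: "smooth \<phi>" and E: "E \<in> boundary_edges \<Omega> \<T>"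
  shows "AE x in arclen E. bdry_trace \<Omega> \<T> \<phi> x = \<phi> x"
proof -
  have \<Omega>: "\<Omega> \<in> sets lebesgue" "bounded \<Omega>" using L by (auto simp: lipschitz_domain_def lmeasurable_open)
  let ?t = "bdry_trace \<Omega> \<T> \<phi>"
  note H = smooth_H1[OF L s]
  obtain C where C: "C \<ge> 0" "\<And>\<T> \<phi>. mesh \<Omega> \<T> \<Longrightarrow> smooth \<phi> \<Longrightarrow>
    (\<Sum>E\<in>boundary_edges \<Omega> \<T>. (L2norm (arclen E) \<phi>)\<^sup>2) \<le> C * ((L2norm (lebesgue_on \<Omega>) \<phi>)\<^sup>2 + (L2norm (lebesgue_on \<Omega>) (grad \<phi>))\<^sup>2)"
    using trace_domain[OF L m] by blast
  obtain \<psi> where \<psi>: "\<And>n. smooth (\<psi> n)" "(\<lambda>n. L2norm (lebesgue_on \<Omega>) (\<lambda>x. \<psi> n x - \<phi> x)) \<longlonglongrightarrow> 0"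
    "(\<lambda>n. L2norm (lebesgue_on \<Omega>) (\<lambda>x. grad (\<psi> n) x - wgrad \<Omega> \<phi> x)) \<longlonglongrightarrow> 0"
    "(\<lambda>n. L2norm (arclen E) (\<lambda>x. \<psi> n x - ?t x)) \<longlonglongrightarrow> 0"
    using bdry_trace_is_trace[OF L m H(1)] E unfolding is_trace_def by blast
  have Lt: "L2 (arclen E) ?t" by (rule bdry_trace_L2[OF L m H(1) E])
  have L\<phi>: "L2 (arclen E) \<phi>" "L2 (arclen E) (\<psi> n)" for n
    by (intro arclen_L2_smooth(1)[OF L m E] smooth_continuous s \<psi>)+
  have g: "L2norm (lebesgue_on \<Omega>) (\<lambda>x. grad (\<psi> n) x - wgrad \<Omega> \<phi> x) = L2norm (lebesgue_on \<Omega>) (\<lambda>x. grad (\<psi> n) x - grad \<phi> x)" for n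
  proof (rule L2norm_cong_AE)
    have cg: "L2 (lebesgue_on \<Omega>) (grad f)" if "smooth f" for f
      by (intro L2_continuous_lebesgue_on continuous_on_grad that \<Omega>)
    show "(\<lambda>x. grad (\<psi> n) x - wgrad \<Omega> \<phi> x) \<in> borel_measurable (lebesgue_on \<Omega>)"
      by (intro L2D(1) L2_diff cg \<psi> wgrad_props(2)[OF H(1)])
    show "(\<lambda>x. grad (\<psi> n) x - grad \<phi> x) \<in> borel_measurable (lebesgue_on \<Omega>)"
      by (intro L2D(1) L2_diff cg \<psi> s)
    show "AE x in lebesgue_on \<Omega>. grad (\<psi> n) x - wgrad \<Omega> \<phi> x = grad (\<psi> n) x - grad \<phi> x"
      using H(2) by eventually_elim simp
  qed
  define e where "e n = (C + 1) * (L2norm (lebesgue_on \<Omega>) (\<lambda>x. \<psi> n x - \<phi> x) + L2norm (lebesgue_on \<Omega>) (\<lambda>x. grad (\<psi> n) x - wgrad \<Omega> \<phi> x))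
     + L2norm (arclen E) (\<lambda>x. \<psi> n x - ?t x)" for n
  have "L2norm (arclen E) (\<lambda>x. \<phi> x - ?t x) \<le> e n" for n
  proof -
    have "L2norm (arclen E) (\<lambda>x. \<phi> x - ?t x) \<le> L2norm (arclen E) (\<lambda>x. \<phi> x - \<psi> n x) + L2norm (arclen E) (\<lambda>x. \<psi> n x - ?t x)"
      by (intro L2norm_diff_trans L2_diff L\<phi> Lt)
    moreover have "L2norm (arclen E) (\<lambda>x. \<psi> n x - \<phi> x) \<le> (C + 1) * (L2norm (lebesgue_on \<Omega>) (\<lambda>x. \<psi> n x - \<phi> x) + L2norm (lebesgue_on \<Omega>) (grad (\<lambda>x. \<psi> n x - \<phi> x)))"
      by (rule trace_edge_le[OF L m C(1) C(2)[OF m] smooth_diff[OF \<psi>(1) s] E])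
    ultimately show ?thesis
      using L2norm_commute[of "arclen E" \<phi> "\<psi> n"] by (simp add: e_def g grad_diff[OF \<psi>(1) s])
  qed
  moreover have "e \<longlonglongrightarrow> (C + 1) * (0 + 0) + 0" unfolding e_def
    by (intro tendsto_add tendsto_mult tendsto_const \<psi>)
  ultimately have "L2norm (arclen E) (\<lambda>x. \<phi> x - ?t x) \<le> 0" by (intro LIMSEQ_le_const) auto
  then have "L2norm (arclen E) (\<lambda>x. \<phi> x - ?t x) = 0" using L2norm_nonneg[of "arclen E" "\<lambda>x. \<phi> x - ?t x"] by linarith
  from L2_zero_AE[OF L2_diff[OF L\<phi>(1) Lt] this] show ?thesis by eventually_elim simp
qed

section \<open>The error estimate\<close>

lemma smooth_power: "smooth f \<Longrightarrow> smooth (\<lambda>x. f x ^ n)"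
  by (induction n) (auto intro: smooth_const smooth_mult)

lemma poly_deg_le_smooth:
  assumes "poly_deg_le n q" shows "smooth q"
proof -
  obtain c where c: "\<And>x. q x = (\<Sum>i\<le>n. \<Sum>j\<le>n - i. c i j * complex_of_real (x $ 1 ^ i * x $ 2 ^ j))"
    using assms by (auto simp: poly_deg_le_def)
  have co: "smooth (\<lambda>x. complex_of_real (x $ i))" for i
    by (intro smooth_linear bounded_linear_compose[OF bounded_linear_of_real] bounded_linear_vec_nth)
  have "smooth (\<lambda>x. \<Sum>i\<le>n. \<Sum>j\<le>n - i. c i j * (complex_of_real (x $ 1) ^ i * complex_of_real (x $ 2) ^ j))"
    by (intro smooth_sum smooth_mult smooth_const smooth_power co)
  moreover have "q = (\<lambda>x. \<Sum>i\<le>n. \<Sum>j\<le>n - i. c i j * (complex_of_real (x $ 1) ^ i * complex_of_real (x $ 2) ^ j))"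
    by (rule ext) (simp add: c)
  ultimately show ?thesis by simp
qed

lemma sum_mult_le_L2:
  fixes a b :: "'i \<Rightarrow> real"
  assumes "\<And>i. i \<in> I \<Longrightarrow> 0 \<le> a i" "\<And>i. i \<in> I \<Longrightarrow> 0 \<le> b i"
  shows "(\<Sum>i\<in>I. a i * b i) \<le> sqrt (\<Sum>i\<in>I. (a i)\<^sup>2) * sqrt (\<Sum>i\<in>I. (b i)\<^sup>2)"
proof -
  have "(\<Sum>i\<in>I. a i * b i) = (\<Sum>i\<in>I. \<bar>a i\<bar> * \<bar>b i\<bar>)" using assms by (intro sum.cong) auto
  also have "\<dots> \<le> L2_set a I * L2_set b I" by (rule L2_set_mult_ineq)
  finally show ?thesis by (simp add: L2_set_def)
qed

text \<open>If \<open>x\<close> exceeded \<open>2 * B\<close> with \<open>B = A + S\<close>, then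
  \<open>x\<^sup>2\<close> would be larger than \<open>2 * B * x \<ge> B * x + B * B\<close>, more
  than the hypothesis allows.\<close>

lemma quadratic_bound:
  fixes x A S :: real
  assumes "0 \<le> A" "0 \<le> S" "x\<^sup>2 \<le> A * (x + S) + x * S"
  shows "x \<le> 2 * (A + S)"
proof (rule ccontr)
  assume n: "\<not> x \<le> 2 * (A + S)"
  define B where "B = A + S"
  have B: "0 \<le> B" "2 * B < x" using assms n by (auto simp: B_def)
  have "A * S \<le> B * B" using assms by (intro mult_mono) (auto simp: B_def)
  then have "x\<^sup>2 \<le> B * x + B * B" using assms(3) by (simp add: B_def algebra_simps)
  also have "\<dots> \<le> B * x + B * x" using B by (intro add_left_mono mult_left_mono) auto
  also have "\<dots> = (2 * B) * x" by simp
  also have "\<dots> < x * x" using B by (intro mult_strict_right_mono) auto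
  finally show False by (simp add: power2_eq_square)
qed

lemma residual_orthogonal:
  assumes M: "finite_measure M" and q: "L2 M q" "L2 M \<phi>" and z: "(\<integral>x. q x \<partial>M) = 0"
  shows "ip M q \<phi> = ip M q (\<lambda>x. \<phi> x - m)"
proof -
  interpret finite_measure M by (rule M)
  have "ip M q (\<lambda>x. m) = 0" using z by (simp add: ip_def)
  then show ?thesis using ip_diff_right[OF q(2) L2_const[of m] q(1)] by simp
qed

text \<open>The data chosen after the constant are fixed here, together with the domain, whereas the
  constants \<open>CP\<close> and \<open>CT\<close> enter as parameters of single lemmas; this keeps
  them free of any dependence on mesh, degrees, wave number and data.\<close>

locale dg_error =
  fixes \<Omega> \<T> p and \<beta> \<gamma> k :: real and f g u u\<^sub>h \<sigma> s
  assumes L: "lipschitz_domain \<Omega>" and m: "mesh \<Omega> \<T>" and k: "0 < k"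
    and f: "L2 (lebesgue_on \<Omega>) f" and g: "L2_bdry \<Omega> \<T> g"
    and u: "weak_solution \<Omega> \<T> k f g u" and uh: "u\<^sub>h \<in> V_hp \<T> p"
    and eq: "equilibrated_flux \<Omega> \<T> p \<gamma> k f g u\<^sub>h \<sigma>" and s: "s \<in> H1 \<Omega>"
begin

abbreviation "MO \<equiv> lebesgue_on \<Omega>"
abbreviation "G T \<equiv> dg_grad \<T> p \<beta> u\<^sub>h T"
abbreviation "res T \<equiv> \<lambda>x. f x + (complex_of_real k)\<^sup>2 * u\<^sub>h T x - wdiv \<Omega> \<sigma> x"
abbreviation "bq E \<equiv> \<lambda>x. ntrace \<Omega> \<T> \<sigma> x + g x + \<i> * k * bval \<T> E u\<^sub>h x - bres \<T> p \<gamma> k g u\<^sub>h E x"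
abbreviation "bE T \<equiv> {E. E edge_of T \<and> E \<in> boundary_edges \<Omega> \<T>}"

lemma dom: "\<Omega> \<in> sets lebesgue" "bounded \<Omega>"
  using L by (auto simp: lipschitz_domain_def lmeasurable_open)

lemma uh_smooth: "T \<in> \<T> \<Longrightarrow> smooth (u\<^sub>h T)"
  using uh poly_deg_le_smooth by (auto simp: V_hp_def)

lemma G_cont: "T \<in> \<T> \<Longrightarrow> continuous_on UNIV (G T)"
  unfolding dg_grad_def gradh_def by (intro continuous_intros continuous_on_grad uh_smooth)

lemma uH: "u \<in> H1 \<Omega>" using u by (simp add: weak_solution_def)

lemma flux:
  "L2 MO \<sigma>" "L2 MO (wdiv \<Omega> \<sigma>)" "is_ntrace \<Omega> \<T> \<sigma> (ntrace \<Omega> \<T> \<sigma>)"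
proof -
  have h: "\<sigma> \<in> Hdiv \<Omega>" "\<exists>q. is_ntrace \<Omega> \<T> \<sigma> q" using eq by (auto simp: equilibrated_flux_def)
  show "L2 MO \<sigma>" using h(1) by (simp add: Hdiv_def)
  have "\<exists>d. L2 MO d \<and> has_weak_div \<Omega> \<sigma> d" using h(1) by (simp add: Hdiv_def)
  from someI_ex[OF this] show "L2 MO (wdiv \<Omega> \<sigma>)" by (simp add: wdiv_def)
  show "is_ntrace \<Omega> \<T> \<sigma> (ntrace \<Omega> \<T> \<sigma>)" unfolding ntrace_def using h(2) by (rule someI_ex)
qed

lemma edge_L2:
  assumes E: "E \<in> boundary_edges \<Omega> \<T>"
  shows "finite_measure (arclen E)" "L2 (arclen E) g" "L2 (arclen E) (ntrace \<Omega> \<T> \<sigma>)"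
    "L2 (arclen E) (bval \<T> E u\<^sub>h)" "L2 (arclen E) (bres \<T> p \<gamma> k g u\<^sub>h E)" "L2 (arclen E) (bq E)"
    "L2 (arclen E) (bdry_trace \<Omega> \<T> u)"
proof -
  obtain T where T: "T \<in> \<T>" "E edge_of T" using E by (rule boundary_edgeE)
  have be: "bdry_elt \<T> E = T" by (rule bdry_elt_eq[OF L m E T])
  show "finite_measure (arclen E)" by (rule arclen_L2_smooth(2)[OF L m E continuous_on_const])
  show lg: "L2 (arclen E) g" using g E by (simp add: L2_bdry_def)
  show ln: "L2 (arclen E) (ntrace \<Omega> \<T> \<sigma>)" using flux(3) E by (simp add: is_ntrace_def L2_bdry_def)
  have "bval \<T> E u\<^sub>h = u\<^sub>h T" by (simp add: fun_eq_iff bval_def be)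
  then show lb: "L2 (arclen E) (bval \<T> E u\<^sub>h)"
    using arclen_L2_smooth(1)[OF L m E smooth_continuous[OF uh_smooth[OF T(1)]]] by simp
  have "continuous_on UNIV (bdn \<T> E u\<^sub>h)"
    unfolding bdn_def[abs_def] be gradh_def dotb_def
    by (intro continuous_intros continuous_on_compose2[OF continuous_on_vec_nth'[of UNIV] continuous_on_grad[OF uh_smooth[OF T(1)]]]) auto
  then have ld: "L2 (arclen E) (bdn \<T> E u\<^sub>h)" by (rule arclen_L2_smooth(1)[OF L m E])
  show lr: "L2 (arclen E) (bres \<T> p \<gamma> k g u\<^sub>h E)"
    unfolding bres_def[abs_def] by (intro L2_cmult L2_add L2_diff lg ld lb)
  show "L2 (arclen E) (bq E)" by (intro L2_add L2_diff L2_cmult lg ln lb lr)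
  show "L2 (arclen E) (bdry_trace \<Omega> \<T> u)" by (rule bdry_trace_L2[OF L m uH E])
qed

text \<open>Equilibration makes the residual orthogonal to constants on the edge; the constant
  removed is the mean over the adjacent element, since the trace inequality is available for
  it.\<close>

lemma edge_residual:
  assumes E: "E \<in> boundary_edges \<Omega> \<T>" and T: "T \<in> \<T>" "E edge_of T" and \<phi>: "smooth \<phi>"
  shows "norm (ip (arclen E) (bq E) \<phi>)
    \<le> ktr * (C_tr T * (sqrt (diameter E) * L2norm (arclen E) (bq E))) * L2norm (lebesgue_on T) (grad \<phi>)"
proof -
  note e = edge_L2[OF E]
  interpret finite_measure "arclen E" by (rule e)
  have z: "(\<integral>x. bq E x \<partial>arclen E) = 0"
  proof -
    have i1: "integrable (arclen E) (ntrace \<Omega> \<T> \<sigma>)" by (rule L2_imp_integrable[OF e(3)])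
    have i2: "integrable (arclen E) (\<lambda>x. - (g x + \<i> * k * bval \<T> E u\<^sub>h x) + bres \<T> p \<gamma> k g u\<^sub>h E x)"
      by (intro L2_imp_integrable L2_add L2_minus L2_cmult e)
    have "(\<integral>x. ntrace \<Omega> \<T> \<sigma> x \<partial>arclen E) = (\<integral>x. - (g x + \<i> * k * bval \<T> E u\<^sub>h x) + bres \<T> p \<gamma> k g u\<^sub>h E x \<partial>arclen E)"
      using eq E by (simp add: equilibrated_flux_def)
    moreover have "(\<integral>x. bq E x \<partial>arclen E) = (\<integral>x. ntrace \<Omega> \<T> \<sigma> x - (- (g x + \<i> * k * bval \<T> E u\<^sub>h x) + bres \<T> p \<gamma> k g u\<^sub>h E x) \<partial>arclen E)"
      by (simp add: algebra_simps)
    ultimately show ?thesis using Bochner_Integration.integral_diff[OF i1 i2] by simp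
  qed
  have c: "continuous_on UNIV (\<lambda>x. \<phi> x - mean T \<phi>)" by (intro continuous_intros smooth_continuous \<phi>)
  have orth: "ip (arclen E) (bq E) \<phi> = ip (arclen E) (bq E) (\<lambda>x. \<phi> x - mean T \<phi>)"
    by (rule residual_orthogonal[OF e(1,6) arclen_L2_smooth(1)[OF L m E smooth_continuous[OF \<phi>]] z])
  have "norm (ip (arclen E) (bq E) \<phi>) \<le> L2norm (arclen E) (bq E) * L2norm (arclen E) (\<lambda>x. \<phi> x - mean T \<phi>)"
    unfolding orth by (rule norm_ip_le[OF e(6) arclen_L2_smooth(1)[OF L m E c]])
  also have "\<dots> \<le> L2norm (arclen E) (bq E) * (ktr * (C_tr T * sqrt (diameter E)) * L2norm (lebesgue_on T) (grad \<phi>))"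
    by (rule mult_left_mono[OF mesh_edge_bound[OF L m T \<phi>] L2norm_nonneg])
  finally show ?thesis by (simp add: mult_ac)
qed

text \<open>The Poincare constant is twice the diameter while the estimator weights by
  \<open>diameter T / j11\<close>; the factor \<open>2 * j11\<close> reconciles the two.\<close>

lemma element_residual:
  assumes T: "T \<in> \<T>" and \<phi>: "smooth \<phi>"
  shows "norm (ip (lebesgue_on T) (res T) \<phi>)
    \<le> 2 * j11 * (diameter T / j11 * L2norm (lebesgue_on T) (res T)) * L2norm (lebesgue_on T) (grad \<phi>)"
proof -
  note ms = mesh_sets[OF L m T]
  interpret finite_measure "lebesgue_on T" by (rule finite_measure_lebesgue_on[OF ms(3)])
  have c: "L2 (lebesgue_on T) h" if "continuous_on UNIV h" for h :: "pt \<Rightarrow> complex"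
    by (rule L2_continuous_lebesgue_on[OF that ms(2,4)])
  have l1: "L2 (lebesgue_on T) (\<lambda>x. f x + (complex_of_real k)\<^sup>2 * u\<^sub>h T x)"
    by (intro L2_add mesh_L2(1)[OF L m f T] L2_cmult c smooth_continuous uh_smooth T)
  have l2: "L2 (lebesgue_on T) (wdiv \<Omega> \<sigma>)" by (rule mesh_L2(1)[OF L m flux(2) T])
  have lr: "L2 (lebesgue_on T) (res T)" by (rule L2_diff[OF l1 l2])
  have z: "(\<integral>x. res T x \<partial>lebesgue_on T) = 0"
    using eq T Bochner_Integration.integral_diff[OF L2_imp_integrable[OF l1] L2_imp_integrable[OF l2]]
    by (simp add: equilibrated_flux_def)
  have orth: "ip (lebesgue_on T) (res T) \<phi> = ip (lebesgue_on T) (res T) (\<lambda>x. \<phi> x - mean T \<phi>)"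
    by (rule residual_orthogonal[OF finite_measure_axioms lr c[OF smooth_continuous[OF \<phi>]] z])
  have "norm (ip (lebesgue_on T) (res T) \<phi>) \<le> L2norm (lebesgue_on T) (res T) * L2norm (lebesgue_on T) (\<lambda>x. \<phi> x - mean T \<phi>)"
    unfolding orth by (rule norm_ip_le[OF lr c]) (intro continuous_intros smooth_continuous \<phi>)
  also have "\<dots> \<le> L2norm (lebesgue_on T) (res T) * (2 * diameter T * L2norm (lebesgue_on T) (grad \<phi>))"
    by (rule mult_left_mono[OF mesh_elt_bound[OF L m T \<phi>] L2norm_nonneg])
  finally show ?thesis using j11_pos by (simp add: mult_ac)
qed

abbreviation "aT T \<equiv> L2norm (lebesgue_on T) (\<lambda>x. G T x + \<sigma> x)
   + diameter T / j11 * L2norm (lebesgue_on T) (res T)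
   + C_tr T * (\<Sum>E\<in>bE T. sqrt (diameter E) * L2norm (arclen E) (bq E))"

lemma C_tr_nonneg: "0 \<le> C_tr T"
  using j11_pos by (simp add: C_tr_def)

lemma aT_parts:
  assumes T: "T \<in> \<T>"
  shows "0 \<le> diameter T / j11 * L2norm (lebesgue_on T) (res T)"
    "0 \<le> C_tr T * (\<Sum>E\<in>bE T. sqrt (diameter E) * L2norm (arclen E) (bq E))"
proof -
  show "0 \<le> diameter T / j11 * L2norm (lebesgue_on T) (res T)"
    using j11_pos diameter_ge_0[OF mesh_sets(4)[OF L m T]] by simp
  have "0 \<le> diameter E" if "E \<in> bE T" for E
    using that edge_of_imp_subset bounded_subset[OF mesh_sets(4)[OF L m T]] by (intro diameter_ge_0) blast
  then show "0 \<le> C_tr T * (\<Sum>E\<in>bE T. sqrt (diameter E) * L2norm (arclen E) (bq E))"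
    by (intro mult_nonneg_nonneg C_tr_nonneg sum_nonneg) auto
qed

text \<open>The flux approximates minus the gradient, which is why the two products are added: the
  weak form rewrites the first, Green's formula in \<open>is_ntrace\<close> the second. Inserting
  the discrete volume and boundary terms separates the residuals, which equilibration controls, from
  the errors in \<open>u\<close>.\<close>

lemma error_identity:
  assumes \<phi>: "smooth \<phi>"
  shows "ipv MO (wgrad \<Omega> u) (grad \<phi>) + ipv MO \<sigma> (grad \<phi>)
    = (\<Sum>T\<in>\<T>. ip (lebesgue_on T) (res T) \<phi>) + k\<^sup>2 * ip MO (\<lambda>x. u x - glue \<T> u\<^sub>h x) \<phi>
      + (\<Sum>E\<in>boundary_edges \<Omega> \<T>. ip (arclen E) (bq E) \<phi> + ip (arclen E) (bres \<T> p \<gamma> k g u\<^sub>h E) \<phi>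
           + \<i> * k * ip (arclen E) (\<lambda>x. bdry_trace \<Omega> \<T> u x - bval \<T> E u\<^sub>h x) \<phi>)"
proof -
  note H = smooth_H1[OF L \<phi>]
  note wu = wgrad_props[OF uH] and w\<phi> = wgrad_props[OF H(1)]
  have Lg: "L2 MO (grad \<phi>)" and L\<phi>: "L2 MO \<phi>"
    by (intro L2_continuous_lebesgue_on continuous_on_grad smooth_continuous \<phi> dom)+
  \<comment> \<open>Under the integrals, \<open>wgrad\<close> and \<open>bdry_trace\<close> of the
    smooth test function are replaced by the classical gradient and the restriction.\<close>
  have gr: "ipv MO v (wgrad \<Omega> \<phi>) = ipv MO v (grad \<phi>)" if "L2 MO v" for v
    by (rule ipv_cong_AE_right) (use H(2) w\<phi>(2) Lg that in \<open>auto intro: L2D(1)\<close>)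
  have tr: "ip_bdry \<Omega> \<T> v (bdry_trace \<Omega> \<T> \<phi>) = (\<Sum>E\<in>boundary_edges \<Omega> \<T>. ip (arclen E) v \<phi>)"
    if "\<And>E. E \<in> boundary_edges \<Omega> \<T> \<Longrightarrow> L2 (arclen E) v" for v
    unfolding ip_bdry_def
  proof (rule sum.cong[OF refl])
    fix E assume E: "E \<in> boundary_edges \<Omega> \<T>"
    show "ip (arclen E) v (bdry_trace \<Omega> \<T> \<phi>) = ip (arclen E) v \<phi>"
      by (rule ip_cong_AE(2)[OF L2D(1)[OF bdry_trace_L2[OF L m H(1) E]] L2D(1)[OF arclen_L2_smooth(1)[OF L m E smooth_continuous[OF \<phi>]]]
          L2D(1)[OF that[OF E]] bdry_trace_smooth[OF L m \<phi> E]])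
  qed
  have 1: "ipv MO (wgrad \<Omega> u) (grad \<phi>) = k\<^sup>2 * ip MO u \<phi> + \<i> * k * (\<Sum>E\<in>boundary_edges \<Omega> \<T>. ip (arclen E) (bdry_trace \<Omega> \<T> u) \<phi>)
      + ip MO f \<phi> + (\<Sum>E\<in>boundary_edges \<Omega> \<T>. ip (arclen E) g \<phi>)"
  proof -
    have "a_form \<Omega> \<T> k u \<phi> = F_form \<Omega> \<T> f g \<phi>" using u H(1) by (simp add: weak_solution_def)
    moreover have "ip_bdry \<Omega> \<T> (bdry_trace \<Omega> \<T> u) (bdry_trace \<Omega> \<T> \<phi>) = (\<Sum>E\<in>boundary_edges \<Omega> \<T>. ip (arclen E) (bdry_trace \<Omega> \<T> u) \<phi>)"
      "ip_bdry \<Omega> \<T> g (bdry_trace \<Omega> \<T> \<phi>) = (\<Sum>E\<in>boundary_edges \<Omega> \<T>. ip (arclen E) g \<phi>)"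
      by (rule tr, erule edge_L2)+
    ultimately show ?thesis
      unfolding a_form_def F_form_def gr[OF wu(2)] by (simp add: algebra_simps)
  qed
  have 2: "ipv MO \<sigma> (grad \<phi>) + ip MO (wdiv \<Omega> \<sigma>) \<phi> = (\<Sum>E\<in>boundary_edges \<Omega> \<T>. ip (arclen E) (ntrace \<Omega> \<T> \<sigma>) \<phi>)"
  proof -
    have "ip_bdry \<Omega> \<T> (ntrace \<Omega> \<T> \<sigma>) (bdry_trace \<Omega> \<T> \<phi>) = (\<Sum>E\<in>boundary_edges \<Omega> \<T>. ip (arclen E) (ntrace \<Omega> \<T> \<sigma>) \<phi>)"
      by (rule tr, erule edge_L2)
    moreover have "ipv MO \<sigma> (wgrad \<Omega> \<phi>) + ip MO (wdiv \<Omega> \<sigma>) \<phi> = ip_bdry \<Omega> \<T> (ntrace \<Omega> \<T> \<sigma>) (bdry_trace \<Omega> \<T> \<phi>)"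
      using flux(3) H(1) by (simp add: is_ntrace_def)
    ultimately show ?thesis by (simp add: gr[OF flux(1)])
  qed
  let ?U = "glue \<T> u\<^sub>h"
  have LU: "L2 MO ?U" by (rule glue_L2[OF L m smooth_continuous[OF uh_smooth]])
  let ?\<rho> = "\<lambda>x. f x + (complex_of_real k)\<^sup>2 * ?U x - wdiv \<Omega> \<sigma> x"
  have L\<rho>: "L2 MO ?\<rho>" by (intro L2_add L2_diff L2_cmult f LU flux)
  have 3: "ip MO ?\<rho> \<phi> = ip MO f \<phi> + k\<^sup>2 * ip MO ?U \<phi> - ip MO (wdiv \<Omega> \<sigma>) \<phi>"
    by (simp add: ip_diff_left[OF L2_add[OF f L2_cmult[OF LU]] flux(2) L\<phi>] ip_add_left[OF f L2_cmult[OF LU] L\<phi>] ip_cmult_left)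
  have 4: "ip MO (\<lambda>x. u x - ?U x) \<phi> = ip MO u \<phi> - ip MO ?U \<phi>" by (rule ip_diff_left[OF wu(1) LU L\<phi>])
  have 5: "ip MO ?\<rho> \<phi> = (\<Sum>T\<in>\<T>. ip (lebesgue_on T) (res T) \<phi>)"
  proof -
    have "ip MO ?\<rho> \<phi> = (\<Sum>T\<in>\<T>. ip (lebesgue_on T) ?\<rho> \<phi>)"
      unfolding ip_def by (rule mesh_integral(2)[OF L m integrable_mult_cnj[OF L\<rho> L\<phi>]])
    also have "\<dots> = (\<Sum>T\<in>\<T>. ip (lebesgue_on T) (res T) \<phi>)"
    proof (rule sum.cong[OF refl])
      fix T assume T: "T \<in> \<T>"
      have c: "L2 (lebesgue_on T) h" if "continuous_on UNIV h" for h :: "pt \<Rightarrow> complex"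
        by (rule L2_continuous_lebesgue_on[OF that mesh_sets(2,4)[OF L m T]])
      have lr: "L2 (lebesgue_on T) (res T)"
        by (intro L2_add L2_diff L2_cmult mesh_L2(1)[OF L m f T] mesh_L2(1)[OF L m flux(2) T] c smooth_continuous uh_smooth T)
      show "ip (lebesgue_on T) ?\<rho> \<phi> = ip (lebesgue_on T) (res T) \<phi>"
      proof (rule ip_cong_AE(1)[OF L2D(1)[OF mesh_L2(1)[OF L m L\<rho> T]] L2D(1)[OF lr] L2D(1)[OF c[OF smooth_continuous[OF \<phi>]]]])
        show "AE x in lebesgue_on T. ?\<rho> x = res T x"
          using glue_AE[OF L m T, of u\<^sub>h] by eventually_elim simp
      qed
    qed
    finally show ?thesis .
  qed
  \<comment> \<open>Edge by edge, \<open>bq\<close> and \<open>bres\<close> are inserted so that the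
    discrete traces cancel.\<close>
  have 6: "ip (arclen E) (ntrace \<Omega> \<T> \<sigma>) \<phi> + ip (arclen E) g \<phi> + \<i> * k * ip (arclen E) (bdry_trace \<Omega> \<T> u) \<phi>
    = ip (arclen E) (bq E) \<phi> + ip (arclen E) (bres \<T> p \<gamma> k g u\<^sub>h E) \<phi> + \<i> * k * ip (arclen E) (\<lambda>x. bdry_trace \<Omega> \<T> u x - bval \<T> E u\<^sub>h x) \<phi>"
    if E: "E \<in> boundary_edges \<Omega> \<T>" for E
  proof -
    note e = edge_L2[OF E]
    have l: "L2 (arclen E) \<phi>" by (rule arclen_L2_smooth(1)[OF L m E smooth_continuous[OF \<phi>]])
    have A: "ip (arclen E) (bq E) \<phi> = ip (arclen E) (ntrace \<Omega> \<T> \<sigma>) \<phi> + ip (arclen E) g \<phi> + \<i> * k * ip (arclen E) (bval \<T> E u\<^sub>h) \<phi> - ip (arclen E) (bres \<T> p \<gamma> k g u\<^sub>h E) \<phi>"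
      unfolding ip_diff_left[OF L2_add[OF L2_add[OF e(3,2)] L2_cmult[OF e(4)]] e(5) l]
        ip_add_left[OF L2_add[OF e(3,2)] L2_cmult[OF e(4)] l] ip_add_left[OF e(3,2) l] ip_cmult_left ..
    have B: "ip (arclen E) (\<lambda>x. bdry_trace \<Omega> \<T> u x - bval \<T> E u\<^sub>h x) \<phi> = ip (arclen E) (bdry_trace \<Omega> \<T> u) \<phi> - ip (arclen E) (bval \<T> E u\<^sub>h) \<phi>"
      by (rule ip_diff_left[OF e(7,4) l])
    show ?thesis unfolding A B by (simp add: algebra_simps)
  qed
  have "(\<Sum>E\<in>boundary_edges \<Omega> \<T>. ip (arclen E) (bq E) \<phi> + ip (arclen E) (bres \<T> p \<gamma> k g u\<^sub>h E) \<phi>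
           + \<i> * k * ip (arclen E) (\<lambda>x. bdry_trace \<Omega> \<T> u x - bval \<T> E u\<^sub>h x) \<phi>)
    = (\<Sum>E\<in>boundary_edges \<Omega> \<T>. ip (arclen E) (ntrace \<Omega> \<T> \<sigma>) \<phi> + ip (arclen E) g \<phi> + \<i> * k * ip (arclen E) (bdry_trace \<Omega> \<T> u) \<phi>)"
    by (rule sum.cong[OF refl]) (rule 6[symmetric])
  also have "\<dots> = (\<Sum>E\<in>boundary_edges \<Omega> \<T>. ip (arclen E) (ntrace \<Omega> \<T> \<sigma>) \<phi>) + (\<Sum>E\<in>boundary_edges \<Omega> \<T>. ip (arclen E) g \<phi>)
      + \<i> * k * (\<Sum>E\<in>boundary_edges \<Omega> \<T>. ip (arclen E) (bdry_trace \<Omega> \<T> u) \<phi>)"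
    by (simp add: sum.distrib sum_distrib_left)
  finally have 7: "(\<Sum>E\<in>boundary_edges \<Omega> \<T>. ip (arclen E) (bq E) \<phi> + ip (arclen E) (bres \<T> p \<gamma> k g u\<^sub>h E) \<phi>
           + \<i> * k * ip (arclen E) (\<lambda>x. bdry_trace \<Omega> \<T> u x - bval \<T> E u\<^sub>h x) \<phi>)
    = (ipv MO \<sigma> (grad \<phi>) + ip MO (wdiv \<Omega> \<sigma>) \<phi>) + (\<Sum>E\<in>boundary_edges \<Omega> \<T>. ip (arclen E) g \<phi>)
      + \<i> * k * (\<Sum>E\<in>boundary_edges \<Omega> \<T>. ip (arclen E) (bdry_trace \<Omega> \<T> u) \<phi>)"
    by (simp only: 2)
  show ?thesis unfolding 7 5[symmetric] 3 4 1 by (simp add: algebra_simps)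
qed

text \<open>The terms in \<open>u - u\<^sub>h\<close> and in \<open>bres\<close> have no mean value
  zero and use the domain inequalities with \<open>CP\<close> and \<open>CT\<close>; the
  equilibrated residuals are estimated element by element and summed by Cauchy-Schwarz, so they
  enter with the weights of the estimator.\<close>

lemma smooth_test_bound:
  assumes CP: "CP \<ge> 0" "\<And>\<phi>. smooth \<phi> \<Longrightarrow> \<exists>c. L2norm MO (\<lambda>x. \<phi> x - c) \<le> CP * L2norm MO (grad \<phi>)"
    and CT: "CT \<ge> 0" "\<And>\<phi>. smooth \<phi> \<Longrightarrow> (\<Sum>E\<in>boundary_edges \<Omega> \<T>. (L2norm (arclen E) \<phi>)\<^sup>2)
      \<le> CT * ((L2norm MO \<phi>)\<^sup>2 + (L2norm MO (grad \<phi>))\<^sup>2)"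
    and \<phi>0: "smooth \<phi>0"
  shows "norm (ipv MO (\<lambda>x. wgrad \<Omega> u x - glue \<T> G x) (grad \<phi>0))
    \<le> ((1 + 2 * j11 + ktr) * sqrt (\<Sum>T\<in>\<T>. (aT T)\<^sup>2) + CP * (k\<^sup>2 * L2norm MO (\<lambda>x. u x - glue \<T> u\<^sub>h x))
       + sqrt (CT * (CP\<^sup>2 + 1)) * (k * L2norm_bdry \<Omega> \<T> (\<lambda>E x. bdry_trace \<Omega> \<T> u x - bval \<T> E u\<^sub>h x)
         + L2norm_bdry \<Omega> \<T> (bres \<T> p \<gamma> k g u\<^sub>h))) * L2norm MO (grad \<phi>0)"
proof -
  let ?N = "L2norm MO (grad \<phi>0)" and ?B = "boundary_edges \<Omega> \<T>"
  obtain c where c: "L2norm MO (\<lambda>x. \<phi>0 x - c) \<le> CP * ?N" using CP(2)[OF \<phi>0] by blast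
  define \<phi> where "\<phi> = (\<lambda>x. \<phi>0 x - c)"
  have \<phi>: "smooth \<phi>" unfolding \<phi>_def by (intro smooth_diff smooth_const \<phi>0)
  have gr: "grad \<phi> = grad \<phi>0" unfolding \<phi>_def by (rule grad_minus_const[OF \<phi>0])
  have fin: "finite \<T>" "finite ?B" by (rule mesh_finite[OF m] finite_boundary_edges[OF L m])+
  note wu = wgrad_props[OF uH]
  have Lg: "L2 MO (grad \<phi>)" and L\<phi>: "L2 MO \<phi>"
    by (intro L2_continuous_lebesgue_on continuous_on_grad smooth_continuous \<phi> dom)+
  have LG: "L2 MO (glue \<T> G)" by (rule glue_L2[OF L m G_cont])
  have LU: "L2 MO (glue \<T> u\<^sub>h)" by (rule glue_L2[OF L m smooth_continuous[OF uh_smooth]])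
  let ?n = "\<lambda>T. L2norm (lebesgue_on T) (grad \<phi>)"
  have Nsq: "sqrt (\<Sum>T\<in>\<T>. (?n T)\<^sup>2) = ?N"
    using mesh_L2(2)[OF L m Lg] by (simp add: gr real_sqrt_unique)
  have \<phi>N: "L2norm MO \<phi> \<le> CP * ?N" using c by (simp add: \<phi>_def)
  \<comment> \<open>Trace inequality followed by the Poincare inequality for \<open>\<phi>\<close>;
    this is the origin of \<open>sqrt (CT * (CP\<^sup>2 + 1))\<close>.\<close>
  have bN: "sqrt (\<Sum>E\<in>?B. (L2norm (arclen E) \<phi>)\<^sup>2) \<le> sqrt (CT * (CP\<^sup>2 + 1)) * ?N"
  proof -
    have "(\<Sum>E\<in>?B. (L2norm (arclen E) \<phi>)\<^sup>2) \<le> CT * ((L2norm MO \<phi>)\<^sup>2 + ?N\<^sup>2)" using CT(2)[OF \<phi>] by (simp add: gr)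
    also have "\<dots> \<le> CT * ((CP * ?N)\<^sup>2 + ?N\<^sup>2)"
      by (intro mult_left_mono add_right_mono power_mono \<phi>N CT(1)) simp
    also have "\<dots> = CT * (CP\<^sup>2 + 1) * ?N\<^sup>2" by (simp add: algebra_simps power_mult_distrib)
    finally have "sqrt (\<Sum>E\<in>?B. (L2norm (arclen E) \<phi>)\<^sup>2) \<le> sqrt (CT * (CP\<^sup>2 + 1) * ?N\<^sup>2)" by (rule real_sqrt_le_mono)
    then show ?thesis by (simp add: real_sqrt_mult)
  qed
  have "ipv MO (\<lambda>x. wgrad \<Omega> u x - glue \<T> G x) (grad \<phi>)
    = (ipv MO (wgrad \<Omega> u) (grad \<phi>) + ipv MO \<sigma> (grad \<phi>)) - ipv MO (\<lambda>x. glue \<T> G x + \<sigma> x) (grad \<phi>)"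
    by (simp add: ipv_diff_left[OF wu(2) LG Lg] ipv_add_left[OF LG flux(1) Lg])
  also have "norm \<dots> \<le> norm (ipv MO (wgrad \<Omega> u) (grad \<phi>) + ipv MO \<sigma> (grad \<phi>)) + norm (ipv MO (\<lambda>x. glue \<T> G x + \<sigma> x) (grad \<phi>))"
    by (rule norm_triangle_ineq4)
  also have "norm (ipv MO (\<lambda>x. glue \<T> G x + \<sigma> x) (grad \<phi>)) \<le> (\<Sum>T\<in>\<T>. L2norm (lebesgue_on T) (\<lambda>x. G T x + \<sigma> x) * ?n T)"
  proof -
    have "ipv MO (\<lambda>x. glue \<T> G x + \<sigma> x) (grad \<phi>) = (\<Sum>T\<in>\<T>. ipv (lebesgue_on T) (\<lambda>x. glue \<T> G x + \<sigma> x) (grad \<phi>))"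
      unfolding ipv_def by (rule mesh_integral(2)[OF L m integrable_dotc[OF L2_add[OF LG flux(1)] Lg]])
    also have "norm \<dots> \<le> (\<Sum>T\<in>\<T>. L2norm (lebesgue_on T) (\<lambda>x. G T x + \<sigma> x) * ?n T)"
    proof (rule sum_norm_le)
      fix T assume T: "T \<in> \<T>"
      have l: "L2 (lebesgue_on T) (\<lambda>x. glue \<T> G x + \<sigma> x)" by (rule mesh_L2(1)[OF L m L2_add[OF LG flux(1)] T])
      have l': "L2 (lebesgue_on T) (\<lambda>x. G T x + \<sigma> x)"
        by (intro L2_add L2_continuous_lebesgue_on G_cont T mesh_sets[OF L m T] mesh_L2(1)[OF L m flux(1) T])
      have "L2norm (lebesgue_on T) (\<lambda>x. glue \<T> G x + \<sigma> x) = L2norm (lebesgue_on T) (\<lambda>x. G T x + \<sigma> x)"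
        by (rule L2norm_cong_AE[OF L2D(1)[OF l] L2D(1)[OF l']]) (use glue_AE[OF L m T, of G] in eventually_elim, simp)
      then show "norm (ipv (lebesgue_on T) (\<lambda>x. glue \<T> G x + \<sigma> x) (grad \<phi>)) \<le> L2norm (lebesgue_on T) (\<lambda>x. G T x + \<sigma> x) * ?n T"
        using norm_ipv_le[OF l mesh_L2(1)[OF L m Lg T]] by simp
    qed
    finally show ?thesis .
  qed
  also have "norm (ipv MO (wgrad \<Omega> u) (grad \<phi>) + ipv MO \<sigma> (grad \<phi>))
    \<le> (\<Sum>T\<in>\<T>. 2 * j11 * (diameter T / j11 * L2norm (lebesgue_on T) (res T)) * ?n T)
      + k\<^sup>2 * (L2norm MO (\<lambda>x. u x - glue \<T> u\<^sub>h x) * (CP * ?N))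
      + ((\<Sum>T\<in>\<T>. ktr * (C_tr T * (\<Sum>E\<in>bE T. sqrt (diameter E) * L2norm (arclen E) (bq E))) * ?n T)
        + L2norm_bdry \<Omega> \<T> (bres \<T> p \<gamma> k g u\<^sub>h) * (sqrt (CT * (CP\<^sup>2 + 1)) * ?N)
        + k * (L2norm_bdry \<Omega> \<T> (\<lambda>E x. bdry_trace \<Omega> \<T> u x - bval \<T> E u\<^sub>h x) * (sqrt (CT * (CP\<^sup>2 + 1)) * ?N)))"
  proof -
    have e\<phi>: "L2 (arclen E) \<phi>" if "E \<in> ?B" for E by (rule arclen_L2_smooth(1)[OF L m that smooth_continuous[OF \<phi>]])
    have a1: "norm (\<Sum>T\<in>\<T>. ip (lebesgue_on T) (res T) \<phi>) \<le> (\<Sum>T\<in>\<T>. 2 * j11 * (diameter T / j11 * L2norm (lebesgue_on T) (res T)) * ?n T)"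
      by (rule sum_norm_le) (rule element_residual[OF _ \<phi>])
    have a2: "norm (k\<^sup>2 * ip MO (\<lambda>x. u x - glue \<T> u\<^sub>h x) \<phi>) \<le> k\<^sup>2 * (L2norm MO (\<lambda>x. u x - glue \<T> u\<^sub>h x) * (CP * ?N))"
      unfolding norm_mult using norm_ip_le[OF L2_diff[OF wu(1) LU] L\<phi>] \<phi>N
      by (auto simp: norm_power intro!: mult_left_mono intro: order_trans[OF _ mult_left_mono])
    have a3: "norm (\<Sum>E\<in>?B. ip (arclen E) (bq E) \<phi>) \<le> (\<Sum>T\<in>\<T>. ktr * (C_tr T * (\<Sum>E\<in>bE T. sqrt (diameter E) * L2norm (arclen E) (bq E))) * ?n T)"
    proof -
      let ?y = "\<lambda>T E. ktr * (C_tr T * (sqrt (diameter E) * L2norm (arclen E) (bq E))) * ?n T"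
      have y0: "0 \<le> ?y T E" if "T \<in> \<T>" "E edge_of T" for T E
      proof -
        have "0 \<le> diameter E"
          using that edge_of_imp_subset bounded_subset[OF mesh_sets(4)[OF L m that(1)]] by (intro diameter_ge_0) blast
        then show ?thesis by (intro mult_nonneg_nonneg ktr_nonneg C_tr_nonneg) auto
      qed
      \<comment> \<open>The sum over boundary edges is regrouped by elements; summing over every
        element that has \<open>E\<close> as an edge can only increase a nonnegative bound and makes
        the exchange of sums formal.\<close>
      have "norm (\<Sum>E\<in>?B. ip (arclen E) (bq E) \<phi>) \<le> (\<Sum>E\<in>?B. \<Sum>T | T \<in> \<T> \<and> E edge_of T. ?y T E)"
      proof (rule sum_norm_le)
        fix E assume E: "E \<in> ?B"
        obtain T where T: "T \<in> \<T>" "E edge_of T" using E by (rule boundary_edgeE)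
        have "norm (ip (arclen E) (bq E) \<phi>) \<le> ?y T E" by (rule edge_residual[OF E T \<phi>])
        also have "\<dots> \<le> (\<Sum>T | T \<in> \<T> \<and> E edge_of T. ?y T E)"
          by (rule member_le_sum) (use T y0 fin(1) in auto)
        finally show "norm (ip (arclen E) (bq E) \<phi>) \<le> (\<Sum>T | T \<in> \<T> \<and> E edge_of T. ?y T E)" .
      qed
      also have "\<dots> = (\<Sum>T\<in>\<T>. \<Sum>E | E \<in> ?B \<and> E edge_of T. ?y T E)"
        by (rule sum.swap_restrict[OF fin(2,1)])
      also have "\<dots> = (\<Sum>T\<in>\<T>. ktr * (C_tr T * (\<Sum>E\<in>bE T. sqrt (diameter E) * L2norm (arclen E) (bq E))) * ?n T)"
        by (simp add: sum_distrib_left sum_distrib_right conj_commute)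
      finally show ?thesis .
    qed
    have bsum: "norm (\<Sum>E\<in>?B. ip (arclen E) (z E) \<phi>) \<le> L2norm_bdry \<Omega> \<T> z * (sqrt (CT * (CP\<^sup>2 + 1)) * ?N)"
      if z: "\<And>E. E \<in> ?B \<Longrightarrow> L2 (arclen E) (z E)" for z
    proof -
      have "norm (\<Sum>E\<in>?B. ip (arclen E) (z E) \<phi>) \<le> (\<Sum>E\<in>?B. L2norm (arclen E) (z E) * L2norm (arclen E) \<phi>)"
        by (rule sum_norm_le) (rule norm_ip_le[OF z e\<phi>])
      also have "\<dots> \<le> sqrt (\<Sum>E\<in>?B. (L2norm (arclen E) (z E))\<^sup>2) * sqrt (\<Sum>E\<in>?B. (L2norm (arclen E) \<phi>)\<^sup>2)"
        by (rule sum_mult_le_L2) auto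
      also have "\<dots> \<le> L2norm_bdry \<Omega> \<T> z * (sqrt (CT * (CP\<^sup>2 + 1)) * ?N)"
        unfolding L2norm_bdry_def by (intro mult_left_mono bN) (auto intro: sum_nonneg)
      finally show ?thesis .
    qed
    have a4: "norm (\<Sum>E\<in>?B. ip (arclen E) (bres \<T> p \<gamma> k g u\<^sub>h E) \<phi>) \<le> L2norm_bdry \<Omega> \<T> (bres \<T> p \<gamma> k g u\<^sub>h) * (sqrt (CT * (CP\<^sup>2 + 1)) * ?N)"
      by (rule bsum) (rule edge_L2(5))
    have a5: "norm (\<i> * k * (\<Sum>E\<in>?B. ip (arclen E) (\<lambda>x. bdry_trace \<Omega> \<T> u x - bval \<T> E u\<^sub>h x) \<phi>))
      \<le> k * (L2norm_bdry \<Omega> \<T> (\<lambda>E x. bdry_trace \<Omega> \<T> u x - bval \<T> E u\<^sub>h x) * (sqrt (CT * (CP\<^sup>2 + 1)) * ?N))"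
    proof -
      have "norm (\<Sum>E\<in>?B. ip (arclen E) (\<lambda>x. bdry_trace \<Omega> \<T> u x - bval \<T> E u\<^sub>h x) \<phi>)
        \<le> L2norm_bdry \<Omega> \<T> (\<lambda>E x. bdry_trace \<Omega> \<T> u x - bval \<T> E u\<^sub>h x) * (sqrt (CT * (CP\<^sup>2 + 1)) * ?N)"
        by (rule bsum) (intro L2_diff edge_L2)
      then show ?thesis using k by (simp add: norm_mult)
    qed
    have split: "(\<Sum>E\<in>?B. ip (arclen E) (bq E) \<phi> + ip (arclen E) (bres \<T> p \<gamma> k g u\<^sub>h E) \<phi>
           + \<i> * k * ip (arclen E) (\<lambda>x. bdry_trace \<Omega> \<T> u x - bval \<T> E u\<^sub>h x) \<phi>)
      = (\<Sum>E\<in>?B. ip (arclen E) (bq E) \<phi>) + (\<Sum>E\<in>?B. ip (arclen E) (bres \<T> p \<gamma> k g u\<^sub>h E) \<phi>)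
       + \<i> * k * (\<Sum>E\<in>?B. ip (arclen E) (\<lambda>x. bdry_trace \<Omega> \<T> u x - bval \<T> E u\<^sub>h x) \<phi>)"
      by (simp add: sum.distrib sum_distrib_left)
    show ?thesis unfolding error_identity[OF \<phi>] split
      by (intro order_trans[OF norm_triangle_ineq] add_mono a1 a2 a3 a4 a5)
  qed
  also have "(\<Sum>T\<in>\<T>. 2 * j11 * (diameter T / j11 * L2norm (lebesgue_on T) (res T)) * ?n T)
      + k\<^sup>2 * (L2norm MO (\<lambda>x. u x - glue \<T> u\<^sub>h x) * (CP * ?N))
      + ((\<Sum>T\<in>\<T>. ktr * (C_tr T * (\<Sum>E\<in>bE T. sqrt (diameter E) * L2norm (arclen E) (bq E))) * ?n T)
        + L2norm_bdry \<Omega> \<T> (bres \<T> p \<gamma> k g u\<^sub>h) * (sqrt (CT * (CP\<^sup>2 + 1)) * ?N)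
        + k * (L2norm_bdry \<Omega> \<T> (\<lambda>E x. bdry_trace \<Omega> \<T> u x - bval \<T> E u\<^sub>h x) * (sqrt (CT * (CP\<^sup>2 + 1)) * ?N)))
      + (\<Sum>T\<in>\<T>. L2norm (lebesgue_on T) (\<lambda>x. G T x + \<sigma> x) * ?n T)
    = (\<Sum>T\<in>\<T>. (L2norm (lebesgue_on T) (\<lambda>x. G T x + \<sigma> x) + 2 * j11 * (diameter T / j11 * L2norm (lebesgue_on T) (res T))
        + ktr * (C_tr T * (\<Sum>E\<in>bE T. sqrt (diameter E) * L2norm (arclen E) (bq E)))) * ?n T)
      + (CP * (k\<^sup>2 * L2norm MO (\<lambda>x. u x - glue \<T> u\<^sub>h x)) + sqrt (CT * (CP\<^sup>2 + 1)) * (k * L2norm_bdry \<Omega> \<T> (\<lambda>E x. bdry_trace \<Omega> \<T> u x - bval \<T> E u\<^sub>h x)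
         + L2norm_bdry \<Omega> \<T> (bres \<T> p \<gamma> k g u\<^sub>h))) * ?N"
    unfolding distrib_right sum.distrib by (simp only: distrib_left distrib_right mult_ac add_ac)
  also have "(\<Sum>T\<in>\<T>. (L2norm (lebesgue_on T) (\<lambda>x. G T x + \<sigma> x) + 2 * j11 * (diameter T / j11 * L2norm (lebesgue_on T) (res T))
        + ktr * (C_tr T * (\<Sum>E\<in>bE T. sqrt (diameter E) * L2norm (arclen E) (bq E)))) * ?n T)
     \<le> (1 + 2 * j11 + ktr) * sqrt (\<Sum>T\<in>\<T>. (aT T)\<^sup>2) * ?N"
  proof -
    \<comment> \<open>The three parts of \<open>aT\<close> carry the factors 1,
      \<open>2 * j11\<close> and \<open>ktr\<close>; their sum bounds each of them.\<close>
    let ?K = "1 + 2 * j11 + ktr"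
    have "(\<Sum>T\<in>\<T>. (L2norm (lebesgue_on T) (\<lambda>x. G T x + \<sigma> x) + 2 * j11 * (diameter T / j11 * L2norm (lebesgue_on T) (res T))
        + ktr * (C_tr T * (\<Sum>E\<in>bE T. sqrt (diameter E) * L2norm (arclen E) (bq E)))) * ?n T)
      \<le> (\<Sum>T\<in>\<T>. ?K * (aT T * ?n T))"
    proof (rule sum_mono)
      fix T assume T: "T \<in> \<T>"
      have le: "a + 2 * j11 * b + ktr * d \<le> ?K * (a + b + d)" if "0 \<le> a" "0 \<le> b" "0 \<le> d" for a b d
      proof -
        have "0 \<le> (2 * j11 + ktr) * a + (1 + ktr) * b + (1 + 2 * j11) * d"
          using that j11_pos ktr_nonneg by simp
        then show ?thesis by (simp add: algebra_simps)
      qed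
      show "(L2norm (lebesgue_on T) (\<lambda>x. G T x + \<sigma> x) + 2 * j11 * (diameter T / j11 * L2norm (lebesgue_on T) (res T))
        + ktr * (C_tr T * (\<Sum>E\<in>bE T. sqrt (diameter E) * L2norm (arclen E) (bq E)))) * ?n T \<le> ?K * (aT T * ?n T)"
        unfolding mult.assoc[of ?K, symmetric]
        by (rule mult_right_mono[OF le[OF L2norm_nonneg aT_parts[OF T]]]) simp
    qed
    also have "\<dots> = ?K * (\<Sum>T\<in>\<T>. aT T * ?n T)" by (simp only: sum_distrib_left)
    also have "\<dots> \<le> ?K * (sqrt (\<Sum>T\<in>\<T>. (aT T)\<^sup>2) * sqrt (\<Sum>T\<in>\<T>. (?n T)\<^sup>2))"
    proof (rule mult_left_mono[OF sum_mult_le_L2])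
      show "0 \<le> aT T" if "T \<in> \<T>" for T using aT_parts[OF that] by (intro add_nonneg_nonneg) auto
    qed (use j11_pos ktr_nonneg in auto)
    finally show ?thesis unfolding Nsq by (simp only: mult.assoc)
  qed
  finally show ?thesis unfolding gr by (simp only: distrib_right add_ac)
qed

lemma error_bound:
  assumes CP: "CP \<ge> 0" "\<And>\<phi>. smooth \<phi> \<Longrightarrow> \<exists>c. L2norm MO (\<lambda>x. \<phi> x - c) \<le> CP * L2norm MO (grad \<phi>)"
    and CT: "CT \<ge> 0" "\<And>\<phi>. smooth \<phi> \<Longrightarrow> (\<Sum>E\<in>boundary_edges \<Omega> \<T>. (L2norm (arclen E) \<phi>)\<^sup>2)
      \<le> CT * ((L2norm MO \<phi>)\<^sup>2 + (L2norm MO (grad \<phi>))\<^sup>2)"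
  shows "L2norm MO (\<lambda>x. wgrad \<Omega> u x - glue \<T> G x)
    \<le> 2 * (2 + 2 * j11 + ktr + CP + sqrt (CT * (CP\<^sup>2 + 1))) * (eta_hp \<Omega> \<T> p \<beta> \<gamma> k f g u\<^sub>h \<sigma> s
            + k\<^sup>2 * L2norm MO (\<lambda>x. u x - glue \<T> u\<^sub>h x)
            + k * L2norm_bdry \<Omega> \<T> (\<lambda>E x. bdry_trace \<Omega> \<T> u x - bval \<T> E u\<^sub>h x)
            + L2norm_bdry \<Omega> \<T> (bres \<T> p \<gamma> k g u\<^sub>h))"
proof -
  note wu = wgrad_props[OF uH] and ws = wgrad_props[OF s]
  let ?e = "\<lambda>x. wgrad \<Omega> u x - glue \<T> G x" and ?w = "\<lambda>x. wgrad \<Omega> u x - wgrad \<Omega> s x"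
  define X1 where "X1 = k\<^sup>2 * L2norm MO (\<lambda>x. u x - glue \<T> u\<^sub>h x)"
  define X2 where "X2 = k * L2norm_bdry \<Omega> \<T> (\<lambda>E x. bdry_trace \<Omega> \<T> u x - bval \<T> E u\<^sub>h x)"
  define X3 where "X3 = L2norm_bdry \<Omega> \<T> (bres \<T> p \<gamma> k g u\<^sub>h)"
  define \<eta> where "\<eta> = eta_hp \<Omega> \<T> p \<beta> \<gamma> k f g u\<^sub>h \<sigma> s"
  define K where "K = 1 + 2 * j11 + ktr"
  define Q where "Q = sqrt (CT * (CP\<^sup>2 + 1))"
  define a where "a = sqrt (\<Sum>T\<in>\<T>. (aT T)\<^sup>2)"
  define A where "A = K * a + CP * X1 + Q * (X2 + X3)"
  define S where "S = L2norm MO (\<lambda>x. glue \<T> G x - wgrad \<Omega> s x)"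
  have X: "0 \<le> X1" "0 \<le> X2" "0 \<le> X3" using k by (auto simp: X1_def X2_def X3_def L2norm_bdry_def sum_nonneg)
  have pos: "0 \<le> K" "0 \<le> Q" "0 \<le> a" "0 \<le> S" using j11_pos ktr_nonneg CT(1) by (auto simp: K_def Q_def a_def S_def sum_nonneg)
  have A0: "0 \<le> A" using X pos CP(1) by (simp add: A_def)
  have LG: "L2 MO (glue \<T> G)" by (rule glue_L2[OF L m G_cont])
  have Le: "L2 MO ?e" by (rule L2_diff[OF wu(2) LG])
  have Lw: "L2 MO ?w" by (rule L2_diff[OF wu(2) ws(2)])
  have LS: "L2 MO (\<lambda>x. glue \<T> G x - wgrad \<Omega> s x)" by (rule L2_diff[OF LG ws(2)])
  have S_eq: "S\<^sup>2 = (\<Sum>T\<in>\<T>. (L2norm (lebesgue_on T) (\<lambda>x. G T x - wgrad \<Omega> s x))\<^sup>2)"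
    unfolding S_def mesh_L2(2)[OF L m LS]
  proof (rule sum.cong[OF refl])
    fix T assume T: "T \<in> \<T>"
    have l': "L2 (lebesgue_on T) (\<lambda>x. G T x - wgrad \<Omega> s x)"
      by (intro L2_diff L2_continuous_lebesgue_on G_cont T mesh_sets[OF L m T] mesh_L2(1)[OF L m ws(2) T])
    have "L2norm (lebesgue_on T) (\<lambda>x. glue \<T> G x - wgrad \<Omega> s x) = L2norm (lebesgue_on T) (\<lambda>x. G T x - wgrad \<Omega> s x)"
      by (rule L2norm_cong_AE[OF L2D(1)[OF mesh_L2(1)[OF L m LS T]] L2D(1)[OF l']]) (use glue_AE[OF L m T, of G] in eventually_elim, simp)
    then show "(L2norm (lebesgue_on T) (\<lambda>x. glue \<T> G x - wgrad \<Omega> s x))\<^sup>2 = (L2norm (lebesgue_on T) (\<lambda>x. G T x - wgrad \<Omega> s x))\<^sup>2" by simp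
  qed
  have a_sq: "a\<^sup>2 = (\<Sum>T\<in>\<T>. (aT T)\<^sup>2)" by (simp add: a_def sum_nonneg)
  have \<eta>: "\<eta> = sqrt (a\<^sup>2 + S\<^sup>2)" unfolding \<eta>_def eta_hp_def a_sq S_eq ..
  have \<eta>a: "a \<le> \<eta>" "S \<le> \<eta>" unfolding \<eta> by (rule real_le_rsqrt, simp)+
  \<comment> \<open>The bound is available for smooth gradients; smooth approximation of
    \<open>u - s\<close> extends it at the price of an arbitrary \<open>\<epsilon>\<close>.\<close>
  have ew: "norm (ipv MO ?e ?w) \<le> A * L2norm MO ?w"
  proof (rule field_le_epsilon)
    fix \<epsilon> :: real assume \<epsilon>: "\<epsilon> > 0"
    \<comment> \<open>Replacing \<open>?w\<close> by \<open>grad \<phi>\<close> costs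
      \<open>A * \<delta>\<close> in the norm of the gradient and
      \<open>L2norm MO ?e * \<delta>\<close> in the product; the denominator holds both, and the 1
      keeps it positive.\<close>
    define \<delta> where "\<delta> = \<epsilon> / (A + L2norm MO ?e + 1)"
    have den: "A + L2norm MO ?e + 1 > 0" using A0 by (simp add: add_nonneg_pos)
    have \<delta>: "\<delta> > 0" using \<epsilon> den by (simp add: \<delta>_def)
    obtain \<phi> where \<phi>: "smooth \<phi>" "L2norm MO (\<lambda>x. grad \<phi> x - ?w x) < \<delta>"
      using smooth_dense[OF L L2_diff[OF wu(1) ws(1)] Lw has_weak_grad_diff[OF dom wu(1) ws(1) wu(2) ws(2) wu(3) ws(3)] \<delta>] by blast
    have Lg: "L2 MO (grad \<phi>)" by (intro L2_continuous_lebesgue_on continuous_on_grad \<phi> dom)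
    have gw: "L2norm MO (grad \<phi>) \<le> L2norm MO ?w + \<delta>"
      using L2norm_le_add_diff[OF Lg Lw] \<phi>(2) by simp
    have split: "ipv MO ?e ?w = ipv MO ?e (grad \<phi>) - ipv MO ?e (\<lambda>x. grad \<phi> x - ?w x)"
      using ipv_diff_right[OF Lg Lw Le] by simp
    have "norm (ipv MO ?e ?w) \<le> norm (ipv MO ?e (grad \<phi>)) + norm (ipv MO ?e (\<lambda>x. grad \<phi> x - ?w x))"
      unfolding split by (rule norm_triangle_ineq4)
    moreover have "norm (ipv MO ?e (grad \<phi>)) \<le> A * L2norm MO (grad \<phi>)"
      unfolding A_def K_def Q_def a_def X1_def X2_def X3_def
      by (rule smooth_test_bound[OF CP(1) _ CT(1) _ \<phi>(1)]) (erule CP CT)+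
    moreover have "norm (ipv MO ?e (\<lambda>x. grad \<phi> x - ?w x)) \<le> L2norm MO ?e * L2norm MO (\<lambda>x. grad \<phi> x - ?w x)"
      by (rule norm_ipv_le[OF Le L2_diff[OF Lg Lw]])
    moreover have "A * L2norm MO (grad \<phi>) \<le> A * (L2norm MO ?w + \<delta>)" by (rule mult_left_mono[OF gw A0])
    moreover have "L2norm MO ?e * L2norm MO (\<lambda>x. grad \<phi> x - ?w x) \<le> L2norm MO ?e * \<delta>"
      using \<phi>(2) by (intro mult_left_mono) auto
    moreover have "A * (L2norm MO ?w + \<delta>) + L2norm MO ?e * \<delta> = A * L2norm MO ?w + (A + L2norm MO ?e) * \<delta>"
      by (simp add: algebra_simps)
    moreover have "(A + L2norm MO ?e) * \<delta> \<le> (A + L2norm MO ?e + 1) * \<delta>" using \<delta> by (intro mult_right_mono) auto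
    moreover have "(A + L2norm MO ?e + 1) * \<delta> = \<epsilon>" using den by (simp add: \<delta>_def)
    ultimately show "norm (ipv MO ?e ?w) \<le> A * L2norm MO ?w + \<epsilon>" by linarith
  qed
  have "ipv MO ?e ?e = ipv MO ?e ?w - ipv MO ?e (\<lambda>x. glue \<T> G x - wgrad \<Omega> s x)"
    using ipv_diff_right[OF Lw LS Le] by (simp add: algebra_simps)
  then have self: "complex_of_real ((L2norm MO ?e)\<^sup>2) = ipv MO ?e ?w - ipv MO ?e (\<lambda>x. glue \<T> G x - wgrad \<Omega> s x)"
    by (simp only: ipv_self)
  have "(L2norm MO ?e)\<^sup>2 = norm (ipv MO ?e ?w - ipv MO ?e (\<lambda>x. glue \<T> G x - wgrad \<Omega> s x))"
    unfolding self[symmetric] norm_of_real by simp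
  moreover have "norm (ipv MO ?e ?w - ipv MO ?e (\<lambda>x. glue \<T> G x - wgrad \<Omega> s x))
      \<le> norm (ipv MO ?e ?w) + norm (ipv MO ?e (\<lambda>x. glue \<T> G x - wgrad \<Omega> s x))"
    by (rule norm_triangle_ineq4)
  moreover have "norm (ipv MO ?e (\<lambda>x. glue \<T> G x - wgrad \<Omega> s x)) \<le> L2norm MO ?e * S"
    unfolding S_def by (rule norm_ipv_le[OF Le LS])
  moreover have "A * L2norm MO ?w \<le> A * (L2norm MO ?e + S)"
    using L2norm_triangle[OF Le LS] by (intro mult_left_mono A0) (simp add: S_def)
  ultimately have "(L2norm MO ?e)\<^sup>2 \<le> A * (L2norm MO ?e + S) + L2norm MO ?e * S"
    using ew by linarith
  then have "L2norm MO ?e \<le> 2 * (A + S)" by (rule quadratic_bound[OF A0 pos(4)])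
  \<comment> \<open>Both \<open>a\<close> and \<open>S\<close> are at most the estimator; the term
    \<open>S\<close> contributes the extra 1 that turns \<open>1 + 2 * j11 + ktr\<close> into
    \<open>2 + 2 * j11 + ktr\<close>.\<close>
  also have "A + S \<le> (2 + 2 * j11 + ktr + CP + Q) * (\<eta> + X1 + X2 + X3)"
  proof -
    let ?Z = "\<eta> + X1 + X2 + X3"
    have \<eta>0: "0 \<le> \<eta>" using \<eta>a(2) pos(4) by linarith
    have "K * a \<le> K * ?Z" using \<eta>a X pos by (intro mult_left_mono) auto
    moreover have "CP * X1 \<le> CP * ?Z" using \<eta>0 X CP(1) by (intro mult_left_mono) auto
    moreover have "Q * (X2 + X3) \<le> Q * ?Z" using \<eta>0 X pos by (intro mult_left_mono) auto
    moreover have "S \<le> ?Z" using \<eta>a X by simp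
    ultimately have "A + S \<le> K * ?Z + CP * ?Z + Q * ?Z + ?Z" unfolding A_def by linarith
    also have "\<dots> = (2 + 2 * j11 + ktr + CP + Q) * ?Z" by (simp add: K_def algebra_simps)
    finally show ?thesis .
  qed
  finally show ?thesis by (simp only: \<eta>_def X1_def X2_def X3_def Q_def mult.assoc)
qed

end

theorem theorem3p3:
  fixes \<Omega> :: "(real^2) set" and \<alpha> \<beta> \<gamma> \<kappa> :: real
  assumes "lipschitz_domain \<Omega>" and "\<alpha> > 0" and "\<beta> > 0" and "0 < \<gamma>" and "\<gamma> < 1/3"
  shows "\<exists>C>0. \<forall>(k::real) (\<T>::(real^2) set set) (p::(real^2) set \<Rightarrow> nat)
      (f::real^2 \<Rightarrow> complex) (g::real^2 \<Rightarrow> complex) (u::real^2 \<Rightarrow> complex) (u\<^sub>h\<^sub>p::complex broken)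
      (\<sigma>::real^2 \<Rightarrow> complex^2) (s::real^2 \<Rightarrow> complex).
    k > 0 \<longrightarrow> mesh \<Omega> \<T> \<longrightarrow> shape_regular \<kappa> \<T> \<longrightarrow> (\<forall>T\<in>\<T>. p T \<ge> 1) \<longrightarrow>
    L2 (lebesgue_on \<Omega>) f \<longrightarrow> L2_bdry \<Omega> \<T> g \<longrightarrow>
    weak_solution \<Omega> \<T> k f g u \<longrightarrow>
    dg_solution \<Omega> \<T> p \<alpha> \<beta> \<gamma> k f g u\<^sub>h\<^sub>p \<longrightarrow>
    equilibrated_flux \<Omega> \<T> p \<gamma> k f g u\<^sub>h\<^sub>p \<sigma> \<longrightarrow>
    s \<in> H1_mean0 \<Omega> \<longrightarrow>
    L2norm (lebesgue_on \<Omega>) (\<lambda>x. wgrad \<Omega> u x - glue \<T> (dg_grad \<T> p \<beta> u\<^sub>h\<^sub>p) x)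
      \<le> C * (eta_hp \<Omega> \<T> p \<beta> \<gamma> k f g u\<^sub>h\<^sub>p \<sigma> s
            + k\<^sup>2 * L2norm (lebesgue_on \<Omega>) (\<lambda>x. u x - glue \<T> u\<^sub>h\<^sub>p x)
            + k * L2norm_bdry \<Omega> \<T> (\<lambda>E x. bdry_trace \<Omega> \<T> u x - bval \<T> E u\<^sub>h\<^sub>p x)
            + L2norm_bdry \<Omega> \<T> (bres \<T> p \<gamma> k g u\<^sub>h\<^sub>p))"
proof (cases "\<exists>\<T>0. mesh \<Omega> \<T>0")
  case True
  then obtain \<T>0 where m0: "mesh \<Omega> \<T>0" by blast
  note L = assms(1)
  obtain CP where CP: "CP \<ge> 0" "\<And>\<phi>. smooth \<phi> \<Longrightarrow> \<exists>c. L2norm (lebesgue_on \<Omega>) (\<lambda>x. \<phi> x - c) \<le> CP * L2norm (lebesgue_on \<Omega>) (grad \<phi>)"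
    using poincare_domain[OF L m0] by blast
  obtain CT where CT: "CT \<ge> 0" "\<And>\<T> \<phi>. mesh \<Omega> \<T> \<Longrightarrow> smooth \<phi> \<Longrightarrow>
    (\<Sum>E\<in>boundary_edges \<Omega> \<T>. (L2norm (arclen E) \<phi>)\<^sup>2) \<le> CT * ((L2norm (lebesgue_on \<Omega>) \<phi>)\<^sup>2 + (L2norm (lebesgue_on \<Omega>) (grad \<phi>))\<^sup>2)"
    using trace_domain[OF L m0] by blast
  show ?thesis
  proof (intro exI[of _ "2 * (2 + 2 * j11 + ktr + CP + sqrt (CT * (CP\<^sup>2 + 1)))"] conjI allI impI)
    show "0 < 2 * (2 + 2 * j11 + ktr + CP + sqrt (CT * (CP\<^sup>2 + 1)))"
      using j11_pos ktr_nonneg CP(1) CT(1) by (simp add: add_pos_nonneg)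
    fix k :: real and \<T> p f g u u\<^sub>h\<^sub>p \<sigma> s
    assume h: "k > 0" "mesh \<Omega> \<T>" "L2 (lebesgue_on \<Omega>) f" "L2_bdry \<Omega> \<T> g" "weak_solution \<Omega> \<T> k f g u"
      "dg_solution \<Omega> \<T> p \<alpha> \<beta> \<gamma> k f g u\<^sub>h\<^sub>p" "equilibrated_flux \<Omega> \<T> p \<gamma> k f g u\<^sub>h\<^sub>p \<sigma>" "s \<in> H1_mean0 \<Omega>"
    have "u\<^sub>h\<^sub>p \<in> V_hp \<T> p" "s \<in> H1 \<Omega>" using h(6,8) by (auto simp: dg_solution_def H1_mean0_def)
    then interpret dg_error \<Omega> \<T> p \<beta> \<gamma> k f g u u\<^sub>h\<^sub>p \<sigma> s
      by unfold_locales (use L h in auto)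
    from error_bound[OF CP(1) _ CT(1)] CP(2) CT(2)[OF h(2)]
    show "L2norm (lebesgue_on \<Omega>) (\<lambda>x. wgrad \<Omega> u x - glue \<T> (dg_grad \<T> p \<beta> u\<^sub>h\<^sub>p) x)
      \<le> 2 * (2 + 2 * j11 + ktr + CP + sqrt (CT * (CP\<^sup>2 + 1))) * (eta_hp \<Omega> \<T> p \<beta> \<gamma> k f g u\<^sub>h\<^sub>p \<sigma> s
            + k\<^sup>2 * L2norm (lebesgue_on \<Omega>) (\<lambda>x. u x - glue \<T> u\<^sub>h\<^sub>p x)
            + k * L2norm_bdry \<Omega> \<T> (\<lambda>E x. bdry_trace \<Omega> \<T> u x - bval \<T> E u\<^sub>h\<^sub>p x)
            + L2norm_bdry \<Omega> \<T> (bres \<T> p \<gamma> k g u\<^sub>h\<^sub>p))" by blast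
  qed
next
  \<comment> \<open>If the domain has no mesh, the premise \<open>mesh \<Omega> \<T>\<close> is
    never met and any positive constant will do.\<close>
  case False
  then show ?thesis by (intro exI[of _ 1]) simp
qed

end
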